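(* Let $d=2$ and $\sigma\ge0$. Let $p\in(1,2]$, $s\in(\frac2p-1,1]$, and $H=s-1\in(\frac2p-2,0]$. Let $\mathcal D\subset\mathbb R^2$ be a bounded domain and let $f$ be a real-valued centered Gaussian random field with compact support contained in $\mathcal D$ whose covariance operator $Q_f$ is a classical pseudo-differential operator with principal symbol $\mu(x)|\xi|^{-2s}$, where $0\le\mu\in C_0^\infty(\mathcal D)$. Assume that $f\in L^2(\Omega,W^{H-\epsilon,p}(\mathbb R^2))$ for any $\epsilon>0$. Let $\mathcal U\subset\mathbb R^2$ be a bounded domain with $\mathrm{dist}(\mathcal U,\mathcal D)=r_0>0$. For $k>0$ let $u(x;k)=-\int_{\mathbb R^2}\Phi_\kappa(x,y)f(y)\,dy$ be the solution of $\Delta u+(k^2+\mathrm i k\sigma)u=f$ in $\mathbb R^2$. Then for any $x\in\mathcal U$, $$\lim_{k\to\infty}k^{2s+1}\,\mathbb E|u(x;k)|^2=\frac1{2^3\pi}\int_{\mathbb R^2}\frac{e^{-\sigma|x-y|}}{|x-y|}\mu(y)\,dy .$$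
   Context: $(\Omega,\mathcal F,\mathbb P)$ is a complete probability space. A real-valued centered Gaussian random field is a measurable map $f:\Omega\to\mathcal S'(\mathbb R^2)$ with real values such that $\langle f,\phi\rangle$ is a centered Gaussian random variable for each real $\phi\in C_0^\infty$. Its covariance operator $Q_f:C_0^\infty\to\mathcal S'$ is given by $\langle\varphi,Q_f\psi\rangle=\mathbb E[\langle f,\varphi\rangle\langle f,\psi\rangle]$. That $Q_f$ is a classical pseudo-differential operator with principal symbol $\mu(x)|\xi|^{-2s}$ means $(Q_f\psi)(x)=\frac1{(2\pi)^2}\int_{\mathbb R^2}e^{\mathrm i x\cdot\xi}c(x,\xi)\hat\psi(\xi)\,d\xi$ for $\psi\in C_0^\infty$, with $\hat\psi(\xi)=\int e^{-\mathrm i x\cdot\xi}\psi(x)\,dx$, where $c$ is a classical symbol of order $-2s$ with leading term $\mu(x)|\xi|^{-2s}$. $\kappa$ is the square root of $k^2+\mathrm i k\sigma$ with $\Re\kappa>0$, $\Im\kappa\ge0$, and $\Phi_\kappa(x,y)=\frac{\mathrm i}4H_0^{(1)}(\kappa|x-y|)$ with $H_0^{(1)}$ the Hankel function of the first kind of order $0$. For $x\in\mathcal U$ the integral defining $u(x;k)$ is the pairing of $f$ with $\Phi_\kappa(x,\cdot)$, which is smooth near the support of $f$. $W^{t,p}(\mathbb R^2)$ is the Sobolev (Bessel potential) space. *)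

theory Defs
  imports "HOL-Probability.Probability"
begin

type_synonym plane = "real ^ 2"

section \<open>Smooth functions and test functions\<close>

primrec dir_derivs :: "'a::euclidean_space list \<Rightarrow> ('a \<Rightarrow> 'b::real_normed_vector) \<Rightarrow> 'a \<Rightarrow> 'b" where
  "dir_derivs [] f = f"
| "dir_derivs (b # bs) f = (\<lambda>x. frechet_derivative (dir_derivs bs f) (at x) b)"

(* For open S this is C^infinity on S: a function all of whose iterated partial derivatives are
   Frechet differentiable has continuous partial derivatives of every order. *)
definition smooth_fun_on :: "'a::euclidean_space set \<Rightarrow> ('a \<Rightarrow> 'b::real_normed_vector) \<Rightarrow> bool" where
  "smooth_fun_on S f \<longleftrightarrow>
     (\<forall>bs. set bs \<subseteq> Basis \<longrightarrow> (\<forall>x\<in>S. dir_derivs bs f differentiable (at x)))"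

definition fun_supp :: "('a::topological_space \<Rightarrow> 'b::zero) \<Rightarrow> 'a set" where
  "fun_supp f = closure {x. f x \<noteq> 0}"

(* C_0^infinity(S), for S open *)
definition test_functions :: "'a::euclidean_space set \<Rightarrow> ('a \<Rightarrow> 'b::real_normed_vector) set" where
  "test_functions S = {f. smooth_fun_on UNIV f \<and> compact (fun_supp f) \<and> fun_supp f \<subseteq> S}"


section \<open>Schwartz functions and tempered distributions on the plane\<close>

definition schwartz :: "(plane \<Rightarrow> complex) set" where
  "schwartz = {\<phi>. smooth_fun_on UNIV \<phi> \<and>
     (\<forall>bs N. set bs \<subseteq> Basis \<longrightarrow> (\<exists>C. \<forall>x. (1 + norm x) ^ N * norm (dir_derivs bs \<phi> x) \<le> C))}"

(* On Schwartz functions the supremum is over a bounded set. *)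
definition schwartz_seminorm :: "nat \<Rightarrow> (plane \<Rightarrow> complex) \<Rightarrow> real" where
  "schwartz_seminorm N \<phi> =
     Sup {(1 + norm x) ^ N * norm (dir_derivs bs \<phi> x) | x bs. set bs \<subseteq> Basis \<and> length bs \<le> N}"

(* The tempered distributions: complex linear functionals on the Schwartz space that are continuous
   for the seminorms. Extensionality makes equality of functions equality of distributions. *)
definition tempered :: "((plane \<Rightarrow> complex) \<Rightarrow> complex) set" where
  "tempered = {u. u \<in> extensional schwartz \<and>
     (\<forall>\<phi>\<in>schwartz. \<forall>\<psi>\<in>schwartz. \<forall>a b.
        u (\<lambda>x. a * \<phi> x + b * \<psi> x) = a * u \<phi> + b * u \<psi>) \<and>
     (\<exists>C N. \<forall>\<phi>\<in>schwartz. norm (u \<phi>) \<le> C * schwartz_seminorm N \<phi>)}"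

definition dist_supp :: "((plane \<Rightarrow> complex) \<Rightarrow> complex) \<Rightarrow> plane set" where
  "dist_supp u = - \<Union>{V. open V \<and> (\<forall>\<phi>\<in>test_functions V. u \<phi> = 0)}"

(* The pairing of a compactly supported distribution u with a function g that is smooth near the
   support of u: the common value of u at all test functions equal to g near the support. *)
definition dist_pairing :: "((plane \<Rightarrow> complex) \<Rightarrow> complex) \<Rightarrow> (plane \<Rightarrow> complex) \<Rightarrow> complex" where
  "dist_pairing u g = (THE z. \<exists>\<phi>\<in>test_functions UNIV. \<exists>V. open V \<and> dist_supp u \<subseteq> V \<and>
     (\<forall>y\<in>V. \<phi> y = g y) \<and> z = u \<phi>)"

definition regular_dist :: "(plane \<Rightarrow> complex) \<Rightarrow> (plane \<Rightarrow> complex) \<Rightarrow> complex" where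
  "regular_dist g = (\<lambda>\<phi>\<in>schwartz. \<integral>x. g x * \<phi> x \<partial>lborel)"


section \<open>Fourier transform and Bessel potential spaces\<close>

definition fourier :: "(plane \<Rightarrow> complex) \<Rightarrow> plane \<Rightarrow> complex" where
  "fourier \<phi> \<xi> = (\<integral>x. exp (- \<i> * complex_of_real (x \<bullet> \<xi>)) * \<phi> x \<partial>lborel)"

definition inv_fourier :: "(plane \<Rightarrow> complex) \<Rightarrow> plane \<Rightarrow> complex" where
  "inv_fourier \<phi> x =
     complex_of_real (1 / (2 * pi)\<^sup>2) * (\<integral>\<xi>. exp (\<i> * complex_of_real (x \<bullet> \<xi>)) * \<phi> \<xi> \<partial>lborel)"

definition dist_fourier :: "((plane \<Rightarrow> complex) \<Rightarrow> complex) \<Rightarrow> (plane \<Rightarrow> complex) \<Rightarrow> complex" where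
  "dist_fourier u = (\<lambda>\<phi>\<in>schwartz. u (fourier \<phi>))"

definition dist_inv_fourier :: "((plane \<Rightarrow> complex) \<Rightarrow> complex) \<Rightarrow> (plane \<Rightarrow> complex) \<Rightarrow> complex" where
  "dist_inv_fourier u = (\<lambda>\<phi>\<in>schwartz. u (inv_fourier \<phi>))"

definition dist_mult ::
  "(plane \<Rightarrow> real) \<Rightarrow> ((plane \<Rightarrow> complex) \<Rightarrow> complex) \<Rightarrow> (plane \<Rightarrow> complex) \<Rightarrow> complex" where
  "dist_mult m u = (\<lambda>\<phi>\<in>schwartz. u (\<lambda>\<xi>. complex_of_real (m \<xi>) * \<phi> \<xi>))"

(* (I - Laplacian)^(t/2) *)
definition bessel_potential ::
  "real \<Rightarrow> ((plane \<Rightarrow> complex) \<Rightarrow> complex) \<Rightarrow> (plane \<Rightarrow> complex) \<Rightarrow> complex" where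
  "bessel_potential t u =
     dist_inv_fourier (dist_mult (\<lambda>\<xi>. (1 + (norm \<xi>)\<^sup>2) powr (t / 2)) (dist_fourier u))"

definition Lp_functions :: "real \<Rightarrow> (plane \<Rightarrow> complex) set" where
  "Lp_functions p = {g \<in> borel_measurable lborel. integrable lborel (\<lambda>x. norm (g x) powr p)}"

definition bessel_space :: "real \<Rightarrow> real \<Rightarrow> ((plane \<Rightarrow> complex) \<Rightarrow> complex) set" where
  "bessel_space t p =
     {u \<in> tempered. \<exists>g\<in>Lp_functions p. bessel_potential t u = regular_dist g}"

(* The function g below is unique up to null sets, so the norm does not depend on the choice. *)
definition bessel_norm :: "real \<Rightarrow> real \<Rightarrow> ((plane \<Rightarrow> complex) \<Rightarrow> complex) \<Rightarrow> real" where
  "bessel_norm t p u =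
     (let g = (SOME g. g \<in> Lp_functions p \<and> bessel_potential t u = regular_dist g)
      in (\<integral>x. norm (g x) powr p \<partial>lborel) powr (1 / p))"

(* The Bochner space L^2(Omega; W^{t,p}): f is an almost sure limit in W^{t,p} of simple functions,
   and its norm is square integrable. *)
definition L2_bessel :: "'w measure \<Rightarrow> real \<Rightarrow> real \<Rightarrow> ('w \<Rightarrow> (plane \<Rightarrow> complex) \<Rightarrow> complex) set" where
  "L2_bessel M t p = {f.
     (AE \<omega> in M. f \<omega> \<in> bessel_space t p) \<and>
     (\<exists>g. (\<forall>n. simple_function M (g n) \<and> g n \<in> space M \<rightarrow> bessel_space t p) \<and>
          (AE \<omega> in M. (\<lambda>n. bessel_norm t p (\<lambda>\<phi>\<in>schwartz. f \<omega> \<phi> - g n \<omega> \<phi>)) \<longlonglongrightarrow> 0)) \<and>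
     integrable M (\<lambda>\<omega>. (bessel_norm t p (f \<omega>))\<^sup>2)}"


section \<open>Gaussian random fields\<close>

(* The sigma-algebra generated by the evaluations at Schwartz functions; on this space it coincides
   with the Borel sigma-algebra of the weak-* and of the strong topology. *)
definition tempered_measurable_space :: "((plane \<Rightarrow> complex) \<Rightarrow> complex) measure" where
  "tempered_measurable_space = restrict_space (PiM schwartz (\<lambda>_. borel)) tempered"

(* The degenerate variable 0 counts as Gaussian: it arises from test functions supported away from
   the support of the field. *)
definition centered_gaussian :: "'w measure \<Rightarrow> ('w \<Rightarrow> real) \<Rightarrow> bool" where
  "centered_gaussian M X \<longleftrightarrow> X \<in> borel_measurable M \<and>
     ((AE \<omega> in M. X \<omega> = 0) \<or>
      (\<exists>\<tau>>0. distributed M lborel X (\<lambda>x. ennreal (normal_density 0 \<tau> x))))"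

definition real_gaussian_field ::
  "'w measure \<Rightarrow> ('w \<Rightarrow> (plane \<Rightarrow> complex) \<Rightarrow> complex) \<Rightarrow> bool" where
  "real_gaussian_field M f \<longleftrightarrow>
     f \<in> measurable M tempered_measurable_space \<and>
     (\<forall>\<phi>\<in>test_functions UNIV.
        (\<forall>\<omega>\<in>space M. f \<omega> (\<lambda>x. complex_of_real (\<phi> x)) \<in> \<real>) \<and>
        centered_gaussian M (\<lambda>\<omega>. Re (f \<omega> (\<lambda>x. complex_of_real (\<phi> x)))))"

(* The bilinear pairing of phi with Q_f psi; no complex conjugation. *)
definition covariance ::
  "'w measure \<Rightarrow> ('w \<Rightarrow> (plane \<Rightarrow> complex) \<Rightarrow> complex) \<Rightarrow> (plane \<Rightarrow> complex) \<Rightarrow> (plane \<Rightarrow> complex) \<Rightarrow> complex"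
where
  "covariance M f \<phi> \<psi> = (\<integral>\<omega>. f \<omega> \<phi> * f \<omega> \<psi> \<partial>M)"


section \<open>Classical pseudo-differential operators\<close>

(* A symbol c(x, xi) is a function of the pair. The directions (0, b) and (b, 0) differentiate in xi
   and in x; only the former improve the decay. The estimates are locally uniform in x. *)
definition symbol_class :: "real \<Rightarrow> (plane \<times> plane \<Rightarrow> complex) set" where
  "symbol_class m = {c. smooth_fun_on UNIV c \<and>
     (\<forall>as bs K. set as \<subseteq> Basis \<and> set bs \<subseteq> Basis \<and> compact K \<longrightarrow>
        (\<exists>C. \<forall>x\<in>K. \<forall>\<xi>.
           norm (dir_derivs (map (\<lambda>b. (0, b)) as @ map (\<lambda>b. (b, 0)) bs) c (x, \<xi>))
             \<le> C * (1 + norm \<xi>) powr (m - real (length as))))}"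

definition excision :: "(plane \<Rightarrow> real) \<Rightarrow> bool" where
  "excision \<theta> \<longleftrightarrow> smooth_fun_on UNIV \<theta> \<and>
     (\<exists>r>0. \<forall>\<xi>. norm \<xi> < r \<longrightarrow> \<theta> \<xi> = 0) \<and> (\<exists>R. \<forall>\<xi>. R \<le> norm \<xi> \<longrightarrow> \<theta> \<xi> = 1)"

(* c is a classical symbol of order m with leading term c0: it has an asymptotic expansion
   a 0 + a 1 + ... with a 0 = c0, where a j is homogeneous of degree m - j in xi. *)
definition classical_symbol ::
  "real \<Rightarrow> (plane \<times> plane \<Rightarrow> complex) \<Rightarrow> (plane \<times> plane \<Rightarrow> complex) \<Rightarrow> bool" where
  "classical_symbol m c0 c \<longleftrightarrow> c \<in> symbol_class m \<and>
     (\<exists>a. (\<forall>x \<xi>. \<xi> \<noteq> 0 \<longrightarrow> a (0::nat) (x, \<xi>) = c0 (x, \<xi>)) \<and>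
          (\<forall>j. smooth_fun_on (UNIV \<times> - {0}) (a j) \<and>
               (\<forall>x \<xi> t. \<xi> \<noteq> 0 \<and> t > 0 \<longrightarrow>
                  a j (x, t *\<^sub>R \<xi>) = complex_of_real (t powr (m - real j)) * a j (x, \<xi>))) \<and>
          (\<exists>\<theta>. excision \<theta> \<and>
               (\<forall>N. (\<lambda>(x, \<xi>). c (x, \<xi>) - complex_of_real (\<theta> \<xi>) * (\<Sum>j<N. a j (x, \<xi>)))
                      \<in> symbol_class (m - real N))))"

definition pseudo_diff_op ::
  "(plane \<times> plane \<Rightarrow> complex) \<Rightarrow> (plane \<Rightarrow> complex) \<Rightarrow> plane \<Rightarrow> complex" where
  "pseudo_diff_op c \<psi> x =
     complex_of_real (1 / (2 * pi)\<^sup>2) *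
     (\<integral>\<xi>. exp (\<i> * complex_of_real (x \<bullet> \<xi>)) * c (x, \<xi>) * fourier \<psi> \<xi> \<partial>lborel)"

definition covariance_classical_psido ::
  "'w measure \<Rightarrow> ('w \<Rightarrow> (plane \<Rightarrow> complex) \<Rightarrow> complex) \<Rightarrow> real \<Rightarrow> (plane \<times> plane \<Rightarrow> complex) \<Rightarrow> bool"
where
  "covariance_classical_psido M f m c0 \<longleftrightarrow>
     (\<exists>c. classical_symbol m c0 c \<and>
        (\<forall>\<phi>\<in>test_functions UNIV. \<forall>\<psi>\<in>test_functions UNIV.
           covariance M f \<phi> \<psi> = (\<integral>x. \<phi> x * pseudo_diff_op c \<psi> x \<partial>lborel)))"


section \<open>The Helmholtz equation with attenuation\<close>

definition bessel_J0 :: "complex \<Rightarrow> complex" where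
  "bessel_J0 z = (\<Sum>n. (-1) ^ n * (z\<^sup>2 / 4) ^ n / (fact n)\<^sup>2)"

definition bessel_Y0 :: "complex \<Rightarrow> complex" where
  "bessel_Y0 z = complex_of_real (2 / pi) *
     ((Ln (z / 2) + euler_mascheroni) * bessel_J0 z
      - (\<Sum>n. (-1) ^ n * harm n * (z\<^sup>2 / 4) ^ n / (fact n)\<^sup>2))"

definition hankel1_0 :: "complex \<Rightarrow> complex" where
  "hankel1_0 z = bessel_J0 z + \<i> * bessel_Y0 z"

definition wave_number :: "real \<Rightarrow> real \<Rightarrow> complex" where
  "wave_number \<sigma> k = csqrt (complex_of_real (k\<^sup>2) + \<i> * complex_of_real (k * \<sigma>))"

lemma wave_number:
  assumes "k > 0" "\<sigma> \<ge> 0"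
  shows "(wave_number \<sigma> k)\<^sup>2 = complex_of_real (k\<^sup>2) + \<i> * complex_of_real (k * \<sigma>)"
    and "Re (wave_number \<sigma> k) > 0" and "Im (wave_number \<sigma> k) \<ge> 0"
proof -
  let ?w = "wave_number \<sigma> k"
  show sq: "?w\<^sup>2 = complex_of_real (k\<^sup>2) + \<i> * complex_of_real (k * \<sigma>)"
    by (simp add: wave_number_def)
  have re: "(Re ?w)\<^sup>2 - (Im ?w)\<^sup>2 = k\<^sup>2" and im: "2 * Re ?w * Im ?w = k * \<sigma>"
    using arg_cong[OF sq, of Re] arg_cong[OF sq, of Im] by (simp_all add: power2_eq_square mult_ac)
  have "Re ?w \<noteq> 0"
  proof
    assume "Re ?w = 0"
    with re have "k\<^sup>2 = - (Im ?w)\<^sup>2" by simp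
    then have "k\<^sup>2 \<le> 0" using zero_le_power2[of "Im ?w"] by linarith
    with assms show False by simp
  qed
  then show pos: "Re ?w > 0"
    using Re_csqrt unfolding wave_number_def by (metis less_eq_real_def)
  have "0 \<le> k * \<sigma>" using assms by simp
  with im have "0 \<le> Re ?w * Im ?w" by simp
  with pos show "Im ?w \<ge> 0" by (simp add: zero_le_mult_iff)
qed

definition fundamental_solution :: "complex \<Rightarrow> plane \<Rightarrow> plane \<Rightarrow> complex" where
  "fundamental_solution \<kappa> x y = \<i> / 4 * hankel1_0 (\<kappa> * complex_of_real (norm (x - y)))"

(* The sample of u(x; k) for the realization F of the source, for x away from the support of F. *)
definition helmholtz_solution ::
  "real \<Rightarrow> ((plane \<Rightarrow> complex) \<Rightarrow> complex) \<Rightarrow> real \<Rightarrow> plane \<Rightarrow> complex" where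
  "helmholtz_solution \<sigma> F k x = - dist_pairing F (fundamental_solution (wave_number \<sigma> k) x)"

end

theory Submission
  imports Defs "HOL-Complex_Analysis.Complex_Analysis"
begin

text \<open>Let \<zeta> be a cutoff equal to 1 near the closure of D and vanishing near x, and put
  g = \<zeta> \<cdot> cnj \<Phi>. Pairing f with \<Phi> is evaluating f at cnj g, so, f being real, the second moment
  of u is the integral of cnj g \<cdot> Q g.

  For a cutoff \<eta> let F \<eta> be the Fourier transform of \<eta> \<cdot> cnj \<Phi>. Since \<Phi> solves the
  Helmholtz equation away from x, Green's identity expresses (|\<xi>|^2 - cnj \<kappa>^2) F \<eta> through F of
  the derivatives of \<eta>. Iterating, (1 + ||\<xi>| - k|)^n |F \<eta>| is bounded by a finite sum of such |F \<eta>'|,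
  and as k |\<Phi>|^2 is bounded by 1 / (8 pi |x - y|), Parseval shows that all these weighted L2 norms
  are O(k^(-1/2)): the frequencies concentrate at |\<xi>| = k. There k^(2s) c(y, \<xi>) differs from
  \<mu>(y) by O((1 + ||\<xi>| - k|)^3 / k), so the second moment may be replaced by the integral of
  k^(-2s) \<mu> |\<Phi>|^2, and k |\<Phi>|^2 tends to exp (-\<sigma> |x - y|) / (8 pi |x - y|).

  The bound and the limit of |\<Phi>|^2 are read off from the representation of the Hankel function as
  (1 - i) / pi \<cdot> exp (i z) times the Laplace transform of (t + i t^2 / 2)^(-1/2).\<close>

section \<open>Smooth functions and cutoffs\<close>

text \<open>The error budget is tight. The symbol error costs 1/k and the pairing with g its L1
  norm, O(k^(-1/2)); so the integral of (1 + ||\<xi>| - k|)^3 |F \<zeta>| must be o(k^(1/2)). The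
  pointwise bound |F \<zeta>| = O(k^(-1/2)) on an annulus of area of order k gives only O(k^(1/2)).
  Hence the L2 estimate: Cauchy-Schwarz with weights -2 and 5 gives o(k) times O(k^(-1/2)). The cube
  pays for frequencies far from the annulus, where the weight is at least k/2 while k^(2s) may be as
  large as k^2.

  The Hankel function is given by its series at 0, but its size is needed at infinity and, for
  \<sigma> > 0, off the real axis. The integral representation bridges the two; identifying both
  sides means matching expansions at 0 down to the constant, which brings in Euler's constant as
  -Gamma'(1). The number 8 pi comes from |H|^2 ~ 2 / (pi |z|) exp (-2 Im z) and |i/4|^2 = 1/16, the
  decay rate \<sigma> from the limit \<sigma>/2 of Im \<kappa>.\<close>

lemma dir_derivs_append: "dir_derivs (as @ bs) f = dir_derivs as (dir_derivs bs f)"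
  by (induction as) auto

text \<open>The two functions have the same derivatives at x, so the choice operator inside
  \<open>frechet_derivative\<close> picks the same one, also at points where there is none.\<close>

lemma frechet_derivative_cong_open:
  assumes "open S" "x \<in> S" "\<And>y. y \<in> S \<Longrightarrow> f y = g y"
  shows "frechet_derivative f (at x) = frechet_derivative g (at x)"
proof -
  have "(f has_derivative D) (at x) \<longleftrightarrow> (g has_derivative D) (at x)" for D
    using has_derivative_transform_within_open[OF _ assms(1,2), of f D UNIV g]
      has_derivative_transform_within_open[OF _ assms(1,2), of g D UNIV f] assms(3) by auto
  then show ?thesis by (simp add: frechet_derivative_def)
qed

lemma differentiable_cong_open:
  assumes "open S" "x \<in> S" "\<And>y. y \<in> S \<Longrightarrow> f y = g y" "f differentiable (at x)"
  shows "g differentiable (at x)"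
  using assms(4) has_derivative_transform_within_open[OF _ assms(1,2), of f _ UNIV g] assms(3)
  unfolding differentiable_def by blast

lemma dir_derivs_cong_open:
  assumes "open S" "x \<in> S" "\<And>y. y \<in> S \<Longrightarrow> f y = g y"
  shows "dir_derivs bs f x = dir_derivs bs g x"
  using assms(2)
proof (induction bs arbitrary: x)
  case (Cons b bs)
  then show ?case
    using frechet_derivative_cong_open[OF assms(1), of x "dir_derivs bs f" "dir_derivs bs g"] by simp
qed (use assms in auto)

lemma smooth_fun_on_cong:
  assumes "open S" "\<And>y. y \<in> S \<Longrightarrow> f y = g y" "smooth_fun_on S f"
  shows "smooth_fun_on S g"
  unfolding smooth_fun_on_def
proof (intro allI impI ballI)
  fix bs :: "'a list" and x assume "set bs \<subseteq> Basis" "x \<in> S"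
  then have d: "dir_derivs bs f differentiable (at x)" using assms(3) by (auto simp: smooth_fun_on_def)
  show "dir_derivs bs g differentiable (at x)"
    by (rule differentiable_cong_open[OF assms(1) \<open>x \<in> S\<close> _ d], rule dir_derivs_cong_open[OF assms(1)])
       (use assms in auto)
qed

lemma smooth_fun_on_Un: "smooth_fun_on S f \<Longrightarrow> smooth_fun_on T f \<Longrightarrow> smooth_fun_on (S \<union> T) f"
  unfolding smooth_fun_on_def by blast

lemma smooth_fun_on_subset: "smooth_fun_on S f \<Longrightarrow> T \<subseteq> S \<Longrightarrow> smooth_fun_on T f"
  unfolding smooth_fun_on_def by blast

lemma smooth_fun_on_dir_derivs: "smooth_fun_on S f \<Longrightarrow> set bs \<subseteq> Basis \<Longrightarrow> smooth_fun_on S (dir_derivs bs f)"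
  unfolding smooth_fun_on_def by (metis Un_subset_iff dir_derivs_append set_append)

lemma smooth_fun_on_differentiable: "smooth_fun_on S f \<Longrightarrow> x \<in> S \<Longrightarrow> f differentiable (at x)"
  unfolding smooth_fun_on_def by (metis dir_derivs.simps(1) empty_set empty_subsetI)

lemma smooth_fun_on_continuous: "smooth_fun_on S f \<Longrightarrow> continuous_on S f"
  by (intro continuous_at_imp_continuous_on ballI differentiable_imp_continuous_within smooth_fun_on_differentiable)

text \<open>By induction on the list of directions every iterated partial derivative agrees on S
  with a member of A. Agreement on S alone is enough, so singular functions can be treated away from
  their singularity.\<close>

lemma smooth_fun_on_coinduct:
  assumes "open S"
    and "\<And>f x. f \<in> A \<Longrightarrow> x \<in> S \<Longrightarrow> f differentiable (at x)"
    and "\<And>f b. f \<in> A \<Longrightarrow> b \<in> Basis \<Longrightarrow> \<exists>g\<in>A. \<forall>x\<in>S. frechet_derivative f (at x) b = g x"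
    and "f \<in> A"
  shows "smooth_fun_on S f"
proof -
  have "\<exists>g\<in>A. \<forall>x\<in>S. dir_derivs bs f x = g x" if "set bs \<subseteq> Basis" for bs
    using that
  proof (induction bs)
    case (Cons b bs)
    then obtain g where g: "g \<in> A" "\<forall>x\<in>S. dir_derivs bs f x = g x" by auto
    moreover obtain h where h: "h \<in> A" "\<forall>x\<in>S. frechet_derivative g (at x) b = h x"
      using assms(3)[OF g(1), of b] Cons by auto
    ultimately have "\<forall>x\<in>S. dir_derivs (b # bs) f x = h x"
      using frechet_derivative_cong_open[OF assms(1), of _ "dir_derivs bs f" g] by auto
    then show ?case using h by blast
  qed (use assms in auto)
  then show ?thesis
    unfolding smooth_fun_on_def
    by (metis differentiable_cong_open[OF assms(1)] assms(2))
qed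

text \<open>Smoothness of a concrete function is checked by placing it in an algebra generated by functions
  whose partial derivatives lie in that algebra.\<close>
inductive_set gen_alg :: "('a \<Rightarrow> 'b::real_normed_algebra_1) set \<Rightarrow> ('a \<Rightarrow> 'b) set" for G where
  gen_alg_base: "g \<in> G \<Longrightarrow> g \<in> gen_alg G"
| gen_alg_const: "(\<lambda>_. c) \<in> gen_alg G"
| gen_alg_add: "f \<in> gen_alg G \<Longrightarrow> g \<in> gen_alg G \<Longrightarrow> (\<lambda>x. f x + g x) \<in> gen_alg G"
| gen_alg_mult: "f \<in> gen_alg G \<Longrightarrow> g \<in> gen_alg G \<Longrightarrow> (\<lambda>x. f x * g x) \<in> gen_alg G"

lemma gen_alg_mono: "F \<subseteq> G \<Longrightarrow> f \<in> gen_alg F \<Longrightarrow> f \<in> gen_alg G"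
  by (erule gen_alg.induct) (auto intro: gen_alg.intros)

lemma gen_alg_uminus: "f \<in> gen_alg G \<Longrightarrow> (\<lambda>x. - f x) \<in> gen_alg G"
  using gen_alg_mult[OF gen_alg_const[of "-1"]] by fastforce

lemma gen_alg_diff: "f \<in> gen_alg G \<Longrightarrow> g \<in> gen_alg G \<Longrightarrow> (\<lambda>x. f x - g x) \<in> gen_alg G"
  using gen_alg_add[OF _ gen_alg_uminus, of f G g] by simp

lemma frechet_derivative_add_at:
  "f differentiable (at x) \<Longrightarrow> g differentiable (at x) \<Longrightarrow>
   frechet_derivative (\<lambda>x. f x + g x) (at x) b = frechet_derivative f (at x) b + frechet_derivative g (at x) b"
  by (subst frechet_derivative_at[symmetric, OF has_derivative_add]) (auto simp: frechet_derivative_works)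

lemma frechet_derivative_mult_at:
  fixes f g :: "'a::real_normed_vector \<Rightarrow> 'b::real_normed_algebra"
  shows "f differentiable (at x) \<Longrightarrow> g differentiable (at x) \<Longrightarrow>
   frechet_derivative (\<lambda>x. f x * g x) (at x) b = f x * frechet_derivative g (at x) b + frechet_derivative f (at x) b * g x"
  by (subst frechet_derivative_at[symmetric, OF has_derivative_mult]) (auto simp: frechet_derivative_works)

text \<open>By the sum and product rules the whole algebra is closed under partial derivatives as
  soon as those of the generators lie in it; coinduction then applies to the algebra.\<close>

lemma smooth_gen_alg:
  assumes "open S"
    and d: "\<And>g x. g \<in> G \<Longrightarrow> x \<in> S \<Longrightarrow> g differentiable (at x)"
    and c: "\<And>g b. g \<in> G \<Longrightarrow> b \<in> Basis \<Longrightarrow> \<exists>h\<in>gen_alg G. \<forall>x\<in>S. frechet_derivative g (at x) b = h x"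
    and "f \<in> gen_alg G"
  shows "smooth_fun_on S f"
proof (rule smooth_fun_on_coinduct[OF assms(1) _ _ assms(4)])
  show diff: "f differentiable (at x)" if "f \<in> gen_alg G" "x \<in> S" for f x
    using that by (induction f rule: gen_alg.induct) (auto intro: d)
  show "\<exists>g\<in>gen_alg G. \<forall>x\<in>S. frechet_derivative f (at x) b = g x" if "f \<in> gen_alg G" "b \<in> Basis" for f b
    using that
  proof (induction f rule: gen_alg.induct)
    case (gen_alg_base g)
    then show ?case by (intro c)
  next
    case (gen_alg_const c)
    show ?case by (intro bexI[of _ "\<lambda>_. 0"]) (auto intro: gen_alg.gen_alg_const)
  next
    case (gen_alg_add f g)
    then obtain f' g' where fg: "f' \<in> gen_alg G" "g' \<in> gen_alg G"
      "\<forall>x\<in>S. frechet_derivative f (at x) b = f' x" "\<forall>x\<in>S. frechet_derivative g (at x) b = g' x" by blast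
    then have "\<forall>x\<in>S. frechet_derivative (\<lambda>x. f x + g x) (at x) b = f' x + g' x"
      using gen_alg_add.hyps diff by (auto simp: frechet_derivative_add_at)
    then show ?case by (intro bexI[OF _ gen_alg.gen_alg_add[OF fg(1,2)]])
  next
    case (gen_alg_mult f g)
    then obtain f' g' where fg: "f' \<in> gen_alg G" "g' \<in> gen_alg G"
      "\<forall>x\<in>S. frechet_derivative f (at x) b = f' x" "\<forall>x\<in>S. frechet_derivative g (at x) b = g' x" by blast
    then have "\<forall>x\<in>S. frechet_derivative (\<lambda>x. f x * g x) (at x) b = f x * g' x + f' x * g x"
      using gen_alg_mult.hyps diff by (auto simp: frechet_derivative_mult_at)
    then show ?case
      by (intro bexI[OF _ gen_alg.gen_alg_add[OF gen_alg.gen_alg_mult[OF gen_alg_mult.hyps(1) fg(2)] gen_alg.gen_alg_mult[OF fg(1) gen_alg_mult.hyps(2)]]])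
  qed
qed

text \<open>Taking all iterated derivatives of members of F as generators makes the generating set
  closed under differentiation, so no higher Leibniz formula has to be written down.\<close>

lemma smooth_fun_on_algebra:
  assumes S: "open S" and F: "\<And>g. g \<in> F \<Longrightarrow> smooth_fun_on S g" and f: "f \<in> gen_alg F"
  shows "smooth_fun_on S f"
proof (rule smooth_gen_alg[OF S, where G="{dir_derivs bs g | bs g. g \<in> F \<and> set bs \<subseteq> Basis}"])
  let ?G = "{dir_derivs bs g | bs g. g \<in> F \<and> set bs \<subseteq> Basis}"
  show "h differentiable (at x)" if "h \<in> ?G" "x \<in> S" for h x
    using that F unfolding smooth_fun_on_def by blast
  show "\<exists>k\<in>gen_alg ?G. \<forall>x\<in>S. frechet_derivative h (at x) b = k x" if "h \<in> ?G" "b \<in> Basis" for h b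
  proof -
    from that obtain bs g where "g \<in> F" "h = dir_derivs bs g" "set bs \<subseteq> Basis" by blast
    moreover from this have "set (b # bs) \<subseteq> Basis" using that by simp
    ultimately have "dir_derivs (b # bs) g \<in> ?G" by blast
    moreover have "\<forall>x\<in>S. frechet_derivative h (at x) b = dir_derivs (b # bs) g x"
      using \<open>h = dir_derivs bs g\<close> by simp
    ultimately show ?thesis by (intro bexI[OF _ gen_alg_base])
  qed
  have "F \<subseteq> ?G"
  proof
    fix g assume "g \<in> F"
    then have "dir_derivs [] g \<in> ?G" by fastforce
    then show "g \<in> ?G" by simp
  qed
  then show "f \<in> gen_alg ?G" using f by (rule gen_alg_mono)
qed

lemma smooth_fun_on_add: "open S \<Longrightarrow> smooth_fun_on S f \<Longrightarrow> smooth_fun_on S g \<Longrightarrow> smooth_fun_on S (\<lambda>x. f x + g x :: 'b::real_normed_algebra_1)"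
  by (rule smooth_fun_on_algebra[where F="{f, g}"]) (auto intro: gen_alg.intros)
lemma smooth_fun_on_mult: "open S \<Longrightarrow> smooth_fun_on S f \<Longrightarrow> smooth_fun_on S g \<Longrightarrow> smooth_fun_on S (\<lambda>x. f x * g x :: 'b::real_normed_algebra_1)"
  by (rule smooth_fun_on_algebra[where F="{f, g}"]) (auto intro: gen_alg.intros)
lemma smooth_fun_on_const: "open S \<Longrightarrow> smooth_fun_on S (\<lambda>x. c :: 'b::real_normed_algebra_1)"
  by (rule smooth_fun_on_algebra[where F="{}"]) (auto intro: gen_alg.intros)
lemma smooth_fun_on_cmult: "open S \<Longrightarrow> smooth_fun_on S f \<Longrightarrow> smooth_fun_on S (\<lambda>x. c * f x :: 'b::real_normed_algebra_1)"
  by (intro smooth_fun_on_mult smooth_fun_on_const)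
lemma smooth_fun_on_diff: "open S \<Longrightarrow> smooth_fun_on S f \<Longrightarrow> smooth_fun_on S g \<Longrightarrow> smooth_fun_on S (\<lambda>x. f x - g x :: 'b::real_normed_algebra_1)"
  by (rule smooth_fun_on_algebra[where F="{f, g}"]) (auto intro: gen_alg.intros gen_alg_diff)

lemma dir_derivs_bounded_linear:
  assumes "open S" "smooth_fun_on S f" "bounded_linear T" "set bs \<subseteq> Basis" "x \<in> S"
  shows "dir_derivs bs (\<lambda>x. T (f x)) x = T (dir_derivs bs f x)"
  using assms(4,5)
proof (induction bs arbitrary: x)
  case (Cons b bs)
  then have "frechet_derivative (dir_derivs bs (\<lambda>x. T (f x))) (at x) = frechet_derivative (\<lambda>x. T (dir_derivs bs f x)) (at x)"
    by (intro frechet_derivative_cong_open[OF assms(1)]) auto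
  also have "\<dots> = (\<lambda>h. T (frechet_derivative (dir_derivs bs f) (at x) h))"
  proof (rule frechet_derivative_at[symmetric], rule bounded_linear.has_derivative[OF assms(3)])
    have "dir_derivs bs f differentiable (at x)" using assms(2) Cons by (auto simp: smooth_fun_on_def)
    then show "(dir_derivs bs f has_derivative frechet_derivative (dir_derivs bs f) (at x)) (at x)"
      by (simp add: frechet_derivative_works)
  qed
  finally show ?case by simp
qed auto

lemma smooth_fun_on_bounded_linear:
  assumes "open S" "smooth_fun_on S f" "bounded_linear T"
  shows "smooth_fun_on S (\<lambda>x. T (f x))"
  unfolding smooth_fun_on_def
proof (intro allI impI ballI)
  fix bs :: "'a list" and x assume bs: "set bs \<subseteq> Basis" "x \<in> S"
  have "dir_derivs bs f differentiable (at x)" using assms(2) bs by (auto simp: smooth_fun_on_def)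
  then have "(\<lambda>x. T (dir_derivs bs f x)) differentiable (at x)"
    using bounded_linear.has_derivative[OF assms(3)] unfolding differentiable_def by blast
  then show "dir_derivs bs (\<lambda>x. T (f x)) differentiable (at x)"
    by (rule differentiable_cong_open[OF assms(1) bs(2), rotated]) (simp add: dir_derivs_bounded_linear[OF assms bs(1)])
qed

section \<open>Supports and the calculus of test functions\<close>

lemma fun_supp_closed: "closed (fun_supp f)" by (simp add: fun_supp_def)
lemma fun_supp_zero: "x \<notin> fun_supp f \<Longrightarrow> f x = 0"
  using closure_subset[of "{x. f x \<noteq> 0}"] by (auto simp: fun_supp_def)
lemma fun_supp_subset: "closed C \<Longrightarrow> (\<And>x. x \<notin> C \<Longrightarrow> f x = 0) \<Longrightarrow> fun_supp f \<subseteq> C"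
  unfolding fun_supp_def by (rule closure_minimal) auto

lemma test_functionsI:
  assumes "smooth_fun_on UNIV f" "compact K" "K \<subseteq> S" "\<And>x. x \<notin> K \<Longrightarrow> f x = 0"
  shows "f \<in> test_functions S"
proof -
  have "fun_supp f \<subseteq> K" using assms compact_imp_closed by (intro fun_supp_subset) auto
  moreover from this have "compact (fun_supp f)"
    using assms(2) fun_supp_closed compact_Int_closed by (metis inf.absorb_iff2)
  ultimately show ?thesis using assms by (auto simp: test_functions_def)
qed

lemma test_functions_mono: "S \<subseteq> T \<Longrightarrow> test_functions S \<subseteq> test_functions T"
  by (auto simp: test_functions_def)

lemma smooth_fun_on_0: "open S \<Longrightarrow> (\<And>x. x \<in> S \<Longrightarrow> f x = 0) \<Longrightarrow> smooth_fun_on S f"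
proof -
  assume S: "open S" "\<And>x. x \<in> S \<Longrightarrow> f x = 0"
  have "smooth_fun_on S (\<lambda>_. 0 :: 'b)"
    by (rule smooth_fun_on_coinduct[where A="{\<lambda>_. 0}"]) (use S in auto)
  then show ?thesis by (rule smooth_fun_on_cong[OF S(1), rotated]) (simp add: S)
qed

lemma dir_derivs_outside_supp:
  fixes f :: "'a::euclidean_space \<Rightarrow> 'b::real_normed_vector"
  assumes x: "x \<notin> fun_supp f"
  shows "dir_derivs bs f x = 0"
proof -
  have "dir_derivs bs f x = dir_derivs bs (\<lambda>_. 0) x"
    using x fun_supp_closed[of f] by (intro dir_derivs_cong_open[of "- fun_supp f"]) (auto simp: fun_supp_zero)
  moreover have "dir_derivs bs (\<lambda>_::'a. 0::'b) = (\<lambda>_. 0)" by (induction bs) auto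
  ultimately show ?thesis by simp
qed

lemma test_functions_dir_derivs:
  assumes "f \<in> test_functions S" "set bs \<subseteq> Basis" shows "dir_derivs bs f \<in> test_functions S"
  using assms by (intro test_functionsI[where K="fun_supp f"] smooth_fun_on_dir_derivs)
    (auto simp: test_functions_def dir_derivs_outside_supp)

text \<open>The product is smooth on W and zero off the support of f, and these two open sets cover
  the space. So a cutoff supported away from x removes the singularity of the fundamental
  solution.\<close>

lemma test_functions_mult:
  fixes f g :: "'a::euclidean_space \<Rightarrow> 'b::real_normed_algebra_1"
  assumes "f \<in> test_functions S" "open W" "fun_supp f \<subseteq> W" "smooth_fun_on W g"
  shows "(\<lambda>x. f x * g x) \<in> test_functions S"
proof (rule test_functionsI[where K="fun_supp f"])
  have "smooth_fun_on W (\<lambda>x. f x * g x)"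
    using assms by (intro smooth_fun_on_mult) (auto simp: test_functions_def intro: smooth_fun_on_subset)
  moreover have "smooth_fun_on (- fun_supp f) (\<lambda>x. f x * g x)"
    using fun_supp_closed[of f] by (intro smooth_fun_on_0) (auto simp: fun_supp_zero)
  ultimately have "smooth_fun_on (W \<union> - fun_supp f) (\<lambda>x. f x * g x)" by (rule smooth_fun_on_Un)
  moreover have "W \<union> - fun_supp f = UNIV" using assms(3) by blast
  ultimately show "smooth_fun_on UNIV (\<lambda>x. f x * g x)" by simp
qed (use assms in \<open>auto simp: test_functions_def fun_supp_zero\<close>)

lemma test_functions_add:
  fixes f g :: "'a::euclidean_space \<Rightarrow> 'b::real_normed_algebra_1"
  assumes "f \<in> test_functions S" "g \<in> test_functions S"
  shows "(\<lambda>x. f x + g x) \<in> test_functions S"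
  using assms by (intro test_functionsI[where K="fun_supp f \<union> fun_supp g"] smooth_fun_on_add)
    (auto simp: test_functions_def fun_supp_zero)

lemma test_functions_diff:
  fixes f g :: "'a::euclidean_space \<Rightarrow> 'b::real_normed_algebra_1"
  assumes "f \<in> test_functions S" "g \<in> test_functions S"
  shows "(\<lambda>x. f x - g x) \<in> test_functions S"
  using assms by (intro test_functionsI[where K="fun_supp f \<union> fun_supp g"] smooth_fun_on_diff)
    (auto simp: test_functions_def fun_supp_zero)

lemma test_functions_bounded_linear:
  assumes "f \<in> test_functions S" "bounded_linear T"
  shows "(\<lambda>x. T (f x)) \<in> test_functions S"
proof (rule test_functionsI[where K="fun_supp f"])
  show "smooth_fun_on UNIV (\<lambda>x. T (f x))"
    using assms(1) by (intro smooth_fun_on_bounded_linear[OF open_UNIV _ assms(2)]) (simp add: test_functions_def)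
  show "T (f x) = 0" if "x \<notin> fun_supp f" for x
    using fun_supp_zero[OF that] linear_0[OF bounded_linear.linear[OF assms(2)]] by simp
qed (use assms in \<open>auto simp: test_functions_def\<close>)

lemma test_functions_continuous: "f \<in> test_functions S \<Longrightarrow> continuous_on UNIV f"
  by (auto simp: test_functions_def intro: smooth_fun_on_continuous)

lemma test_functions_bounded:
  assumes "f \<in> test_functions S" obtains B where "B \<ge> 0" "\<And>x. norm (f x) \<le> B"
proof -
  have "compact (f ` fun_supp f)"
    using assms test_functions_continuous[OF assms] by (intro compact_continuous_image) (auto simp: test_functions_def intro: continuous_on_subset)
  then obtain B where B: "\<And>y. y \<in> f ` fun_supp f \<Longrightarrow> norm y \<le> B" using compact_imp_bounded bounded_iff by metis
  have "norm (f x) \<le> max B 0" for x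
    using B[of "f x"] fun_supp_zero[of x f] by (cases "x \<in> fun_supp f") (auto simp: le_max_iff_disj)
  then show ?thesis using that[of "max B 0"] by auto
qed

section \<open>Bump functions and cutoffs of compact sets\<close>

text \<open>The powers of 1 / t close the family under differentiation.\<close>
definition expn :: "nat \<Rightarrow> real \<Rightarrow> real" where "expn n t = (if t > 0 then exp (- 1 / t) / t ^ n else 0)"

lemma expn_tendsto_0: "(expn n \<longlongrightarrow> 0) (at 0)"
proof -
  have "((\<lambda>x::real. x ^ n / exp x) \<longlongrightarrow> 0) at_top" by (rule tendsto_power_div_exp_0)
  then have "((\<lambda>t::real. inverse t ^ n / exp (inverse t)) \<longlongrightarrow> 0) (at_right 0)"
    using filterlim_inverse_at_top_right by (rule filterlim_compose)
  moreover have "eventually (\<lambda>t. inverse t ^ n / exp (inverse t) = expn n t) (at_right 0)"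
    using eventually_at_right_less[of 0] by eventually_elim (auto simp: expn_def field_simps exp_minus)
  ultimately have "(expn n \<longlongrightarrow> 0) (at_right 0)" by (rule Lim_transform_eventually)
  moreover have "(expn n \<longlongrightarrow> 0) (at_left 0)"
    by (rule tendsto_eventually) (auto simp: eventually_at_filter expn_def)
  ultimately show ?thesis by (simp add: filterlim_split_at)
qed

lemma expn_deriv: "(expn n has_real_derivative (expn (n + 2) t - real n * expn (n + 1) t)) (at t)"
proof -
  consider "t > 0" | "t < 0" | "t = 0" by linarith
  then show ?thesis
  proof cases
    case 1
    have "((\<lambda>t. exp (- 1 / t) / t ^ n) has_real_derivative (expn (n + 2) t - real n * expn (n + 1) t)) (at t)"
    proof -
      have p: "((\<lambda>t. t ^ n) has_real_derivative real n * t ^ n / t) (at t)"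
        by (rule DERIV_cong[OF DERIV_pow]) (use 1 in \<open>cases n; simp\<close>)
      have e: "((\<lambda>t. exp (- 1 / t)) has_real_derivative exp (- 1 / t) / t\<^sup>2) (at t)"
        using 1 by (auto intro!: derivative_eq_intros simp: power2_eq_square)
      show ?thesis
        using 1 by (intro DERIV_cong[OF DERIV_divide[OF e p]]) (auto simp: expn_def field_simps power2_eq_square)
    qed
    then show ?thesis
      by (rule has_field_derivative_transform_within_open[of _ _ _ "{0<..}"]) (use 1 in \<open>auto simp: expn_def\<close>)
  next
    case 2
    have "((\<lambda>t. 0) has_real_derivative (expn (n + 2) t - real n * expn (n + 1) t)) (at t)"
      using 2 by (auto simp: expn_def)
    then show ?thesis
      by (rule has_field_derivative_transform_within_open[of _ _ _ "{..<0}"]) (use 2 in \<open>auto simp: expn_def\<close>)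
  next
    case 3
    \<comment> \<open>At 0 the difference quotient of \<open>expn n\<close> is
      \<open>expn (n + 1)\<close> itself, whose limit is already known.\<close>
    have "eventually (\<lambda>h. expn (n + 1) h = (expn n (0 + h) - expn n 0) / h) (at 0)"
      by (auto simp: eventually_at_filter expn_def)
    then have "((\<lambda>h. (expn n (0 + h) - expn n 0) / h) \<longlongrightarrow> 0) (at 0)"
      by (rule Lim_transform_eventually[OF expn_tendsto_0])
    then show ?thesis using 3 by (simp add: DERIV_def expn_def)
  qed
qed

context
  fixes a :: "'a::euclidean_space" and \<epsilon> :: real
  assumes eps: "\<epsilon> > 0"
begin

text \<open>Affine in the squared distance, hence smooth at the centre as well, and normalised to be
  1 on the sphere of radius \<epsilon> and 0 on that of radius 2 \<epsilon>.\<close>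

definition bump_arg :: "'a \<Rightarrow> real" where "bump_arg y = (4 * \<epsilon>\<^sup>2 - (norm (y - a))\<^sup>2) / (3 * \<epsilon>\<^sup>2)"
text \<open>Denominator of the smooth step e(t) / (e(t) + e(1 - t)) with e = \<open>expn 0\<close>,
  which is 0 for t \<le> 0 and 1 for t \<ge> 1. It never vanishes because t or 1 - t is
  positive.\<close>

definition bump_den :: "'a \<Rightarrow> real" where "bump_den y = expn 0 (bump_arg y) + expn 0 (1 - bump_arg y)"
definition bump :: "'a \<Rightarrow> real" where "bump y = expn 0 (bump_arg y) * inverse (bump_den y)"

lemma bump_den_pos: "bump_den y > 0"
  unfolding bump_den_def by (cases "bump_arg y > 0") (auto simp: expn_def add_pos_nonneg)

lemma bump_arg_has_derivative:
  "(bump_arg has_derivative (\<lambda>h. - 2 / (3 * \<epsilon>\<^sup>2) * ((y - a) \<bullet> h))) (at y)"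
proof -
  have "((\<lambda>y. (4 * \<epsilon>\<^sup>2 - (y - a) \<bullet> (y - a)) * c) has_derivative (\<lambda>h. - 2 * c * ((y - a) \<bullet> h))) (at y)" for c
    by (auto intro!: derivative_eq_intros simp: inner_commute algebra_simps)
  from this[of "1 / (3 * \<epsilon>\<^sup>2)"] show ?thesis by (simp add: bump_arg_def[abs_def] power2_norm_eq_inner)
qed

lemma expn_bump_has_derivative:
  "((\<lambda>y. expn n (bump_arg y)) has_derivative
     (\<lambda>h. (expn (n + 2) (bump_arg y) - real n * expn (n + 1) (bump_arg y)) * (- 2 / (3 * \<epsilon>\<^sup>2) * ((y - a) \<bullet> h)))) (at y)"
  "((\<lambda>y. expn n (1 - bump_arg y)) has_derivative
     (\<lambda>h. (expn (n + 2) (1 - bump_arg y) - real n * expn (n + 1) (1 - bump_arg y)) * (2 / (3 * \<epsilon>\<^sup>2) * ((y - a) \<bullet> h)))) (at y)"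
proof -
  show "((\<lambda>y. expn n (bump_arg y)) has_derivative
     (\<lambda>h. (expn (n + 2) (bump_arg y) - real n * expn (n + 1) (bump_arg y)) * (- 2 / (3 * \<epsilon>\<^sup>2) * ((y - a) \<bullet> h)))) (at y)"
    using has_derivative_compose[OF bump_arg_has_derivative expn_deriv[unfolded has_field_derivative_def]] by simp
  have "((\<lambda>y. 1 - bump_arg y) has_derivative (\<lambda>h. 2 / (3 * \<epsilon>\<^sup>2) * ((y - a) \<bullet> h))) (at y)"
    using has_derivative_diff[OF has_derivative_const bump_arg_has_derivative, of 1] by simp
  from has_derivative_compose[OF this expn_deriv[unfolded has_field_derivative_def]]
  show "((\<lambda>y. expn n (1 - bump_arg y)) has_derivative
     (\<lambda>h. (expn (n + 2) (1 - bump_arg y) - real n * expn (n + 1) (1 - bump_arg y)) * (2 / (3 * \<epsilon>\<^sup>2) * ((y - a) \<bullet> h)))) (at y)"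
    by simp
qed

lemma smooth_bump: "smooth_fun_on UNIV bump"
proof -
  \<comment> \<open>The index n absorbs the powers of 1/t that differentiation produces. The
    reciprocal of the denominator is a generator of its own, since its derivative is again a
    polynomial in the generators.\<close>
  define G where "G = range (\<lambda>n y. expn n (bump_arg y)) \<union> range (\<lambda>n y. expn n (1 - bump_arg y))
     \<union> {\<lambda>y. inverse (bump_den y)} \<union> (\<lambda>b y. (y - a) \<bullet> b) ` Basis"
  have G1: "(\<lambda>y. expn n (bump_arg y)) \<in> gen_alg G" and G2: "(\<lambda>y. expn n (1 - bump_arg y)) \<in> gen_alg G"
    and G3: "(\<lambda>y. inverse (bump_den y)) \<in> gen_alg G" and G4: "b \<in> Basis \<Longrightarrow> (\<lambda>y. (y - a) \<bullet> b) \<in> gen_alg G" for n b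
    unfolding G_def by (intro gen_alg_base; blast)+
  define D1 where "D1 n b y = (expn (n + 2) (bump_arg y) - real n * expn (n + 1) (bump_arg y)) * (- 2 / (3 * \<epsilon>\<^sup>2) * ((y - a) \<bullet> b))" for n b y
  define D2 where "D2 n b y = (expn (n + 2) (1 - bump_arg y) - real n * expn (n + 1) (1 - bump_arg y)) * (2 / (3 * \<epsilon>\<^sup>2) * ((y - a) \<bullet> b))" for n b y
  have D1: "D1 n b \<in> gen_alg G" and D2: "D2 n b \<in> gen_alg G" if "b \<in> Basis" for n b
    unfolding D1_def[abs_def] D2_def[abs_def] using that by (intro gen_alg_mult gen_alg_diff gen_alg_const G1 G2 G4; simp)+
  have dden: "(bump_den has_derivative (\<lambda>b. D1 0 b y + D2 0 b y)) (at y)" for y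
    unfolding bump_den_def[abs_def] D1_def D2_def by (intro has_derivative_add expn_bump_has_derivative)
  have dinv: "((\<lambda>y. inverse (bump_den y)) has_derivative (\<lambda>b. - (inverse (bump_den y) * (D1 0 b y + D2 0 b y) * inverse (bump_den y)))) (at y)" for y
    using bump_den_pos[of y] by (intro Deriv.has_derivative_inverse dden) auto
  have din: "((\<lambda>y. (y - a) \<bullet> c) has_derivative (\<lambda>b. b \<bullet> c)) (at y)" for c y
    by (auto intro!: derivative_eq_intros)
  show ?thesis
  proof (rule smooth_gen_alg[where G=G])
    show "g differentiable (at y)" if "g \<in> G" for g y
      using that expn_bump_has_derivative dinv din unfolding G_def differentiable_def by blast
    show "\<exists>h\<in>gen_alg G. \<forall>y\<in>UNIV. frechet_derivative g (at y) b = h y" if "g \<in> G" and b: "b \<in> Basis" for g b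
    proof -
      from that(1) consider n where "g = (\<lambda>y. expn n (bump_arg y))" | n where "g = (\<lambda>y. expn n (1 - bump_arg y))"
        | "g = (\<lambda>y. inverse (bump_den y))" | c where "c \<in> Basis" "g = (\<lambda>y. (y - a) \<bullet> c)"
        unfolding G_def by blast
      then show ?thesis
      proof cases
        case 1
        have "\<forall>y\<in>UNIV. frechet_derivative g (at y) b = D1 n b y"
          unfolding 1 by (simp add: frechet_derivative_at[OF expn_bump_has_derivative(1), symmetric] D1_def)
        then show ?thesis by (rule bexI[OF _ D1[OF b]])
      next
        case 2
        have "\<forall>y\<in>UNIV. frechet_derivative g (at y) b = D2 n b y"
          unfolding 2 by (simp add: frechet_derivative_at[OF expn_bump_has_derivative(2), symmetric] D2_def)
        then show ?thesis by (rule bexI[OF _ D2[OF b]])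
      next
        case 3
        have "\<forall>y\<in>UNIV. frechet_derivative g (at y) b = - (inverse (bump_den y) * (D1 0 b y + D2 0 b y) * inverse (bump_den y))"
          unfolding 3 by (simp add: frechet_derivative_at[OF dinv, symmetric])
        moreover have "(\<lambda>y. - (inverse (bump_den y) * (D1 0 b y + D2 0 b y) * inverse (bump_den y))) \<in> gen_alg G"
          using b by (intro gen_alg_uminus gen_alg_mult gen_alg_add G3 D1 D2)
        ultimately show ?thesis by (rule bexI)
      next
        case 4
        have "\<forall>y\<in>UNIV. frechet_derivative g (at y) b = (\<lambda>_. b \<bullet> c) y"
          unfolding 4 by (simp add: frechet_derivative_at[OF din, symmetric])
        then show ?thesis by (rule bexI[OF _ gen_alg_const])
      qed
    qed
    show "bump \<in> gen_alg G" unfolding bump_def[abs_def] by (intro gen_alg_mult G1 G3)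
  qed auto
qed

lemma bump_eq_1: "dist a y \<le> \<epsilon> \<Longrightarrow> bump y = 1"
proof -
  assume "dist a y \<le> \<epsilon>"
  then have "(norm (y - a))\<^sup>2 \<le> \<epsilon>\<^sup>2" by (intro power_mono) (auto simp: dist_norm norm_minus_commute)
  then have "bump_arg y \<ge> 1" using eps by (simp add: bump_arg_def field_simps)
  then show ?thesis using bump_den_pos[of y] by (simp add: bump_def bump_den_def expn_def)
qed

lemma bump_eq_0: "y \<notin> cball a (2 * \<epsilon>) \<Longrightarrow> bump y = 0"
proof -
  assume "y \<notin> cball a (2 * \<epsilon>)"
  then have "(2 * \<epsilon>)\<^sup>2 \<le> (norm (y - a))\<^sup>2" using eps by (intro power_mono) (auto simp: dist_norm norm_minus_commute)
  then have "bump_arg y \<le> 0" using eps by (simp add: bump_arg_def field_simps)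
  then show ?thesis by (simp add: bump_def expn_def)
qed
end

lemma bump_exists:
  fixes a :: "'a::euclidean_space"
  assumes "\<epsilon> > 0" "cball a (2 * \<epsilon>) \<subseteq> S"
  shows "\<exists>\<zeta>::'a \<Rightarrow> real. \<zeta> \<in> test_functions S \<and> (\<forall>y\<in>ball a \<epsilon>. \<zeta> y = 1)"
proof (intro exI conjI)
  show "bump a \<epsilon> \<in> test_functions S"
    using assms by (intro test_functionsI[where K="cball a (2 * \<epsilon>)"] smooth_bump bump_eq_0) auto
  show "\<forall>y\<in>ball a \<epsilon>. bump a \<epsilon> y = 1" using assms(1) by (auto intro: bump_eq_1 less_imp_le)
qed

lemma cutoff_exists:
  fixes K W :: "'a::euclidean_space set"
  assumes "compact K" "open W" "K \<subseteq> W"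
  obtains \<zeta> :: "'a \<Rightarrow> real" and V where "\<zeta> \<in> test_functions W" "open V" "K \<subseteq> V" "\<And>y. y \<in> V \<Longrightarrow> \<zeta> y = 1"
proof -
  have "\<exists>e>0. cball a (2 * e) \<subseteq> W" if "a \<in> K" for a
  proof -
    obtain e where "e > 0" "cball a e \<subseteq> W" using assms \<open>a \<in> K\<close> open_contains_cball by (metis subsetD)
    then show ?thesis by (intro exI[of _ "e / 2"]) auto
  qed
  then obtain e where e: "\<And>a. a \<in> K \<Longrightarrow> e a > 0 \<and> cball a (2 * e a) \<subseteq> W" by metis
  have cov: "K \<subseteq> (\<Union>a\<in>K. ball a (e a))" using e by force
  have op: "\<And>a. a \<in> K \<Longrightarrow> open (ball a (e a))" by simp
  obtain F where F: "finite F" "F \<subseteq> K" "K \<subseteq> (\<Union>a\<in>F. ball a (e a))"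
    by (rule compactE_image[OF assms(1) op cov])
  have "\<exists>\<zeta>::'a \<Rightarrow> real. \<zeta> \<in> test_functions W \<and> (\<forall>y\<in>(\<Union>a\<in>F. ball a (e a)). \<zeta> y = 1)"
    using F(1,2)
  proof (induction F)
    case empty
    have "(\<lambda>_. 0 :: real) \<in> test_functions W"
      by (rule test_functionsI[where K="{}"]) (auto intro: smooth_fun_on_0)
    then show ?case by auto
  next
    case (insert a F)
    then obtain \<zeta> :: "'a \<Rightarrow> real" where c: "\<zeta> \<in> test_functions W" "\<forall>y\<in>(\<Union>a\<in>F. ball a (e a)). \<zeta> y = 1" by auto
    obtain \<rho> :: "'a \<Rightarrow> real" where r: "\<rho> \<in> test_functions W" "\<forall>y\<in>ball a (e a). \<rho> y = 1"
      using bump_exists[of "e a" a W] e[of a] insert.prems by auto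
    \<comment> \<open>The combination \<zeta> + \<rho> - \<zeta> \<rho> = 1 - (1 - \<zeta>) (1 -
      \<rho>) is 1 wherever one of the two is, so cutoffs for single balls merge into one for their
      union.\<close>
    have "(\<lambda>y. \<zeta> y * \<rho> y) \<in> test_functions W"
      using c(1) r(1) by (intro test_functions_mult[where W=UNIV]) (auto simp: test_functions_def)
    then have "(\<lambda>y. \<zeta> y + \<rho> y - \<zeta> y * \<rho> y) \<in> test_functions W"
      by (intro test_functions_diff test_functions_add c r)
    moreover have "\<forall>y\<in>(\<Union>a\<in>insert a F. ball a (e a)). \<zeta> y + \<rho> y - \<zeta> y * \<rho> y = 1"
      using c(2) r(2) by auto
    ultimately show ?case by blast
  qed
  then obtain \<zeta> :: "'a \<Rightarrow> real" where "\<zeta> \<in> test_functions W" "\<forall>y\<in>(\<Union>a\<in>F. ball a (e a)). \<zeta> y = 1" by blast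
  with F(3) show ?thesis by (intro that[of \<zeta> "\<Union>a\<in>F. ball a (e a)"]) auto
qed

section \<open>Pairings with compactly supported distributions\<close>

lemma test_functions_schwartz:
  assumes "f \<in> test_functions S" shows "f \<in> schwartz"
proof -
  have "\<exists>C. \<forall>x. (1 + norm x) ^ N * norm (dir_derivs bs f x) \<le> C" if bs: "set bs \<subseteq> Basis" for bs N
  proof -
    have t: "dir_derivs bs f \<in> test_functions S" by (rule test_functions_dir_derivs[OF assms bs])
    obtain B where B: "B \<ge> 0" "\<And>x. norm (dir_derivs bs f x) \<le> B" using test_functions_bounded[OF t] by blast
    have "bounded (fun_supp f)" using assms by (auto simp: test_functions_def compact_imp_bounded)
    then obtain R where R: "\<And>x. x \<in> fun_supp f \<Longrightarrow> norm x \<le> R" using bounded_iff by metis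
    have "(1 + norm x) ^ N * norm (dir_derivs bs f x) \<le> (1 + \<bar>R\<bar>) ^ N * B" for x
    proof (cases "x \<in> fun_supp f")
      case True
      then have "norm x \<le> \<bar>R\<bar>" using R by force
      then show ?thesis using B by (intro mult_mono power_mono) auto
    next
      case False
      then show ?thesis using B(1) by (simp add: dir_derivs_outside_supp)
    qed
    then show ?thesis by blast
  qed
  then show ?thesis using assms by (auto simp: schwartz_def test_functions_def)
qed

lemma tempered_linear:
  assumes "u \<in> tempered" "\<phi> \<in> schwartz" "\<psi> \<in> schwartz"
  shows "u (\<lambda>x. a * \<phi> x + b * \<psi> x) = a * u \<phi> + b * u \<psi>"
  using assms unfolding tempered_def by blast

text \<open>By compactness finitely many balls, each inside an open set on which u vanishes, cover
  the support of \<phi>. A bump \<rho> splits off the piece \<rho> \<psi> living in one of these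
  sets; the rest (1 - \<rho>) \<psi> is supported in the remaining balls, which is why the induction
  runs over arbitrary test functions \<psi>.\<close>

lemma tempered_vanishes:
  assumes u: "u \<in> tempered" and \<phi>: "\<phi> \<in> test_functions UNIV" and disj: "fun_supp \<phi> \<inter> dist_supp u = {}"
  shows "u \<phi> = 0"
proof -
  define \<V> where "\<V> = {V. open V \<and> (\<forall>\<phi>\<in>test_functions V. u \<phi> = 0)}"
  have cov: "fun_supp \<phi> \<subseteq> \<Union>\<V>" using disj unfolding dist_supp_def \<V>_def by blast
  have "\<exists>e V. e > 0 \<and> V \<in> \<V> \<and> cball a (2 * e) \<subseteq> V" if a: "a \<in> fun_supp \<phi>" for a
  proof -
    from a cov obtain V where V: "V \<in> \<V>" "a \<in> V" by blast
    then have "open V" by (simp add: \<V>_def)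
    then obtain e where "e > 0" "cball a e \<subseteq> V" using V open_contains_cball by metis
    then show ?thesis using V by (intro exI[of _ "e / 2"] exI[of _ V]) auto
  qed
  then obtain e V where eV: "\<And>a. a \<in> fun_supp \<phi> \<Longrightarrow> e a > 0 \<and> V a \<in> \<V> \<and> cball a (2 * e a) \<subseteq> V a" by metis
  have cov': "fun_supp \<phi> \<subseteq> (\<Union>a\<in>fun_supp \<phi>. ball a (e a))" using eV by force
  have op: "\<And>a. a \<in> fun_supp \<phi> \<Longrightarrow> open (ball a (e a))" by simp
  have cpt: "compact (fun_supp \<phi>)" using \<phi> by (simp add: test_functions_def)
  obtain F where F: "finite F" "F \<subseteq> fun_supp \<phi>" "fun_supp \<phi> \<subseteq> (\<Union>a\<in>F. ball a (e a))"
    by (rule compactE_image[OF cpt op cov'])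
  have "\<forall>\<psi>\<in>test_functions UNIV. fun_supp \<psi> \<subseteq> (\<Union>a\<in>F. ball a (e a)) \<longrightarrow> u \<psi> = 0"
    using F(1,2)
  proof (induction F)
    case empty
    show ?case
    proof (intro ballI impI)
      fix \<psi> :: "plane \<Rightarrow> complex" assume \<psi>: "\<psi> \<in> test_functions UNIV" "fun_supp \<psi> \<subseteq> (\<Union>a\<in>{}. ball a (e a))"
      then have z: "\<psi> = (\<lambda>_. 0)" using fun_supp_zero[of _ \<psi>] by auto
      have "u (\<lambda>x. 0 * \<psi> x + 0 * \<psi> x) = 0 * u \<psi> + 0 * u \<psi>"
        using \<psi> test_functions_schwartz by (intro tempered_linear u) auto
      then show "u \<psi> = 0" by (simp add: z)
    qed
  next
    case (insert a F)
    show ?case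
    proof (intro ballI impI)
      fix \<psi> :: "plane \<Rightarrow> complex" assume \<psi>: "\<psi> \<in> test_functions UNIV" "fun_supp \<psi> \<subseteq> (\<Union>a\<in>insert a F. ball a (e a))"
      have ea: "e a > 0" "V a \<in> \<V>" "cball a (2 * e a) \<subseteq> V a" using eV[of a] insert.prems by auto
      obtain \<rho> :: "plane \<Rightarrow> real" where r: "\<rho> \<in> test_functions (V a)" "\<forall>y\<in>ball a (e a). \<rho> y = 1"
        using bump_exists[OF ea(1,3)] by blast
      have rc: "(\<lambda>y. complex_of_real (\<rho> y)) \<in> test_functions (V a)"
        by (rule test_functions_bounded_linear[OF r(1) bounded_linear_of_real])
      have t1: "(\<lambda>y. complex_of_real (\<rho> y) * \<psi> y) \<in> test_functions (V a)"
        using \<psi> by (intro test_functions_mult[OF rc, of UNIV]) (auto simp: test_functions_def)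
      then have u1: "u (\<lambda>y. complex_of_real (\<rho> y) * \<psi> y) = 0" using ea(2) by (auto simp: \<V>_def)
      have t2: "(\<lambda>y. \<psi> y - complex_of_real (\<rho> y) * \<psi> y) \<in> test_functions UNIV"
        using t1 test_functions_mono[of "V a" UNIV] by (intro test_functions_diff \<psi>) auto
      have "fun_supp (\<lambda>y. \<psi> y - complex_of_real (\<rho> y) * \<psi> y) \<subseteq> fun_supp \<psi> - ball a (e a)"
        using r(2) by (intro fun_supp_subset closed_Diff fun_supp_closed) (auto simp: fun_supp_zero)
      also have "\<dots> \<subseteq> (\<Union>a\<in>F. ball a (e a))" using \<psi>(2) by auto
      finally have u2: "u (\<lambda>y. \<psi> y - complex_of_real (\<rho> y) * \<psi> y) = 0" using insert t2 by simp
      have "u (\<lambda>y. 1 * (complex_of_real (\<rho> y) * \<psi> y) + 1 * (\<psi> y - complex_of_real (\<rho> y) * \<psi> y))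
         = 1 * u (\<lambda>y. complex_of_real (\<rho> y) * \<psi> y) + 1 * u (\<lambda>y. \<psi> y - complex_of_real (\<rho> y) * \<psi> y)"
        using t1 t2 test_functions_schwartz by (intro tempered_linear u) auto
      then show "u \<psi> = 0" by (simp add: u1 u2)
    qed
  qed
  then show ?thesis using \<phi> F(3) by blast
qed

text \<open>Two test functions that equal g near the support of u differ by one whose support misses
  it, and u vanishes there; this is the uniqueness behind the definite description.\<close>

lemma dist_pairing_eq:
  assumes u: "u \<in> tempered" and \<phi>: "\<phi> \<in> test_functions UNIV" and V: "open V" "dist_supp u \<subseteq> V" "\<And>y. y \<in> V \<Longrightarrow> \<phi> y = g y"
  shows "dist_pairing u g = u \<phi>"
  unfolding dist_pairing_def
proof (rule the_equality)
  show "\<exists>\<phi>'\<in>test_functions UNIV. \<exists>V. open V \<and> dist_supp u \<subseteq> V \<and> (\<forall>y\<in>V. \<phi>' y = g y) \<and> u \<phi> = u \<phi>'"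
    using \<phi> V by blast
  fix z assume "\<exists>\<phi>\<in>test_functions UNIV. \<exists>V. open V \<and> dist_supp u \<subseteq> V \<and> (\<forall>y\<in>V. \<phi> y = g y) \<and> z = u \<phi>"
  then obtain \<psi> V' where \<psi>: "\<psi> \<in> test_functions UNIV" "open V'" "dist_supp u \<subseteq> V'" "\<forall>y\<in>V'. \<psi> y = g y" "z = u \<psi>"
    by blast
  have "u (\<lambda>y. \<psi> y - \<phi> y) = 0"
  proof (rule tempered_vanishes[OF u test_functions_diff[OF \<psi>(1) \<phi>]])
    have "fun_supp (\<lambda>y. \<psi> y - \<phi> y) \<subseteq> - (V \<inter> V')"
      using V \<psi> by (intro fun_supp_subset closed_Compl open_Int) auto
    then show "fun_supp (\<lambda>y. \<psi> y - \<phi> y) \<inter> dist_supp u = {}" using V(2) \<psi>(3) by blast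
  qed
  moreover have "u (\<lambda>y. 1 * \<psi> y + (- 1) * \<phi> y) = 1 * u \<psi> + (- 1) * u \<phi>"
    using \<phi> \<psi> test_functions_schwartz by (intro tempered_linear u) auto
  ultimately show "z = u \<phi>" by (simp add: \<psi>(5))
qed

section \<open>Fourier inversion on test functions\<close>

text \<open>Reduces integrals over the plane to the line, both for the Gaussian and for a product
  majorant of the annular weight.\<close>

lemma lborel_integral_prod_coords:
  fixes f :: "'a::euclidean_space \<Rightarrow> real \<Rightarrow> 'b::{real_normed_field,banach,second_countable_topology}"
  assumes int: "\<And>b. b \<in> Basis \<Longrightarrow> integrable lborel (f b)"
  shows "integrable lborel (\<lambda>x. \<Prod>b\<in>Basis. f b (x \<bullet> b))"
    and "(\<integral>x. (\<Prod>b\<in>Basis. f b (x \<bullet> b)) \<partial>lborel) = (\<Prod>b\<in>Basis. \<integral>t. f b t \<partial>lborel)"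
proof -
  interpret product_sigma_finite "\<lambda>_::'a. lborel :: real measure" by standard
  have m: "(\<lambda>g. \<Sum>b\<in>Basis. g b *\<^sub>R b) \<in> measurable (\<Pi>\<^sub>M b\<in>Basis. lborel) (borel :: 'a measure)" by measurable
  have [measurable]: "f b \<in> borel_measurable borel" if "b \<in> Basis" for b using int[OF that] by (auto dest: borel_measurable_integrable)
  have F: "(\<lambda>x. \<Prod>b\<in>Basis. f b (x \<bullet> b)) \<in> borel_measurable (borel :: 'a measure)" by measurable
  have c: "(\<Prod>b\<in>Basis. f b ((\<Sum>c\<in>Basis. g c *\<^sub>R c) \<bullet> b)) = (\<Prod>b\<in>Basis. f b (g b))" for g
    by (intro prod.cong refl) (simp add: inner_sum_left_Basis)
  show "integrable lborel (\<lambda>x. \<Prod>b\<in>Basis. f b (x \<bullet> b))"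
    unfolding lborel_eq[where 'a='a] integrable_distr_eq[OF m F] c by (rule product_integrable_prod) (auto intro: int)
  show "(\<integral>x. (\<Prod>b\<in>Basis. f b (x \<bullet> b)) \<partial>lborel) = (\<Prod>b\<in>Basis. \<integral>t. f b t \<partial>lborel)"
    unfolding lborel_eq[where 'a='a] integral_distr[OF m F] c by (rule product_integral_prod) (auto intro: int)
qed

text \<open>Up to the factor sqrt (2 pi) this is the characteristic function of the standard normal
  distribution.\<close>

lemma gaussian_fourier_real:
  "integrable lborel (\<lambda>t::real. complex_of_real (exp (- t\<^sup>2 / 2)) * exp (\<i> * of_real (t * c)))"
  "(\<integral>t. complex_of_real (exp (- t\<^sup>2 / 2)) * exp (\<i> * of_real (t * c)) \<partial>lborel) = of_real (sqrt (2 * pi) * exp (- c\<^sup>2 / 2))"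
proof -
  have e: "complex_of_real (exp (- t\<^sup>2 / 2)) * exp (\<i> * of_real (t * c)) = of_real (sqrt (2 * pi)) * (std_normal_density t *\<^sub>R exp (\<i> * of_real (c * t)))" for t
    by (simp add: std_normal_density_def scaleR_conv_of_real mult.commute)
  have i: "integrable lborel (\<lambda>t. std_normal_density t *\<^sub>R exp (\<i> * of_real (c * t)))"
    by (rule Bochner_Integration.integrable_bound[OF integrable_normal_density[of 1 0]]) (auto simp: std_normal_density_def)
  show "integrable lborel (\<lambda>t::real. complex_of_real (exp (- t\<^sup>2 / 2)) * exp (\<i> * of_real (t * c)))"
    unfolding e by (intro integrable_mult_right i)
  have "(\<integral>t. std_normal_density t *\<^sub>R exp (\<i> * of_real (c * t)) \<partial>lborel) = char std_normal_distribution c"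
    unfolding char_def by (subst integral_density) (auto simp: std_normal_density_def)
  then show "(\<integral>t. complex_of_real (exp (- t\<^sup>2 / 2)) * exp (\<i> * of_real (t * c)) \<partial>lborel) = of_real (sqrt (2 * pi) * exp (- c\<^sup>2 / 2))"
    unfolding e by (subst integral_mult_right_zero) (simp add: char_std_normal_distribution)
qed

lemma norm_sq_Basis: "(norm (x::'a::euclidean_space))\<^sup>2 = (\<Sum>b\<in>Basis. (x \<bullet> b)\<^sup>2)"
  by (simp add: norm_eq_sqrt_inner euclidean_inner[of x x] power2_eq_square sum_nonneg)

lemma gaussian_fourier_plane:
  "integrable lborel (\<lambda>w::plane. complex_of_real (exp (- (norm w)\<^sup>2 / 2)) * exp (\<i> * of_real (w \<bullet> y)))"
  "(\<integral>w. complex_of_real (exp (- (norm (w::plane))\<^sup>2 / 2)) * exp (\<i> * of_real (w \<bullet> y)) \<partial>lborel) = of_real (2 * pi * exp (- (norm y)\<^sup>2 / 2))"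
proof -
  let ?f = "\<lambda>b t. complex_of_real (exp (- t\<^sup>2 / 2)) * exp (\<i> * of_real (t * (y \<bullet> b)))"
  have e: "complex_of_real (exp (- (norm w)\<^sup>2 / 2)) * exp (\<i> * of_real (w \<bullet> y)) = (\<Prod>b\<in>Basis. ?f b (w \<bullet> b))" for w :: plane
  proof -
    have "exp (- (norm w)\<^sup>2 / 2) = (\<Prod>b\<in>Basis. exp (- (w \<bullet> b)\<^sup>2 / 2))"
      unfolding norm_sq_Basis by (simp add: exp_sum[symmetric] sum_negf sum_divide_distrib)
    moreover have "exp (\<i> * of_real (w \<bullet> y)) = (\<Prod>b\<in>Basis. exp (\<i> * complex_of_real ((w \<bullet> b) * (y \<bullet> b))))"
      by (subst euclidean_inner) (simp add: exp_sum[symmetric] sum_distrib_left)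
    ultimately show ?thesis by (simp add: prod.distrib of_real_prod)
  qed
  show "integrable lborel (\<lambda>w::plane. complex_of_real (exp (- (norm w)\<^sup>2 / 2)) * exp (\<i> * of_real (w \<bullet> y)))"
    unfolding e by (intro lborel_integral_prod_coords(1) gaussian_fourier_real)
  have "(\<integral>w. complex_of_real (exp (- (norm (w::plane))\<^sup>2 / 2)) * exp (\<i> * of_real (w \<bullet> y)) \<partial>lborel)
    = (\<Prod>b\<in>Basis. of_real (sqrt (2 * pi) * exp (- (y \<bullet> b)\<^sup>2 / 2)))"
    unfolding e by (subst lborel_integral_prod_coords(2)) (intro gaussian_fourier_real, simp only: gaussian_fourier_real(2))
  also have "\<dots> = of_real ((sqrt (2 * pi)) ^ card (Basis :: plane set) * (\<Prod>b\<in>(Basis :: plane set). exp (- (y \<bullet> b)\<^sup>2 / 2)))"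
    by (simp only: of_real_mult prod.distrib prod_constant of_real_power of_real_prod)
  also have "(\<Prod>b\<in>(Basis :: plane set). exp (- (y \<bullet> b)\<^sup>2 / 2)) = exp (- (norm y)\<^sup>2 / 2)"
    unfolding norm_sq_Basis by (simp add: exp_sum[symmetric] sum_negf sum_divide_distrib)
  also have "(sqrt (2 * pi)) ^ card (Basis :: plane set) = 2 * pi" by simp
  finally show "(\<integral>w. complex_of_real (exp (- (norm (w::plane))\<^sup>2 / 2)) * exp (\<i> * of_real (w \<bullet> y)) \<partial>lborel) = of_real (2 * pi * exp (- (norm y)\<^sup>2 / 2))" .
qed

lemma plane_integral_affine:
  fixes f :: "plane \<Rightarrow> 'b::{banach,second_countable_topology}"
  assumes "c > 0" and [measurable]: "f \<in> borel_measurable borel"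
  shows "(\<integral>x. f x \<partial>lborel) = c\<^sup>2 *\<^sub>R (\<integral>x. f (t + c *\<^sub>R x) \<partial>lborel)"
proof -
  have "(\<integral>x. f x \<partial>lborel) = (\<integral>x. f x \<partial>density (distr lborel borel (\<lambda>x. t + c *\<^sub>R x)) (\<lambda>_. \<bar>c\<bar> ^ DIM(plane)))"
    using assms(1) by (subst lborel_affine[of c t]) auto
  also have "\<dots> = (\<integral>x. \<bar>c\<bar> ^ DIM(plane) *\<^sub>R f x \<partial>distr lborel borel (\<lambda>x. t + c *\<^sub>R x))"
    by (subst integral_density) auto
  also have "\<dots> = (\<integral>x. \<bar>c\<bar> ^ DIM(plane) *\<^sub>R f (t + c *\<^sub>R x) \<partial>lborel)"
    by (subst integral_distr) auto
  finally show ?thesis by simp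
qed

lemma plane_integrable_affine:
  fixes f :: "plane \<Rightarrow> 'b::{banach,second_countable_topology}"
  assumes c: "c > 0" and f: "integrable lborel f"
  shows "integrable lborel (\<lambda>x. f (t + c *\<^sub>R x))"
proof -
  have [measurable]: "f \<in> borel_measurable borel" using f by auto
  have "integrable (density (distr lborel borel (\<lambda>x. t + c *\<^sub>R x)) (\<lambda>_. ennreal (\<bar>c\<bar> ^ DIM(plane)))) f"
    using f c by (subst (asm) lborel_affine[of c t]) auto
  then have "integrable (distr lborel borel (\<lambda>x. t + c *\<^sub>R x)) (\<lambda>x. \<bar>c\<bar> ^ DIM(plane) *\<^sub>R f x)"
    by (subst (asm) integrable_density) auto
  then have "integrable lborel (\<lambda>x. \<bar>c\<bar> ^ DIM(plane) *\<^sub>R f (t + c *\<^sub>R x))"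
    by (subst (asm) integrable_distr_eq) auto
  from integrable_scaleR_right[OF this, of "inverse (\<bar>c\<bar> ^ DIM(plane))"] show ?thesis using c by simp
qed

lemma plane_integral_translate:
  fixes f :: "plane \<Rightarrow> 'b::{banach,second_countable_topology}"
  assumes "f \<in> borel_measurable borel"
  shows "(\<integral>x. f (t + x) \<partial>lborel) = (\<integral>x. f x \<partial>lborel)"
  using plane_integral_affine[of 1 f t] assms by simp

text \<open>Fubini for an integrable tensor product times a bounded kernel; the kernel will be an
  exponential of modulus 1.\<close>

lemma Fubini_kernel:
  fixes a b :: "plane \<Rightarrow> complex" and k :: "plane \<times> plane \<Rightarrow> complex"
  assumes a: "integrable lborel a" and b: "integrable lborel b"
    and [measurable]: "k \<in> borel_measurable borel" and k: "\<And>p. norm (k p) \<le> C"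
  shows "(\<integral>x. \<integral>y. a x * b y * k (x, y) \<partial>lborel \<partial>lborel) = (\<integral>y. \<integral>x. a x * b y * k (x, y) \<partial>lborel \<partial>lborel)"
proof -
  have [measurable]: "a \<in> borel_measurable borel" "b \<in> borel_measurable borel" using a b by auto
  have nb: "norm (a x * b y * k (x, y)) \<le> norm (C * norm (a x) * norm (b y))" for x y
  proof -
    have "norm (a x * b y * k (x, y)) \<le> norm (a x) * norm (b y) * C"
      unfolding norm_mult by (intro mult_left_mono k) auto
    also have "\<dots> \<le> norm (C * norm (a x) * norm (b y))" using abs_ge_self[of "C * norm (a x) * norm (b y)"] by (simp add: abs_mult mult_ac)
    finally show ?thesis .
  qed
  have iy: "integrable lborel (\<lambda>y. a x * b y * k (x, y))" for x
    by (rule Bochner_Integration.integrable_bound[where f="\<lambda>y. C * norm (a x) * norm (b y)"]) (use b nb in auto)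
  have "integrable (lborel \<Otimes>\<^sub>M lborel) (\<lambda>(x, y). a x * b y * k (x, y))"
  proof (rule lborel_pair.Fubini_integrable)
    show "integrable lborel (\<lambda>x. \<integral>y. norm (case (x, y) of (x, y) \<Rightarrow> a x * b y * k (x, y)) \<partial>lborel)"
    proof (rule Bochner_Integration.integrable_bound[where f="\<lambda>x. norm (a x) * (\<integral>y. norm (C * norm (b y)) \<partial>lborel)"])
      show "integrable lborel (\<lambda>x. norm (a x) * (\<integral>y. norm (C * norm (b y)) \<partial>lborel))" using a by auto
      show "AE x in lborel. norm (\<integral>y. norm (case (x, y) of (x, y) \<Rightarrow> a x * b y * k (x, y)) \<partial>lborel) \<le> norm (norm (a x) * (\<integral>y. norm (C * norm (b y)) \<partial>lborel))"
      proof (rule AE_I2)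
        fix x
        have "(\<integral>y. norm (a x * b y * k (x, y)) \<partial>lborel) \<le> (\<integral>y. norm (a x) * norm (C * norm (b y)) \<partial>lborel)"
        proof (rule integral_mono)
          show "integrable lborel (\<lambda>y. norm (a x) * norm (C * norm (b y)))" using b by auto
          show "norm (a x * b y * k (x, y)) \<le> norm (a x) * norm (C * norm (b y))" for y
            using nb[of x y] by (simp add: abs_mult mult_ac)
        qed (use iy in auto)
        then show "norm (\<integral>y. norm (case (x, y) of (x, y) \<Rightarrow> a x * b y * k (x, y)) \<partial>lborel) \<le> norm (norm (a x) * (\<integral>y. norm (C * norm (b y)) \<partial>lborel))"
          by (simp add: abs_mult)
      qed
    qed measurable
  qed (use iy in auto)
  from lborel_pair.Fubini_integral[OF this] show ?thesis by simp
qed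

lemma test_functions_borel: "f \<in> test_functions S \<Longrightarrow> f \<in> borel_measurable borel"
  by (intro borel_measurable_continuous_onI test_functions_continuous)

lemma test_functions_integrable:
  fixes f :: "'a::euclidean_space \<Rightarrow> 'b::euclidean_space"
  assumes "f \<in> test_functions S" shows "integrable lborel f"
proof -
  have "compact (fun_supp f)" using assms by (simp add: test_functions_def)
  then have "integrable lborel (\<lambda>x. indicator (fun_supp f) x *\<^sub>R f x)"
    using assms by (intro borel_integrable_compact continuous_on_subset[OF test_functions_continuous]) auto
  moreover have "(\<lambda>x. indicator (fun_supp f) x *\<^sub>R f x) = f"
    using fun_supp_zero[of _ f] by (auto simp: fun_eq_iff indicator_def)
  ultimately show ?thesis by simp
qed

lemma fourier_measurable [measurable]:
  assumes [measurable]: "g \<in> borel_measurable borel" shows "fourier g \<in> borel_measurable borel"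
  unfolding fourier_def[abs_def] by measurable

lemma fourier_norm_le: "norm (fourier g \<xi>) \<le> (\<integral>x. norm (g x) \<partial>lborel)"
proof -
  have "norm (fourier g \<xi>) \<le> (\<integral>x. norm (exp (- \<i> * complex_of_real (x \<bullet> \<xi>)) * g x) \<partial>lborel)"
    unfolding fourier_def by (rule integral_norm_bound)
  then show ?thesis by (simp add: norm_mult)
qed

text \<open>Gaussian regularisation: with the factor \<open>G (e n *\<^sub>R \<xi>)\<close>
  inserted, the order of integration may be exchanged, and the integral over \<xi> becomes a
  Gaussian approximate identity acting on g. Both sides converge by dominated convergence as the
  scale e n tends to 0.\<close>

theorem fourier_inversion:
  fixes g :: "plane \<Rightarrow> complex"
  assumes g: "g \<in> test_functions S" and gi: "integrable lborel (fourier g)"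
  shows "(\<integral>\<xi>. exp (\<i> * complex_of_real (y \<bullet> \<xi>)) * fourier g \<xi> \<partial>lborel) = of_real ((2 * pi)\<^sup>2) * g y"
proof -
  note [measurable] = test_functions_borel[OF g]
  define G where "G w = complex_of_real (exp (- (norm (w::plane))\<^sup>2 / 2))" for w
  have [measurable]: "G \<in> borel_measurable borel" unfolding G_def[abs_def] by measurable
  have G_int: "integrable lborel G" and G_val: "(\<integral>w. G w \<partial>lborel) = of_real (2 * pi)"
    using gaussian_fourier_plane[of 0]
    by (simp_all only: G_def[abs_def] inner_zero_right of_real_0 mult_zero_right exp_zero mult_1_right
      norm_zero power_zero_numeral minus_zero div_0)
  have G_le: "norm (G w) \<le> 1" for w by (simp add: G_def)
  define e where "e n = 1 / real (Suc n)" for n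
  have e: "e n > 0" for n by (simp add: e_def)
  have e0: "e \<longlonglongrightarrow> 0" unfolding e_def[abs_def] by real_asymp
  obtain B where B: "B \<ge> 0" "\<And>x. norm (g x) \<le> B" using test_functions_bounded[OF g] by blast
  have gc: "isCont g x" for x
    using test_functions_continuous[OF g] by (simp add: continuous_on_eq_continuous_at)
  have Gc: "isCont G x" for x unfolding G_def by (intro continuous_intros) simp_all
  have G_scaled: "integrable lborel (\<lambda>\<xi>. G (e n *\<^sub>R \<xi>))" for n
  proof -
    have "integrable lborel (\<lambda>\<xi>. G (0 + e n *\<^sub>R \<xi>))"
      by (rule plane_integrable_affine[OF e G_int])
    then show ?thesis by simp
  qed
  have main: "(\<integral>\<xi>. exp (\<i> * complex_of_real (y \<bullet> \<xi>)) * fourier g \<xi> * G (e n *\<^sub>R \<xi>) \<partial>lborel)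
     = of_real (2 * pi) * (\<integral>w. g (y + e n *\<^sub>R w) * G w \<partial>lborel)" for n
  proof -
    let ?k = "\<lambda>(\<xi>, z). exp (\<i> * complex_of_real ((y - z) \<bullet> \<xi>))"
    have "(\<integral>\<xi>. exp (\<i> * complex_of_real (y \<bullet> \<xi>)) * fourier g \<xi> * G (e n *\<^sub>R \<xi>) \<partial>lborel)
       = (\<integral>\<xi>. \<integral>z. G (e n *\<^sub>R \<xi>) * g z * ?k (\<xi>, z) \<partial>lborel \<partial>lborel)"
    proof (intro Bochner_Integration.integral_cong refl)
      fix \<xi>
      have "exp (\<i> * complex_of_real (y \<bullet> \<xi>)) * fourier g \<xi> * G (e n *\<^sub>R \<xi>)
        = (\<integral>z. (exp (\<i> * complex_of_real (y \<bullet> \<xi>)) * G (e n *\<^sub>R \<xi>)) * (exp (- \<i> * complex_of_real (z \<bullet> \<xi>)) * g z) \<partial>lborel)"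
        unfolding fourier_def by simp
      also have "\<dots> = (\<integral>z. G (e n *\<^sub>R \<xi>) * g z * ?k (\<xi>, z) \<partial>lborel)"
      proof (intro Bochner_Integration.integral_cong refl)
        fix z
        have "exp (\<i> * complex_of_real ((y - z) \<bullet> \<xi>)) = exp (\<i> * complex_of_real (y \<bullet> \<xi>)) * exp (- \<i> * complex_of_real (z \<bullet> \<xi>))"
          by (simp add: exp_add[symmetric] inner_diff_left algebra_simps)
        then show "(exp (\<i> * complex_of_real (y \<bullet> \<xi>)) * G (e n *\<^sub>R \<xi>)) * (exp (- \<i> * complex_of_real (z \<bullet> \<xi>)) * g z) = G (e n *\<^sub>R \<xi>) * g z * ?k (\<xi>, z)"
          by simp
      qed
      finally show "exp (\<i> * complex_of_real (y \<bullet> \<xi>)) * fourier g \<xi> * G (e n *\<^sub>R \<xi>) = (\<integral>z. G (e n *\<^sub>R \<xi>) * g z * ?k (\<xi>, z) \<partial>lborel)" .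
    qed
    also have "\<dots> = (\<integral>z. \<integral>\<xi>. G (e n *\<^sub>R \<xi>) * g z * ?k (\<xi>, z) \<partial>lborel \<partial>lborel)"
      by (rule Fubini_kernel[OF G_scaled test_functions_integrable[OF g], where C=1]) (auto simp: split_beta intro!: borel_measurable_continuous_onI continuous_intros)
    also have "\<dots> = (\<integral>z. g z * (of_real ((1 / e n)\<^sup>2 * (2 * pi)) * G ((1 / e n) *\<^sub>R (y - z))) \<partial>lborel)"
    proof (intro Bochner_Integration.integral_cong refl)
      fix z
      have "(\<integral>\<xi>. G (e n *\<^sub>R \<xi>) * g z * ?k (\<xi>, z) \<partial>lborel)
        = (1 / e n)\<^sup>2 *\<^sub>R (\<integral>\<xi>. G (e n *\<^sub>R (0 + (1 / e n) *\<^sub>R \<xi>)) * g z * ?k (0 + (1 / e n) *\<^sub>R \<xi>, z) \<partial>lborel)"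
        using e[of n] by (intro plane_integral_affine) auto
      also have "\<dots> = (1 / e n)\<^sup>2 *\<^sub>R (\<integral>\<xi>. g z * (complex_of_real (exp (- (norm \<xi>)\<^sup>2 / 2)) * exp (\<i> * of_real (\<xi> \<bullet> ((1 / e n) *\<^sub>R (y - z))))) \<partial>lborel)"
        using e[of n] by (simp add: G_def mult_ac inner_commute)
      also have "\<dots> = (1 / e n)\<^sup>2 *\<^sub>R (g z * of_real (2 * pi * exp (- (norm ((1 / e n) *\<^sub>R (y - z)))\<^sup>2 / 2)))"
        by (subst integral_mult_right_zero) (simp only: gaussian_fourier_plane(2))
      also have "\<dots> = g z * (of_real ((1 / e n)\<^sup>2 * (2 * pi)) * G ((1 / e n) *\<^sub>R (y - z)))"
        by (simp add: G_def scaleR_conv_of_real)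
      finally show "(\<integral>\<xi>. G (e n *\<^sub>R \<xi>) * g z * ?k (\<xi>, z) \<partial>lborel) = \<dots>" .
    qed
    \<comment> \<open>Substituting z = y + e n w undoes the scaling of the Gaussian and moves the
      scale into the argument of g, where continuity handles the limit.\<close>
    also have "\<dots> = (e n)\<^sup>2 *\<^sub>R (\<integral>w. g (y + e n *\<^sub>R w) * (of_real ((1 / e n)\<^sup>2 * (2 * pi)) * G ((1 / e n) *\<^sub>R (y - (y + e n *\<^sub>R w)))) \<partial>lborel)"
      using e[of n] by (intro plane_integral_affine) auto
    also have "\<dots> = (e n)\<^sup>2 *\<^sub>R (\<integral>w. of_real ((1 / e n)\<^sup>2 * (2 * pi)) * (g (y + e n *\<^sub>R w) * G w) \<partial>lborel)"
      using e[of n] by (simp add: G_def mult_ac)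
    also have "\<dots> = of_real (2 * pi) * (\<integral>w. g (y + e n *\<^sub>R w) * G w \<partial>lborel)"
      using e[of n] by (subst integral_mult_right_zero) (simp add: scaleR_conv_of_real power_divide)
    finally show ?thesis .
  qed
  have L1: "(\<lambda>n. \<integral>\<xi>. exp (\<i> * complex_of_real (y \<bullet> \<xi>)) * fourier g \<xi> * G (e n *\<^sub>R \<xi>) \<partial>lborel)
     \<longlonglongrightarrow> (\<integral>\<xi>. exp (\<i> * complex_of_real (y \<bullet> \<xi>)) * fourier g \<xi> \<partial>lborel)"
  proof (rule integral_dominated_convergence[where w="\<lambda>\<xi>. norm (fourier g \<xi>)"])
    show "AE \<xi> in lborel. (\<lambda>n. exp (\<i> * complex_of_real (y \<bullet> \<xi>)) * fourier g \<xi> * G (e n *\<^sub>R \<xi>)) \<longlonglongrightarrow> exp (\<i> * complex_of_real (y \<bullet> \<xi>)) * fourier g \<xi>"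
    proof (rule AE_I2)
      fix \<xi> :: plane
      have "(\<lambda>n. e n *\<^sub>R \<xi>) \<longlonglongrightarrow> 0 *\<^sub>R \<xi>" by (intro tendsto_intros e0)
      then have "(\<lambda>n. G (e n *\<^sub>R \<xi>)) \<longlonglongrightarrow> G (0 *\<^sub>R \<xi>)" by (intro isCont_tendsto_compose[OF Gc])
      then have "(\<lambda>n. exp (\<i> * complex_of_real (y \<bullet> \<xi>)) * fourier g \<xi> * G (e n *\<^sub>R \<xi>)) \<longlonglongrightarrow> exp (\<i> * complex_of_real (y \<bullet> \<xi>)) * fourier g \<xi> * G (0 *\<^sub>R \<xi>)"
        by (intro tendsto_intros)
      then show "(\<lambda>n. exp (\<i> * complex_of_real (y \<bullet> \<xi>)) * fourier g \<xi> * G (e n *\<^sub>R \<xi>)) \<longlonglongrightarrow> exp (\<i> * complex_of_real (y \<bullet> \<xi>)) * fourier g \<xi>"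
        by (simp add: G_def)
    qed
    show "AE \<xi> in lborel. norm (exp (\<i> * complex_of_real (y \<bullet> \<xi>)) * fourier g \<xi> * G (e n *\<^sub>R \<xi>)) \<le> norm (fourier g \<xi>)" for n
      using G_le by (intro AE_I2) (auto simp: norm_mult mult_left_le)
  qed (use gi in auto)
  have L2: "(\<lambda>n. \<integral>w. g (y + e n *\<^sub>R w) * G w \<partial>lborel) \<longlonglongrightarrow> (\<integral>w. g y * G w \<partial>lborel)"
  proof (rule integral_dominated_convergence[where w="\<lambda>w. B * norm (G w)"])
    show "AE w in lborel. (\<lambda>n. g (y + e n *\<^sub>R w) * G w) \<longlonglongrightarrow> g y * G w"
    proof (rule AE_I2)
      fix w :: plane
      have "(\<lambda>n. y + e n *\<^sub>R w) \<longlonglongrightarrow> y + 0 *\<^sub>R w" by (intro tendsto_intros e0)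
      then have "(\<lambda>n. g (y + e n *\<^sub>R w)) \<longlonglongrightarrow> g (y + 0 *\<^sub>R w)" by (intro isCont_tendsto_compose[OF gc])
      then show "(\<lambda>n. g (y + e n *\<^sub>R w) * G w) \<longlonglongrightarrow> g y * G w" by (intro tendsto_intros) simp
    qed
    show "AE w in lborel. norm (g (y + e n *\<^sub>R w) * G w) \<le> B * norm (G w)" for n
      using B by (intro AE_I2) (auto simp: norm_mult intro!: mult_right_mono)
  qed (use G_int in auto)
  have "(\<lambda>n. of_real (2 * pi) * (\<integral>w. g (y + e n *\<^sub>R w) * G w \<partial>lborel)) \<longlonglongrightarrow> of_real (2 * pi) * (g y * of_real (2 * pi))"
    using tendsto_mult[OF tendsto_const L2, of "of_real (2 * pi)"] by (simp only: integral_mult_right_zero G_val)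
  with L1 have "(\<integral>\<xi>. exp (\<i> * complex_of_real (y \<bullet> \<xi>)) * fourier g \<xi> \<partial>lborel) = of_real (2 * pi) * (g y * of_real (2 * pi))"
    unfolding main by (rule LIMSEQ_unique)
  then show ?thesis by (simp add: power2_eq_square mult_ac)
qed

lemma cnj_fourier: "cnj (fourier h \<xi>) = (\<integral>y. exp (\<i> * complex_of_real (y \<bullet> \<xi>)) * cnj (h y) \<partial>lborel)"
proof -
  have "cnj (fourier h \<xi>) = (\<integral>y. cnj (exp (- \<i> * complex_of_real (y \<bullet> \<xi>)) * h y) \<partial>lborel)"
    unfolding fourier_def by (rule Bochner_Integration.integral_cnj[symmetric])
  also have "\<dots> = (\<integral>y. exp (\<i> * complex_of_real (y \<bullet> \<xi>)) * cnj (h y) \<partial>lborel)"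
    by (intro Bochner_Integration.integral_cong) (auto simp: exp_cnj)
  finally show ?thesis .
qed

text \<open>Fubini moves the exponential inside \<open>cnj (fourier h \<xi>)\<close> onto
  \<open>fourier g\<close>, where inversion applies; of h only integrability is used.\<close>

theorem parseval:
  assumes g: "g \<in> test_functions S" and gi: "integrable lborel (fourier g)" and h: "integrable lborel h"
  shows "(\<integral>\<xi>. fourier g \<xi> * cnj (fourier h \<xi>) \<partial>lborel) = of_real ((2 * pi)\<^sup>2) * (\<integral>y. g y * cnj (h y) \<partial>lborel)"
proof -
  have hc: "integrable lborel (\<lambda>y. cnj (h y))" using h by simp
  let ?k = "\<lambda>(\<xi>, y). exp (\<i> * complex_of_real (y \<bullet> \<xi>))"
  have "(\<integral>\<xi>. fourier g \<xi> * cnj (fourier h \<xi>) \<partial>lborel) = (\<integral>\<xi>. \<integral>y. fourier g \<xi> * cnj (h y) * ?k (\<xi>, y) \<partial>lborel \<partial>lborel)"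
    unfolding cnj_fourier by (subst integral_mult_right_zero[symmetric]) (simp add: mult_ac)
  also have "\<dots> = (\<integral>y. \<integral>\<xi>. fourier g \<xi> * cnj (h y) * ?k (\<xi>, y) \<partial>lborel \<partial>lborel)"
    by (rule Fubini_kernel[OF gi hc, where C=1]) (auto simp: split_beta intro!: borel_measurable_continuous_onI continuous_intros)
  also have "\<dots> = (\<integral>y. cnj (h y) * (\<integral>\<xi>. exp (\<i> * complex_of_real (y \<bullet> \<xi>)) * fourier g \<xi> \<partial>lborel) \<partial>lborel)"
    by (subst integral_mult_right_zero[symmetric]) (simp add: mult_ac)
  also have "\<dots> = (\<integral>y. of_real ((2 * pi)\<^sup>2) * (g y * cnj (h y)) \<partial>lborel)"
    unfolding fourier_inversion[OF g gi] by (simp add: mult_ac)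
  finally show ?thesis by (simp only: integral_mult_right_zero)
qed

section \<open>Integrals of partial derivatives\<close>

lemma test_functions_has_derivative:
  "f \<in> test_functions S \<Longrightarrow> (f has_derivative frechet_derivative f (at x)) (at x)"
  using smooth_fun_on_differentiable[of UNIV f x] by (simp add: test_functions_def frechet_derivative_works)

text \<open>Every difference quotient has integral 0 by translation invariance, and dominated
  convergence carries this to the derivative. It plays the part of the divergence theorem in Green's
  identity.\<close>

lemma integral_partial_derivative_0:
  fixes g :: "plane \<Rightarrow> complex"
  assumes g: "g \<in> test_functions S" and b: "b \<in> Basis"
  shows "(\<integral>x. frechet_derivative g (at x) b \<partial>lborel) = 0"
proof -
  note [measurable] = test_functions_borel[OF g]
  have Dg: "dir_derivs [b] g \<in> test_functions S" using b by (intro test_functions_dir_derivs[OF g]) simp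
  obtain B where B0: "B \<ge> 0" "\<And>x. norm (dir_derivs [b] g x) \<le> B"
    using test_functions_bounded[OF Dg] by blast
  have B: "B \<ge> 0" "\<And>x. norm (frechet_derivative g (at x) b) \<le> B"
    using B0 by simp_all
  have "bounded (fun_supp g)" using g by (auto simp: test_functions_def compact_imp_bounded)
  then obtain R where R: "\<And>x. x \<in> fun_supp g \<Longrightarrow> norm x \<le> R" using bounded_iff by metis
  define h where "h n = 1 / real (Suc n)" for n
  have h: "0 < h n" "h n \<le> 1" for n by (auto simp: h_def)
  have h0: "h \<longlonglongrightarrow> 0" unfolding h_def[abs_def] by real_asymp
  let ?q = "\<lambda>n x. (g (h n *\<^sub>R b + x) - g x) /\<^sub>R h n"
  have along: "((\<lambda>t. g (x + t *\<^sub>R b)) has_derivative (\<lambda>s. s *\<^sub>R frechet_derivative g (at (x + t *\<^sub>R b)) b)) (at t)" for x t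
  proof -
    have "((\<lambda>t. x + t *\<^sub>R b) has_derivative (\<lambda>s. s *\<^sub>R b)) (at t)" by (auto intro!: derivative_eq_intros)
    from has_derivative_compose[OF this test_functions_has_derivative[OF g]]
    show ?thesis by (simp add: linear_cmul[OF has_derivative_linear[OF test_functions_has_derivative[OF g]]])
  qed
  have "(\<lambda>n. \<integral>x. ?q n x \<partial>lborel) \<longlonglongrightarrow> (\<integral>x. frechet_derivative g (at x) b \<partial>lborel)"
  \<comment> \<open>The steps h n are at most 1, so all quotients vanish outside the ball of radius
    R + 1; inside it the mean value inequality bounds them by B.\<close>
  proof (rule integral_dominated_convergence[where w="\<lambda>x. indicator (cball 0 (R + 1)) x *\<^sub>R B"])
    show "integrable lborel (\<lambda>x::plane. indicator (cball 0 (R + 1)) x *\<^sub>R B)"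
      by (rule borel_integrable_compact) auto
    show "AE x in lborel. (\<lambda>n. ?q n x) \<longlonglongrightarrow> frechet_derivative g (at x) b"
    proof (rule AE_I2)
      fix x :: plane
      let ?D = "frechet_derivative g (at x) b"
      have "((\<lambda>t. norm (g (x + t *\<^sub>R b) - g x - t *\<^sub>R ?D) / norm t) \<longlongrightarrow> 0) (at 0)"
        using along[of x 0] by (simp add: has_derivative_iff_norm)
      moreover have "norm (g (x + t *\<^sub>R b) - g x - t *\<^sub>R ?D) / norm t = norm ((g (x + t *\<^sub>R b) - g x) /\<^sub>R t - ?D)" if "t \<noteq> 0" for t
      proof -
        have "(g (x + t *\<^sub>R b) - g x - t *\<^sub>R ?D) /\<^sub>R t = (g (x + t *\<^sub>R b) - g x) /\<^sub>R t - ?D"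
          using that by (simp only: scaleR_diff_right) simp
        moreover have "norm (v /\<^sub>R t) = norm v / norm t" for v :: complex
          by (simp add: divide_inverse_commute)
        ultimately show ?thesis by metis
      qed
      then have "eventually (\<lambda>t. norm (g (x + t *\<^sub>R b) - g x - t *\<^sub>R ?D) / norm t = norm ((g (x + t *\<^sub>R b) - g x) /\<^sub>R t - ?D)) (at 0)"
        by (simp add: eventually_at_filter)
      ultimately have "((\<lambda>t. norm ((g (x + t *\<^sub>R b) - g x) /\<^sub>R t - ?D)) \<longlongrightarrow> 0) (at 0)"
        by (rule Lim_transform_eventually)
      then have "((\<lambda>t. (g (x + t *\<^sub>R b) - g x) /\<^sub>R t) \<longlongrightarrow> ?D) (at 0)"
        by (simp add: tendsto_norm_zero_iff LIM_zero_iff)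
      moreover have "filterlim h (at 0) sequentially"
        unfolding filterlim_at using h0 h(1) by (auto simp: less_imp_neq[symmetric])
      ultimately have "(\<lambda>n. (g (x + h n *\<^sub>R b) - g x) /\<^sub>R h n) \<longlonglongrightarrow> frechet_derivative g (at x) b"
        by (rule filterlim_compose)
      then show "(\<lambda>n. ?q n x) \<longlonglongrightarrow> frechet_derivative g (at x) b" by (simp add: add.commute)
    qed
    show "AE x in lborel. norm (?q n x) \<le> indicator (cball 0 (R + 1)) x *\<^sub>R B" for n
    proof (rule AE_I2)
      fix x :: plane
      show "norm (?q n x) \<le> indicator (cball 0 (R + 1)) x *\<^sub>R B"
      proof (cases "norm x \<le> R + 1")
        case True
        have "continuous_on {0..h n} (\<lambda>t. g (x + t *\<^sub>R b))"
          by (intro continuous_at_imp_continuous_on ballI has_derivative_continuous[OF along])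
        then obtain t where "norm (g (x + h n *\<^sub>R b) - g (x + 0 *\<^sub>R b)) \<le> norm ((h n - 0) *\<^sub>R frechet_derivative g (at (x + t *\<^sub>R b)) b)"
          using mvt_general[OF h(1), of n "\<lambda>t. g (x + t *\<^sub>R b)" "\<lambda>t s. s *\<^sub>R frechet_derivative g (at (x + t *\<^sub>R b)) b"] along by (metis (no_types, lifting))
        also have "\<dots> \<le> h n * B" using h(1)[of n] B(2) by (simp add: mult_left_mono)
        finally have "norm (g (h n *\<^sub>R b + x) - g x) \<le> h n * B" by (simp add: add.commute)
        then have "inverse (h n) * norm (g (h n *\<^sub>R b + x) - g x) \<le> inverse (h n) * (h n * B)"
          using h(1)[of n] by (intro mult_left_mono) auto
        moreover have "norm (?q n x) = inverse (h n) * norm (g (h n *\<^sub>R b + x) - g x)"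
          unfolding norm_scaleR using h(1)[of n] by simp
        moreover have "inverse (h n) * (h n * B) = B" using h(1)[of n] by simp
        ultimately have "norm (?q n x) \<le> B" by (simp only:)
        then show ?thesis using True by simp
      next
        case False
        have "x \<notin> fun_supp g" using R[of x] False by auto
        moreover have "h n *\<^sub>R b + x \<notin> fun_supp g"
        proof
          assume "h n *\<^sub>R b + x \<in> fun_supp g"
          then have "norm (h n *\<^sub>R b + x) \<le> R" by (rule R)
          moreover have "norm x \<le> norm (h n *\<^sub>R b + x) + norm (h n *\<^sub>R b)"
            using norm_triangle_ineq4[of "h n *\<^sub>R b + x" "h n *\<^sub>R b"] by simp
          moreover have "norm (h n *\<^sub>R b) \<le> 1" using b h[of n] by simp
          ultimately show False using False by linarith
        qed
        ultimately show ?thesis using False by (simp add: fun_supp_zero)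
      qed
    qed
  next
    have "dir_derivs [b] g \<in> borel_measurable borel" by (rule test_functions_borel[OF Dg])
    then show "(\<lambda>x. frechet_derivative g (at x) b) \<in> borel_measurable lborel" by simp
  qed measurable
  moreover have "(\<integral>x. ?q n x \<partial>lborel) = 0" for n
  proof -
    have i: "integrable lborel g" by (rule test_functions_integrable[OF g])
    have "integrable lborel (\<lambda>x. g (h n *\<^sub>R b + 1 *\<^sub>R x))" by (rule plane_integrable_affine[OF _ i]) simp
    then show ?thesis using i plane_integral_translate[of g "h n *\<^sub>R b"] by simp
  qed
  ultimately have "(\<lambda>n. 0) \<longlonglongrightarrow> (\<integral>x. frechet_derivative g (at x) b \<partial>lborel)" by (simp only:)
  then show ?thesis by (simp add: LIMSEQ_const_iff)
qed

section \<open>Integrability of the weight around the circle of radius k\<close>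

text \<open>The exponent 4 allows two powers for each coordinate: (1 + |\<xi>|)^4 dominates the
  product of the factors 1 + (\<xi> \<bullet> b)^2, whose reciprocals are integrable on the
  line.\<close>

lemma integrable_inverse_4: "integrable lborel (\<lambda>\<xi>::plane. 1 / (1 + norm \<xi>) ^ 4)"
proof -
  have "set_integrable lborel (einterval (-\<infinity>) \<infinity>) (\<lambda>t::real. inverse (1 + t\<^sup>2))"
    by (rule integrable_inverse_1_plus_square)
  then have 1: "integrable lborel (\<lambda>t::real. inverse (1 + t\<^sup>2))"
    by (simp add: set_integrable_def einterval_def)
  have "integrable lborel (\<lambda>\<xi>::plane. \<Prod>b\<in>Basis. inverse (1 + (\<xi> \<bullet> b)\<^sup>2))"
    by (rule lborel_integral_prod_coords(1)) (rule 1)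
  then show ?thesis
  proof (rule Bochner_Integration.integrable_bound)
    show "AE \<xi>::plane in lborel. norm (1 / (1 + norm \<xi>) ^ 4) \<le> norm (\<Prod>b\<in>Basis. inverse (1 + (\<xi> \<bullet> b)\<^sup>2))"
    proof (rule AE_I2)
      fix \<xi> :: plane
      have "(\<Prod>b\<in>(Basis :: plane set). 1 + (\<xi> \<bullet> b)\<^sup>2) \<le> (\<Prod>b\<in>(Basis :: plane set). (1 + norm \<xi>)\<^sup>2)"
      proof (rule prod_mono)
        fix b :: plane assume "b \<in> Basis"
        then have "\<bar>\<xi> \<bullet> b\<bar> \<le> norm \<xi>" by (rule Basis_le_norm)
        then have "(\<xi> \<bullet> b)\<^sup>2 \<le> (norm \<xi>)\<^sup>2" by (simp add: abs_le_square_iff[symmetric])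
        then show "0 \<le> 1 + (\<xi> \<bullet> b)\<^sup>2 \<and> 1 + (\<xi> \<bullet> b)\<^sup>2 \<le> (1 + norm \<xi>)\<^sup>2"
          by (simp add: power2_sum add_increasing2)
      qed
      also have "\<dots> = (1 + norm \<xi>) ^ 4" by (simp add: power_mult[symmetric])
      finally have "(\<Prod>b\<in>(Basis :: plane set). 1 + (\<xi> \<bullet> b)\<^sup>2) \<le> (1 + norm \<xi>) ^ 4" .
      moreover have "(\<Prod>b\<in>(Basis :: plane set). 1 + (\<xi> \<bullet> b)\<^sup>2) > 0"
        by (intro prod_pos) (auto simp: add_pos_nonneg)
      ultimately have "1 / (1 + norm \<xi>) ^ 4 \<le> 1 / (\<Prod>b\<in>(Basis :: plane set). 1 + (\<xi> \<bullet> b)\<^sup>2)"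
        by (intro divide_left_mono mult_pos_pos zero_less_power) (auto simp: add_pos_nonneg)
      moreover have "(\<Prod>b\<in>(Basis :: plane set). inverse (1 + (\<xi> \<bullet> b)\<^sup>2)) = 1 / (\<Prod>b\<in>(Basis :: plane set). 1 + (\<xi> \<bullet> b)\<^sup>2)"
        by (simp add: prod_inversef[unfolded o_def] divide_inverse)
      ultimately show "norm (1 / (1 + norm \<xi>) ^ 4) \<le> norm (\<Prod>b\<in>Basis. inverse (1 + (\<xi> \<bullet> b)\<^sup>2))"
        by (simp add: abs_prod)
    qed
  qed simp
qed

text \<open>Compared with the case k = 0 through 1 + |\<xi>| \<le> (1 + k) (1 + ||\<xi>| -
  k|).\<close>

lemma integrable_ring_weight:
  assumes "k \<ge> 0" shows "integrable lborel (\<lambda>\<xi>::plane. 1 / (1 + \<bar>norm \<xi> - k\<bar>) ^ 4)"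
proof -
  have "integrable lborel (\<lambda>\<xi>::plane. (1 + k) ^ 4 * (1 / (1 + norm \<xi>) ^ 4))"
    by (intro integrable_mult_right integrable_inverse_4)
  then show ?thesis
  proof (rule Bochner_Integration.integrable_bound)
    show "AE \<xi>::plane in lborel. norm (1 / (1 + \<bar>norm \<xi> - k\<bar>) ^ 4) \<le> norm ((1 + k) ^ 4 * (1 / (1 + norm \<xi>) ^ 4))"
    proof (rule AE_I2)
      fix \<xi> :: plane
      have "1 + norm \<xi> \<le> 1 + (\<bar>norm \<xi> - k\<bar> + k)" by simp
      also have "\<dots> \<le> (1 + k) * (1 + \<bar>norm \<xi> - k\<bar>)" using assms by (simp add: algebra_simps)
      finally have "(1 + norm \<xi>) ^ 4 \<le> ((1 + k) * (1 + \<bar>norm \<xi> - k\<bar>)) ^ 4" by (intro power_mono) auto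
      then have le: "(1 + norm \<xi>) ^ 4 \<le> (1 + k) ^ 4 * (1 + \<bar>norm \<xi> - k\<bar>) ^ 4" by (simp add: power_mult_distrib)
      have "1 + norm \<xi> > 0" "1 + \<bar>norm \<xi> - k\<bar> > 0" using norm_ge_zero[of \<xi>] by linarith+
      then have pos: "(1 + norm \<xi>) ^ 4 > 0" "(1 + \<bar>norm \<xi> - k\<bar>) ^ 4 > 0" by (simp_all only: zero_less_power)
      have "1 / (1 + \<bar>norm \<xi> - k\<bar>) ^ 4 \<le> (1 + k) ^ 4 * (1 / (1 + norm \<xi>) ^ 4)"
      proof -
        have "1 / b \<le> c * (1 / a)" if "a \<le> c * b" "a > 0" "b > 0" for a b c :: real
          using that by (simp add: field_simps)
        from this[OF le pos] show ?thesis .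
      qed
      then show "norm (1 / (1 + \<bar>norm \<xi> - k\<bar>) ^ 4) \<le> norm ((1 + k) ^ 4 * (1 / (1 + norm \<xi>) ^ 4))"
        using assms by simp
    qed
  qed simp
qed

text \<open>The weight is concentrated on an annulus of bounded width, of area O(k) = o(k^2).\<close>
lemma ring_weight_asymptotic:
  "((\<lambda>k. (\<integral>\<xi>. 1 / (1 + \<bar>norm (\<xi>::plane) - k\<bar>) ^ 4 \<partial>lborel) / k\<^sup>2) \<longlongrightarrow> 0) at_top"
proof -
  \<comment> \<open>Scaling \<xi> by k turns the quotient into the integral of \<open>?s k\<close>.
    For k \<ge> 1 this is at most \<open>?s 1\<close>, and it tends to 0 off the unit sphere, a null
    set; so dominated convergence gives the claim without computing an area.\<close>
  let ?s = "\<lambda>(k::real) (\<xi>::plane). 1 / (1 + k * \<bar>norm \<xi> - 1\<bar>) ^ 4"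
  have "((\<lambda>k. \<integral>\<xi>. ?s k \<xi> \<partial>lborel) \<longlongrightarrow> (\<integral>\<xi>. (0::real) \<partial>(lborel :: plane measure))) at_top"
  proof (rule integral_dominated_convergence_at_top)
    show "integrable lborel (\<lambda>\<xi>::plane. 1 / (1 + \<bar>norm \<xi> - 1\<bar>) ^ 4)" by (rule integrable_ring_weight) simp
    show "\<forall>\<^sub>F k in at_top. AE \<xi> in lborel. norm (?s k \<xi>) \<le> 1 / (1 + \<bar>norm \<xi> - 1\<bar>) ^ 4"
      using eventually_ge_at_top[of 1]
    proof (eventually_elim, intro AE_I2)
      fix k :: real and \<xi> :: plane assume k: "1 \<le> k"
      have "1 * \<bar>norm \<xi> - 1\<bar> \<le> k * \<bar>norm \<xi> - 1\<bar>" using k by (intro mult_right_mono) auto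
      then have "(1 + \<bar>norm \<xi> - 1\<bar>) ^ 4 \<le> (1 + k * \<bar>norm \<xi> - 1\<bar>) ^ 4" by (intro power_mono) auto
      then have "1 / (1 + k * \<bar>norm \<xi> - 1\<bar>) ^ 4 \<le> 1 / (1 + \<bar>norm \<xi> - 1\<bar>) ^ 4"
        using k by (intro divide_left_mono mult_pos_pos zero_less_power add_pos_nonneg) auto
      then show "norm (?s k \<xi>) \<le> 1 / (1 + \<bar>norm \<xi> - 1\<bar>) ^ 4" by simp
    qed
    have "negligible (sphere (0::plane) 1)" by (rule negligible_sphere)
    then have "sphere (0::plane) 1 \<in> null_sets lebesgue" by (simp add: negligible_iff_null_sets)
    then have "AE \<xi> in lebesgue. \<xi> \<notin> sphere (0::plane) 1" by (rule AE_not_in)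
    then have "AE \<xi> in lborel. \<xi> \<notin> sphere (0::plane) 1"
      by (subst (asm) AE_completion_iff) auto
    then show "AE \<xi> in lborel. ((\<lambda>k. ?s k \<xi>) \<longlongrightarrow> 0) at_top"
    proof eventually_elim
      case (elim \<xi>)
      then have c: "\<bar>norm \<xi> - 1\<bar> > 0" by simp
      show ?case using c by real_asymp
    qed
  qed measurable
  then have "((\<lambda>k. \<integral>\<xi>. ?s k \<xi> \<partial>lborel) \<longlongrightarrow> 0) at_top" by simp
  moreover have "eventually (\<lambda>k. (\<integral>\<xi>. ?s k \<xi> \<partial>lborel) = (\<integral>\<xi>. 1 / (1 + \<bar>norm (\<xi>::plane) - k\<bar>) ^ 4 \<partial>lborel) / k\<^sup>2) at_top"
    using eventually_gt_at_top[of 0]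
  proof eventually_elim
    case (elim k)
    have "(\<integral>\<xi>. 1 / (1 + \<bar>norm (\<xi>::plane) - k\<bar>) ^ 4 \<partial>lborel) = k\<^sup>2 *\<^sub>R (\<integral>\<xi>. 1 / (1 + \<bar>norm ((0::plane) + k *\<^sub>R \<xi>) - k\<bar>) ^ 4 \<partial>lborel)"
      by (rule plane_integral_affine[OF elim]) simp
    also have "(\<lambda>\<xi>::plane. 1 / (1 + \<bar>norm ((0::plane) + k *\<^sub>R \<xi>) - k\<bar>) ^ 4) = ?s k"
    proof
      fix \<xi> :: plane
      have "\<bar>k * norm \<xi> - k\<bar> = k * \<bar>norm \<xi> - 1\<bar>" using elim by (simp add: abs_mult_pos' algebra_simps flip: right_diff_distrib abs_mult_pos)
      then show "1 / (1 + \<bar>norm ((0::plane) + k *\<^sub>R \<xi>) - k\<bar>) ^ 4 = ?s k \<xi>" using elim by simp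
    qed
    finally show ?case using elim by simp
  qed
  ultimately show ?thesis by (rule Lim_transform_eventually)
qed

section \<open>Almost sure equality and square integrability of Gaussian variables\<close>

text \<open>The sample of u is a definite description that is identified with an evaluation of f
  only almost surely; completeness turns this identification into measurability.\<close>

lemma complete_measure_borel_measurable_AE:
  fixes f g :: "'w \<Rightarrow> 'b::topological_space"
  assumes "complete_measure M" and g: "g \<in> borel_measurable M" and ae: "AE x in M. f x = g x"
  shows "f \<in> borel_measurable M"
proof (rule measurableI)
  fix A :: "'b set" assume A: "A \<in> sets borel"
  have "AE x in M. (x \<in> g -` A \<inter> space M) = (x \<in> f -` A \<inter> space M)" using ae by (auto elim: eventually_mono)
  then show "f -` A \<inter> space M \<in> sets M"
    by (rule complete_measure.in_sets_AE[OF assms(1)]) (use g A in auto)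
qed simp

lemma centered_gaussian_sq_integrable:
  assumes "centered_gaussian M X" shows "integrable M (\<lambda>\<omega>. (X \<omega>)\<^sup>2)"
proof -
  have X [measurable]: "X \<in> borel_measurable M" using assms by (simp add: centered_gaussian_def)
  from assms consider "AE \<omega> in M. X \<omega> = 0"
    | \<tau> where "\<tau> > 0" "distributed M lborel X (\<lambda>x. ennreal (normal_density 0 \<tau> x))"
    unfolding centered_gaussian_def by blast
  then show ?thesis
  proof cases
    case 1
    have "integrable M (\<lambda>\<omega>. 0 :: real)" by simp
    then show ?thesis
      by (rule integrable_cong_AE_imp) (use 1 in \<open>auto elim: eventually_mono\<close>)
  next
    case 2
    have "integrable lborel (\<lambda>x. normal_density 0 \<tau> x * (x - 0) ^ 2)" by (rule integrable_normal_moment[OF 2(1)])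
    then have "integrable lborel (\<lambda>x. normal_density 0 \<tau> x * x\<^sup>2)" by simp
    then show ?thesis
      using distributed_integrable[OF 2(2), of "\<lambda>x. x\<^sup>2"] by simp
  qed
qed

section \<open>Laplace transforms\<close>

lemma Gamma_lborel_integral:
  fixes a :: real
  assumes "a > 0"
  shows "set_integrable lborel {0<..} (\<lambda>t. t powr (a - 1) * exp (-t))"
    and "(LBINT t:{0<..}. t powr (a - 1) * exp (-t)) = Gamma a"
proof -
  have "(\<integral>\<^sup>+t. ennreal (indicator {0<..} t * (t powr (a - 1) * exp (-t))) \<partial>lborel) = ennreal (Gamma a)"
    unfolding Gamma_conv_nn_integral_real[OF assms]
    by (intro nn_integral_cong) (auto simp: indicator_def exp_minus divide_inverse)
  then have "has_bochner_integral lborel (\<lambda>t. indicator {0<..} t * (t powr (a - 1) * exp (-t))) (Gamma a)"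
    using assms by (intro has_bochner_integral_nn_integral) (auto intro: Gamma_real_pos less_imp_le)
  then show "set_integrable lborel {0<..} (\<lambda>t. t powr (a - 1) * exp (-t))"
    and "(LBINT t:{0<..}. t powr (a - 1) * exp (-t)) = Gamma a"
    unfolding set_integrable_def set_lebesgue_integral_def
    by (auto simp: has_bochner_integral_iff)
qed

lemma powr_exp_set_integrable:
  fixes a c :: real
  assumes "a > -1" "c > 0"
  shows "set_integrable lborel {0<..} (\<lambda>t. t powr a * exp (- (c * t)))"
proof -
  have "set_integrable lborel {0<..} (\<lambda>t. t powr a * exp (-t))"
    using Gamma_lborel_integral(1)[of "a+1"] assms by simp
  then have "integrable lborel (\<lambda>t. indicator {0<..} (0 + c*t) *\<^sub>R ((0 + c*t) powr a * exp (-(0 + c*t))))"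
    unfolding set_integrable_def using assms by (intro lborel_integrable_real_affine) auto
  then have "integrable lborel (\<lambda>t. (1 / c powr a) * (indicator {0<..} (0 + c*t) *\<^sub>R ((0 + c*t) powr a * exp (-(0 + c*t)))))"
    by (intro integrable_mult_right) auto
  then show ?thesis unfolding set_integrable_def
    by (rule back_subst[where P="integrable lborel"])
       (use assms in \<open>auto simp: fun_eq_iff indicator_def powr_mult zero_less_mult_iff\<close>)
qed

definition laplace :: "(real \<Rightarrow> complex) \<Rightarrow> complex \<Rightarrow> complex" where
  "laplace q z = (LBINT t:{0<..}. exp (- (z * of_real t)) * q t)"

text \<open>Asking for all polynomial moments against every decaying exponential makes the class
  stable under multiplication by -t, so that transforms can be differentiated repeatedly under the
  integral.\<close>

definition laplace_admissible :: "(real \<Rightarrow> complex) \<Rightarrow> bool" where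
  "laplace_admissible q \<longleftrightarrow> q \<in> borel_measurable borel \<and>
     (\<forall>c>0. \<forall>n::nat. set_integrable lborel {0<..} (\<lambda>t. t ^ n * exp (- (c * t)) * norm (q t)))"

lemma laplace_admissible_mult:
  assumes "laplace_admissible q"
  shows "laplace_admissible (\<lambda>t. - of_real t * q t)"
proof -
  have "set_integrable lborel {0<..} (\<lambda>t. t ^ n * exp (- (c * t)) * norm (- of_real t * q t))"
    if "c > 0" for c n
  proof -
    have "set_integrable lborel {0<..} (\<lambda>t. t ^ Suc n * exp (- (c * t)) * norm (q t))"
      using assms that unfolding laplace_admissible_def by blast
    moreover have "set_integrable lborel {0<..} (\<lambda>t. t ^ n * exp (- (c * t)) * norm (- of_real t * q t))
       \<longleftrightarrow> set_integrable lborel {0<..} (\<lambda>t. t ^ Suc n * exp (- (c * t)) * norm (q t))"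
      by (rule set_integrable_cong) (auto simp: norm_mult)
    ultimately show ?thesis by simp
  qed
  then show ?thesis using assms unfolding laplace_admissible_def by auto
qed

text \<open>One term of the bound controls the singularity at 0, integrable because a > -1, the
  other the growth at infinity.\<close>

lemma laplace_admissibleI:
  assumes "q \<in> borel_measurable borel" "\<And>t. t > 0 \<Longrightarrow> norm (q t) \<le> C * (t powr a + t ^ m)" "a > -1"
  shows "laplace_admissible q"
  unfolding laplace_admissible_def
proof (intro conjI allI impI)
  fix c :: real and n :: nat assume "c > 0"
  have "set_integrable lborel {0<..} (\<lambda>t. C * (t powr (a + n) * exp (-(c*t)) + t powr (real (n + m)) * exp (-(c*t))))"
    using \<open>c > 0\<close> assms(3) by (intro set_integrable_mult_right set_integral_add powr_exp_set_integrable) auto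
  then show "set_integrable lborel {0<..} (\<lambda>t. t ^ n * exp (- (c * t)) * norm (q t))"
  proof (rule set_integrable_bound)
    show "set_borel_measurable lborel {0<..} (\<lambda>t. t ^ n * exp (- (c * t)) * norm (q t))"
      unfolding set_borel_measurable_def using assms(1) by measurable
    show "AE t in lborel. t \<in> {0<..} \<longrightarrow> norm (t ^ n * exp (- (c * t)) * norm (q t))
        \<le> norm (C * (t powr (a + n) * exp (-(c*t)) + t powr (real (n + m)) * exp (-(c*t))))"
    proof (intro AE_I2 impI)
      fix t :: real assume "t \<in> {0<..}"
      then have "t > 0" by simp
      have "t ^ n * exp (- (c * t)) * norm (q t) \<le> t ^ n * exp (- (c * t)) * (C * (t powr a + t ^ m))"
        using \<open>t > 0\<close> assms(2) by (intro mult_left_mono) auto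
      also have "\<dots> = C * (t powr (a + n) * exp (-(c*t)) + t powr (real (n + m)) * exp (-(c*t)))"
        using \<open>t > 0\<close> by (simp add: powr_add powr_realpow algebra_simps power_add)
      finally show "norm (t ^ n * exp (- (c * t)) * norm (q t)) \<le> norm (C * (t powr (a + n) * exp (-(c*t)) + t powr (real (n + m)) * exp (-(c*t))))"
        using \<open>t > 0\<close> by (simp add: norm_mult)
    qed
  qed
qed (rule assms)

lemma laplace_integrable:
  assumes "laplace_admissible q" "Re z > 0"
  shows "set_integrable lborel {0<..} (\<lambda>t. exp (- (z * of_real t)) * q t)"
proof -
  have "set_integrable lborel {0<..} (\<lambda>t. t ^ 0 * exp (- (Re z * t)) * norm (q t))"
    using assms unfolding laplace_admissible_def by blast
  then show ?thesis
    apply (rule set_integrable_bound)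
    subgoal using assms(1) unfolding set_borel_measurable_def laplace_admissible_def by auto
    subgoal by (auto simp: norm_mult)
    done
qed

text \<open>Mean value inequality on the convex half-plane Re w \<ge> c. The factor exp (- c t),
  common to all w there, makes the right-hand side a majorant for difference quotients.\<close>

lemma norm_exp_diff_le:
  fixes y z :: complex
  assumes "c \<le> Re y" "c \<le> Re z" "0 \<le> t"
  shows "norm (exp (- (y * of_real t)) - exp (- (z * of_real t))) \<le> t * exp (- (c * t)) * norm (y - z)"
proof (rule field_differentiable_bound[of "{w. c \<le> Re w}" _ "\<lambda>w. - of_real t * exp (- (w * of_real t))"])
  show "convex {w. c \<le> Re w}" by (rule convex_halfspace_Re_ge)
  show "((\<lambda>w. exp (- (w * of_real t))) has_field_derivative - of_real t * exp (- (w * of_real t))) (at w within {w. c \<le> Re w})" for w :: complex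
    by (auto intro!: derivative_eq_intros)
  show "cmod (- of_real t * exp (- (w * of_real t))) \<le> t * exp (- (c * t))" if "w \<in> {w. c \<le> Re w}" for w
    using that assms by (auto simp: norm_mult mult_right_mono intro!: mult_left_mono)
qed (use assms in auto)

lemma laplace_has_field_derivative:
  assumes q: "laplace_admissible q" and z: "Re z > 0"
  shows "(laplace q has_field_derivative laplace (\<lambda>t. - of_real t * q t) z) (at z)"
proof -
  \<comment> \<open>Half of Re z leaves a neighbourhood of z in which Re w > c > 0, so one
    exponential dominates all difference quotients.\<close>
  define c where "c = Re z / 2"
  define S where "S = {w. c < Re w}"
  have c: "c > 0" "c \<le> Re z" and zS: "z \<in> S" using z by (auto simp: c_def S_def)
  have "open S" unfolding S_def by (rule open_halfspace_Re_gt)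
  have [measurable]: "q \<in> borel_measurable borel" using q by (simp add: laplace_admissible_def)
  have "((\<lambda>w. (laplace q w - laplace q z) / (w - z)) \<longlongrightarrow> laplace (\<lambda>t. - of_real t * q t) z) (at z within S)"
    unfolding tendsto_at_iff_sequentially
  proof (intro allI impI)
    fix X assume X: "\<forall>i. X i \<in> S - {z}" "X \<longlonglongrightarrow> z"
    let ?s = "\<lambda>i t. indicator {0<..} t *\<^sub>R ((exp (- (X i * of_real t)) - exp (- (z * of_real t))) / (X i - z) * q t)"
    have eq: "(laplace q (X i) - laplace q z) / (X i - z) = (\<integral>t. ?s i t \<partial>lborel)" for i
    proof -
      have "Re (X i) > 0" using X(1)[rule_format, of i] c by (simp add: S_def)
      then have "laplace q (X i) - laplace q z = (LBINT t:{0<..}. exp (- (X i * of_real t)) * q t - exp (- (z * of_real t)) * q t)"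
        unfolding laplace_def by (intro set_integral_diff(2)[symmetric] laplace_integrable q z)
      then have "(laplace q (X i) - laplace q z) / (X i - z) = (LBINT t:{0<..}. (exp (- (X i * of_real t)) * q t - exp (- (z * of_real t)) * q t) / (X i - z))"
        by simp
      also have "\<dots> = (\<integral>t. ?s i t \<partial>lborel)" unfolding set_lebesgue_integral_def
        by (intro Bochner_Integration.integral_cong) (auto simp: algebra_simps diff_divide_distrib)
      finally show ?thesis .
    qed
    have "(\<lambda>i. \<integral>t. ?s i t \<partial>lborel) \<longlonglongrightarrow> (\<integral>t. indicator {0<..} t *\<^sub>R (exp (- (z * of_real t)) * (- of_real t * q t)) \<partial>lborel)"
    proof (rule integral_dominated_convergence[where w="\<lambda>t. indicator {0<..} t *\<^sub>R (t ^ 1 * exp (- (c * t)) * norm (q t))"])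
      show "integrable lborel (\<lambda>t. indicator {0<..} t *\<^sub>R (t ^ 1 * exp (- (c * t)) * norm (q t)))"
        using q c unfolding laplace_admissible_def set_integrable_def by blast
      show "AE t in lborel. (\<lambda>i. ?s i t) \<longlonglongrightarrow> indicator {0<..} t *\<^sub>R (exp (- (z * of_real t)) * (- of_real t * q t))"
      proof (rule AE_I2)
        fix t :: real
        have "((\<lambda>w. exp (- (w * of_real t))) has_field_derivative - of_real t * exp (- (z * of_real t))) (at z within S)"
          by (auto intro!: derivative_eq_intros)
        then have "((\<lambda>w. (exp (- (w * of_real t)) - exp (- (z * of_real t))) / (w - z)) \<longlongrightarrow> - of_real t * exp (- (z * of_real t))) (at z within S)"
          by (simp add: has_field_derivative_iff)
        then have "((\<lambda>w. (exp (- (w * of_real t)) - exp (- (z * of_real t))) / (w - z)) \<circ> X) \<longlonglongrightarrow> - of_real t * exp (- (z * of_real t))"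
          using X unfolding tendsto_at_iff_sequentially by blast
        then have "(\<lambda>i. indicator {0<..} t *\<^sub>R ((((\<lambda>w. (exp (- (w * of_real t)) - exp (- (z * of_real t))) / (w - z)) \<circ> X) i) * q t)) \<longlonglongrightarrow> indicator {0<..} t *\<^sub>R ((- of_real t * exp (- (z * of_real t))) * q t)"
          by (intro tendsto_intros)
        then show "(\<lambda>i. ?s i t) \<longlonglongrightarrow> indicator {0<..} t *\<^sub>R (exp (- (z * of_real t)) * (- of_real t * q t))"
          by (simp add: o_def mult_ac)
      qed
      show "AE t in lborel. norm (?s i t) \<le> indicator {0<..} t *\<^sub>R (t ^ 1 * exp (- (c * t)) * norm (q t))" for i
      proof (rule AE_I2)
        fix t :: real
        have "norm ((exp (- (X i * of_real t)) - exp (- (z * of_real t))) / (X i - z)) \<le> t * exp (- (c * t))" if "t > 0"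
          using norm_exp_diff_le[of c "X i" z t] X(1) c that by (auto simp: S_def norm_divide divide_simps less_imp_le)
        then show "norm (?s i t) \<le> indicator {0<..} t *\<^sub>R (t ^ 1 * exp (- (c * t)) * norm (q t))"
          using mult_right_mono[of _ _ "norm (q t)"] by (cases "t > 0") (auto simp: norm_mult simp del: times_divide_eq_left)
      qed
    qed auto
    then show "((\<lambda>w. (laplace q w - laplace q z) / (w - z)) \<circ> X) \<longlonglongrightarrow> laplace (\<lambda>t. - of_real t * q t) z"
      unfolding o_def eq unfolding laplace_def set_lebesgue_integral_def .
  qed
  then have "(laplace q has_field_derivative laplace (\<lambda>t. - of_real t * q t) z) (at z within S)"
    by (simp add: has_field_derivative_iff)
  then show ?thesis using at_within_open[OF zS \<open>open S\<close>] by simp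
qed

text \<open>The boundary term at 0 vanishes because G does, that at infinity because linear growth
  loses against the exponential. Continuity of g is asked on the open half-line only, so g may be
  singular at 0, as 1 / \<open>hroot\<close> is.\<close>

lemma laplace_by_parts:
  assumes G: "\<And>t. t > 0 \<Longrightarrow> (G has_vector_derivative g t) (at t)"
    and g: "continuous_on {0<..} g"
    and adm: "laplace_admissible G" "laplace_admissible g"
    and G0: "(G \<longlongrightarrow> 0) (at_right 0)"
    and bd: "\<And>t. t > 0 \<Longrightarrow> norm (G t) \<le> C * (1 + t)"
    and z: "Re z > 0"
  shows "laplace g z = z * laplace G z"
proof -
  let ?F = "\<lambda>t. exp (- (z * of_real t)) * G t"
  let ?f = "\<lambda>t. exp (- (z * of_real t)) * g t - z * (exp (- (z * of_real t)) * G t)"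
  have int1: "set_integrable lborel {0<..} (\<lambda>t. exp (- (z * of_real t)) * g t)"
    and int2: "set_integrable lborel {0<..} (\<lambda>t. exp (- (z * of_real t)) * G t)"
    using adm z by (auto intro: laplace_integrable)
  have cG: "continuous_on {0<..} G"
    by (intro continuous_at_imp_continuous_on) (auto dest!: G intro: has_vector_derivative_continuous)
  have ei: "einterval 0 \<infinity> = {0<..}" by (auto simp: einterval_def zero_ereal_def)
  have "(LBINT t=0..\<infinity>. ?f t) = 0 - 0"
  proof (rule interval_integral_FTC_integrable)
    show "(0::ereal) < \<infinity>" by simp
    show "(?F has_vector_derivative ?f t) (at t)" if "0 < ereal t" "ereal t < \<infinity>" for t
    proof -
      have "t > 0" using that by simp
      have "((\<lambda>t. exp (- (z * of_real t))) has_vector_derivative - z * exp (- (z * of_real t))) (at t)"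
        by (rule has_vector_derivative_real_field) (auto intro!: derivative_eq_intros)
      from has_vector_derivative_mult[OF this G[OF \<open>t > 0\<close>]] show ?thesis by (simp add: algebra_simps)
    qed
    show "isCont ?f t" if "0 < ereal t" "ereal t < \<infinity>" for t
    proof -
      have "t > 0" using that by simp
      then have "isCont G t" "isCont g t" using cG g by (auto simp: continuous_on_eq_continuous_at)
      then show ?thesis by (intro continuous_intros) auto
    qed
    show "set_integrable lborel (einterval 0 \<infinity>) ?f"
      unfolding ei by (intro set_integral_diff(1) set_integrable_mult_right int1 int2)
    have "((\<lambda>t. exp (- (z * of_real t)) * G t) \<longlongrightarrow> exp (- (z * of_real 0)) * 0) (at_right 0)"
      by (intro tendsto_intros G0)
    then show "((?F \<circ> real_of_ereal) \<longlongrightarrow> 0) (at_right 0)"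
      unfolding zero_ereal_def by (simp add: ereal_tendsto_simps1)
    have "((\<lambda>t. C * (1 + t) * exp (- (Re z * t))) \<longlongrightarrow> 0) at_top"
      using z by real_asymp
    moreover have "eventually (\<lambda>t. norm (?F t) \<le> C * (1 + t) * exp (- (Re z * t))) at_top"
      using eventually_gt_at_top[of 0] by eventually_elim (auto simp: norm_mult mult.commute intro!: mult_right_mono bd)
    ultimately have "(?F \<longlongrightarrow> 0) at_top" by (rule Lim_null_comparison[rotated])
    then show "((?F \<circ> real_of_ereal) \<longlongrightarrow> 0) (at_left \<infinity>)"
      by (simp add: ereal_tendsto_simps1)
  qed
  then have "(LBINT t:{0<..}. ?f t) = 0"
    by (simp add: interval_lebesgue_integral_def ei)
  moreover have "(LBINT t:{0<..}. ?f t) = laplace g z - z * laplace G z"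
    unfolding laplace_def
    by (subst set_integral_diff(2)) (auto intro!: set_integrable_mult_right int1 int2)
  ultimately show ?thesis by simp
qed

lemma csqrt_measurable [measurable]: "csqrt \<in> borel_measurable borel"
  unfolding borel_measurable_complex_iff by simp

section \<open>The Laplace transform representing the Hankel function\<close>

definition hroot :: "real \<Rightarrow> complex" where
  "hroot t = csqrt (Complex t (t\<^sup>2 / 2))"

lemma hroot_sq: "(hroot t)\<^sup>2 = Complex t (t\<^sup>2 / 2)"
  by (simp add: hroot_def)

lemma hroot_Re_pos: "t > 0 \<Longrightarrow> Re (hroot t) > 0"
  and hroot_Im_nonneg: "t > 0 \<Longrightarrow> Im (hroot t) \<ge> 0"
proof -
  assume t: "t > 0"
  have "cmod (Complex t (t\<^sup>2 / 2)) + t > 0"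
    using t norm_ge_zero[of "Complex t (t\<^sup>2 / 2)"] by linarith
  then show "Re (hroot t) > 0" by (simp add: hroot_def)
  have "cmod (Complex t (t\<^sup>2 / 2)) - t \<ge> 0"
    using complex_Re_le_cmod[of "Complex t (t\<^sup>2 / 2)"] by simp
  then show "Im (hroot t) \<ge> 0" using t by (simp add: hroot_def)
qed

lemma hroot_neq_0: "t > 0 \<Longrightarrow> hroot t \<noteq> 0"
  using hroot_Re_pos by force

lemma norm_hroot_sq: "(norm (hroot t))\<^sup>2 = cmod (Complex t (t\<^sup>2 / 2))"
  by (metis hroot_sq norm_power)

text \<open>The real part t of the square gives the bound that is sharp near 0, its imaginary part
  t^2 / 2 the one of the right order at infinity.\<close>

lemma norm_hroot_ge: "t > 0 \<Longrightarrow> sqrt t \<le> norm (hroot t)" "t > 0 \<Longrightarrow> t / sqrt 2 \<le> norm (hroot t)"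
proof -
  assume t: "t > 0"
  have "(sqrt t)\<^sup>2 \<le> (norm (hroot t))\<^sup>2"
    unfolding norm_hroot_sq using t complex_Re_le_cmod[of "Complex t (t\<^sup>2 / 2)"] by simp
  then show "sqrt t \<le> norm (hroot t)" by (rule power2_le_imp_le) simp
  have "(t / sqrt 2)\<^sup>2 \<le> (norm (hroot t))\<^sup>2"
    unfolding norm_hroot_sq using t abs_Im_le_cmod[of "Complex t (t\<^sup>2 / 2)"] by (simp add: power_divide)
  then show "t / sqrt 2 \<le> norm (hroot t)" by (rule power2_le_imp_le) simp
qed

lemma norm_hroot_le: "t > 0 \<Longrightarrow> norm (hroot t) \<le> 1 + t"
proof -
  assume t: "t > 0"
  have "cmod (Complex t (t\<^sup>2 / 2)) \<le> \<bar>t\<bar> + \<bar>t\<^sup>2 / 2\<bar>"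
    using cmod_le[of "Complex t (t\<^sup>2 / 2)"] by simp
  also have "\<dots> \<le> (1 + t)\<^sup>2" using t by (simp add: power2_eq_square algebra_simps)
  finally have "(norm (hroot t))\<^sup>2 \<le> (1 + t)\<^sup>2" unfolding norm_hroot_sq .
  then show ?thesis by (rule power2_le_imp_le) (use t in simp)
qed

lemma hroot_measurable [measurable]: "hroot \<in> borel_measurable borel"
proof -
  have "(\<lambda>t. of_real t + \<i> * of_real (t\<^sup>2 / 2)) \<in> borel_measurable (borel :: real measure)" by measurable
  then have "(\<lambda>t. csqrt (of_real t + \<i> * of_real (t\<^sup>2 / 2))) \<in> borel_measurable (borel :: real measure)" by measurable
  then show ?thesis unfolding hroot_def[abs_def] by (simp add: complex_eq_iff Complex_eq)
qed

lemma hroot_has_vector_derivative: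
  assumes "t > 0"
  shows "(hroot has_vector_derivative (1 + \<i> * of_real t) / (2 * hroot t)) (at t)"
proof -
  have "((\<lambda>z. csqrt (z + \<i> * z\<^sup>2 / 2)) has_field_derivative (1 + \<i> * of_real t) / (2 * csqrt (of_real t + \<i> * (of_real t)\<^sup>2 / 2))) (at (of_real t))"
    using assms by (auto intro!: derivative_eq_intros simp: complex_nonpos_Reals_iff)
  from has_vector_derivative_real_field[OF this] show ?thesis
    unfolding hroot_def[abs_def] by (simp add: Complex_eq)
qed

lemma continuous_hroot: "continuous_on {0<..} hroot"
  by (intro continuous_at_imp_continuous_on) (auto dest!: hroot_has_vector_derivative intro: has_vector_derivative_continuous)

text \<open>Up to constants Ln (hZ t) is the primitive of 1 / hroot t; integrating by parts with it exposes the
  logarithmic singularity of the Hankel function at 0.\<close>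
definition hZ :: "real \<Rightarrow> complex" where
  "hZ t = of_real t - \<i> + (1 - \<i>) * hroot t"

text \<open>Keeps \<open>hZ t\<close> in the right half-plane, away from the branch cut of
  Ln.\<close>

lemma hZ_Re: "t > 0 \<Longrightarrow> Re (hZ t) > t"
  using hroot_Re_pos[of t] hroot_Im_nonneg[of t] by (simp add: hZ_def)

lemma hZ_norm:
  assumes "t > 0"
  shows "norm (hZ t) \<le> 3 * (1 + t)" "norm (hZ t) \<ge> 1 / (3 * (1 + t))"
proof -
  have n1: "norm (of_real t - \<i> + e * ((1 - \<i>) * hroot t)) \<le> 3 * (1 + t)" if "norm e = 1" for e
  proof -
    have "norm (of_real t - \<i> + e * ((1 - \<i>) * hroot t)) \<le> (norm (of_real t :: complex) + norm \<i>) + norm (e * ((1 - \<i>) * hroot t))"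
      by (intro norm_triangle_mono norm_triangle_ineq4) auto
    also have "\<dots> \<le> (t + 1) + 2 * (1 + t)"
    proof -
      have "norm (1 - \<i>) \<le> 2" using norm_triangle_ineq4[of 1 \<i>] by simp
      then have "norm (1 - \<i>) * norm (hroot t) \<le> 2 * (1 + t)"
        using norm_hroot_le[OF assms] assms by (intro mult_mono) auto
      then show ?thesis using assms that by (simp add: norm_mult)
    qed
    finally show ?thesis by simp
  qed
  from n1[of 1] show "norm (hZ t) \<le> 3 * (1 + t)" by (simp add: hZ_def)
  \<comment> \<open>Multiplying by the companion with the opposite sign of the root gives exactly
    -1. As the companion obeys the same upper bound, the lower bound on |hZ t| follows.\<close>
  have "hZ t * (of_real t - \<i> + (- 1) * ((1 - \<i>) * hroot t)) = (of_real t - \<i>)\<^sup>2 - (1 - \<i>)\<^sup>2 * (hroot t)\<^sup>2"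
    by (simp add: hZ_def power2_eq_square algebra_simps)
  also have "\<dots> = -1"
    unfolding hroot_sq by (simp add: complex_eq_iff power2_eq_square)
  finally have "norm (hZ t) * norm (of_real t - \<i> + (- 1) * ((1 - \<i>) * hroot t)) = 1"
    by (metis norm_mult norm_minus_cancel norm_one)
  moreover have "norm (of_real t - \<i> + (- 1) * ((1 - \<i>) * hroot t)) \<le> 3 * (1 + t)" by (rule n1) simp
  ultimately have "1 \<le> norm (hZ t) * (3 * (1 + t))"
    by (metis mult_left_mono norm_ge_zero)
  then show "norm (hZ t) \<ge> 1 / (3 * (1 + t))" using assms by (simp add: field_simps)
qed

text \<open>The constant \<i> pi / 2 is -Ln (-\<i>), with -\<i> the limit of \<open>hZ\<close> at 0;
  it makes this primitive vanish at 0.\<close>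

definition hprim :: "real \<Rightarrow> complex" where
  "hprim t = (1 - \<i>) * (Ln (hZ t) + \<i> * of_real (pi / 2))"

lemma Ln_hZ_bound:
  assumes "t > 0" shows "norm (Ln (hZ t)) \<le> 6 + 3 * t"
proof -
  have nz: "hZ t \<noteq> 0" using hZ_Re[OF assms] assms by force
  have "norm (Ln (hZ t)) \<le> \<bar>Re (Ln (hZ t))\<bar> + \<bar>Im (Ln (hZ t))\<bar>" by (rule cmod_le)
  moreover have "\<bar>Im (Ln (hZ t))\<bar> < pi / 2"
    using Re_Ln_pos_lt[OF nz] hZ_Re[OF assms] assms by simp
  moreover have "ln (norm (hZ t)) \<le> 3 * (1 + t) - 1"
    using ln_le_minus_one[of "norm (hZ t)"] hZ_norm(1)[OF assms] nz by simp
  moreover have "- ln (norm (hZ t)) \<le> 3 * (1 + t) - 1"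
  proof -
    have "- ln (norm (hZ t)) = ln (1 / norm (hZ t))" using nz by (simp add: ln_div)
    also have "\<dots> \<le> 1 / norm (hZ t) - 1" using nz by (intro ln_le_minus_one) auto
    also have "1 / norm (hZ t) \<le> 3 * (1 + t)"
      using hZ_norm(2)[OF assms] nz assms by (simp add: field_simps)
    finally show ?thesis by simp
  qed
  ultimately show ?thesis using nz pi_less_4 by simp
qed

lemma hprim_bound:
  assumes "t > 0" shows "norm (hprim t) \<le> 16 * (1 + t)"
proof -
  have "norm (1 - \<i>) \<le> 2" using norm_triangle_ineq4[of 1 \<i>] by simp
  moreover have "norm (Ln (hZ t) + \<i> * of_real (pi / 2)) \<le> 8 + 3 * t"
    using norm_triangle_ineq[of "Ln (hZ t)" "\<i> * of_real (pi / 2)"] Ln_hZ_bound[OF assms] pi_less_4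
    by (simp add: norm_mult)
  ultimately have "norm (hprim t) \<le> 2 * (8 + 3 * t)"
    unfolding hprim_def norm_mult using assms by (intro mult_mono) auto
  then show ?thesis using assms by simp
qed

lemma hprim_has_vector_derivative:
  assumes "t > 0"
  shows "(hprim has_vector_derivative 1 / hroot t) (at t)"
proof -
  have nz: "hroot t \<noteq> 0" by (rule hroot_neq_0[OF assms])
  have Znz: "hZ t \<notin> \<real>\<^sub>\<le>\<^sub>0" "hZ t \<noteq> 0" using hZ_Re[OF assms] assms by (auto simp: complex_nonpos_Reals_iff)
  have 1: "(hZ has_vector_derivative 1 + (1 - \<i>) * ((1 + \<i> * of_real t) / (2 * hroot t))) (at t)"
    unfolding hZ_def[abs_def] using hroot_has_vector_derivative[OF assms]
    by (auto intro!: derivative_eq_intros)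
  have 2: "(Ln has_field_derivative inverse (hZ t)) (at (hZ t))"
    using Znz by (intro has_field_derivative_Ln) auto
  have "((\<lambda>t. Ln (hZ t)) has_vector_derivative (1 + (1 - \<i>) * ((1 + \<i> * of_real t) / (2 * hroot t))) * inverse (hZ t)) (at t)"
    using field_vector_diff_chain_at[OF 1 2] by (simp add: o_def)
  then have "(hprim has_vector_derivative (1 - \<i>) * ((1 + (1 - \<i>) * ((1 + \<i> * of_real t) / (2 * hroot t))) * inverse (hZ t))) (at t)"
    unfolding hprim_def[abs_def] by (auto intro!: derivative_eq_intros)
  moreover have "(1 - \<i>) * ((1 + (1 - \<i>) * ((1 + \<i> * of_real t) / (2 * hroot t))) * inverse (hZ t)) = 1 / hroot t"
  proof -
    \<comment> \<open>Since (1 - \<i>)^2 (1 + \<i> t) = 2 (t - \<i>), the numerator reproduces 2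
      \<open>hZ t\<close> and cancels the factor from Ln.\<close>
    have "2 * hroot t * (1 - \<i>) + (1 - \<i>)\<^sup>2 * (1 + \<i> * of_real t) = 2 * hZ t"
      by (simp add: hZ_def power2_eq_square algebra_simps)
    then show ?thesis using nz Znz by (simp add: field_simps power2_eq_square)
  qed
  ultimately show ?thesis by simp
qed

section \<open>Euler's constant as a logarithmic integral\<close>

lemma set_integral_exp_neg:
  "set_integrable lborel {0<..} (\<lambda>u::real. exp (-u))" "(LBINT u:{0<..}. exp (-u)) = (1::real)"
proof -
  have "set_integrable lborel {0<..} (\<lambda>u::real. exp (-u)) \<longleftrightarrow> set_integrable lborel {0<..} (\<lambda>t. t powr ((1::real) - 1) * exp (-t))"
    by (rule set_integrable_cong) auto
  then show "set_integrable lborel {0<..} (\<lambda>u::real. exp (-u))"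
    using Gamma_lborel_integral(1)[of 1] by simp
  have "(LBINT u:{0<..}. exp (-u)) = (LBINT t:{0<..}. t powr ((1::real) - 1) * exp (-t))"
    by (intro set_lebesgue_integral_cong) auto
  then show "(LBINT u:{0<..}. exp (-u)) = (1::real)"
    using Gamma_lborel_integral(2)[of 1] by simp
qed

text \<open>The inequality ln v \<le> v - 1 at v = u and at v = u^(-1/2) gives a majorant of the
  logarithm that is integrable at 0.\<close>

lemma abs_ln_le:
  fixes u :: real
  assumes "u > 0" shows "\<bar>ln u\<bar> \<le> u + 2 * u powr (-1/2)"
proof -
  have "ln u \<le> u" using ln_le_minus_one[OF assms] by simp
  moreover have "- ln u \<le> 2 * u powr (-1/2)"
    using ln_le_minus_one[of "u powr (-1/2)"] assms by (simp add: ln_powr)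
  ultimately show ?thesis using assms by (simp add: abs_le_iff add_increasing add_increasing2)
qed

text \<open>The value is Gamma'(1). The difference quotients of Gamma at 1 with step 1 / (n + 1)
  have the integrands exp (-u) (u^(1/(n+1)) - 1) (n + 1), which tend to exp (-u) ln u.\<close>

lemma integral_exp_neg_ln:
  "set_integrable lborel {0<..} (\<lambda>u::real. exp (-u) * ln u)"
  "(LBINT u:{0<..}. exp (-u) * ln u) = (- euler_mascheroni :: real)"
proof -
  \<comment> \<open>This is exp (-u) (u + 2 u^(-1/2)) (1 + u) multiplied out: the first bracket
    bounds |ln u|, the factor 1 + u bounds u^z for 0 \<le> z \<le> 1 in the mean value estimate
    below.\<close>
  let ?w = "\<lambda>u::real. 1 * (u powr 1 * exp (-(1*u)) + u powr 2 * exp (-(1*u)))  + 2 * (u powr (-1/2) * exp (-(1*u)) + u powr (1/2) * exp (-(1*u)))"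
  have w: "set_integrable lborel {0<..} (\<lambda>u. ?w u :: real)"
    by (intro set_integral_add set_integrable_mult_right powr_exp_set_integrable) auto
  have w_ge: "exp (-u) * (\<bar>ln u\<bar> * (1 + u)) \<le> ?w u" if "u > 0" for u :: real
  proof -
    have "\<bar>ln u\<bar> * (1 + u) \<le> (u + 2 * u powr (-1/2)) * (1 + u)"
      using that abs_ln_le by (intro mult_right_mono) auto
    also have "\<dots> = u powr 1 + u powr 2 + 2 * (u powr (-1/2) + u powr (1/2))"
      using that powr_add[of u "-1/2" 1] by (simp add: algebra_simps power2_eq_square)
    finally have "exp (-u) * (\<bar>ln u\<bar> * (1 + u)) \<le> exp (-u) * (u powr 1 + u powr 2 + 2 * (u powr (-1/2) + u powr (1/2)))"
      by (intro mult_left_mono) auto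
    then show ?thesis by (simp add: algebra_simps)
  qed
  show int: "set_integrable lborel {0<..} (\<lambda>u::real. exp (-u) * ln u)"
    using w
  proof (rule set_integrable_bound)
    show "AE u in lborel. u \<in> {0<..} \<longrightarrow> norm (exp (-u) * ln u) \<le> norm (?w u)"
    proof (intro AE_I2 impI)
      fix u :: real assume "u \<in> {0<..}"
      then have u: "u > 0" by simp
      have "exp (-u) * \<bar>ln u\<bar> \<le> exp (-u) * (\<bar>ln u\<bar> * (1 + u))" using u by (simp add: mult_left_le algebra_simps)
      also have "\<dots> \<le> ?w u" by (rule w_ge[OF u])
      finally show "norm (exp (-u) * ln u) \<le> norm (?w u)" by (simp add: abs_mult)
    qed
  qed (auto simp: set_borel_measurable_def)
  let ?s = "\<lambda>n::nat. \<lambda>u::real. indicator {0<..} u *\<^sub>R (exp (-u) * ((u powr (1 / Suc n) - 1) * Suc n))"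
  have "(\<lambda>n. \<integral>u. ?s n u \<partial>lborel) \<longlonglongrightarrow> (\<integral>u. indicator {0<..} u *\<^sub>R (exp (-u) * ln u) \<partial>lborel)"
  proof (rule integral_dominated_convergence[where w="\<lambda>u. indicator {0<..} u *\<^sub>R ?w u"])
    show "integrable lborel (\<lambda>u. indicator {0<..} u *\<^sub>R ?w u)" using w unfolding set_integrable_def .
    show "AE u in lborel. (\<lambda>n. ?s n u) \<longlonglongrightarrow> indicator {0<..} u *\<^sub>R (exp (-u) * ln u)"
    proof (rule AE_I2)
      fix u :: real
      show "(\<lambda>n. ?s n u) \<longlonglongrightarrow> indicator {0<..} u *\<^sub>R (exp (-u) * ln u)"
      proof (cases "u > 0")
        case True
        then have "(\<lambda>n. (u powr (1 / Suc n) - 1) * Suc n) \<longlonglongrightarrow> ln u"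
          by real_asymp
        then show ?thesis by (intro tendsto_intros) 
      qed auto
    qed
    show "AE u in lborel. norm (?s n u) \<le> indicator {0<..} u *\<^sub>R ?w u" for n
    proof (rule AE_I2)
      fix u :: real
      show "norm (?s n u) \<le> indicator {0<..} u *\<^sub>R ?w u"
      proof (cases "u > 0")
        case True
        define h where "h = 1 / real (Suc n)"
        have h: "0 < h" "h \<le> 1" by (auto simp: h_def)
        have "\<bar>u powr h - 1\<bar> \<le> h * \<bar>ln u\<bar> * (1 + u)"
        proof -
          have "norm (exp (h * ln u) - exp (0 * ln u)) \<le> \<bar>ln u\<bar> * (1 + u) * norm (h - 0)"
          proof (rule field_differentiable_bound[of "{0..1}" _ "\<lambda>h. ln u * exp (h * ln u)"])
            show "((\<lambda>h. exp (h * ln u)) has_field_derivative ln u * exp (z * ln u)) (at z within {0..1})" for z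
              by (auto intro!: derivative_eq_intros)
            show "norm (ln u * exp (z * ln u)) \<le> \<bar>ln u\<bar> * (1 + u)" if "z \<in> {0..1}" for z
            proof -
              have "exp (z * ln u) \<le> 1 + u"
              proof (cases "ln u \<ge> 0")
                case True
                then have "z * ln u \<le> 1 * ln u" using that by (intro mult_right_mono) auto
                then have "exp (z * ln u) \<le> exp (ln u)" by simp
                then show ?thesis using \<open>u > 0\<close> by simp
              next
                case False
                then have "z * ln u \<le> 0" using that by (intro mult_nonneg_nonpos) auto
                then have "exp (z * ln u) \<le> exp 0" unfolding exp_le_cancel_iff .
                then show ?thesis using \<open>u > 0\<close> unfolding exp_zero by linarith
              qed
              then show ?thesis by (simp add: abs_mult mult_left_mono)
            qed
          qed (use h in auto)
          then show ?thesis using True h by (simp add: powr_def mult_ac)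
        qed
        then have "\<bar>u powr h - 1\<bar> * Suc n \<le> \<bar>ln u\<bar> * (1 + u)"
          by (simp add: h_def field_simps)
        then have "exp (-u) * (\<bar>u powr h - 1\<bar> * Suc n) \<le> exp (-u) * (\<bar>ln u\<bar> * (1 + u))"
          by (intro mult_left_mono) auto
        also have "\<dots> \<le> ?w u" by (rule w_ge[OF True])
        finally show ?thesis using True by (simp add: h_def abs_mult)
      qed auto
    qed
  qed (auto simp: indicator_def[abs_def])
  moreover have "(\<integral>u. ?s n u \<partial>lborel) = (Gamma (1 + 1 / Suc n) - Gamma 1) / (1 / Suc n)" for n
  proof -
    have "(\<integral>u. ?s n u \<partial>lborel) = (LBINT u:{0<..}. Suc n * (u powr ((1 + 1 / Suc n) - 1) * exp (-u) - u powr (1 - 1) * exp (-u)))"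
      unfolding set_lebesgue_integral_def by (intro Bochner_Integration.integral_cong) (auto simp: indicator_def algebra_simps)
    also have "\<dots> = Suc n * (Gamma (1 + 1 / Suc n) - Gamma 1)"
      by (subst set_integral_mult_right, subst set_integral_diff(2))
         (use Gamma_lborel_integral[of "1 + 1 / Suc n"] Gamma_lborel_integral[of "1"] in \<open>auto simp: add_pos_pos\<close>)
    finally show ?thesis by simp
  qed
  moreover have "(\<lambda>n. (Gamma (1 + 1 / real (Suc n)) - Gamma 1) / (1 / Suc n)) \<longlonglongrightarrow> - euler_mascheroni"
  proof -
    have "(Gamma has_field_derivative Gamma 1 * Digamma 1) (at (1::real))"
      by (rule has_field_derivative_Gamma) auto
    then have "((\<lambda>h. (Gamma (1 + h) - Gamma 1) / h) \<longlongrightarrow> - euler_mascheroni) (at (0::real))"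
      by (simp add: DERIV_def)
    moreover have "filterlim (\<lambda>n. 1 / real (Suc n)) (at 0) sequentially"
      by real_asymp
    ultimately show ?thesis by (rule filterlim_compose)
  qed
  ultimately show "(LBINT u:{0<..}. exp (-u) * ln u) = (- euler_mascheroni :: real)"
    unfolding set_lebesgue_integral_def using LIMSEQ_unique by auto
qed

section \<open>The transform of 1 / \<open>hroot\<close>: differential equation and behaviour at
  infinity\<close>

lemma hroot_tendsto_0: "(hroot \<longlongrightarrow> 0) (at_right 0)"
proof (rule Lim_null_comparison)
  show "eventually (\<lambda>t. norm (hroot t) \<le> sqrt (t + t\<^sup>2 / 2)) (at_right 0)"
    using eventually_at_right_less[of 0]
  proof eventually_elim
    case (elim t)
    have "(norm (hroot t))\<^sup>2 \<le> t + t\<^sup>2 / 2"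
      unfolding norm_hroot_sq using cmod_le[of "Complex t (t\<^sup>2 / 2)"] elim by simp
    then show ?case by (simp add: real_le_rsqrt)
  qed
  show "((\<lambda>t. sqrt (t + t\<^sup>2 / 2)) \<longlongrightarrow> 0) (at_right 0)"
    by (auto intro!: tendsto_eq_intros)
qed

definition hP :: "complex \<Rightarrow> complex" where "hP = laplace (\<lambda>t. 1 / hroot t)"

lemma admissible_inverse_hroot: "laplace_admissible (\<lambda>t. 1 / hroot t)"
proof (rule laplace_admissibleI[where C=1 and a="-1/2" and m=0])
  show "norm (1 / hroot t) \<le> 1 * (t powr (-1/2) + t ^ 0)" if "t > 0" for t
  proof -
    have "norm (1 / hroot t) \<le> 1 / sqrt t"
      using norm_hroot_ge(1)[OF that] that by (simp add: norm_divide frac_le)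
    also have "\<dots> = t powr (-1/2)" using that by (simp add: powr_minus powr_half_sqrt[symmetric] divide_simps)
    finally show ?thesis by simp
  qed
qed auto

lemma admissible_hroot: "laplace_admissible hroot"
  by (rule laplace_admissibleI[where C=1 and a=0 and m=1]) (auto intro: norm_hroot_le)

lemma hprim_measurable [measurable]: "hprim \<in> borel_measurable borel"
  unfolding hprim_def hZ_def by measurable

lemma admissible_hprim: "laplace_admissible hprim"
  by (rule laplace_admissibleI[where C=16 and a=0 and m=1]) (use hprim_bound in \<open>auto simp: algebra_simps\<close>)

lemmas admissible_t_inverse_hroot = laplace_admissible_mult[OF admissible_inverse_hroot]
lemmas admissible_t2_inverse_hroot = laplace_admissible_mult[OF admissible_t_inverse_hroot]

lemma laplace_add:
  assumes "laplace_admissible p" "laplace_admissible q" "Re z > 0"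
  shows "laplace (\<lambda>t. a * p t + b * q t) z = a * laplace p z + b * laplace q z"
proof -
  have "(LBINT t:{0<..}. a * (exp (- (z * of_real t)) * p t) + b * (exp (- (z * of_real t)) * q t)) = a * laplace p z + b * laplace q z"
    unfolding laplace_def using assms
    by (subst set_integral_add(2)) (auto intro!: laplace_integrable set_integrable_mult_right)
  then show ?thesis unfolding laplace_def by (simp add: algebra_simps)
qed

lemma laplace_cong: "(\<And>t. t > 0 \<Longrightarrow> p t = q t) \<Longrightarrow> laplace p z = laplace q z"
  unfolding laplace_def by (intro set_lebesgue_integral_cong) auto

abbreviation "hP1 \<equiv> laplace (\<lambda>t. - of_real t * (1 / hroot t))"
abbreviation "hP2 \<equiv> laplace (\<lambda>t. - of_real t * (- of_real t * (1 / hroot t)))"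

lemma hP_deriv: "Re z > 0 \<Longrightarrow> (hP has_field_derivative hP1 z) (at z)"
  and hP1_deriv: "Re z > 0 \<Longrightarrow> (hP1 has_field_derivative hP2 z) (at z)"
  unfolding hP_def
  by (intro laplace_has_field_derivative admissible_inverse_hroot admissible_t_inverse_hroot; simp)+

text \<open>Bessel's equation for exp (\<i> z) \<open>hP z\<close> with the exponential divided out.
  Writing h for \<open>hroot\<close>, it rests on two facts: 2 h h' = 1 + \<i> t, used through
  integration by parts (\<open>A\<close> and \<open>B\<close>), and h^2 = t + \<i> t^2 / 2, which
  turns the density of 2 \<i> \<open>hP1\<close> + \<open>hP2\<close> into a multiple of h
  (\<open>C\<close>).\<close>

lemma hP_ode:
  assumes "Re z > 0"
  shows "z * (2 * \<i> * hP1 z + hP2 z) = - \<i> * hP z - hP1 z"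
proof -
  have adm: "laplace_admissible (\<lambda>t. (1 + \<i> * of_real t) / (2 * hroot t))"
  proof (rule laplace_admissibleI[where C=2 and a="-1/2" and m=0])
    show "norm ((1 + \<i> * of_real t) / (2 * hroot t)) \<le> 2 * (t powr (-1/2) + t ^ 0)" if "t > 0" for t
    proof -
      have "norm (1 / hroot t) \<le> 1 / sqrt t"
        using norm_hroot_ge(1)[OF that] that by (simp add: norm_divide frac_le)
      also have "\<dots> = t powr (-1/2)" using that by (simp add: powr_minus powr_half_sqrt[symmetric] divide_simps)
      finally have 1: "norm (1 / hroot t) \<le> t powr (-1/2)" .
      have "norm (of_real t / hroot t) \<le> t / (t / sqrt 2)"
        using norm_hroot_ge(2)[OF that] that by (simp add: norm_divide frac_le del: divide_divide_eq_right)
      also have "\<dots> \<le> 2" using that real_sqrt_le_mono[of 2 4] by simp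
      finally have 2: "norm (of_real t / hroot t) \<le> 2" .
      have "(1 + \<i> * of_real t) / (2 * hroot t) = (1/2) * (1 / hroot t) + (\<i>/2) * (of_real t / hroot t)"
        using hroot_neq_0[OF that] by (simp add: field_simps)
      also have "norm \<dots> \<le> norm ((1/2) * (1 / hroot t)) + norm ((\<i>/2) * (of_real t / hroot t))"
        by (rule norm_triangle_ineq)
      also have "\<dots> = 1/2 * norm (1 / hroot t) + 1/2 * norm (of_real t / hroot t)"
        by (simp add: norm_mult norm_divide)
      finally have 3: "norm ((1 + \<i> * of_real t) / (2 * hroot t)) \<le> 1/2 * norm (1 / hroot t) + 1/2 * norm (of_real t / hroot t)" .
      have "norm ((1 + \<i> * of_real t) / (2 * hroot t)) \<le> 2 * (t powr (-1/2) + 1)"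
      proof -
        have gen: "y \<le> 2 * (x + 1)" if "y \<le> 1/2 * a + 1/2 * b" "a \<le> x" "b \<le> 2" "0 \<le> x" for a b x y :: real
          using that by argo
        show ?thesis by (rule gen[OF 3 1 2]) simp
      qed
      then show ?thesis by simp
    qed
  qed auto
  have A: "laplace (\<lambda>t. (1 + \<i> * of_real t) / (2 * hroot t)) z = z * laplace hroot z"
  proof (rule laplace_by_parts[where C=1])
    show "continuous_on {0<..} (\<lambda>t. (1 + \<i> * of_real t) / (2 * hroot t))"
      by (intro continuous_intros continuous_hroot) (auto simp: hroot_neq_0)
  qed (use assms hroot_tendsto_0 adm admissible_hroot norm_hroot_le hroot_has_vector_derivative in auto)
  have B: "laplace (\<lambda>t. (1 + \<i> * of_real t) / (2 * hroot t)) z = (1/2) * hP z + (- \<i> / 2) * hP1 z"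
  proof -
    have "laplace (\<lambda>t. (1 + \<i> * of_real t) / (2 * hroot t)) z =
       laplace (\<lambda>t. (1/2) * (1 / hroot t) + (- \<i> / 2) * (- of_real t * (1 / hroot t))) z"
      by (intro laplace_cong) (auto simp: field_simps hroot_neq_0)
    then show ?thesis
      by (simp only: laplace_add[OF admissible_inverse_hroot admissible_t_inverse_hroot assms] hP_def)
  qed
  \<comment> \<open>The coefficients 1 and 0 only bring both sides into the shape of
    \<open>laplace_add\<close>.\<close>
  have C: "2 * \<i> * hP1 z + 1 * hP2 z = - 2 * \<i> * laplace hroot z + 0 * laplace hroot z"
  proof -
    have "2 * \<i> * hP1 z + 1 * hP2 z = laplace (\<lambda>t. 2 * \<i> * (- of_real t * (1 / hroot t)) + 1 * (- of_real t * (- of_real t * (1 / hroot t)))) z"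
      by (simp only: laplace_add[OF admissible_t_inverse_hroot admissible_t2_inverse_hroot assms])
    also have "\<dots> = laplace (\<lambda>t. - 2 * \<i> * hroot t + 0 * hroot t) z"
    proof (rule laplace_cong)
      fix t :: real assume t: "t > 0"
      have "hroot t * hroot t = of_real t + \<i> * (of_real t)\<^sup>2 / 2"
        using hroot_sq[of t] by (simp add: power2_eq_square Complex_eq)
      then have "- 2 * \<i> * (hroot t * hroot t) = - 2 * \<i> * of_real t + (of_real t)\<^sup>2"
        by (simp add: algebra_simps)
      then show "2 * \<i> * (- of_real t * (1 / hroot t)) + 1 * (- of_real t * (- of_real t * (1 / hroot t))) = - 2 * \<i> * hroot t + 0 * hroot t"
        using hroot_neq_0[OF t] by (simp add: field_simps power2_eq_square)
    qed
    also have "\<dots> = - 2 * \<i> * laplace hroot z + 0 * laplace hroot z"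
      by (rule laplace_add[OF admissible_hroot admissible_hroot assms])
    finally show ?thesis .
  qed
  have "z * (2 * \<i> * hP1 z + hP2 z) = z * (- 2 * \<i> * laplace hroot z)"
    using C by simp
  also have "\<dots> = - 2 * \<i> * (z * laplace hroot z)" by (simp only: mult_ac)
  also have "\<dots> = - 2 * \<i> * ((1/2) * hP z + (- \<i> / 2) * hP1 z)"
    by (simp only: A[symmetric] B)
  also have "\<dots> = - \<i> * hP z - hP1 z"
  proof -
    have "- 2 * \<i> * ((1/2) * a + (- \<i> / 2) * b) = - \<i> * a - b" for a b
      by (simp add: algebra_simps)
    then show ?thesis .
  qed
  finally show ?thesis .
qed

text \<open>The transform of 1 / \<open>hroot\<close> diverges as z tends to 0. For real z the
  weight z exp (- z t) has mass 1, so the divergence becomes the logarithmic growth of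
  \<open>hprim\<close> at the scale 1 / z.\<close>

lemma hP_by_parts:
  assumes "Re z > 0" shows "hP z = z * laplace hprim z"
  unfolding hP_def
proof (rule laplace_by_parts[where C=16])
  show "(hprim \<longlongrightarrow> 0) (at_right 0)"
  proof -
    have "(hZ \<longlongrightarrow> of_real 0 - \<i> + (1 - \<i>) * 0) (at_right 0)"
      unfolding hZ_def[abs_def] by (intro tendsto_intros hroot_tendsto_0)
    then have "(hZ \<longlongrightarrow> - \<i>) (at_right 0)" by simp
    moreover have "- \<i> \<notin> \<real>\<^sub>\<le>\<^sub>0" by (simp add: complex_nonpos_Reals_iff)
    ultimately have "((\<lambda>t. Ln (hZ t)) \<longlongrightarrow> Ln (-\<i>)) (at_right 0)"
      by (rule tendsto_Ln)
    then have "(hprim \<longlongrightarrow> (1 - \<i>) * (Ln (-\<i>) + \<i> * of_real (pi / 2))) (at_right 0)"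
      unfolding hprim_def[abs_def] by (intro tendsto_mult tendsto_add tendsto_const)
    then show ?thesis by (simp add: Ln_minus_ii)
  qed
  show "continuous_on {0<..} (\<lambda>t. 1 / hroot t)"
    by (intro continuous_intros continuous_hroot) (auto simp: hroot_neq_0)
qed (use assms admissible_hprim admissible_inverse_hroot hprim_bound hprim_has_vector_derivative in auto)

lemma laplace_scale:
  assumes "x > 0"
  shows "laplace q z = (LBINT u:{0<..}. exp (- (z / of_real x * of_real u)) * (q (u / x) / of_real x))"
proof -
  have "laplace q z = \<bar>1/x\<bar> *\<^sub>R (\<integral>u. indicator {0<..} (0 + 1/x * u) *\<^sub>R (exp (- (z * of_real (0 + 1/x * u))) * q (0 + 1/x * u)) \<partial>lborel)"
    unfolding laplace_def set_lebesgue_integral_def using assms by (intro lborel_integral_real_affine) auto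
  also have "\<dots> = (\<integral>u. \<bar>1/x\<bar> *\<^sub>R (indicator {0<..} (0 + 1/x * u) *\<^sub>R (exp (- (z * of_real (0 + 1/x * u))) * q (0 + 1/x * u))) \<partial>lborel)"
    by (rule integral_scaleR_right[symmetric])
  also have "\<dots> = (LBINT u:{0<..}. exp (- (z / of_real x * of_real u)) * (q (u / x) / of_real x))"
    unfolding set_lebesgue_integral_def using assms
    by (intro Bochner_Integration.integral_cong) (auto simp: indicator_def field_simps scaleR_conv_of_real zero_less_mult_iff zero_less_divide_iff)
  finally show ?thesis .
qed

lemma hroot_scale:
  assumes "a > 0" "t > 0"
  shows "of_real a * hroot t = csqrt (Complex (a\<^sup>2 * t) (a\<^sup>2 * t\<^sup>2 / 2))"
proof -
  have "(of_real a * hroot t)\<^sup>2 = Complex (a\<^sup>2 * t) (a\<^sup>2 * t\<^sup>2 / 2)"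
    unfolding power_mult_distrib hroot_sq by (simp add: complex_eq_iff)
  moreover have "Re (of_real a * hroot t) > 0" using assms hroot_Re_pos by simp
  ultimately show ?thesis using csqrt_square[of "of_real a * hroot t"] by metis
qed

lemma csqrt_tendsto:
  assumes "(f \<longlongrightarrow> l) F" "l \<notin> \<real>\<^sub>\<le>\<^sub>0"
  shows "((\<lambda>x. csqrt (f x)) \<longlongrightarrow> csqrt l) F"
  using assms continuous_on_csqrt by (intro isCont_tendsto_compose[OF _ assms(1)])
   (auto simp: continuous_on_eq_continuous_at open_Compl)

text \<open>Leading order of Watson's lemma. With t = u / Re z only small t matter, where
  \<open>hroot t\<close> behaves like sqrt t, so the limit is Gamma (1/2). The hypothesis on Im z /
  Re z removes the oscillation of the exponential.\<close>

lemma hP_asymptotic: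
  assumes x: "filterlim (\<lambda>k. Re (z k)) at_top at_top"
    and im: "((\<lambda>k. Im (z k) / Re (z k)) \<longlongrightarrow> 0) at_top"
  shows "((\<lambda>k. of_real (sqrt (Re (z k))) * hP (z k)) \<longlongrightarrow> of_real (sqrt pi)) (at_top :: real filter)"
proof -
  let ?s = "\<lambda>k u. indicator {0<..} u *\<^sub>R (exp (- (Complex 1 (Im (z k) / Re (z k)) * of_real u)) / (of_real (sqrt (Re (z k))) * hroot (u / Re (z k))))"
  have ev: "eventually (\<lambda>k. Re (z k) > 0) at_top"
    using x by (simp add: filterlim_at_top_dense)
  have int: "set_integrable lborel {0<..} (\<lambda>t::real. t powr (-1/2) * exp (- (1 * t)))"
    by (rule powr_exp_set_integrable) auto
  have bd: "norm (?s k u) \<le> indicator {0<..} u *\<^sub>R (u powr (-1/2) * exp (- (1 * u)))" if k: "Re (z k) > 0" for k u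
  proof (cases "u > 0")
    case True
    have "sqrt u = sqrt (Re (z k)) * sqrt (u / Re (z k))" using k by (simp add: real_sqrt_mult[symmetric])
    also have "\<dots> \<le> sqrt (Re (z k)) * norm (hroot (u / Re (z k)))"
      using True k by (intro mult_left_mono norm_hroot_ge) auto
    finally have 1: "sqrt u \<le> sqrt (Re (z k)) * norm (hroot (u / Re (z k)))" .
    have "norm (?s k u) = exp (-u) / (sqrt (Re (z k)) * norm (hroot (u / Re (z k))))"
      using True k by (simp add: norm_divide norm_mult)
    also have "\<dots> \<le> exp (-u) / sqrt u"
      using 1 True by (intro divide_left_mono mult_pos_pos) (use k in \<open>auto simp: hroot_neq_0\<close>)
    also have "\<dots> = u powr (-1/2) * exp (- (1 * u))"
      using True by (simp add: powr_minus powr_half_sqrt[symmetric] divide_simps)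
    finally show ?thesis using True by simp
  qed auto
  have "((\<lambda>k. \<integral>u. ?s k u \<partial>lborel) \<longlongrightarrow> (\<integral>u. complex_of_real (indicator {0<..} u *\<^sub>R (u powr (1/2 - 1) * exp (-u))) \<partial>lborel)) at_top"
  proof (rule integral_dominated_convergence_at_top)
    show "integrable lborel (\<lambda>u::real. indicator {0<..} u *\<^sub>R (u powr (-1/2) * exp (- (1 * u))))"
      using int unfolding set_integrable_def .
    show "\<forall>\<^sub>F k in at_top. AE u in lborel. norm (?s k u) \<le> indicator {0<..} u *\<^sub>R (u powr (-1/2) * exp (- (1 * u)))"
      using ev by eventually_elim (use bd in auto)
    show "AE u in lborel. ((\<lambda>k. ?s k u) \<longlongrightarrow> complex_of_real (indicator {0<..} u *\<^sub>R (u powr (1/2 - 1) * exp (-u)))) at_top"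
    proof (rule AE_I2)
      fix u :: real
      show "((\<lambda>k. ?s k u) \<longlongrightarrow> complex_of_real (indicator {0<..} u *\<^sub>R (u powr (1/2 - 1) * exp (-u)))) at_top"
      proof (cases "u > 0")
        case True
        have i: "((\<lambda>k. inverse (Re (z k))) \<longlongrightarrow> 0) at_top"
          by (rule tendsto_inverse_0_at_top[OF x])
        have "((\<lambda>k. csqrt (Complex u (u\<^sup>2 / 2 * inverse (Re (z k))))) \<longlongrightarrow> csqrt (Complex u (u\<^sup>2 / 2 * 0))) at_top"
          using True by (intro csqrt_tendsto tendsto_Complex tendsto_intros i) (auto simp: complex_nonpos_Reals_iff)
        moreover have "eventually (\<lambda>k. csqrt (Complex u (u\<^sup>2 / 2 * inverse (Re (z k)))) = of_real (sqrt (Re (z k))) * hroot (u / Re (z k))) at_top"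
          using ev
        proof eventually_elim
          case (elim k)
          have "of_real (sqrt (Re (z k))) * hroot (u / Re (z k)) = csqrt (Complex ((sqrt (Re (z k)))\<^sup>2 * (u / Re (z k))) ((sqrt (Re (z k)))\<^sup>2 * (u / Re (z k))\<^sup>2 / 2))"
            using elim True by (intro hroot_scale) auto
          then show ?case using elim by (simp add: power2_eq_square field_simps)
        qed
        ultimately have h: "((\<lambda>k. of_real (sqrt (Re (z k))) * hroot (u / Re (z k))) \<longlongrightarrow> csqrt (Complex u (u\<^sup>2 / 2 * 0))) at_top"
          by (rule Lim_transform_eventually)
        have su: "csqrt (Complex u (u\<^sup>2 / 2 * 0)) = of_real (sqrt u)"
          using True by (simp add: Complex_eq)
        have "((\<lambda>k. indicator {0<..} u *\<^sub>R (exp (- (Complex 1 (Im (z k) / Re (z k)) * of_real u)) / (of_real (sqrt (Re (z k))) * hroot (u / Re (z k)))))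
            \<longlongrightarrow> indicator {0<..} u *\<^sub>R (exp (- (Complex 1 0 * of_real u)) / csqrt (Complex u (u\<^sup>2 / 2 * 0)))) at_top"
          by (intro tendsto_scaleR tendsto_const tendsto_divide h tendsto_exp tendsto_minus tendsto_mult tendsto_Complex im) (use su True in simp)
        moreover have "indicator {0<..} u *\<^sub>R (exp (- (Complex 1 0 * of_real u)) / csqrt (Complex u (u\<^sup>2 / 2 * 0))) = complex_of_real (indicator {0<..} u *\<^sub>R (u powr (1/2 - 1) * exp (-u)))"
          unfolding su using True by (simp add: Complex_eq exp_of_real[symmetric] powr_minus powr_half_sqrt[symmetric] divide_simps)
        ultimately show ?thesis by simp
      qed auto
    qed
  qed measurable
  moreover have "(\<integral>u. complex_of_real (indicator {0<..} u *\<^sub>R (u powr (1/2 - 1) * exp (-u))) \<partial>lborel) = of_real (sqrt pi)"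
    using Gamma_lborel_integral(2)[of "1/2"] unfolding set_lebesgue_integral_def
    by (subst integral_complex_of_real) (simp add: Gamma_one_half_real)
  moreover have "eventually (\<lambda>k. (\<integral>u. ?s k u \<partial>lborel) = of_real (sqrt (Re (z k))) * hP (z k)) at_top"
    using ev
  proof eventually_elim
    case (elim k)
    define x where "x = Re (z k)"
    have x: "x > 0" using elim by (simp add: x_def)
    have zk: "z k / of_real x = Complex 1 (Im (z k) / Re (z k))"
      using x by (auto simp: complex_eq_iff x_def Re_divide_of_real Im_divide_of_real)
    have "of_real (sqrt x) * hP (z k) = (LBINT u:{0<..}. of_real (sqrt x) * (exp (- (z k / of_real x * of_real u)) * (1 / hroot (u / x) / of_real x)))"
      unfolding hP_def by (subst laplace_scale[OF x]) (rule set_integral_mult_right[symmetric])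
    also have "\<dots> = (\<integral>u. ?s k u \<partial>lborel)"
      unfolding set_lebesgue_integral_def zk x_def[symmetric]
    proof (intro Bochner_Integration.integral_cong refl)
      fix u
      have "of_real (sqrt x) * (E * (1 / h / of_real x)) = E / (of_real (sqrt x) * h)" for E h :: complex
      proof -
        have "complex_of_real x = of_real (sqrt x) * of_real (sqrt x)" using x by (simp flip: of_real_mult)
        then show ?thesis using x by (simp add: field_simps)
      qed
      then show "indicator {0<..} u *\<^sub>R (of_real (sqrt x) * (exp (- (Complex 1 (Im (z k) / x) * of_real u)) * (1 / hroot (u / x) / of_real x)))
         = indicator {0<..} u *\<^sub>R (exp (- (Complex 1 (Im (z k) / x) * of_real u)) / (of_real (sqrt x) * hroot (u / x)))"
        by metis
    qed
    finally show ?case unfolding x_def by simp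
  qed
  ultimately show ?thesis by (simp add: Lim_transform_eventually)
qed

text \<open>As |hroot t| \<ge> sqrt t, the transform of t^(-1/2) dominates. The constant is that of
  the asymptotics, but the bound holds in the whole half-plane, which provides the majorants for
  dominated convergence.\<close>

lemma hP_norm_le:
  assumes "Re z > 0" shows "norm (hP z) \<le> sqrt pi / sqrt (Re z)"
proof -
  define x where "x = Re z"
  have x: "x > 0" using assms by (simp add: x_def)
  have "norm (hP z) \<le> (\<integral>t. norm (indicator {0<..} t *\<^sub>R (exp (- (z * of_real t)) * (1 / hroot t))) \<partial>lborel)"
    unfolding hP_def laplace_def set_lebesgue_integral_def by (rule integral_norm_bound)
  also have "\<dots> \<le> (LBINT t:{0<..}. t powr (-1/2) * exp (- (x * t)))"
    unfolding set_lebesgue_integral_def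
  proof (rule integral_mono)
    show "integrable lborel (\<lambda>t. norm (indicator {0<..} t *\<^sub>R (exp (- (z * of_real t)) * (1 / hroot t))))"
      using laplace_integrable[OF admissible_inverse_hroot assms] unfolding set_integrable_def
      by (rule integrable_norm)
    show "integrable lborel (\<lambda>t::real. indicator {0<..} t *\<^sub>R (t powr (-1/2) * exp (- (x * t))))"
      using powr_exp_set_integrable[of "-1/2" x] x unfolding set_integrable_def by simp
    show "norm (indicator {0<..} t *\<^sub>R (exp (- (z * of_real t)) * (1 / hroot t))) \<le> indicator {0<..} t *\<^sub>R (t powr (-1/2) * exp (- (x * t)))" for t
    proof (cases "t > 0")
      case True
      have "1 / norm (hroot t) \<le> 1 / sqrt t"
        using norm_hroot_ge(1)[OF True] True by (simp add: frac_le)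
      also have "\<dots> = t powr (-1/2)" using True by (simp add: powr_minus powr_half_sqrt[symmetric] divide_simps)
      finally have "exp (- (x * t)) * (1 / norm (hroot t)) \<le> exp (- (x * t)) * t powr (-1/2)"
        by (intro mult_left_mono) auto
      then show ?thesis using True by (simp add: norm_mult norm_divide x_def mult.commute)
    qed auto
  qed
  also have "\<dots> = sqrt pi / sqrt x"
  proof -
    have "sqrt pi = (\<integral>t. indicator {0<..} t *\<^sub>R (t powr (1/2 - 1) * exp (-t)) \<partial>lborel)"
      using Gamma_lborel_integral(2)[of "1/2"] unfolding set_lebesgue_integral_def by (simp add: Gamma_one_half_real)
    also have "\<dots> = \<bar>x\<bar> *\<^sub>R (\<integral>t. indicator {0<..} (0 + x * t) *\<^sub>R ((0 + x * t) powr (1/2 - 1) * exp (-(0 + x * t))) \<partial>lborel)"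
      using x by (intro lborel_integral_real_affine) auto
    also have "\<dots> = (\<integral>t. sqrt x * (indicator {0<..} t *\<^sub>R (t powr (-1/2) * exp (- (x * t)))) \<partial>lborel)"
      unfolding integral_scaleR_right[symmetric] using x
      by (intro Bochner_Integration.integral_cong)
        (auto simp: indicator_def zero_less_mult_iff powr_mult powr_minus powr_half_sqrt real_div_sqrt field_simps)
    finally show ?thesis using x by (simp add: set_lebesgue_integral_def field_simps)
  qed
  finally show ?thesis by (simp add: x_def)
qed

section \<open>Power series and Bessel's equation\<close>

text \<open>Coefficients in the variable x = z^2 / 4, in which Bessel's equation reads x w'' + w' +
  w = 0 and the two series of J_0 and Y_0 are entire.\<close>

definition J0_coeff :: "nat \<Rightarrow> complex" where "J0_coeff n = (-1) ^ n / (fact n)\<^sup>2"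
definition Y0_coeff :: "nat \<Rightarrow> complex" where "Y0_coeff n = (-1) ^ n * harm n / (fact n)\<^sup>2"

definition psum :: "(nat \<Rightarrow> complex) \<Rightarrow> complex \<Rightarrow> complex" where "psum c x = (\<Sum>n. c n * x ^ n)"

lemma summable_J0_coeff: "summable (\<lambda>n. J0_coeff n * x ^ n)"
proof (rule summable_comparison_test')
  show "summable (\<lambda>n. norm x ^ n / fact n)" using summable_exp[of "norm x"] by (simp add: field_simps)
  show "norm (J0_coeff n * x ^ n) \<le> norm x ^ n / fact n" for n
  proof -
    have "norm x ^ n / (fact n)\<^sup>2 \<le> norm x ^ n / fact n"
      by (intro divide_left_mono) (auto simp: power2_eq_square)
    then show ?thesis by (simp add: J0_coeff_def norm_mult norm_divide norm_power)
  qed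
qed

lemma harm_le_fact: "harm n \<le> (fact n :: real)"
proof -
  have "harm n \<le> real n"
  proof (induction n)
    case (Suc n)
    have "inverse (real (Suc n)) \<le> 1" by (simp add: divide_simps)
    with Suc show ?case unfolding harm_Suc by simp
  qed (simp add: harm_def)
  also have "\<dots> \<le> fact n" using fact_ge_self[of n] by (metis of_nat_fact of_nat_le_iff)
  finally show ?thesis .
qed

lemma summable_Y0_coeff: "summable (\<lambda>n. Y0_coeff n * x ^ n)"
proof (rule summable_comparison_test')
  show "summable (\<lambda>n. norm x ^ n / fact n)" using summable_exp[of "norm x"] by (simp add: field_simps)
  show "norm (Y0_coeff n * x ^ n) \<le> norm x ^ n / fact n" for n
  proof -
    have "norm (harm n :: complex) \<le> fact n" using harm_le_fact[of n] harm_nonneg[of n]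
      by (metis norm_of_real of_real_harm abs_of_nonneg)
    then have "norm (harm n :: complex) * norm x ^ n / (fact n)\<^sup>2 \<le> fact n * norm x ^ n / (fact n)\<^sup>2"
      by (intro divide_right_mono mult_right_mono) auto
    then show ?thesis by (simp add: Y0_coeff_def norm_mult norm_divide norm_power power2_eq_square)
  qed
qed

lemma psum_deriv:
  assumes "\<And>x. summable (\<lambda>n. c n * x ^ n)"
  shows "(psum c has_field_derivative psum (diffs c) x) (at x)"
  unfolding psum_def[abs_def] using assms by (rule termdiffs_strong_converges_everywhere)

lemmas summable_diffs = termdiff_converges_all

text \<open>On coefficients the operator x w'' + w' is a weighted shift, which reduces the
  differential equations below to recurrences with two terms.\<close>

lemma psum_second_order:
  assumes "\<And>x. summable (\<lambda>n. c n * x ^ n)"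
  shows "x * psum (diffs (diffs c)) x + psum (diffs c) x = psum (\<lambda>n. (of_nat (Suc n))\<^sup>2 * c (Suc n)) x"
proof -
  have s1: "summable (\<lambda>n. diffs c n * x ^ n)" and s2: "summable (\<lambda>n. diffs (diffs c) n * x ^ n)"
    using assms by (intro summable_diffs; simp)+
  have "(\<lambda>n. x * (of_nat n * diffs c n * x ^ (n - Suc 0))) sums (x * psum (diffs (diffs c)) x)"
    unfolding psum_def by (intro sums_mult diffs_equiv s2)
  also have "(\<lambda>n. x * (of_nat n * diffs c n * x ^ (n - Suc 0))) = (\<lambda>n. of_nat n * diffs c n * x ^ n)"
  proof
    fix n show "x * (of_nat n * diffs c n * x ^ (n - Suc 0)) = of_nat n * diffs c n * x ^ n"
      by (cases n) auto
  qed
  finally have "(\<lambda>n. of_nat n * diffs c n * x ^ n + diffs c n * x ^ n) sums (x * psum (diffs (diffs c)) x + psum (diffs c) x)"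
    using s1 unfolding psum_def by (intro sums_add) (auto intro: summable_sums)
  also have "(\<lambda>n. of_nat n * diffs c n * x ^ n + diffs c n * x ^ n) = (\<lambda>n. (of_nat (Suc n))\<^sup>2 * c (Suc n) * x ^ n)"
    by (auto simp: diffs_def algebra_simps power2_eq_square)
  finally show ?thesis unfolding psum_def by (rule sums_unique)
qed

lemma J0_ode: "x * psum (diffs (diffs J0_coeff)) x + psum (diffs J0_coeff) x + psum J0_coeff x = 0"
proof -
  have "(of_nat (Suc n))\<^sup>2 * J0_coeff (Suc n) = - J0_coeff n" for n
    unfolding J0_coeff_def fact_Suc power_mult_distrib by (simp del: of_nat_Suc)
  then have "psum (\<lambda>n. (of_nat (Suc n))\<^sup>2 * J0_coeff (Suc n)) x = - psum J0_coeff x"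
    unfolding psum_def by (simp add: suminf_minus[OF summable_J0_coeff])
  then show ?thesis by (simp add: psum_second_order[OF summable_J0_coeff])
qed

text \<open>The harmonic number grows by 1 / (n + 1) from one coefficient to the next; this
  increment leaves the derivative of the J_0 series as a source term.\<close>

lemma Y0_ode: "x * psum (diffs (diffs Y0_coeff)) x + psum (diffs Y0_coeff) x + psum Y0_coeff x = psum (diffs J0_coeff) x"
proof -
  have "(of_nat (Suc n))\<^sup>2 * Y0_coeff (Suc n) = diffs J0_coeff n - Y0_coeff n" for n
  proof -
    have "(of_nat (Suc n))\<^sup>2 * Y0_coeff (Suc n) = (-1) ^ Suc n * (harm n + inverse (of_nat (Suc n))) / (fact n)\<^sup>2"
      unfolding Y0_coeff_def fact_Suc power_mult_distrib harm_Suc by (simp del: of_nat_Suc)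
    moreover have "diffs J0_coeff n = (-1) ^ Suc n * inverse (of_nat (Suc n)) / (fact n)\<^sup>2"
      unfolding J0_coeff_def diffs_def fact_Suc power_mult_distrib power2_eq_square
      by (simp del: of_nat_Suc add: field_simps)
    ultimately show ?thesis unfolding Y0_coeff_def by (simp del: of_nat_Suc add: algebra_simps add_divide_distrib diff_divide_distrib)
  qed
  then have "psum (\<lambda>n. (of_nat (Suc n))\<^sup>2 * Y0_coeff (Suc n)) x = (\<Sum>n. diffs J0_coeff n * x ^ n - Y0_coeff n * x ^ n)"
    unfolding psum_def by (simp only: left_diff_distrib)
  also have "\<dots> = psum (diffs J0_coeff) x - psum Y0_coeff x"
    unfolding psum_def by (rule suminf_diff[symmetric]) (intro summable_diffs summable_J0_coeff summable_Y0_coeff)+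
  finally have "psum (\<lambda>n. (of_nat (Suc n))\<^sup>2 * Y0_coeff (Suc n)) x = psum (diffs J0_coeff) x - psum Y0_coeff x" .
  then show ?thesis by (simp add: psum_second_order[OF summable_Y0_coeff])
qed

definition J_fun :: "complex \<Rightarrow> complex" where "J_fun z = psum J0_coeff (z\<^sup>2 / 4)"
definition J_fun' :: "complex \<Rightarrow> complex" where "J_fun' z = z / 2 * psum (diffs J0_coeff) (z\<^sup>2 / 4)"
definition J_fun'' :: "complex \<Rightarrow> complex" where
  "J_fun'' z = psum (diffs J0_coeff) (z\<^sup>2 / 4) / 2 + z\<^sup>2 / 4 * psum (diffs (diffs J0_coeff)) (z\<^sup>2 / 4)"
definition M_fun :: "complex \<Rightarrow> complex" where "M_fun z = psum Y0_coeff (z\<^sup>2 / 4)"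
definition M_fun' :: "complex \<Rightarrow> complex" where "M_fun' z = z / 2 * psum (diffs Y0_coeff) (z\<^sup>2 / 4)"
definition M_fun'' :: "complex \<Rightarrow> complex" where
  "M_fun'' z = psum (diffs Y0_coeff) (z\<^sup>2 / 4) / 2 + z\<^sup>2 / 4 * psum (diffs (diffs Y0_coeff)) (z\<^sup>2 / 4)"

lemma psum_sq_deriv:
  assumes "\<And>x. summable (\<lambda>n. c n * x ^ n)"
  shows "((\<lambda>z. psum c (z\<^sup>2 / 4)) has_field_derivative z / 2 * psum (diffs c) (z\<^sup>2 / 4)) (at z)"
proof -
  have "((\<lambda>z. psum c (z\<^sup>2 / 4)) has_field_derivative psum (diffs c) (z\<^sup>2 / 4) * (z / 2)) (at z)"
    by (rule DERIV_chain2[OF psum_deriv[OF assms]]) (auto intro!: derivative_eq_intros)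
  then show ?thesis by (simp add: mult.commute)
qed

lemma J_fun_deriv: "(J_fun has_field_derivative J_fun' z) (at z)"
  unfolding J_fun_def[abs_def] J_fun'_def by (rule psum_sq_deriv[OF summable_J0_coeff])
lemma M_fun_deriv: "(M_fun has_field_derivative M_fun' z) (at z)"
  unfolding M_fun_def[abs_def] M_fun'_def by (rule psum_sq_deriv[OF summable_Y0_coeff])
lemma J_fun'_deriv: "(J_fun' has_field_derivative J_fun'' z) (at z)"
  unfolding J_fun'_def[abs_def] J_fun''_def
  by (rule DERIV_cong[OF DERIV_mult[OF _ psum_sq_deriv[OF summable_diffs[OF summable_J0_coeff]]]])
     (auto intro!: derivative_eq_intros simp: power2_eq_square)
lemma M_fun'_deriv: "(M_fun' has_field_derivative M_fun'' z) (at z)"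
  unfolding M_fun'_def[abs_def] M_fun''_def
  by (rule DERIV_cong[OF DERIV_mult[OF _ psum_sq_deriv[OF summable_diffs[OF summable_Y0_coeff]]]])
     (auto intro!: derivative_eq_intros simp: power2_eq_square)

lemma J_fun_ode: "z * J_fun'' z + J_fun' z + z * J_fun z = 0"
proof -
  have "z * J_fun'' z + J_fun' z + z * J_fun z = z * (z\<^sup>2 / 4 * psum (diffs (diffs J0_coeff)) (z\<^sup>2 / 4) + psum (diffs J0_coeff) (z\<^sup>2 / 4) + psum J0_coeff (z\<^sup>2 / 4))"
    by (simp add: J_fun_def J_fun'_def J_fun''_def algebra_simps)
  then show ?thesis unfolding J0_ode by simp
qed

lemma M_fun_ode: "z * M_fun'' z + M_fun' z + z * M_fun z = 2 * J_fun' z"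
proof -
  have "z * M_fun'' z + M_fun' z + z * M_fun z = z * (z\<^sup>2 / 4 * psum (diffs (diffs Y0_coeff)) (z\<^sup>2 / 4) + psum (diffs Y0_coeff) (z\<^sup>2 / 4) + psum Y0_coeff (z\<^sup>2 / 4))"
    by (simp add: M_fun_def M_fun'_def M_fun''_def algebra_simps)
  also have "\<dots> = 2 * J_fun' z" unfolding Y0_ode J_fun'_def by simp
  finally show ?thesis .
qed

lemma psum_0: "psum c 0 = c 0"
  unfolding psum_def by (simp add: powser_zero)

lemma J_fun_0: "J_fun 0 = 1" "J_fun' 0 = 0" "M_fun 0 = 0" "M_fun' 0 = 0"
  by (simp_all add: J_fun_def J_fun'_def M_fun_def M_fun'_def psum_0 J0_coeff_def Y0_coeff_def harm_def)

lemma hankel_eq: "hankel1_0 z = J_fun z + \<i> * of_real (2 / pi) * ((Ln (z / 2) + euler_mascheroni) * J_fun z - M_fun z)"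
proof -
  have "bessel_J0 z = J_fun z"
    unfolding bessel_J0_def J_fun_def psum_def J0_coeff_def by (intro suminf_cong) simp
  moreover have "(\<Sum>n. (-1) ^ n * harm n * (z\<^sup>2 / 4) ^ n / (fact n)\<^sup>2) = M_fun z"
    unfolding M_fun_def psum_def Y0_coeff_def by (intro suminf_cong) simp
  ultimately show ?thesis by (simp add: hankel1_0_def bessel_Y0_def mult.assoc)
qed

definition hankel' :: "complex \<Rightarrow> complex" where
  "hankel' z = J_fun' z + \<i> * of_real (2 / pi) * (J_fun z / z + (Ln (z / 2) + euler_mascheroni) * J_fun' z - M_fun' z)"
definition hankel'' :: "complex \<Rightarrow> complex" where
  "hankel'' z = J_fun'' z + \<i> * of_real (2 / pi) * (2 * J_fun' z / z - J_fun z / z\<^sup>2 + (Ln (z / 2) + euler_mascheroni) * J_fun'' z - M_fun'' z)"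

lemma Ln_half_deriv:
  assumes "Re z > 0"
  shows "((\<lambda>z. Ln (z / 2) + euler_mascheroni) has_field_derivative 1 / z) (at z)"
  using assms by (auto intro!: derivative_eq_intros simp: complex_nonpos_Reals_iff)

lemma hankel_deriv:
  assumes "Re z > 0" shows "(hankel1_0 has_field_derivative hankel' z) (at z)"
  unfolding hankel_eq[abs_def] hankel'_def
  by (rule derivative_eq_intros J_fun_deriv M_fun_deriv Ln_half_deriv[OF assms] refl)+ (simp add: algebra_simps)

lemma hankel'_deriv:
  assumes "Re z > 0" shows "(hankel' has_field_derivative hankel'' z) (at z)"
proof -
  have "z \<noteq> 0" using assms by auto
  then show ?thesis
  unfolding hankel'_def[abs_def] hankel''_def
  by - ((rule derivative_eq_intros J_fun_deriv J_fun'_deriv M_fun'_deriv Ln_half_deriv[OF assms] refl | assumption)+,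
     simp add: field_simps power2_eq_square)
qed

lemma hankel_ode:
  assumes "Re z > 0" shows "z * hankel'' z + hankel' z + z * hankel1_0 z = 0"
proof -
  have z: "z \<noteq> 0" using assms by auto
  define c where "c = \<i> * complex_of_real (2 / pi)"
  define L where "L = Ln (z / 2) + (euler_mascheroni :: complex)"
  \<comment> \<open>Differentiating the logarithm times J_0 contributes 2 J_0', which cancels the
    source in the equation of \<open>M_fun\<close>.\<close>
  have "z * hankel'' z + hankel' z + z * hankel1_0 z
    = (1 + c * L) * (z * J_fun'' z + J_fun' z + z * J_fun z)
      + c * (2 * J_fun' z - (z * M_fun'' z + M_fun' z + z * M_fun z))"
    unfolding hankel_eq hankel'_def hankel''_def c_def[symmetric] L_def[symmetric]
    using z by (simp add: field_simps power2_eq_square)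
  then show ?thesis by (simp add: J_fun_ode M_fun_ode)
qed

section \<open>Behaviour of the transform at 0\<close>

text \<open>For large argument the quadratic term dominates; u (1 + \<i>) / 2 is the square root of
  \<i> u^2 / 2 in the right half-plane.\<close>

lemma hroot_scaled_tendsto:
  assumes "u > 0"
  shows "((\<lambda>y. hroot (u * y) / of_real y) \<longlongrightarrow> of_real u * (1 + \<i>) / 2) (at_top :: real filter)"
proof -
  have "((\<lambda>y. csqrt (Complex (u * inverse y) (u\<^sup>2 / 2))) \<longlongrightarrow> csqrt (Complex (u * 0) (u\<^sup>2 / 2))) at_top"
    using assms by (intro csqrt_tendsto tendsto_Complex tendsto_intros tendsto_inverse_0_at_top filterlim_ident)
      (auto simp: complex_nonpos_Reals_iff)
  moreover have "eventually (\<lambda>y. csqrt (Complex (u * inverse y) (u\<^sup>2 / 2)) = hroot (u * y) / of_real y) at_top"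
    using eventually_gt_at_top[of 0]
  proof eventually_elim
    case (elim y)
    have "of_real (inverse y) * hroot (u * y) = csqrt (Complex ((inverse y)\<^sup>2 * (u * y)) ((inverse y)\<^sup>2 * (u * y)\<^sup>2 / 2))"
      using elim assms by (intro hroot_scale) auto
    then show ?case using elim by (simp add: power2_eq_square field_simps)
  qed
  ultimately have "((\<lambda>y. hroot (u * y) / of_real y) \<longlongrightarrow> csqrt (Complex (u * 0) (u\<^sup>2 / 2))) at_top"
    by (rule Lim_transform_eventually)
  moreover have "csqrt (Complex (u * 0) (u\<^sup>2 / 2)) = of_real u * (1 + \<i>) / 2"
  proof -
    have "(of_real u * (1 + \<i>) / 2)\<^sup>2 = Complex (u * 0) (u\<^sup>2 / 2)"
      by (simp add: complex_eq_iff power2_eq_square)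
    moreover have "Re (of_real u * (1 + \<i>) / 2) > 0" using assms by simp
    ultimately show ?thesis using csqrt_square by metis
  qed
  ultimately show ?thesis by (simp only:)
qed

lemma exp_minus_of_real: "exp (- complex_of_real x) = of_real (exp (- x))"
  by (metis exp_of_real of_real_minus)

text \<open>With z = 1 / y this is the pole -(1 - \<i>) / z of the derivative. After the
  substitution t = u y the density -t / \<open>hroot t\<close> tends to the constant -2 / (1 + \<i>)
  = -(1 - \<i>).\<close>

lemma hP1_at_0: "((\<lambda>y. hP1 (of_real (1 / y)) / of_real y) \<longlongrightarrow> - (1 - \<i>)) (at_top :: real filter)"
proof -
  let ?s = "\<lambda>(y::real) u. indicator {0<..} u *\<^sub>R (- of_real (u * exp (- u)) / (hroot (u * y) / of_real y))"
  have int: "integrable lborel (\<lambda>u::real. indicator {0<..} u *\<^sub>R (2 * exp (- u)))"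
    using set_integrable_mult_right[OF set_integral_exp_neg(1), of 2] unfolding set_integrable_def by simp
  have "((\<lambda>y. \<integral>u. ?s y u \<partial>lborel) \<longlongrightarrow> (\<integral>u. of_real (indicator {0<..} u *\<^sub>R exp (- u)) * (- (1 - \<i>)) \<partial>lborel)) at_top"
  proof (rule integral_dominated_convergence_at_top[OF _ _ int])
    show "\<forall>\<^sub>F y in at_top. AE u in lborel. norm (?s y u) \<le> indicator {0<..} u *\<^sub>R (2 * exp (- u))"
      using eventually_gt_at_top[of 0]
    proof (eventually_elim, intro AE_I2)
      fix y u :: real assume y: "0 < y"
      show "norm (?s y u) \<le> indicator {0<..} u *\<^sub>R (2 * exp (- u))"
      proof (cases "u > 0")
        case True
        have "u / 2 \<le> u / sqrt 2" using True real_sqrt_le_mono[of 2 4] by (intro divide_left_mono) auto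
        also have "\<dots> \<le> norm (hroot (u * y)) / y"
          using norm_hroot_ge(2)[of "u * y"] True y by (simp add: field_simps)
        finally have 1: "u / 2 \<le> norm (hroot (u * y)) / y" .
        have "norm (?s y u) = u * exp (-u) / (norm (hroot (u * y)) / y)"
          using True y by (simp add: norm_divide norm_mult)
        also have "\<dots> \<le> u * exp (-u) / (u / 2)"
          using 1 True y by (intro divide_left_mono mult_pos_pos divide_pos_pos) (auto simp: hroot_neq_0)
        finally show ?thesis using True by simp
      qed auto
    qed
    show "AE u in lborel. ((\<lambda>y. ?s y u) \<longlongrightarrow> of_real (indicator {0<..} u *\<^sub>R exp (- u)) * (- (1 - \<i>))) at_top"
    proof (rule AE_I2)
      fix u :: real
      show "((\<lambda>y. ?s y u) \<longlongrightarrow> of_real (indicator {0<..} u *\<^sub>R exp (- u)) * (- (1 - \<i>))) at_top"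
      proof (cases "u > 0")
        case True
        have nz: "1 + \<i> \<noteq> 0" by (simp add: complex_eq_iff)
        have "((\<lambda>y. ?s y u) \<longlongrightarrow> indicator {0<..} u *\<^sub>R (- of_real (u * exp (- u)) / (of_real u * (1 + \<i>) / 2))) at_top"
          by (intro tendsto_scaleR tendsto_const tendsto_divide hroot_scaled_tendsto True) (use True nz in auto)
        moreover have "indicator {0<..} u *\<^sub>R (- of_real (u * exp (- u)) / (of_real u * (1 + \<i>) / 2)) = complex_of_real (indicator {0<..} u *\<^sub>R exp (- u)) * (- (1 - \<i>))"
        proof -
          have "- (U * E) / (U * (1 + \<i>) / 2) = E * (- (1 - \<i>))" if "U \<noteq> 0" for U E
          proof (subst nonzero_divide_eq_eq)
            show "U * (1 + \<i>) / 2 \<noteq> 0" using that nz by simp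
          qed (simp add: algebra_simps)
          from this[of "of_real u" "of_real (exp (-u))"] show ?thesis using True by simp
        qed
        ultimately show ?thesis by (simp only:)
      qed auto
    qed
  qed measurable
  moreover have "(\<integral>u. complex_of_real (indicator {0<..} u *\<^sub>R exp (- u)) * (- (1 - \<i>)) \<partial>lborel) = - (1 - \<i>)"
    using set_integral_exp_neg(2) unfolding set_lebesgue_integral_def
    by (subst integral_mult_left_zero, subst integral_complex_of_real) simp
  moreover have "eventually (\<lambda>y. (\<integral>u. ?s y u \<partial>lborel) = hP1 (of_real (1 / y)) / of_real y) at_top"
    using eventually_gt_at_top[of 0]
  proof eventually_elim
    case (elim y)
    have "hP1 (of_real (1 / y)) = (LBINT u:{0<..}. exp (- (of_real (1/y) / of_real (1/y) * of_real u)) * (- of_real (u / (1/y)) * (1 / hroot (u / (1/y))) / of_real (1/y)))"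
      using elim by (intro laplace_scale) auto
    also have "\<dots> = (LBINT u:{0<..}. of_real y * (- of_real (u * exp (- u)) / (hroot (u * y) / of_real y)))"
      unfolding set_lebesgue_integral_def using elim
      by (intro Bochner_Integration.integral_cong) (auto simp: exp_minus_of_real field_simps)
    also have "\<dots> = of_real y * (\<integral>u. ?s y u \<partial>lborel)"
      unfolding set_lebesgue_integral_def[symmetric] by (rule set_integral_mult_right)
    finally show ?case using elim by simp
  qed
  ultimately show ?thesis by (simp add: Lim_transform_eventually)
qed

text \<open>Scaling \<open>hP_by_parts\<close> by t = u y gives the mean of
  \<open>hprim (u * y)\<close> for the density exp (-u). There Ln (hZ (u y)) splits into ln y and Ln
  (hZ (u y) / y), and hZ (u y) / y tends to 2 u. The constant is therefore the integral of exp (-u)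
  ln (2 u), that is ln 2 minus Euler's constant, plus the \<i> pi / 2 of
  \<open>hprim\<close>.\<close>

lemma hP_at_0:
  "((\<lambda>y. hP (of_real (1 / y)) - (1 - \<i>) * of_real (ln y)) \<longlongrightarrow>
     (1 - \<i>) * (of_real (ln 2 - euler_mascheroni) + \<i> * of_real (pi / 2))) (at_top :: real filter)"
proof -
  let ?s = "\<lambda>(y::real) u. indicator {0<..} u *\<^sub>R (of_real (exp (- u)) * (Ln (hZ (u * y) / of_real y) + \<i> * of_real (pi / 2)))"
  let ?l = "\<lambda>u. indicator {0<..} u *\<^sub>R (of_real (exp (- u)) * (of_real (ln (2 * u)) + \<i> * of_real (pi / 2)))"
  let ?w = "\<lambda>u::real. 10 * exp (-u) + (3 * (u powr 1 * exp (- (1 * u))) + 2 * (u powr (-1/2) * exp (- (1 * u))))"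
  have int: "integrable lborel (\<lambda>u::real. indicator {0<..} u *\<^sub>R ?w u)"
    unfolding set_integrable_def[symmetric]
    by (intro set_integral_add set_integrable_mult_right powr_exp_set_integrable set_integral_exp_neg) auto
  \<comment> \<open>With Z = hZ (u y) / y, Re Z \<ge> u bounds -ln |Z| by -ln u, which is integrable
    at 0, and y \<ge> 1 bounds |Z| by 3 (1 + u); both are uniform in y. The argument of Z stays
    below pi / 2.\<close>
  have bd: "norm (?s y u) \<le> indicator {0<..} u *\<^sub>R ?w u" if y: "1 \<le> y" for y u
    proof (cases "u > 0")
      case True
      define Z where "Z = hZ (u * y) / of_real y"
      have Re: "Re Z \<ge> u"
        using hZ_Re[of "u * y"] True y by (simp add: Z_def Re_divide_of_real field_simps)
      have nz: "Z \<noteq> 0" using Re True by auto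
      have nl: "u \<le> norm Z" using Re complex_Re_le_cmod[of Z] by linarith
      have "norm Z \<le> 3 * (1 + u * y) / y"
        using hZ_norm(1)[of "u * y"] True y by (simp add: Z_def norm_divide divide_right_mono)
      also have "\<dots> \<le> 3 * (1 + u)" using True y by (simp add: field_simps)
      finally have nu: "norm Z \<le> 3 * (1 + u)" .
      define p where "p = u powr (-1/2)"
    have p0: "p \<ge> 0" by (simp add: p_def)
    have l1: "ln (norm Z) \<le> 3 * (1 + u)" using ln_le_minus_one[of "norm Z"] nu nz by simp
    have "- ln (norm Z) \<le> - ln u" using nl True nz by simp
    also have "- ln u \<le> 2 * p"
      using ln_le_minus_one[of p] True by (simp add: ln_powr p_def)
    finally have l2: "- ln (norm Z) \<le> 2 * p" .
    have "\<bar>Re (Ln Z)\<bar> \<le> 3 + 3 * u + 2 * p"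
      unfolding Re_Ln[OF nz] using True p0 by (intro abs_leI order_trans[OF l1] order_trans[OF l2]) auto
    moreover have "\<bar>Im (Ln Z)\<bar> < pi / 2" using Re_Ln_pos_lt[OF nz] Re True by simp
    moreover have "norm (Ln Z + \<i> * of_real (pi / 2)) \<le> \<bar>Re (Ln Z)\<bar> + \<bar>Im (Ln Z)\<bar> + pi / 2"
      using norm_triangle_ineq[of "Ln Z" "\<i> * of_real (pi / 2)"] cmod_le[of "Ln Z"] by (simp add: norm_mult)
    moreover have "n \<le> 10 + (3 * u + 2 * p)"
        if "a \<le> 3 + 3 * u + 2 * p" "b < pi / 2" "n \<le> a + b + pi / 2" for a b n :: real
      using that pi_less_4 by linarith
    ultimately have "norm (Ln Z + \<i> * of_real (pi / 2)) \<le> 10 + (3 * u + 2 * p)"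
      by blast
    then have "exp (-u) * norm (Ln Z + \<i> * of_real (pi / 2)) \<le> exp (-u) * (10 + (3 * u powr 1 + 2 * u powr (-1/2)))"
      using True by (intro mult_left_mono) (auto simp: p_def)
    moreover have "norm (?s y u) = exp (-u) * norm (Ln Z + \<i> * of_real (pi / 2))"
      using True by (simp add: norm_mult Z_def)
    moreover have "indicator {0<..} u *\<^sub>R ?w u = exp (-u) * (10 + (3 * u powr 1 + 2 * u powr (-1/2)))"
      using True by (simp add: algebra_simps)
    ultimately show ?thesis by (simp only:)
    qed auto
  have "((\<lambda>y. \<integral>u. ?s y u \<partial>lborel) \<longlongrightarrow> (\<integral>u. ?l u \<partial>lborel)) at_top"
  proof (rule integral_dominated_convergence_at_top[OF _ _ int])
    show "\<forall>\<^sub>F y in at_top. AE u in lborel. norm (?s y u) \<le> indicator {0<..} u *\<^sub>R ?w u"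
      using eventually_ge_at_top[of 1] by eventually_elim (use bd in auto)
    show "AE u in lborel. ((\<lambda>y. ?s y u) \<longlongrightarrow> ?l u) at_top"
    proof (rule AE_I2)
      fix u :: real
      show "((\<lambda>y. ?s y u) \<longlongrightarrow> ?l u) at_top"
      proof (cases "u > 0")
        case True
        have "((\<lambda>y. (of_real u - \<i> * of_real (inverse y)) + (1 - \<i>) * (hroot (u * y) / of_real y)) \<longlongrightarrow>
            (of_real u - \<i> * of_real 0) + (1 - \<i>) * (of_real u * (1 + \<i>) / 2)) at_top"
          by (intro tendsto_intros hroot_scaled_tendsto True tendsto_inverse_0_at_top filterlim_ident)
        moreover have "eventually (\<lambda>y. (of_real u - \<i> * of_real (inverse y)) + (1 - \<i>) * (hroot (u * y) / of_real y) = hZ (u * y) / of_real y) at_top"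
          using eventually_gt_at_top[of 0] by eventually_elim (simp add: hZ_def field_simps)
        ultimately have "((\<lambda>y. hZ (u * y) / of_real y) \<longlongrightarrow> (of_real u - \<i> * of_real 0) + (1 - \<i>) * (of_real u * (1 + \<i>) / 2)) at_top"
          by (rule Lim_transform_eventually)
        moreover have "(of_real u - \<i> * of_real 0) + (1 - \<i>) * (of_real u * (1 + \<i>) / 2) = of_real (2 * u)"
          by (simp add: complex_eq_iff)
        ultimately have h: "((\<lambda>y. hZ (u * y) / of_real y) \<longlongrightarrow> of_real (2 * u)) at_top" by (simp only:)
        have "((\<lambda>y. Ln (hZ (u * y) / of_real y)) \<longlongrightarrow> Ln (of_real (2 * u))) at_top"
          by (rule tendsto_Ln[OF h]) (use True in \<open>simp add: complex_nonpos_Reals_iff\<close>)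
        also have "Ln (of_real (2 * u)) = complex_of_real (ln (2 * u))" using True by (intro Ln_of_real) simp
        finally show ?thesis by (intro tendsto_scaleR tendsto_mult tendsto_add tendsto_const)
      qed auto
    qed
  qed (unfold hZ_def, measurable)
  moreover have "(\<integral>u. ?l u \<partial>lborel) = of_real (ln 2 - euler_mascheroni) + \<i> * of_real (pi / 2)"
  proof -
    have e: "(\<integral>u. complex_of_real (indicator {0<..} u *\<^sub>R exp (- u)) \<partial>lborel) = 1"
      using set_integral_exp_neg(2) unfolding set_lebesgue_integral_def by (subst integral_complex_of_real) simp
    have l: "(\<integral>u. complex_of_real (indicator {0<..} u *\<^sub>R (exp (- u) * ln u)) \<partial>lborel) = - euler_mascheroni"
      using integral_exp_neg_ln(2) unfolding set_lebesgue_integral_def by (subst integral_complex_of_real) simp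
    have i1: "integrable lborel (\<lambda>u. complex_of_real (indicator {0<..} u *\<^sub>R exp (- u)))"
      using set_integral_exp_neg(1) unfolding set_integrable_def by (rule integrable_of_real)
    have i2: "integrable lborel (\<lambda>u. complex_of_real (indicator {0<..} u *\<^sub>R (exp (- u) * ln u)))"
      using integral_exp_neg_ln(1) unfolding set_integrable_def by (rule integrable_of_real)
    have "(\<integral>u. ?l u \<partial>lborel) = (\<integral>u. (of_real (ln 2) + \<i> * of_real (pi / 2)) * complex_of_real (indicator {0<..} u *\<^sub>R exp (- u)) + complex_of_real (indicator {0<..} u *\<^sub>R (exp (- u) * ln u)) \<partial>lborel)"
      by (intro Bochner_Integration.integral_cong) (auto simp: indicator_def ln_mult algebra_simps)
    also have "\<dots> = (of_real (ln 2) + \<i> * of_real (pi / 2)) * 1 + - euler_mascheroni"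
      by (subst Bochner_Integration.integral_add) (use i1 i2 e l in auto)
    finally show ?thesis by simp
  qed
  ultimately have "((\<lambda>y. (1 - \<i>) * (\<integral>u. ?s y u \<partial>lborel)) \<longlongrightarrow> (1 - \<i>) * (of_real (ln 2 - euler_mascheroni) + \<i> * of_real (pi / 2))) at_top"
    by (intro tendsto_mult tendsto_const) simp
  moreover have "eventually (\<lambda>y. (1 - \<i>) * (\<integral>u. ?s y u \<partial>lborel) = hP (of_real (1 / y)) - (1 - \<i>) * of_real (ln y)) at_top"
    using eventually_ge_at_top[of 1]
  proof eventually_elim
    case (elim y)
    then have y: "y > 0" by simp
    have "hP (of_real (1 / y)) = of_real (1 / y) * laplace hprim (of_real (1 / y))"
      using y by (intro hP_by_parts) simp
    also have "laplace hprim (of_real (1 / y)) = (LBINT u:{0<..}. exp (- (of_real (1/y) / of_real (1/y) * of_real u)) * (hprim (u / (1/y)) / of_real (1/y)))"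
      using y by (intro laplace_scale) auto
    also have "\<dots> = (\<integral>u. (of_real y * (1 - \<i>)) * (?s y u + of_real (ln y) * complex_of_real (indicator {0<..} u *\<^sub>R exp (- u))) \<partial>lborel)"
      unfolding set_lebesgue_integral_def
    proof (intro Bochner_Integration.integral_cong refl)
      fix u :: real
      show "indicator {0<..} u *\<^sub>R (exp (- (of_real (1/y) / of_real (1/y) * of_real u)) * (hprim (u / (1/y)) / of_real (1/y)))
        = (of_real y * (1 - \<i>)) * (?s y u + of_real (ln y) * complex_of_real (indicator {0<..} u *\<^sub>R exp (- u)))"
      proof (cases "u > 0")
        case True
        have "u * y > 0" using True y by simp
        then have nz: "hZ (u * y) \<noteq> 0" using hZ_Re[of "u * y"] by (metis less_asym zero_complex.simps(1))
        define L where "L = Ln (hZ (u * y) / of_real y)"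
        have "Ln (hZ (u * y)) = L + of_real (ln y)"
          unfolding L_def Ln_divide_of_real[OF y nz] by (simp only: diff_add_cancel)
        then have key: "hprim (u * y) = (1 - \<i>) * ((L + of_real (ln y)) + \<i> * of_real (pi / 2))"
          unfolding hprim_def by (simp only:)
        have gen: "E * ((1 - \<i>) * ((L + l) + p) * Y) = (Y * (1 - \<i>)) * (E * (L + p) + l * E)" for E l p Y
          by (simp add: algebra_simps)
        have i: "indicator {0<..} u = (1::real)" "u / (1 / y) = u * y" using True by simp_all
        have d1: "of_real (1/y) / of_real (1/y) * complex_of_real u = of_real u" using y by simp
        have d: "a / complex_of_real (1 / y) = a * of_real y" for a
          using y by simp
        show ?thesis unfolding L_def[symmetric] i key d1 unfolding d mult_1_left exp_minus_of_real scaleR_one by (rule gen)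
      qed auto
    qed
    also have "\<dots> = (of_real y * (1 - \<i>)) * ((\<integral>u. ?s y u \<partial>lborel) + of_real (ln y))"
    proof -
      have i1: "integrable lborel (\<lambda>u. complex_of_real (indicator {0<..} u *\<^sub>R exp (- u)))"
        using set_integral_exp_neg(1) unfolding set_integrable_def by (rule integrable_of_real)
      have e: "(\<integral>u. complex_of_real (indicator {0<..} u *\<^sub>R exp (- u)) \<partial>lborel) = 1"
        using set_integral_exp_neg(2) unfolding set_lebesgue_integral_def by (subst integral_complex_of_real) simp
      have i2: "integrable lborel (?s y)"
      proof (rule Bochner_Integration.integrable_bound[OF int])
        show "?s y \<in> borel_measurable lborel" unfolding hZ_def by measurable
        show "AE u in lborel. norm (?s y u) \<le> norm (indicator {0<..} u *\<^sub>R ?w u)"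
        proof (rule AE_I2)
          fix u
          show "norm (?s y u) \<le> norm (indicator {0<..} u *\<^sub>R ?w u)"
            by (rule order_trans[OF bd[OF elim]]) (unfold real_norm_def, rule abs_ge_self)
        qed
      qed
      have "(\<integral>u. ?s y u + of_real (ln y) * complex_of_real (indicator {0<..} u *\<^sub>R exp (- u)) \<partial>lborel) = (\<integral>u. ?s y u \<partial>lborel) + of_real (ln y) * 1"
        by (subst Bochner_Integration.integral_add[OF i2 integrable_mult_right[OF i1]]) (simp only: integral_mult_right_zero e)
      then show ?thesis by (subst integral_mult_right_zero) (simp only: mult_1_right)
    qed
    finally have fin: "hP (of_real (1 / y)) = of_real (1 / y) * ((of_real y * (1 - \<i>)) * ((\<integral>u. ?s y u \<partial>lborel) + of_real (ln y)))" .
    have gen: "of_real (1 / y) * ((of_real y * (1 - \<i>)) * (I + l)) = (1 - \<i>) * I + (1 - \<i>) * l" for I l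
      using y by (simp add: algebra_simps)
    show ?case unfolding fin gen by (rule add_diff_cancel_right'[symmetric])
  qed
  ultimately show ?thesis by (rule Lim_transform_eventually)
qed

section \<open>Integral representation of the Hankel function\<close>

text \<open>The factor is forced by the logarithm at 0: \<open>hP z\<close> behaves like -(1 - \<i>)
  ln z, and -(1 - \<i>)^2 / pi = 2 \<i> / pi is the coefficient of the logarithm in the Hankel
  function.\<close>

definition hankel_int :: "complex \<Rightarrow> complex" where
  "hankel_int z = (1 - \<i>) / of_real pi * (exp (\<i> * z) * hP z)"
definition hankel_int' :: "complex \<Rightarrow> complex" where
  "hankel_int' z = (1 - \<i>) / of_real pi * (exp (\<i> * z) * (\<i> * hP z + hP1 z))"
definition hankel_int'' :: "complex \<Rightarrow> complex" where
  "hankel_int'' z = (1 - \<i>) / of_real pi * (exp (\<i> * z) * (- hP z + 2 * \<i> * hP1 z + hP2 z))"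

lemma hankel_int_deriv:
  assumes "Re z > 0"
  shows "(hankel_int has_field_derivative hankel_int' z) (at z)"
    "(hankel_int' has_field_derivative hankel_int'' z) (at z)"
proof -
  have e: "((\<lambda>z. exp (\<i> * z)) has_field_derivative \<i> * exp (\<i> * z)) (at z)"
    by (auto intro!: derivative_eq_intros)
  show "(hankel_int has_field_derivative hankel_int' z) (at z)"
    unfolding hankel_int_def[abs_def] hankel_int'_def
    by (rule DERIV_cmult[OF DERIV_cong[OF DERIV_mult[OF e hP_deriv[OF assms]]]])
       (simp only: distrib_left mult_ac)
  show "(hankel_int' has_field_derivative hankel_int'' z) (at z)"
    unfolding hankel_int'_def[abs_def] hankel_int''_def
  proof (rule DERIV_cmult[OF DERIV_cong[OF DERIV_mult[OF e DERIV_add[OF DERIV_cmult[OF hP_deriv[OF assms]] hP1_deriv[OF assms]]]]])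
    have "\<i> * E * (\<i> * p + p1) + (\<i> * p1 + p2) * E = E * (- p + 2 * \<i> * p1 + p2)" for E p p1 p2
      by (simp add: algebra_simps)
    then show "\<i> * exp (\<i> * z) * (\<i> * hP z + hP1 z) + (\<i> * hP1 z + hP2 z) * exp (\<i> * z) = exp (\<i> * z) * (- hP z + 2 * \<i> * hP1 z + hP2 z)" .
  qed
qed

lemma hankel_int_ode:
  assumes "Re z > 0" shows "z * hankel_int'' z + hankel_int' z + z * hankel_int z = 0"
proof -
  have "z * (a * (e * (- p + 2 * \<i> * p1 + p2))) + a * (e * (\<i> * p + p1)) + z * (a * (e * p))
    = a * e * (z * (2 * \<i> * p1 + p2) + (\<i> * p + p1))" for a e p p1 p2 :: complex
    by (simp add: algebra_simps)
  then show ?thesis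
    unfolding hankel_int_def hankel_int'_def hankel_int''_def by (simp only: hP_ode[OF assms]) simp
qed

definition hdiff :: "complex \<Rightarrow> complex" where "hdiff z = hankel1_0 z - hankel_int z"
definition hdiff' :: "complex \<Rightarrow> complex" where "hdiff' z = hankel' z - hankel_int' z"

text \<open>Limits at 0 are taken along the positive reals z = 1 / y only, where the expansions of
  \<open>hP\<close> are available.\<close>

abbreviation "inv_at_top F \<equiv> (\<lambda>y::real. F (complex_of_real (1 / y)))"

lemma inv_at_top_0: "filterlim (\<lambda>y. complex_of_real (1 / y)) (nhds 0) at_top"
proof -
  have "((\<lambda>y. complex_of_real (inverse y)) \<longlongrightarrow> of_real 0) at_top"
    by (intro tendsto_of_real tendsto_inverse_0_at_top filterlim_ident)
  then show ?thesis by (simp add: inverse_eq_divide)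
qed

lemma inv_at_top_isCont: "isCont F 0 \<Longrightarrow> (inv_at_top F \<longlongrightarrow> F 0) at_top"
  by (rule isCont_tendsto_compose[OF _ inv_at_top_0])

text \<open>Differentiability at 0 makes the difference O(1/y), which beats ln y.\<close>

lemma ln_times_inv_at_top:
  assumes "(F has_field_derivative D) (at 0)"
  shows "((\<lambda>y. of_real (ln y) * (F (complex_of_real (1 / y)) - F 0)) \<longlongrightarrow> 0) at_top"
proof -
  have "((\<lambda>h. (F h - F 0) / h) \<longlongrightarrow> D) (at 0)"
    using assms by (simp add: has_field_derivative_iff)
  moreover have "filterlim (\<lambda>y::real. complex_of_real (1 / y)) (at 0) at_top"
    unfolding filterlim_at using inv_at_top_0 eventually_gt_at_top[of 0] by (auto elim!: eventually_mono)
  ultimately have 1: "((\<lambda>y::real. (F (complex_of_real (1 / y)) - F 0) / complex_of_real (1 / y)) \<longlongrightarrow> D) at_top"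
    by (rule filterlim_compose)
  have "((\<lambda>y::real. ln y / y) \<longlongrightarrow> 0) at_top" by real_asymp
  then have 2: "((\<lambda>y::real. complex_of_real (ln y / y)) \<longlongrightarrow> of_real 0) at_top" by (rule tendsto_of_real)
  have "((\<lambda>y::real. complex_of_real (ln y / y) * ((F (complex_of_real (1 / y)) - F 0) / complex_of_real (1 / y))) \<longlongrightarrow> of_real 0 * D) at_top"
    by (rule tendsto_mult[OF 2 1])
  moreover have "eventually (\<lambda>y::real. complex_of_real (ln y / y) * ((F (complex_of_real (1 / y)) - F 0) / complex_of_real (1 / y)) = of_real (ln y) * (F (complex_of_real (1 / y)) - F 0)) at_top"
    using eventually_gt_at_top[of 0] by eventually_elim (simp add: field_simps)
  ultimately show ?thesis by (simp add: Lim_transform_eventually)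
qed

lemma hP_over_y: "((\<lambda>y. hP (of_real (1 / y)) / of_real y) \<longlongrightarrow> 0) (at_top :: real filter)"
proof -
  have i: "((\<lambda>y::real. complex_of_real (1 / y)) \<longlongrightarrow> 0) at_top" using inv_at_top_0 .
  have "((\<lambda>y::real. ln y / y) \<longlongrightarrow> 0) at_top" by real_asymp
  then have l: "((\<lambda>y::real. complex_of_real (ln y / y)) \<longlongrightarrow> of_real 0) at_top" by (rule tendsto_of_real)
  have "((\<lambda>y. (hP (of_real (1 / y)) - (1 - \<i>) * of_real (ln y)) * complex_of_real (1 / y) + (1 - \<i>) * complex_of_real (ln y / y)) \<longlongrightarrow>
     ((1 - \<i>) * (of_real (ln 2 - euler_mascheroni) + \<i> * of_real (pi / 2))) * 0 + (1 - \<i>) * of_real 0) (at_top :: real filter)"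
    by (intro tendsto_add tendsto_mult hP_at_0 i l tendsto_const)
  then show ?thesis by (simp add: algebra_simps diff_divide_distrib)
qed

text \<open>The logarithms cancel by the choice of the factor in \<open>hankel_int\<close>, and so
  do the constants: Euler's constant minus ln 2 occurs on both sides, and the value J_0(0) = 1 is
  met by the \<i> pi / 2 of \<open>hP_at_0\<close>.\<close>

lemma hdiff_at_0: "(inv_at_top hdiff \<longlongrightarrow> 0) at_top"
proof -
  define c where "c = \<i> * complex_of_real (2 / pi)"
  define g where "g = complex_of_real (euler_mascheroni - ln 2)"
  define a where "a = (1 - \<i>) / complex_of_real pi"
  have ac: "a * (1 - \<i>) = - c" by (simp add: a_def c_def complex_eq_iff)
  have J: "(inv_at_top J_fun \<longlongrightarrow> 1) at_top" and M: "(inv_at_top M_fun \<longlongrightarrow> 0) at_top"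
    using inv_at_top_isCont[OF DERIV_isCont[OF J_fun_deriv]] inv_at_top_isCont[OF DERIV_isCont[OF M_fun_deriv]] by (simp_all add: J_fun_0)
  have LJ: "((\<lambda>y. of_real (ln y) * (J_fun (complex_of_real (1 / y)) - 1)) \<longlongrightarrow> 0) at_top"
    using ln_times_inv_at_top[OF J_fun_deriv] by (simp add: J_fun_0)
  have ed: "((\<lambda>z. exp (\<i> * z)) has_field_derivative \<i>) (at 0)"
    by (auto intro!: derivative_eq_intros)
  have E: "((\<lambda>y. exp (\<i> * complex_of_real (1 / y))) \<longlongrightarrow> 1) at_top"
    using inv_at_top_isCont[OF DERIV_isCont[OF ed]] by simp
  have LE: "((\<lambda>y. of_real (ln y) * (exp (\<i> * complex_of_real (1 / y)) - 1)) \<longlongrightarrow> 0) at_top"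
    using ln_times_inv_at_top[OF ed] by simp
  let ?p = "\<lambda>y::real. hP (of_real (1 / y)) - (1 - \<i>) * of_real (ln y)"
  \<comment> \<open>The difference is regrouped so that every ln y multiplies a quantity that
    vanishes at 0; what remains has a limit term by term.\<close>
  have "((\<lambda>y. inv_at_top J_fun y + c * (g * inv_at_top J_fun y - inv_at_top M_fun y) - c * (of_real (ln y) * (inv_at_top J_fun y - 1))
      - (a * (exp (\<i> * complex_of_real (1 / y)) * ?p y) - c * (of_real (ln y) * (exp (\<i> * complex_of_real (1 / y)) - 1))))
     \<longlongrightarrow> 1 + c * (g * 1 - 0) - c * 0 - (a * (1 * ((1 - \<i>) * (of_real (ln 2 - euler_mascheroni) + \<i> * of_real (pi / 2)))) - c * 0)) at_top"
    by (intro tendsto_intros J M LJ E LE hP_at_0)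
  moreover have "1 + c * (g * 1 - 0) - c * 0 - (a * (1 * ((1 - \<i>) * (of_real (ln 2 - euler_mascheroni) + \<i> * of_real (pi / 2)))) - c * 0) = 0"
  proof -
    have "1 + c * (g * 1 - 0) - c * 0 - (a * (1 * ((1 - \<i>) * (of_real (ln 2 - euler_mascheroni) + \<i> * of_real (pi / 2)))) - c * 0)
      = 1 + c * g - (a * (1 - \<i>)) * (- g + \<i> * of_real (pi / 2))" by (simp add: g_def algebra_simps)
    also have "\<dots> = 1 + c * \<i> * of_real (pi / 2)" unfolding ac by (simp add: algebra_simps)
    also have "\<dots> = 0" by (simp add: c_def)
    finally show ?thesis .
  qed
  moreover have "eventually (\<lambda>y. inv_at_top J_fun y + c * (g * inv_at_top J_fun y - inv_at_top M_fun y) - c * (of_real (ln y) * (inv_at_top J_fun y - 1))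
      - (a * (exp (\<i> * complex_of_real (1 / y)) * ?p y) - c * (of_real (ln y) * (exp (\<i> * complex_of_real (1 / y)) - 1))) = inv_at_top hdiff y) at_top"
    using eventually_gt_at_top[of 0]
  proof eventually_elim
    case (elim y)
    have "complex_of_real (1 / y) / 2 = of_real (1 / (2 * y))" by simp
    then have "Ln (complex_of_real (1 / y) / 2) = Ln (of_real (1 / (2 * y)))" by (simp only:)
    also have "\<dots> = of_real (ln (1 / (2 * y)))" using elim by (intro Ln_of_real) auto
    also have "\<dots> = of_real (- ln 2 - ln y)" using elim by (simp add: ln_div ln_mult)
    finally have L: "Ln (complex_of_real (1 / y) / 2) + euler_mascheroni = g - of_real (ln y)" by (simp add: g_def)
    have gen: "j + c * (g * j - m) - c * (l * (j - 1)) - (a * (e * (p - (1 - \<i>) * l)) - c * (l * (e - 1)))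
       = j + c * ((g - l) * j - m) - a * (e * p)" for j m l e p
    proof -
      have "a * (e * (p - (1 - \<i>) * l)) = a * (e * p) - (a * (1 - \<i>)) * e * l" by (simp add: algebra_simps)
      then show ?thesis unfolding ac by (simp add: algebra_simps)
    qed
    show ?case unfolding hdiff_def hankel_eq hankel_int_def L c_def[symmetric] a_def[symmetric] by (rule gen)
  qed
  ultimately show ?thesis by (simp only: Lim_transform_eventually)
qed

text \<open>With z = 1 / y this says that z times the derivative tends to 0: the poles 2 \<i> / (pi
  z) of the two derivatives cancel.\<close>

lemma hdiff'_at_0: "((\<lambda>y. hdiff' (of_real (1 / y)) / of_real y) \<longlongrightarrow> 0) (at_top :: real filter)"
proof -
  define c where "c = \<i> * complex_of_real (2 / pi)"
  define g where "g = complex_of_real (euler_mascheroni - ln 2)"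
  define a where "a = (1 - \<i>) / complex_of_real pi"
  have ac: "a * (1 - \<i>) = - c" by (simp add: a_def c_def complex_eq_iff)
  have J: "(inv_at_top J_fun \<longlongrightarrow> 1) at_top" and J': "(inv_at_top J_fun' \<longlongrightarrow> 0) at_top" and M': "(inv_at_top M_fun' \<longlongrightarrow> 0) at_top"
    using inv_at_top_isCont[OF DERIV_isCont[OF J_fun_deriv]] inv_at_top_isCont[OF DERIV_isCont[OF J_fun'_deriv]]
     inv_at_top_isCont[OF DERIV_isCont[OF M_fun'_deriv]] by (simp_all add: J_fun_0)
  have i: "((\<lambda>y::real. complex_of_real (1 / y)) \<longlongrightarrow> 0) at_top" using inv_at_top_0 .
  have LJ': "((\<lambda>y. of_real (ln y) * inv_at_top J_fun' y) \<longlongrightarrow> 0) at_top"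
    using ln_times_inv_at_top[OF J_fun'_deriv] by (simp add: J_fun_0)
  have ed: "((\<lambda>z. exp (\<i> * z)) has_field_derivative \<i>) (at 0)"
    by (auto intro!: derivative_eq_intros)
  have E: "((\<lambda>y. exp (\<i> * complex_of_real (1 / y))) \<longlongrightarrow> 1) at_top"
    using inv_at_top_isCont[OF DERIV_isCont[OF ed]] by simp
  have "((\<lambda>y. complex_of_real (1 / y) * inv_at_top J_fun' y
        + c * (inv_at_top J_fun y + complex_of_real (1 / y) * (g * inv_at_top J_fun' y - of_real (ln y) * inv_at_top J_fun' y) - complex_of_real (1 / y) * inv_at_top M_fun' y)
      - a * (exp (\<i> * complex_of_real (1 / y)) * (\<i> * (hP (of_real (1 / y)) / of_real y) + hP1 (of_real (1 / y)) / of_real y)))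
     \<longlongrightarrow> 0 * 0 + c * (1 + 0 * (g * 0 - 0) - 0 * 0) - a * (1 * (\<i> * 0 + - (1 - \<i>)))) at_top"
    by (intro tendsto_add tendsto_diff tendsto_mult tendsto_const J J' M' LJ' E hP_over_y hP1_at_0 i)
  moreover have "0 * 0 + c * (1 + 0 * (g * 0 - 0) - 0 * 0) - a * (1 * (\<i> * 0 + - (1 - \<i>))) = 0"
    using ac by (simp add: algebra_simps)
  moreover have "eventually (\<lambda>y. complex_of_real (1 / y) * inv_at_top J_fun' y
        + c * (inv_at_top J_fun y + complex_of_real (1 / y) * (g * inv_at_top J_fun' y - of_real (ln y) * inv_at_top J_fun' y) - complex_of_real (1 / y) * inv_at_top M_fun' y)
      - a * (exp (\<i> * complex_of_real (1 / y)) * (\<i> * (hP (of_real (1 / y)) / of_real y) + hP1 (of_real (1 / y)) / of_real y))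
      = hdiff' (of_real (1 / y)) / of_real y) at_top"
    using eventually_gt_at_top[of 0]
  proof eventually_elim
    case (elim y)
    have "complex_of_real (1 / y) / 2 = of_real (1 / (2 * y))" by simp
    then have "Ln (complex_of_real (1 / y) / 2) = Ln (of_real (1 / (2 * y)))" by (simp only:)
    also have "\<dots> = of_real (ln (1 / (2 * y)))" using elim by (intro Ln_of_real) auto
    also have "\<dots> = of_real (- ln 2 - ln y)" using elim by (simp add: ln_div ln_mult)
    finally have L: "Ln (complex_of_real (1 / y) / 2) + euler_mascheroni = g - of_real (ln y)" by (simp add: g_def)
    have gen: "1 / w * j1 + c * (j + 1 / w * (g * j1 - l * j1) - 1 / w * m1) - a * (e * (\<i> * (p / w) + p1 / w))
       = (j1 + c * (j / (1 / w) + (g - l) * j1 - m1) - a * (e * (\<i> * p + p1))) / w" if "w \<noteq> 0" for w j j1 m1 l e p p1 :: complex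
      using that by (simp add: field_simps)
    show ?case unfolding hdiff'_def hankel'_def hankel_int'_def L c_def[symmetric] a_def[symmetric]
      unfolding of_real_divide of_real_1 using gen elim by simp
  qed
  ultimately show ?thesis by (simp only: Lim_transform_eventually)
qed

text \<open>Both sides solve Bessel's equation. The Wronskian of their difference with J_0, multiplied by z, is
  constant and tends to 0 at 0, so the difference is a multiple of J_0; as it tends to 0 at 0, it vanishes.\<close>
theorem hankel_integral_representation:
  assumes "Re z > 0" shows "hankel1_0 z = hankel_int z"
proof -
  let ?R = "{z. Re z > 0}"
  have opR: "open ?R" and cvR: "convex ?R" by (auto simp: open_halfspace_Re_gt convex_halfspace_Re_gt)
  have d1: "(hdiff has_field_derivative hdiff' w) (at w)" if "Re w > 0" for w
    unfolding hdiff_def[abs_def] hdiff'_def using that by (intro DERIV_diff hankel_deriv hankel_int_deriv)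
  have d2: "(hdiff' has_field_derivative (hankel'' w - hankel_int'' w)) (at w)" if "Re w > 0" for w
    unfolding hdiff'_def[abs_def] using that by (intro DERIV_diff hankel'_deriv hankel_int_deriv)
  define W where "W w = w * (hdiff w * J_fun' w - hdiff' w * J_fun w)" for w
  have "(W has_field_derivative 0) (at w within ?R)" if "w \<in> ?R" for w
  proof -
    have w: "Re w > 0" using that by simp
    have o1: "w * (hankel'' w - hankel_int'' w) = - hdiff' w - w * hdiff w"
      using hankel_ode[OF w] hankel_int_ode[OF w] unfolding hdiff_def hdiff'_def by algebra
    have o2: "w * J_fun'' w = - J_fun' w - w * J_fun w"
      using J_fun_ode[of w] by algebra
    have "(W has_field_derivative (hdiff w * J_fun' w - hdiff' w * J_fun w)
        + (hdiff w * (w * J_fun'' w) - (w * (hankel'' w - hankel_int'' w)) * J_fun w)) (at w)"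
      unfolding W_def[abs_def]
      by (rule derivative_eq_intros d1[OF w] d2[OF w] J_fun_deriv J_fun'_deriv refl)+ (simp add: algebra_simps)
    also have "(hdiff w * J_fun' w - hdiff' w * J_fun w)
        + (hdiff w * (w * J_fun'' w) - (w * (hankel'' w - hankel_int'' w)) * J_fun w) = 0"
      unfolding o1 o2 by (simp add: algebra_simps)
    finally show ?thesis by (rule has_field_derivative_at_within)
  qed
  then obtain c where c: "W w = c" if "Re w > 0" for w
    using has_field_derivative_zero_constant[OF cvR, of W] by auto
  have "c = 0"
  proof -
    have J: "(inv_at_top J_fun \<longlongrightarrow> 1) at_top" and J': "(inv_at_top J_fun' \<longlongrightarrow> 0) at_top"
      using inv_at_top_isCont[OF DERIV_isCont[OF J_fun_deriv]] inv_at_top_isCont[OF DERIV_isCont[OF J_fun'_deriv]] by (simp_all add: J_fun_0)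
    have "((\<lambda>y. complex_of_real (1 / y) * (inv_at_top hdiff y * inv_at_top J_fun' y) - hdiff' (of_real (1 / y)) / of_real y * inv_at_top J_fun y)
       \<longlongrightarrow> 0 * (0 * 0) - 0 * 1) at_top"
      by (intro tendsto_diff tendsto_mult inv_at_top_0 hdiff_at_0 hdiff'_at_0 J J')
    moreover have "eventually (\<lambda>y. complex_of_real (1 / y) * (inv_at_top hdiff y * inv_at_top J_fun' y) - hdiff' (of_real (1 / y)) / of_real y * inv_at_top J_fun y = c) at_top"
      using eventually_gt_at_top[of 0]
    proof eventually_elim
      case (elim y)
      have "W (of_real (1 / y)) = c" using elim by (intro c) simp
      then show ?case using elim by (simp add: W_def field_simps)
    qed
    ultimately have "((\<lambda>y::real. c) \<longlongrightarrow> 0) at_top" using Lim_transform_eventually by fastforce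
    then show ?thesis by (simp add: tendsto_const_iff)
  qed
  \<comment> \<open>Division by J_0 is safe only near 0, where J_0 is close to 1. So the difference
    is shown to vanish on a half-disc, and the identity theorem extends this to the
    half-plane.\<close>
  have "isCont J_fun 0" by (rule DERIV_isCont[OF J_fun_deriv])
  then obtain \<delta> where \<delta>: "\<delta> > 0" "\<And>w. dist 0 w < \<delta> \<Longrightarrow> J_fun w \<noteq> 0"
    using continuous_at_avoid[of 0 J_fun 0] J_fun_0 by auto
  let ?S = "?R \<inter> ball 0 \<delta>"
  have "((\<lambda>w. hdiff w / J_fun w) has_field_derivative 0) (at w within ?S)" if "w \<in> ?S" for w
  proof -
    have w: "Re w > 0" and Jn: "J_fun w \<noteq> 0" using that \<delta> by auto
    have "w \<noteq> 0" using w by auto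
    then have e: "hdiff' w * J_fun w - hdiff w * J_fun' w = 0"
      using c[OF w] \<open>c = 0\<close> by (simp add: W_def)
    have "((\<lambda>w. hdiff w / J_fun w) has_field_derivative (hdiff' w * J_fun w - hdiff w * J_fun' w) / (J_fun w * J_fun w)) (at w)"
      using Jn by (intro DERIV_divide d1 w J_fun_deriv)
    then show ?thesis unfolding e by (auto intro: has_field_derivative_at_within)
  qed
  moreover have "convex ?S" using cvR by (intro convex_Int) auto
  ultimately obtain C where C: "hdiff w / J_fun w = C" if "w \<in> ?S" for w
    using has_field_derivative_zero_constant[of ?S "\<lambda>w. hdiff w / J_fun w"] by blast
  have "C = 0"
  proof -
    have J: "(inv_at_top J_fun \<longlongrightarrow> 1) at_top"
      using inv_at_top_isCont[OF DERIV_isCont[OF J_fun_deriv]] by (simp add: J_fun_0)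
    have "((\<lambda>y. inv_at_top hdiff y / inv_at_top J_fun y) \<longlongrightarrow> 0 / 1) at_top"
      by (intro tendsto_divide hdiff_at_0 J) auto
    moreover have "eventually (\<lambda>y. inv_at_top hdiff y / inv_at_top J_fun y = C) at_top"
      using eventually_gt_at_top[of "max 0 (1 / \<delta>)"]
    proof eventually_elim
      case (elim y)
      then have "0 < y" "1 / \<delta> < y" by auto
      moreover from this have "1 / y < \<delta>" using \<delta>(1) by (simp add: field_simps)
      ultimately have "of_real (1 / y) \<in> ?S" by (simp add: norm_divide)
      then show ?case by (rule C)
    qed
    ultimately have "((\<lambda>y::real. C) \<longlongrightarrow> 0) at_top" using Lim_transform_eventually by fastforce
    then show ?thesis by (simp add: tendsto_const_iff)
  qed
  have z0: "hdiff w = 0" if "w \<in> ?S" for w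
    using C[OF that] \<open>C = 0\<close> \<delta>(2)[of w] that by auto
  have "hdiff z = 0"
  proof (rule analytic_continuation_open[of ?S ?R hdiff "\<lambda>_. 0"])
    show "open ?S" using opR by auto
    have "of_real (\<delta> / 2) \<in> ?S" using \<delta>(1) by (auto simp: norm_divide)
    then show "?S \<noteq> {}" by blast
    show "hdiff holomorphic_on ?R"
      using d1 opR by (auto simp: holomorphic_on_open)
  qed (use z0 cvR opR assms in \<open>auto intro: convex_connected\<close>)
  then show ?thesis by (simp add: hdiff_def)
qed

lemma norm_hankel:
  assumes "Re z > 0"
  shows "norm (hankel1_0 z) = sqrt 2 / pi * (exp (- Im z) * norm (hP z))"
proof -
  have "norm (1 - \<i>) = sqrt 2" by (simp add: cmod_def)
  then show ?thesis
    unfolding hankel_integral_representation[OF assms] hankel_int_def by (simp add: norm_mult norm_divide)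
qed

lemma hankel_norm_sq_le:
  assumes "Re z > 0" "Im z \<ge> 0"
  shows "(norm (hankel1_0 z))\<^sup>2 \<le> 2 / (pi * Re z)"
proof -
  have "norm (hankel1_0 z) = sqrt 2 / pi * (exp (- Im z) * norm (hP z))"
    by (rule norm_hankel[OF assms(1)])
  also have "\<dots> \<le> sqrt 2 / pi * (1 * (sqrt pi / sqrt (Re z)))"
    using assms by (intro mult_left_mono mult_mono hP_norm_le) auto
  finally have "(norm (hankel1_0 z))\<^sup>2 \<le> (sqrt 2 / pi * (1 * (sqrt pi / sqrt (Re z))))\<^sup>2"
    by (intro power_mono) auto
  also have "\<dots> = 2 / (pi * Re z)"
    using assms by (simp add: power_mult_distrib power_divide power2_eq_square[of pi])
  finally show ?thesis .
qed

lemma hankel_norm_sq_asymptotic: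
  assumes x: "filterlim (\<lambda>k. Re (z k)) at_top at_top" and im: "((\<lambda>k. Im (z k)) \<longlongrightarrow> b) (at_top :: real filter)"
  shows "((\<lambda>k. Re (z k) * (norm (hankel1_0 (z k)))\<^sup>2) \<longlongrightarrow> 2 / pi * exp (- 2 * b)) at_top"
proof -
  have "((\<lambda>k. Im (z k) / Re (z k)) \<longlongrightarrow> 0) at_top"
    using tendsto_divide_0[OF im filterlim_at_top_imp_at_infinity[OF x]] .
  from hP_asymptotic[OF x this]
  have "((\<lambda>k. (sqrt 2 / pi * (exp (- Im (z k)) * norm (of_real (sqrt (Re (z k))) * hP (z k))))\<^sup>2)
     \<longlongrightarrow> (sqrt 2 / pi * (exp (- b) * norm (complex_of_real (sqrt pi))))\<^sup>2) at_top"
    by (intro tendsto_intros im)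
  moreover have "(sqrt 2 / pi * (exp (- b) * norm (complex_of_real (sqrt pi))))\<^sup>2 = 2 / pi * exp (- 2 * b)"
    by (simp add: power_mult_distrib power_divide power2_eq_square[of pi] exp_double[symmetric])
  moreover have "eventually (\<lambda>k. (sqrt 2 / pi * (exp (- Im (z k)) * norm (of_real (sqrt (Re (z k))) * hP (z k))))\<^sup>2 = Re (z k) * (norm (hankel1_0 (z k)))\<^sup>2) at_top"
    using eventually_compose_filterlim[OF eventually_gt_at_top[of 0] x]
  proof eventually_elim
    case (elim k)
    have "norm (hankel1_0 (z k)) = sqrt 2 / pi * (exp (- Im (z k)) * norm (hP (z k)))"
      by (rule norm_hankel[OF elim])
    then show ?case using elim by (simp add: norm_mult power_mult_distrib power_divide mult_ac)
  qed
  ultimately show ?thesis by (simp only: Lim_transform_eventually)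
qed

section \<open>The fundamental solution of the Helmholtz equation\<close>

lemma norm_diff_has_derivative:
  fixes x y :: "'a::euclidean_space"
  assumes "y \<noteq> x"
  shows "((\<lambda>y. norm (x - y)) has_derivative (\<lambda>h. ((y - x) \<bullet> h) / norm (x - y))) (at y)"
proof -
  have "((\<lambda>y. x - y) has_derivative (\<lambda>h. - h)) (at y)" by (auto intro!: derivative_eq_intros)
  from has_derivative_compose[OF this has_derivative_norm] assms
  have "((\<lambda>y. norm (x - y)) has_derivative (\<lambda>h. - h \<bullet> sgn (x - y))) (at y)" by simp
  moreover have "- h \<bullet> sgn (x - y) = ((y - x) \<bullet> h) / norm (x - y)" for h
    by (simp add: sgn_div_norm inner_diff_left inner_diff_right inner_commute[of h] divide_inverse algebra_simps)
  ultimately show ?thesis by (simp only:)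
qed

lemma radial_has_derivative:
  fixes x y :: "'a::euclidean_space"
  assumes "y \<noteq> x" and H: "(H has_field_derivative D) (at (\<kappa> * complex_of_real (norm (x - y))))"
  shows "((\<lambda>y. H (\<kappa> * complex_of_real (norm (x - y)))) has_derivative
     (\<lambda>h. D * (\<kappa> * complex_of_real (((y - x) \<bullet> h) / norm (x - y))))) (at y)"
proof -
  have "((\<lambda>y. \<kappa> * complex_of_real (norm (x - y))) has_derivative (\<lambda>h. \<kappa> * complex_of_real (((y - x) \<bullet> h) / norm (x - y)))) (at y)"
    by (intro has_derivative_mult_right has_derivative_of_real norm_diff_has_derivative assms)
  from has_derivative_compose[OF this H[unfolded has_field_derivative_def]] show ?thesis by simp
qed

lemma inverse_norm_has_derivative:
  fixes x y :: "'a::euclidean_space"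
  assumes "y \<noteq> x"
  shows "((\<lambda>y. complex_of_real (inverse (norm (x - y)))) has_derivative
    (\<lambda>h. complex_of_real (- ((y - x) \<bullet> h) * inverse (norm (x - y)) ^ 3))) (at y)"
proof -
  have "((\<lambda>y. inverse (norm (x - y))) has_derivative (\<lambda>h. - (inverse (norm (x - y)) * (((y - x) \<bullet> h) / norm (x - y)) * inverse (norm (x - y))))) (at y)"
    using assms by (intro Deriv.has_derivative_inverse norm_diff_has_derivative) auto
  from has_derivative_of_real[OF this]
  have "((\<lambda>y. complex_of_real (inverse (norm (x - y)))) has_derivative
    (\<lambda>h. complex_of_real (- (inverse (norm (x - y)) * (((y - x) \<bullet> h) / norm (x - y)) * inverse (norm (x - y)))))) (at y)" .
  then show ?thesis by (simp add: power3_eq_cube divide_inverse mult_ac)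
qed

lemma coord_has_derivative:
  "((\<lambda>y::'a::euclidean_space. complex_of_real ((y - x) \<bullet> c)) has_derivative (\<lambda>h. complex_of_real (h \<bullet> c))) (at y)"
  by (intro has_derivative_of_real) (auto intro!: derivative_eq_intros)

text \<open>The compositions with all complex derivatives of H, the inverse distance and the
  coordinates generate an algebra closed under partial derivatives away from x.\<close>

lemma smooth_radial:
  fixes x :: "'a::euclidean_space"
  assumes H: "H holomorphic_on {z. Re z > 0}" and \<kappa>: "Re \<kappa> > 0"
  shows "smooth_fun_on (- {x}) (\<lambda>y. H (\<kappa> * complex_of_real (norm (x - y))))"
proof -
  define Hn where "Hn n y = (deriv ^^ n) H (\<kappa> * complex_of_real (norm (x - y)))" for n y
  define ri where "ri y = complex_of_real (inverse (norm (x - y)))" for y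
  define co where "co b y = complex_of_real ((y - x) \<bullet> b)" for b y
  define G where "G = range Hn \<union> {ri} \<union> co ` Basis"
  have G1: "Hn n \<in> gen_alg G" and G2: "ri \<in> gen_alg G" and G3: "b \<in> Basis \<Longrightarrow> co b \<in> gen_alg G" for n b
    unfolding G_def by (intro gen_alg_base; blast)+
  have opR: "open {z. Re z > 0}" by (rule open_halfspace_Re_gt)
  have dH: "(Hn n has_derivative (\<lambda>h. Hn (Suc n) y * (\<kappa> * (co h y * ri y)))) (at y)" if "y \<noteq> x" for n y
  proof -
    have "(deriv ^^ n) H holomorphic_on {z. Re z > 0}" by (rule holomorphic_higher_deriv[OF H opR])
    moreover have "Re (\<kappa> * complex_of_real (norm (x - y))) > 0" using \<kappa> that by simp
    ultimately have "((deriv ^^ n) H has_field_derivative (deriv ^^ Suc n) H (\<kappa> * complex_of_real (norm (x - y)))) (at (\<kappa> * complex_of_real (norm (x - y))))"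
      using holomorphic_derivI[OF _ opR] by auto
    from radial_has_derivative[OF that this] show ?thesis
      by (simp add: Hn_def[abs_def] co_def ri_def divide_inverse)
  qed
  have dr: "(ri has_derivative (\<lambda>h. - co h y * (ri y * ri y * ri y))) (at y)" if "y \<noteq> x" for y
    using inverse_norm_has_derivative[OF that] by (simp add: ri_def[abs_def] co_def power3_eq_cube)
  have dc: "(co c has_derivative (\<lambda>h. complex_of_real (h \<bullet> c))) (at y)" for c y
    unfolding co_def[abs_def] by (rule coord_has_derivative)
  have "smooth_fun_on (- {x}) (Hn 0)"
  proof (rule smooth_gen_alg[where G=G])
    show "g differentiable (at y)" if "g \<in> G" "y \<in> - {x}" for g y
      using that dH[of y] dr[of y] dc unfolding G_def differentiable_def by blast
    show "\<exists>h\<in>gen_alg G. \<forall>y\<in>- {x}. frechet_derivative g (at y) b = h y" if "g \<in> G" and b: "b \<in> Basis" for g b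
    proof -
      from that(1) consider n where "g = Hn n" | "g = ri" | c where "c \<in> Basis" "g = co c" unfolding G_def by blast
      then show ?thesis
      proof cases
        case 1
        have f: "\<forall>y\<in>- {x}. frechet_derivative g (at y) b = Hn (Suc n) y * (\<kappa> * (co b y * ri y))"
          unfolding 1 by (auto simp: frechet_derivative_at[OF dH, symmetric])
        show ?thesis
          by (rule bexI, rule f) (intro gen_alg_mult gen_alg_const G1 G2 G3 b)
      next
        case 2
        have f: "\<forall>y\<in>- {x}. frechet_derivative g (at y) b = - co b y * (ri y * ri y * ri y)"
          unfolding 2 by (auto simp: frechet_derivative_at[OF dr, symmetric])
        show ?thesis
          by (rule bexI, rule f) (intro gen_alg_mult gen_alg_uminus G1 G2 G3 b)
      next
        case 3
        have f: "\<forall>y\<in>- {x}. frechet_derivative g (at y) b = complex_of_real (b \<bullet> c)"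
          unfolding 3 by (auto simp: frechet_derivative_at[OF dc, symmetric])
        show ?thesis by (rule bexI, rule f) (rule gen_alg_const)
      qed
    qed
    show "Hn 0 \<in> gen_alg G" by (rule G1)
  qed auto
  then show ?thesis by (simp add: Hn_def[abs_def])
qed

lemma hankel_holomorphic: "hankel1_0 holomorphic_on {z. Re z > 0}"
  using hankel_deriv by (auto simp: holomorphic_on_open open_halfspace_Re_gt)

lemma smooth_fundamental_solution:
  assumes "Re \<kappa> > 0" shows "smooth_fun_on (- {x}) (fundamental_solution \<kappa> x)"
  unfolding fundamental_solution_def[abs_def]
  by (intro smooth_fun_on_cmult smooth_radial hankel_holomorphic assms) auto

text \<open>The pure second partials add up to the radial Laplacian u'' + u' / r. The coefficient of
  u' / r is 2 - 1: one contribution for each of the two coordinates, less one from differentiating 1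
  / r. Bessel's equation does the rest.\<close>

lemma helmholtz_fundamental_solution:
  assumes \<kappa>: "Re \<kappa> > 0" and y: "y \<noteq> x"
  shows "(\<Sum>b\<in>Basis. dir_derivs [b, b] (fundamental_solution \<kappa> x) y) = - \<kappa>\<^sup>2 * fundamental_solution \<kappa> x y"
proof -
  define h1 where "h1 y = hankel' (\<kappa> * complex_of_real (norm (x - y)))" for y
  define h2 where "h2 y = hankel'' (\<kappa> * complex_of_real (norm (x - y)))" for y
  define ri where "ri y = complex_of_real (inverse (norm (x - y)))" for y
  define co where "co b y = complex_of_real ((y - x) \<bullet> b)" for b y
  have Re: "Re (\<kappa> * complex_of_real (norm (x - z))) > 0" if "z \<noteq> x" for z using \<kappa> that by simp
  have d0: "(fundamental_solution \<kappa> x has_derivative (\<lambda>h. \<i> / 4 * (h1 z * (\<kappa> * (co h z * ri z))))) (at z)" if "z \<noteq> x" for z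
    unfolding fundamental_solution_def[abs_def]
    by (rule has_derivative_eq_rhs[OF has_derivative_mult_right[OF radial_has_derivative[OF that hankel_deriv[OF Re[OF that]]]]])
       (simp only: h1_def co_def ri_def divide_inverse of_real_mult)
  have d1: "(h1 has_derivative (\<lambda>h. h2 z * (\<kappa> * (co h z * ri z)))) (at z)" if "z \<noteq> x" for z
    unfolding h1_def[abs_def]
    by (rule has_derivative_eq_rhs[OF radial_has_derivative[OF that hankel'_deriv[OF Re[OF that]]]])
       (simp only: h2_def co_def ri_def divide_inverse of_real_mult)
  have dr: "(ri has_derivative (\<lambda>h. - co h z * (ri z * ri z * ri z))) (at z)" if "z \<noteq> x" for z
    using inverse_norm_has_derivative[OF that] by (simp add: ri_def[abs_def] co_def power3_eq_cube)
  have dc: "(co c has_derivative (\<lambda>h. complex_of_real (h \<bullet> c))) (at z)" for c z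
    unfolding co_def[abs_def] by (rule coord_has_derivative)
  have second: "dir_derivs [b, b] (fundamental_solution \<kappa> x) y = \<i> / 4 * \<kappa> *
      (h2 y * \<kappa> * ri y * ri y * (co b y)\<^sup>2 + h1 y * ri y - h1 y * ri y * ri y * ri y * (co b y)\<^sup>2)" if b: "b \<in> Basis" for b
  proof -
    have "dir_derivs [b, b] (fundamental_solution \<kappa> x) y = frechet_derivative (\<lambda>z. frechet_derivative (fundamental_solution \<kappa> x) (at z) b) (at y) b"
      by simp
    also have "\<dots> = frechet_derivative (\<lambda>z. \<i> / 4 * (h1 z * (\<kappa> * (co b z * ri z)))) (at y) b"
      by (rule arg_cong[where f="\<lambda>f. f b"], rule frechet_derivative_cong_open[of "- {x}"])
         (use y in \<open>auto simp: frechet_derivative_at[OF d0, symmetric]\<close>)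
    also have "\<dots> = \<i> / 4 * (h1 y * (\<kappa> * (co b y * (- co b y * (ri y * ri y * ri y)) + complex_of_real (b \<bullet> b) * ri y)) + h2 y * (\<kappa> * (co b y * ri y)) * (\<kappa> * (co b y * ri y)))"
      using frechet_derivative_at[OF has_derivative_mult_right[OF has_derivative_mult[OF d1[OF y] has_derivative_mult_right[OF has_derivative_mult[OF dc[of b y] dr[OF y]]]], of "\<i> / 4" \<kappa>], symmetric]
      by simp
    also have "b \<bullet> b = 1" using b by simp
    finally show ?thesis by (simp add: algebra_simps power2_eq_square)
  qed
  have cs: "(\<Sum>b\<in>Basis. (co b y)\<^sup>2) = of_real ((norm (x - y))\<^sup>2)"
    unfolding norm_minus_commute[of x y] norm_sq_Basis co_def by simp
  have card: "(\<Sum>b\<in>(Basis::plane set). c) = 2 * c" for c :: complex by simp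
  have nz: "norm (x - y) \<noteq> 0" using y by simp
  have rr: "of_real (norm (x - y)) * ri y = 1" using nz by (simp add: ri_def flip: of_real_mult)
  define N where "N = complex_of_real (norm (x - y))"
  have N: "N * ri y = 1" "N \<noteq> 0" using rr nz by (simp_all add: N_def)
  have riN: "ri y = 1 / N" using N by (simp add: field_simps)
  have "(\<Sum>b\<in>Basis. dir_derivs [b, b] (fundamental_solution \<kappa> x) y)
    = (\<Sum>b\<in>Basis. \<i> / 4 * \<kappa> * (h2 y * \<kappa> * ri y * ri y - h1 y * ri y * ri y * ri y) * (co b y)\<^sup>2 + \<i> / 4 * \<kappa> * (h1 y * ri y))"
    by (intro sum.cong refl, subst second) (simp_all add: algebra_simps)
  also have "\<dots> = \<i> / 4 * \<kappa> * (h2 y * \<kappa> * ri y * ri y - h1 y * ri y * ri y * ri y) * N\<^sup>2 + 2 * (\<i> / 4 * \<kappa> * (h1 y * ri y))"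
    by (subst sum.distrib, subst sum_distrib_left[symmetric]) (simp only: cs card N_def of_real_power)
  also have "\<dots> = \<i> / 4 * \<kappa> / N * ((\<kappa> * N) * h2 y + h1 y)"
    unfolding riN using N(2) by (simp add: field_simps power2_eq_square)
  also have "(\<kappa> * N) * h2 y + h1 y = - (\<kappa> * N * hankel1_0 (\<kappa> * N))"
    using hankel_ode[OF Re[OF y]] unfolding h1_def h2_def N_def by algebra
  also have "\<i> / 4 * \<kappa> / N * - (\<kappa> * N * hankel1_0 (\<kappa> * N)) = - \<kappa>\<^sup>2 * fundamental_solution \<kappa> x y"
    using N(2) by (simp add: fundamental_solution_def N_def[symmetric] power2_eq_square)
  finally show ?thesis .
qed

lemma frechet_derivative_diff_at:
  "f differentiable (at x) \<Longrightarrow> g differentiable (at x) \<Longrightarrow>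
   frechet_derivative (\<lambda>x. f x - g x) (at x) b = frechet_derivative f (at x) b - frechet_derivative g (at x) b"
  by (subst frechet_derivative_at[symmetric, OF has_derivative_diff]) (auto simp: frechet_derivative_works)

lemma smooth_plane_wave: "smooth_fun_on UNIV (\<lambda>y::plane. exp (- \<i> * complex_of_real (y \<bullet> \<xi>)))"
  and plane_wave_derivative:
    "((\<lambda>y::plane. exp (- \<i> * complex_of_real (y \<bullet> \<xi>))) has_derivative
       (\<lambda>h. - \<i> * complex_of_real (h \<bullet> \<xi>) * exp (- \<i> * complex_of_real (y \<bullet> \<xi>)))) (at y)"
proof -
  let ?E = "\<lambda>y::plane. exp (- \<i> * complex_of_real (y \<bullet> \<xi>))"
  show d: "(?E has_derivative (\<lambda>h. - \<i> * complex_of_real (h \<bullet> \<xi>) * ?E y)) (at y)" for y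
  proof -
    have "((\<lambda>y::plane. - \<i> * complex_of_real (y \<bullet> \<xi>)) has_derivative (\<lambda>h. - \<i> * complex_of_real (h \<bullet> \<xi>))) (at y)"
      by (intro has_derivative_mult_right has_derivative_of_real) (auto intro!: derivative_eq_intros)
    from has_derivative_compose[OF this DERIV_exp[unfolded has_field_derivative_def]]
    show ?thesis by (simp add: mult_ac)
  qed
  show "smooth_fun_on UNIV ?E"
  proof (rule smooth_gen_alg[where G="{?E}"])
    show "g differentiable (at y)" if "g \<in> {?E}" for g y using that d unfolding differentiable_def by blast
    show "\<exists>h\<in>gen_alg {?E}. \<forall>y\<in>UNIV. frechet_derivative g (at y) b = h y" if "g \<in> {?E}" for g b
    proof (rule bexI)
      show "\<forall>y\<in>UNIV. frechet_derivative g (at y) b = (- \<i> * complex_of_real (b \<bullet> \<xi>)) * ?E y"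
      proof
        fix y :: plane
        have "g = ?E" using that by simp
        show "frechet_derivative g (at y) b = (- \<i> * complex_of_real (b \<bullet> \<xi>)) * ?E y"
          unfolding \<open>g = ?E\<close> frechet_derivative_at[OF d, symmetric] ..
      qed
    qed (intro gen_alg_mult gen_alg_const gen_alg_base, simp)
  qed (auto intro: gen_alg_base)
qed

section \<open>Concentration of frequencies\<close>

definition cut_fourier :: "(plane \<Rightarrow> complex) \<Rightarrow> (plane \<Rightarrow> real) \<Rightarrow> plane \<Rightarrow> complex" where
  "cut_fourier \<Psi> \<eta> = fourier (\<lambda>y. complex_of_real (\<eta> y) * \<Psi> y)"

lemma cut_test_function:
  assumes \<Psi>: "smooth_fun_on (- {x}) \<Psi>" and \<eta>: "\<eta> \<in> test_functions (- {x})"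
  shows "(\<lambda>y. complex_of_real (\<eta> y) * \<Psi> y) \<in> test_functions (- {x})"
proof (rule test_functions_mult[where W="- {x}"])
  show c: "(\<lambda>y. complex_of_real (\<eta> y)) \<in> test_functions (- {x})"
    by (rule test_functions_bounded_linear[OF \<eta> bounded_linear_of_real])
  show "fun_supp (\<lambda>y. complex_of_real (\<eta> y)) \<subseteq> - {x}" using c by (simp add: test_functions_def)
qed (use \<Psi> in auto)

lemma fourier_kernel_integrable:
  assumes "f \<in> test_functions S"
  shows "integrable lborel (\<lambda>y. exp (- \<i> * complex_of_real (y \<bullet> \<xi>)) * f y)"
proof (rule Bochner_Integration.integrable_bound[OF test_functions_integrable[OF assms]])
  show "(\<lambda>y. exp (- \<i> * complex_of_real (y \<bullet> \<xi>)) * f y) \<in> borel_measurable lborel"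
    using test_functions_borel[OF assms] by measurable
qed (auto simp: norm_mult)

text \<open>Green's identity for the plane wave times a cutoff against a solution of the Helmholtz
  equation; only derivatives of the cutoff survive.\<close>
lemma cut_fourier_identity:
  assumes \<Psi>: "smooth_fun_on (- {x}) \<Psi>"
    and pde: "\<And>y. y \<noteq> x \<Longrightarrow> (\<Sum>b\<in>Basis. dir_derivs [b, b] \<Psi> y) = - \<Lambda> * \<Psi> y"
    and \<eta>: "\<eta> \<in> test_functions (- {x})"
  shows "(of_real ((norm \<xi>)\<^sup>2) - \<Lambda>) * cut_fourier \<Psi> \<eta> \<xi> =
    (\<Sum>b\<in>Basis. cut_fourier \<Psi> (dir_derivs [b, b] \<eta>) \<xi>)
    - 2 * \<i> * (\<Sum>b\<in>Basis. of_real (\<xi> \<bullet> b) * cut_fourier \<Psi> (dir_derivs [b] \<eta>) \<xi>)"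
proof -
  define E where "E y = exp (- \<i> * complex_of_real (y \<bullet> \<xi>))" for y :: plane
  define C where "C \<eta> y = complex_of_real (\<eta> y)" for \<eta> :: "plane \<Rightarrow> real" and y
  have E_smooth: "smooth_fun_on UNIV E" unfolding E_def[abs_def] by (rule smooth_plane_wave)
  have E_d: "E differentiable (at y)" "frechet_derivative E (at y) b = - \<i> * of_real (\<xi> \<bullet> b) * E y" for y b
  proof -
    show "E differentiable (at y)"
      unfolding E_def[abs_def] differentiable_def using plane_wave_derivative by blast
    show "frechet_derivative E (at y) b = - \<i> * of_real (\<xi> \<bullet> b) * E y"
      unfolding E_def[abs_def] frechet_derivative_at[OF plane_wave_derivative, symmetric] inner_commute[of b \<xi>] ..
  qed
  have nested: "cut_fourier \<Psi> \<zeta> \<xi> = (\<integral>y. E y * (C \<zeta> y * \<Psi> y) \<partial>lborel)" for \<zeta>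
    by (simp add: cut_fourier_def fourier_def E_def C_def)
  have Ct: "C \<zeta> \<in> test_functions (- {x})" if "\<zeta> \<in> test_functions (- {x})" for \<zeta>
    unfolding C_def[abs_def] by (rule test_functions_bounded_linear[OF that bounded_linear_of_real])
  have Cd: "C \<zeta> differentiable (at y)" "frechet_derivative (C \<zeta>) (at y) b = C (dir_derivs [b] \<zeta>) y" if "\<zeta> \<in> test_functions (- {x})" for \<zeta> y b
  proof -
    have "(C \<zeta> has_derivative (\<lambda>h. complex_of_real (frechet_derivative \<zeta> (at y) h))) (at y)"
      unfolding C_def[abs_def] by (intro has_derivative_of_real test_functions_has_derivative[OF that])
    then show "C \<zeta> differentiable (at y)" "frechet_derivative (C \<zeta>) (at y) b = C (dir_derivs [b] \<zeta>) y"
      by (auto simp: differentiable_def frechet_derivative_at[symmetric] C_def)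
  qed
  define P1 where "P1 b = dir_derivs [b] \<Psi>" for b
  have P1s: "smooth_fun_on (- {x}) (P1 b)" if "b \<in> Basis" for b
    unfolding P1_def using that by (intro smooth_fun_on_dir_derivs \<Psi>) auto
  have Pd: "\<Psi> differentiable (at y)" if "y \<noteq> x" for y
    using smooth_fun_on_differentiable[OF \<Psi>] that by simp
  have P1d: "P1 b differentiable (at y)" if "y \<noteq> x" "b \<in> Basis" for y b
    using smooth_fun_on_differentiable[OF P1s] that by simp
  \<comment> \<open>The b-component of the field in Green's identity: with E the plane wave, it is
    the b-derivative of E \<eta> times \<Psi> minus E \<eta> times the b-derivative of \<Psi>. In
    its divergence the first derivatives of \<Psi> cancel.\<close>
  define X where "X b y = E y * ((C (dir_derivs [b] \<eta>) y - \<i> * of_real (\<xi> \<bullet> b) * C \<eta> y) * \<Psi> y - C \<eta> y * P1 b y)" for b y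
  have mem: "(\<lambda>y. C \<zeta> y * Q y) \<in> test_functions (- {x})" if "\<zeta> \<in> test_functions (- {x})" "smooth_fun_on (- {x}) Q" for \<zeta> Q
    unfolding C_def by (rule cut_test_function[OF that(2,1)])
  have D\<eta>: "dir_derivs bs \<eta> \<in> test_functions (- {x})" if "set bs \<subseteq> Basis" for bs
    by (rule test_functions_dir_derivs[OF \<eta> that])
  have Xt: "X b \<in> test_functions (- {x})" if b: "b \<in> Basis" for b
  proof -
    have "(\<lambda>y. ((C (dir_derivs [b] \<eta>) y * \<Psi> y - C \<eta> y * (\<i> * of_real (\<xi> \<bullet> b) * \<Psi> y)) - C \<eta> y * P1 b y) * E y) \<in> test_functions (- {x})"
    proof (rule test_functions_mult[where W=UNIV])
      show "(\<lambda>y. (C (dir_derivs [b] \<eta>) y * \<Psi> y - C \<eta> y * (\<i> * of_real (\<xi> \<bullet> b) * \<Psi> y)) - C \<eta> y * P1 b y) \<in> test_functions (- {x})"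
        using b by (intro test_functions_diff mem D\<eta> \<eta> \<Psi> P1s smooth_fun_on_cmult) auto
    qed (auto intro: E_smooth)
    then show ?thesis unfolding X_def[abs_def] by (rule back_subst[where P="\<lambda>f. f \<in> _"]) (auto simp: algebra_simps)
  qed
  have dX: "frechet_derivative (X b) (at y) b = E y * (C (dir_derivs [b, b] \<eta>) y * \<Psi> y)
      - 2 * \<i> * of_real (\<xi> \<bullet> b) * (E y * (C (dir_derivs [b] \<eta>) y * \<Psi> y))
      - of_real ((\<xi> \<bullet> b)\<^sup>2) * (E y * (C \<eta> y * \<Psi> y)) - E y * (C \<eta> y * dir_derivs [b, b] \<Psi> y)" if b: "b \<in> Basis" for b y
  proof (cases "y = x")
    case True
    \<comment> \<open>Nothing is known of \<Psi> at x itself; there both sides are 0 because \<eta>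
      and its derivatives vanish.\<close>
    have "x \<notin> fun_supp (X b)" using Xt[OF b] by (auto simp: test_functions_def)
    then have "dir_derivs [b] (X b) x = 0" by (rule dir_derivs_outside_supp)
    moreover have "C (dir_derivs bs \<eta>) x = 0" for bs
      using \<eta> by (auto simp: C_def test_functions_def dir_derivs_outside_supp)
    from this[of "[]"] this[of "[b]"] this[of "[b, b]"] have "C \<eta> x = 0" "C (dir_derivs [b] \<eta>) x = 0" "C (dir_derivs [b, b] \<eta>) x = 0" by simp_all
    ultimately show ?thesis unfolding True by (simp only: dir_derivs.simps) simp
  next
    case False
    let ?q = "\<i> * of_real (\<xi> \<bullet> b)"
    have b1: "set [b] \<subseteq> Basis" using b by simp
    have d1: "(\<lambda>y. ?q * C \<eta> y) differentiable (at y)"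
      using Cd(1)[OF \<eta>] by simp
    have d2: "(\<lambda>y. C (dir_derivs [b] \<eta>) y - ?q * C \<eta> y) differentiable (at y)"
      using Cd(1)[OF D\<eta>[OF b1]] d1 by (rule differentiable_diff)
    have d3: "(\<lambda>y. (C (dir_derivs [b] \<eta>) y - ?q * C \<eta> y) * \<Psi> y) differentiable (at y)"
      by (rule differentiable_mult[OF d2 Pd[OF False]])
    have d4: "(\<lambda>y. C \<eta> y * P1 b y) differentiable (at y)"
      by (rule differentiable_mult[OF Cd(1)[OF \<eta>] P1d[OF False b]])
    have d5: "(\<lambda>y. (C (dir_derivs [b] \<eta>) y - ?q * C \<eta> y) * \<Psi> y - C \<eta> y * P1 b y) differentiable (at y)"
      using d3 d4 by (rule differentiable_diff)
    have f1: "frechet_derivative (\<lambda>y. ?q * C \<eta> y) (at y) b = ?q * C (dir_derivs [b] \<eta>) y"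
      by (subst frechet_derivative_mult_at) (use Cd[OF \<eta>] in auto)
    have fP: "frechet_derivative \<Psi> (at y) b = P1 b y" "frechet_derivative (P1 b) (at y) b = dir_derivs [b, b] \<Psi> y"
      by (simp_all add: P1_def)
    have f2: "frechet_derivative (\<lambda>y. C (dir_derivs [b] \<eta>) y - ?q * C \<eta> y) (at y) b = C (dir_derivs [b, b] \<eta>) y - ?q * C (dir_derivs [b] \<eta>) y"
      unfolding frechet_derivative_diff_at[OF Cd(1)[OF D\<eta>[OF b1]] d1] f1 Cd(2)[OF D\<eta>[OF b1]] by simp
    have f3: "frechet_derivative (\<lambda>y. (C (dir_derivs [b] \<eta>) y - ?q * C \<eta> y) * \<Psi> y - C \<eta> y * P1 b y) (at y) b
       = ((C (dir_derivs [b] \<eta>) y - ?q * C \<eta> y) * P1 b y + (C (dir_derivs [b, b] \<eta>) y - ?q * C (dir_derivs [b] \<eta>) y) * \<Psi> y)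
         - (C \<eta> y * dir_derivs [b, b] \<Psi> y + C (dir_derivs [b] \<eta>) y * P1 b y)"
      unfolding frechet_derivative_diff_at[OF d3 d4] frechet_derivative_mult_at[OF d2 Pd[OF False]]
        frechet_derivative_mult_at[OF Cd(1)[OF \<eta>] P1d[OF False b]] f2 fP Cd(2)[OF \<eta>] ..
    have "frechet_derivative (X b) (at y) b = E y * (((C (dir_derivs [b] \<eta>) y - ?q * C \<eta> y) * P1 b y + (C (dir_derivs [b, b] \<eta>) y - ?q * C (dir_derivs [b] \<eta>) y) * \<Psi> y)
         - (C \<eta> y * dir_derivs [b, b] \<Psi> y + C (dir_derivs [b] \<eta>) y * P1 b y))
         + (- \<i> * of_real (\<xi> \<bullet> b) * E y) * ((C (dir_derivs [b] \<eta>) y - ?q * C \<eta> y) * \<Psi> y - C \<eta> y * P1 b y)"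
      unfolding X_def[abs_def] frechet_derivative_mult_at[OF E_d(1) d5] f3 E_d(2) ..
    then show ?thesis by (simp add: algebra_simps power2_eq_square)
  qed
  have int: "integrable lborel (\<lambda>y. E y * (C \<zeta> y * Q y))" if "\<zeta> \<in> test_functions (- {x})" "smooth_fun_on (- {x}) Q" for \<zeta> Q
    unfolding E_def by (rule fourier_kernel_integrable[OF mem[OF that]])
  have P2s: "smooth_fun_on (- {x}) (dir_derivs [b, b] \<Psi>)" if "b \<in> Basis" for b
    using that by (intro smooth_fun_on_dir_derivs \<Psi>) auto
  have z: "0 = cut_fourier \<Psi> (dir_derivs [b, b] \<eta>) \<xi> - 2 * \<i> * of_real (\<xi> \<bullet> b) * cut_fourier \<Psi> (dir_derivs [b] \<eta>) \<xi>
      - of_real ((\<xi> \<bullet> b)\<^sup>2) * cut_fourier \<Psi> \<eta> \<xi> - (\<integral>y. E y * (C \<eta> y * dir_derivs [b, b] \<Psi> y) \<partial>lborel)" if b: "b \<in> Basis" for b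
  proof -
    have b1: "set [b] \<subseteq> Basis" and b2: "set [b, b] \<subseteq> Basis" using b by auto
    have "0 = (\<integral>y. frechet_derivative (X b) (at y) b \<partial>lborel)"
      using integral_partial_derivative_0[OF Xt[OF b] b] by simp
    also have "\<dots> = cut_fourier \<Psi> (dir_derivs [b, b] \<eta>) \<xi> - 2 * \<i> * of_real (\<xi> \<bullet> b) * cut_fourier \<Psi> (dir_derivs [b] \<eta>) \<xi>
      - of_real ((\<xi> \<bullet> b)\<^sup>2) * cut_fourier \<Psi> \<eta> \<xi> - (\<integral>y. E y * (C \<eta> y * dir_derivs [b, b] \<Psi> y) \<partial>lborel)"
      unfolding dX[OF b] nested
      by (simp only: Bochner_Integration.integral_diff integral_mult_right_zero Bochner_Integration.integrable_diff integrable_mult_right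
          int[OF D\<eta>[OF b2] \<Psi>] int[OF D\<eta>[OF b1] \<Psi>] int[OF \<eta> \<Psi>] int[OF \<eta> P2s[OF b]])
    finally show ?thesis .
  qed
  have "(\<Sum>b\<in>Basis. \<integral>y. E y * (C \<eta> y * dir_derivs [b, b] \<Psi> y) \<partial>lborel) = (\<integral>y. (\<Sum>b\<in>Basis. E y * (C \<eta> y * dir_derivs [b, b] \<Psi> y)) \<partial>lborel)"
    by (rule Bochner_Integration.integral_sum[symmetric]) (intro int \<eta> P2s)
  also have "\<dots> = (\<integral>y. - \<Lambda> * (E y * (C \<eta> y * \<Psi> y)) \<partial>lborel)"
  proof (intro Bochner_Integration.integral_cong refl)
    fix y
    have "(\<Sum>b\<in>Basis. E y * (C \<eta> y * dir_derivs [b, b] \<Psi> y)) = E y * (C \<eta> y * (\<Sum>b\<in>Basis. dir_derivs [b, b] \<Psi> y))"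
      by (simp only: sum_distrib_left)
    also have "\<dots> = - \<Lambda> * (E y * (C \<eta> y * \<Psi> y))"
    proof (cases "y = x")
      case True
      have "C \<eta> x = 0" using \<eta> by (auto simp: C_def test_functions_def fun_supp_zero)
      then show ?thesis using True by simp
    next
      case False
      show ?thesis unfolding pde[OF False] by simp
    qed
    finally show "(\<Sum>b\<in>Basis. E y * (C \<eta> y * dir_derivs [b, b] \<Psi> y)) = - \<Lambda> * (E y * (C \<eta> y * \<Psi> y))" .
  qed
  also have "\<dots> = - \<Lambda> * cut_fourier \<Psi> \<eta> \<xi>" by (simp only: integral_mult_right_zero nested)
  finally have lap: "(\<Sum>b\<in>Basis. \<integral>y. E y * (C \<eta> y * dir_derivs [b, b] \<Psi> y) \<partial>lborel) = - \<Lambda> * cut_fourier \<Psi> \<eta> \<xi>" .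
  have "0 = (\<Sum>b\<in>(Basis::plane set). cut_fourier \<Psi> (dir_derivs [b, b] \<eta>) \<xi> - 2 * \<i> * of_real (\<xi> \<bullet> b) * cut_fourier \<Psi> (dir_derivs [b] \<eta>) \<xi>
      - of_real ((\<xi> \<bullet> b)\<^sup>2) * cut_fourier \<Psi> \<eta> \<xi> - (\<integral>y. E y * (C \<eta> y * dir_derivs [b, b] \<Psi> y) \<partial>lborel))"
    by (rule sum.neutral[symmetric]) (intro ballI z[symmetric])
  also have "\<dots> = (\<Sum>b\<in>Basis. cut_fourier \<Psi> (dir_derivs [b, b] \<eta>) \<xi>)
      - 2 * \<i> * (\<Sum>b\<in>Basis. of_real (\<xi> \<bullet> b) * cut_fourier \<Psi> (dir_derivs [b] \<eta>) \<xi>)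
      - of_real ((norm \<xi>)\<^sup>2) * cut_fourier \<Psi> \<eta> \<xi> - (- \<Lambda> * cut_fourier \<Psi> \<eta> \<xi>)"
    unfolding norm_sq_Basis[of \<xi>] of_real_sum sum_subtractf lap sum_distrib_left sum_distrib_right by (simp only: mult.assoc)
  finally show ?thesis by (simp add: algebra_simps)
qed

text \<open>As Re \<Lambda> = k^2, the factor on the left of Green's identity is at least (|\<xi>| +
  k) ||\<xi>| - k|, while the factors \<xi> \<bullet> b on the right cost at most |\<xi>| + k.
  Dividing by |\<xi>| + k \<ge> 1 gains one weight at the price of derivatives of the
  cutoff.\<close>

lemma ring_weight_recursion:
  assumes \<Psi>: "smooth_fun_on (- {x}) \<Psi>"
    and pde: "\<And>y. y \<noteq> x \<Longrightarrow> (\<Sum>b\<in>Basis. dir_derivs [b, b] \<Psi> y) = - \<Lambda> * \<Psi> y"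
    and \<eta>: "\<eta> \<in> test_functions (- {x})" and k: "k \<ge> 1" "Re \<Lambda> = k\<^sup>2"
  shows "(1 + \<bar>norm \<xi> - k\<bar>) * norm (cut_fourier \<Psi> \<eta> \<xi>) \<le> norm (cut_fourier \<Psi> \<eta> \<xi>)
    + (\<Sum>b\<in>Basis. norm (cut_fourier \<Psi> (dir_derivs [b, b] \<eta>) \<xi>))
    + 2 * (\<Sum>b\<in>Basis. norm (cut_fourier \<Psi> (dir_derivs [b] \<eta>) \<xi>))"
proof -
  define A where "A = (\<Sum>b\<in>(Basis::plane set). norm (cut_fourier \<Psi> (dir_derivs [b, b] \<eta>) \<xi>))"
  define B where "B = (\<Sum>b\<in>(Basis::plane set). norm (cut_fourier \<Psi> (dir_derivs [b] \<eta>) \<xi>))"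
  define N where "N = norm (cut_fourier \<Psi> \<eta> \<xi>)"
  have A0: "A \<ge> 0" and B0: "B \<ge> 0" and N0: "N \<ge> 0" by (auto simp: A_def B_def N_def intro: sum_nonneg)
  define m where "m = norm \<xi>"
  have m0: "m \<ge> 0" by (simp add: m_def)
  have "(m + k) * \<bar>m - k\<bar> = \<bar>m\<^sup>2 - k\<^sup>2\<bar>"
  proof -
    have "m\<^sup>2 - k\<^sup>2 = (m + k) * (m - k)" by (simp add: power2_eq_square algebra_simps)
    then show ?thesis using m0 k by (simp add: abs_mult)
  qed
  also have "\<dots> \<le> norm (of_real ((norm \<xi>)\<^sup>2) - \<Lambda>)"
    using abs_Re_le_cmod[of "of_real ((norm \<xi>)\<^sup>2) - \<Lambda>"] k by (simp add: m_def)
  finally have "(m + k) * \<bar>m - k\<bar> * N \<le> norm (of_real ((norm \<xi>)\<^sup>2) - \<Lambda>) * N"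
    using N0 by (rule mult_right_mono)
  also have "\<dots> = norm ((\<Sum>b\<in>Basis. cut_fourier \<Psi> (dir_derivs [b, b] \<eta>) \<xi>)
    - 2 * \<i> * (\<Sum>b\<in>Basis. of_real (\<xi> \<bullet> b) * cut_fourier \<Psi> (dir_derivs [b] \<eta>) \<xi>))"
    unfolding N_def norm_mult[symmetric] using cut_fourier_identity[OF \<Psi> pde \<eta>] by simp
  also have "\<dots> \<le> norm (\<Sum>b\<in>Basis. cut_fourier \<Psi> (dir_derivs [b, b] \<eta>) \<xi>)
    + norm (2 * \<i> * (\<Sum>b\<in>Basis. of_real (\<xi> \<bullet> b) * cut_fourier \<Psi> (dir_derivs [b] \<eta>) \<xi>))"
    by (rule norm_triangle_ineq4)
  also have "\<dots> \<le> A + 2 * (m * B)"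
  proof (rule add_mono)
    show "norm (\<Sum>b\<in>Basis. cut_fourier \<Psi> (dir_derivs [b, b] \<eta>) \<xi>) \<le> A" unfolding A_def by (rule norm_sum)
    have "norm (\<Sum>b\<in>Basis. of_real (\<xi> \<bullet> b) * cut_fourier \<Psi> (dir_derivs [b] \<eta>) \<xi>)
      \<le> (\<Sum>b\<in>Basis. norm (of_real (\<xi> \<bullet> b) * cut_fourier \<Psi> (dir_derivs [b] \<eta>) \<xi>))" by (rule norm_sum)
    also have "\<dots> \<le> (\<Sum>b\<in>(Basis::plane set). m * norm (cut_fourier \<Psi> (dir_derivs [b] \<eta>) \<xi>))"
      by (rule sum_mono) (auto simp: norm_mult m_def intro!: mult_right_mono Basis_le_norm)
    also have "\<dots> = m * B" by (simp add: B_def sum_distrib_left)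
    finally show "norm (2 * \<i> * (\<Sum>b\<in>Basis. of_real (\<xi> \<bullet> b) * cut_fourier \<Psi> (dir_derivs [b] \<eta>) \<xi>)) \<le> 2 * (m * B)"
      by (simp add: norm_mult)
  qed
  also have "\<dots> \<le> (m + k) * (A + 2 * B)"
  proof -
    have "1 * A \<le> (m + k) * A" using A0 m0 k by (intro mult_right_mono) auto
    moreover have "m * B \<le> (m + k) * B" using B0 k by (intro mult_right_mono) auto
    ultimately show ?thesis by (simp add: algebra_simps)
  qed
  finally have "(m + k) * (\<bar>m - k\<bar> * N) \<le> (m + k) * (A + 2 * B)" by (simp only: mult.assoc)
  then have "\<bar>m - k\<bar> * N \<le> A + 2 * B" using m0 k by (simp add: mult_le_cancel_left)
  then have "(1 + \<bar>m - k\<bar>) * N \<le> N + A + 2 * B" by (simp add: algebra_simps)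
  then show ?thesis unfolding A_def B_def N_def m_def .
qed

text \<open>The order of quantifiers matters: the list of cutoffs depends on \<eta>, x and n only,
  not on \<Psi>, \<Lambda>, k or \<xi>, so estimates obtained from it are uniform in k.\<close>

lemma ring_weight_power:
  assumes "\<eta> \<in> test_functions (- {x})"
  shows "\<exists>\<zeta>s. set \<zeta>s \<subseteq> test_functions (- {x}) \<and>
    (\<forall>\<Psi> \<Lambda> k \<xi>. smooth_fun_on (- {x}) \<Psi> \<longrightarrow> (\<forall>y. y \<noteq> x \<longrightarrow> (\<Sum>b\<in>Basis. dir_derivs [b, b] \<Psi> y) = - \<Lambda> * \<Psi> y) \<longrightarrow>
       k \<ge> 1 \<longrightarrow> Re \<Lambda> = k\<^sup>2 \<longrightarrow>
       (1 + \<bar>norm \<xi> - k\<bar>) ^ n * norm (cut_fourier \<Psi> \<eta> \<xi>) \<le> (\<Sum>\<zeta>\<leftarrow>\<zeta>s. norm (cut_fourier \<Psi> \<zeta> \<xi>)))"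
proof (induction n)
  case 0
  show ?case using assms by (intro exI[of _ "[\<eta>]"]) auto
next
  case (Suc n)
  then obtain \<zeta>s where zs: "set \<zeta>s \<subseteq> test_functions (- {x})"
    and ih: "\<And>\<Psi> \<Lambda> k \<xi>. smooth_fun_on (- {x}) \<Psi> \<Longrightarrow> (\<forall>y. y \<noteq> x \<longrightarrow> (\<Sum>b\<in>Basis. dir_derivs [b, b] \<Psi> y) = - \<Lambda> * \<Psi> y) \<Longrightarrow>
       k \<ge> 1 \<Longrightarrow> Re \<Lambda> = k\<^sup>2 \<Longrightarrow>
       (1 + \<bar>norm \<xi> - k\<bar>) ^ n * norm (cut_fourier \<Psi> \<eta> \<xi>) \<le> (\<Sum>\<zeta>\<leftarrow>\<zeta>s. norm (cut_fourier \<Psi> \<zeta> \<xi>))" by blast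
  obtain Bs :: "plane list" where Bs: "set Bs = Basis" "distinct Bs"
    using finite_distinct_list[OF finite_Basis] by blast
  \<comment> \<open>Encodes the right-hand side of the recursion; the first derivatives are listed
    twice to account for the factor 2.\<close>
  define L where "L \<zeta> = \<zeta> # map (\<lambda>b. dir_derivs [b, b] \<zeta>) Bs @ map (\<lambda>b. dir_derivs [b] \<zeta>) Bs @ map (\<lambda>b. dir_derivs [b] \<zeta>) Bs" for \<zeta> :: "plane \<Rightarrow> real"
  have Lt: "set (L \<zeta>) \<subseteq> test_functions (- {x})" if "\<zeta> \<in> test_functions (- {x})" for \<zeta>
  proof -
    have "dir_derivs [b, b] \<zeta> \<in> test_functions (- {x})" "dir_derivs [b] \<zeta> \<in> test_functions (- {x})" if "b \<in> Basis" for b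
      using that \<open>\<zeta> \<in> test_functions (- {x})\<close> by (intro test_functions_dir_derivs; simp)+
    then show ?thesis using that unfolding L_def by (auto simp: Bs simp del: dir_derivs.simps)
  qed
  have Lb: "(1 + \<bar>norm \<xi> - k\<bar>) * norm (cut_fourier \<Psi> \<zeta> \<xi>) \<le> (\<Sum>\<zeta>'\<leftarrow>L \<zeta>. norm (cut_fourier \<Psi> \<zeta>' \<xi>))"
    if "\<zeta> \<in> test_functions (- {x})" "smooth_fun_on (- {x}) \<Psi>" "\<forall>y. y \<noteq> x \<longrightarrow> (\<Sum>b\<in>Basis. dir_derivs [b, b] \<Psi> y) = - \<Lambda> * \<Psi> y" "k \<ge> 1" "Re \<Lambda> = k\<^sup>2" for \<Psi> \<Lambda> k \<xi> \<zeta>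
  proof -
    have l: "(\<Sum>b\<leftarrow>Bs. f b) = (\<Sum>b\<in>Basis. f b)" for f :: "plane \<Rightarrow> real"
      using sum_list_distinct_conv_sum_set[OF Bs(2), of f] by (simp add: Bs(1))
    have "(\<Sum>\<zeta>'\<leftarrow>L \<zeta>. norm (cut_fourier \<Psi> \<zeta>' \<xi>)) = norm (cut_fourier \<Psi> \<zeta> \<xi>)
      + (\<Sum>b\<in>Basis. norm (cut_fourier \<Psi> (dir_derivs [b, b] \<zeta>) \<xi>))
      + 2 * (\<Sum>b\<in>Basis. norm (cut_fourier \<Psi> (dir_derivs [b] \<zeta>) \<xi>))"
      unfolding L_def by (simp add: o_def l del: dir_derivs.simps)
    then show ?thesis
      by (simp only:) (rule ring_weight_recursion[OF that(2) _ that(1,4,5)], use that(3) in blast)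
  qed
  show ?case
  proof (intro exI[of _ "concat (map L \<zeta>s)"] conjI allI impI)
    show "set (concat (map L \<zeta>s)) \<subseteq> test_functions (- {x})" using zs Lt by fastforce
    fix \<Psi> \<Lambda> k and \<xi> :: plane
    assume a: "smooth_fun_on (- {x}) \<Psi>" "\<forall>y. y \<noteq> x \<longrightarrow> (\<Sum>b\<in>Basis. dir_derivs [b, b] \<Psi> y) = - \<Lambda> * \<Psi> y" "k \<ge> 1" "Re \<Lambda> = k\<^sup>2"
    have "(1 + \<bar>norm \<xi> - k\<bar>) ^ Suc n * norm (cut_fourier \<Psi> \<eta> \<xi>) = (1 + \<bar>norm \<xi> - k\<bar>) * ((1 + \<bar>norm \<xi> - k\<bar>) ^ n * norm (cut_fourier \<Psi> \<eta> \<xi>))" by simp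
    also have "\<dots> \<le> (1 + \<bar>norm \<xi> - k\<bar>) * (\<Sum>\<zeta>\<leftarrow>\<zeta>s. norm (cut_fourier \<Psi> \<zeta> \<xi>))"
      by (intro mult_left_mono ih[OF a]) simp
    also have "\<dots> = (\<Sum>\<zeta>\<leftarrow>\<zeta>s. (1 + \<bar>norm \<xi> - k\<bar>) * norm (cut_fourier \<Psi> \<zeta> \<xi>))"
      by (rule sum_list_const_mult[symmetric])
    also have "\<dots> \<le> (\<Sum>\<zeta>\<leftarrow>\<zeta>s. \<Sum>\<zeta>'\<leftarrow>L \<zeta>. norm (cut_fourier \<Psi> \<zeta>' \<xi>))"
      using zs by (intro sum_list_mono Lb[OF _ a]) auto
    also have "\<dots> = (\<Sum>\<zeta>\<leftarrow>concat (map L \<zeta>s). norm (cut_fourier \<Psi> \<zeta> \<xi>))"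
      by (induction \<zeta>s) auto
    finally show "(1 + \<bar>norm \<xi> - k\<bar>) ^ Suc n * norm (cut_fourier \<Psi> \<eta> \<xi>) \<le> (\<Sum>\<zeta>\<leftarrow>concat (map L \<zeta>s). norm (cut_fourier \<Psi> \<zeta> \<xi>))" .
  qed
qed

section \<open>Estimates at a fixed point x, uniform in the wave number\<close>

locale helmholtz_point =
  fixes \<sigma> :: real and x :: plane
  assumes \<sigma>: "\<sigma> \<ge> 0"
begin

abbreviation "kap \<equiv> wave_number \<sigma>"

lemma wave_number_facts:
  assumes k: "k > 0"
  shows "Re (kap k) > 0" "Im (kap k) \<ge> 0" "k \<le> Re (kap k)" "Im (kap k) = k * \<sigma> / (2 * Re (kap k))"
    "(Re (kap k))\<^sup>2 \<le> k\<^sup>2 + (\<sigma> / 2)\<^sup>2" "Re ((kap k)\<^sup>2) = k\<^sup>2"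
proof -
  show pos: "Re (kap k) > 0" and im: "Im (kap k) \<ge> 0" using wave_number[OF k \<sigma>] by auto
  have re: "(Re (kap k))\<^sup>2 - (Im (kap k))\<^sup>2 = k\<^sup>2" and ri: "2 * Re (kap k) * Im (kap k) = k * \<sigma>"
    using arg_cong[OF wave_number(1)[OF k \<sigma>], of Re] arg_cong[OF wave_number(1)[OF k \<sigma>], of Im]
    by (simp_all add: power2_eq_square mult_ac)
  have "k\<^sup>2 \<le> (Re (kap k))\<^sup>2" using re zero_le_power2[of "Im (kap k)"] by linarith
  then show le: "k \<le> Re (kap k)" by (rule power2_le_imp_le) (use pos in simp)
  show i: "Im (kap k) = k * \<sigma> / (2 * Re (kap k))" using ri pos by (simp add: field_simps)
  \<comment> \<open>Re \<kappa> \<ge> k bounds Im \<kappa> by \<sigma> / 2, and this in turn bounds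
    Re \<kappa> from above.\<close>
  have "k * \<sigma> / (2 * Re (kap k)) \<le> \<sigma> / 2"
    using le pos \<sigma> by (simp add: divide_simps mult.commute mult_left_mono)
  then have "(Im (kap k))\<^sup>2 \<le> (\<sigma> / 2)\<^sup>2" using im i by (intro power_mono) auto
  then show "(Re (kap k))\<^sup>2 \<le> k\<^sup>2 + (\<sigma> / 2)\<^sup>2" using re by linarith
  show "Re ((kap k)\<^sup>2) = k\<^sup>2" using re by (simp add: power2_eq_square)
qed

lemma wave_number_limits:
  "((\<lambda>k. Re (kap k) / k) \<longlongrightarrow> 1) at_top" "((\<lambda>k. Im (kap k)) \<longlongrightarrow> \<sigma> / 2) at_top"
  "filterlim (\<lambda>k. Re (kap k)) at_top at_top"
proof -
  have "((\<lambda>k. sqrt (1 + (\<sigma> / 2)\<^sup>2 / k\<^sup>2)) \<longlongrightarrow> 1) at_top" by real_asymp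
  moreover have "eventually (\<lambda>k. Re (kap k) / k \<le> sqrt (1 + (\<sigma> / 2)\<^sup>2 / k\<^sup>2)) at_top"
    using eventually_gt_at_top[of 0]
  proof eventually_elim
    case (elim k)
    have "(Re (kap k) / k)\<^sup>2 \<le> 1 + (\<sigma> / 2)\<^sup>2 / k\<^sup>2"
      using divide_right_mono[OF wave_number_facts(5)[OF elim], of "k\<^sup>2"] elim by (simp add: power_divide add_divide_distrib)
    then show ?case by (rule real_le_rsqrt)
  qed
  moreover have "eventually (\<lambda>k. 1 \<le> Re (kap k) / k) at_top"
    using eventually_gt_at_top[of 0] by eventually_elim (use wave_number_facts(3) in \<open>simp add: field_simps\<close>)
  ultimately show l: "((\<lambda>k. Re (kap k) / k) \<longlongrightarrow> 1) at_top"
    by (intro tendsto_sandwich[OF _ _ tendsto_const, of 1 "\<lambda>k. Re (kap k) / k"]) auto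
  have "((\<lambda>k. \<sigma> / 2 * inverse (Re (kap k) / k)) \<longlongrightarrow> \<sigma> / 2 * inverse 1) at_top"
    by (intro tendsto_intros l) simp
  moreover have "eventually (\<lambda>k. \<sigma> / 2 * inverse (Re (kap k) / k) = Im (kap k)) at_top"
    using eventually_gt_at_top[of 0] by eventually_elim (simp add: wave_number_facts(4))
  ultimately show "((\<lambda>k. Im (kap k)) \<longlongrightarrow> \<sigma> / 2) at_top"
    using Lim_transform_eventually by fastforce
  show "filterlim (\<lambda>k. Re (kap k)) at_top at_top"
    by (rule filterlim_at_top_mono[OF filterlim_ident])
       (use eventually_gt_at_top[of 0] in \<open>eventually_elim, use wave_number_facts(3) in auto\<close>)
qed

definition Psi :: "real \<Rightarrow> plane \<Rightarrow> complex" where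
  "Psi k y = cnj (fundamental_solution (kap k) x y)"

lemma norm_Psi_sq_le:
  assumes k: "k > 0" and y: "y \<noteq> x"
  shows "k * (norm (Psi k y))\<^sup>2 \<le> 1 / (8 * pi * norm (x - y))"
proof -
  note w = wave_number_facts[OF k]
  define r where "r = norm (x - y)"
  have r: "r > 0" using y by (simp add: r_def)
  have "(norm (hankel1_0 (kap k * of_real r)))\<^sup>2 \<le> 2 / (pi * Re (kap k * of_real r))"
    using w(1,2) r by (intro hankel_norm_sq_le) auto
  also have "\<dots> \<le> 2 / (pi * (k * r))"
    using w r k by (intro divide_left_mono mult_left_mono) (auto intro!: mult_right_mono)
  finally have "k * ((norm (hankel1_0 (kap k * of_real r)))\<^sup>2 / 16) \<le> k * (2 / (pi * (k * r)) / 16)"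
    using k by (intro mult_left_mono divide_right_mono) auto
  also have "\<dots> = 1 / (8 * pi * r)" using k r by (simp add: field_simps)
  finally show ?thesis
    by (simp add: Psi_def fundamental_solution_def norm_mult norm_divide power_divide power_mult_distrib r_def)
qed

lemma norm_Psi_sq_tendsto:
  assumes y: "y \<noteq> x"
  shows "((\<lambda>k. k * (norm (Psi k y))\<^sup>2) \<longlongrightarrow> exp (- \<sigma> * norm (x - y)) / (8 * pi * norm (x - y))) at_top"
proof -
  define r where "r = norm (x - y)"
  have r: "r > 0" using y by (simp add: r_def)
  have 1: "filterlim (\<lambda>k. Re (kap k * of_real r)) at_top at_top"
    using filterlim_at_top_mult_tendsto_pos[OF tendsto_const r wave_number_limits(3)] by simp
  have 2: "((\<lambda>k. Im (kap k * of_real r)) \<longlongrightarrow> \<sigma> / 2 * r) at_top"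
    using tendsto_mult[OF wave_number_limits(2) tendsto_const, of r] by simp
  have "((\<lambda>k. (inverse (Re (kap k) / k) / (16 * r)) * (Re (kap k * of_real r) * (norm (hankel1_0 (kap k * of_real r)))\<^sup>2))
      \<longlongrightarrow> (inverse 1 / (16 * r)) * (2 / pi * exp (- 2 * (\<sigma> / 2 * r)))) at_top"
    using r by (intro tendsto_mult tendsto_divide tendsto_inverse tendsto_const wave_number_limits(1) hankel_norm_sq_asymptotic[OF 1 2]) auto
  moreover have "(inverse 1 / (16 * r)) * (2 / pi * exp (- 2 * (\<sigma> / 2 * r))) = exp (- \<sigma> * r) / (8 * pi * r)"
    using r by (simp add: field_simps)
  moreover have "eventually (\<lambda>k. (inverse (Re (kap k) / k) / (16 * r)) * (Re (kap k * of_real r) * (norm (hankel1_0 (kap k * of_real r)))\<^sup>2) = k * (norm (Psi k y))\<^sup>2) at_top"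
    using eventually_gt_at_top[of 0]
  proof eventually_elim
    case (elim k)
    have "(norm (Psi k y))\<^sup>2 = (norm (hankel1_0 (kap k * of_real r)))\<^sup>2 / 16"
      by (simp add: Psi_def fundamental_solution_def norm_mult norm_divide power_divide power_mult_distrib r_def)
    then show ?case using elim r wave_number_facts(1)[OF elim] by (simp add: field_simps)
  qed
  ultimately show ?thesis unfolding r_def by (simp only: Lim_transform_eventually)
qed

lemma smooth_Psi:
  assumes "k > 0" shows "smooth_fun_on (- {x}) (Psi k)"
  unfolding Psi_def[abs_def]
  by (rule smooth_fun_on_bounded_linear[OF _ smooth_fundamental_solution bounded_linear_cnj])
     (use wave_number_facts[OF assms] in auto)

lemma helmholtz_Psi:
  assumes k: "k > 0" and y: "y \<noteq> x"
  shows "(\<Sum>b\<in>Basis. dir_derivs [b, b] (Psi k) y) = - cnj ((kap k)\<^sup>2) * Psi k y"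
proof -
  have "(\<Sum>b\<in>Basis. dir_derivs [b, b] (Psi k) y) = (\<Sum>b\<in>Basis. cnj (dir_derivs [b, b] (fundamental_solution (kap k) x) y))"
    unfolding Psi_def[abs_def]
    by (intro sum.cong refl dir_derivs_bounded_linear[OF _ smooth_fundamental_solution[of _ x] bounded_linear_cnj])
       (use y wave_number_facts[OF k] in auto)
  also have "\<dots> = cnj (\<Sum>b\<in>Basis. dir_derivs [b, b] (fundamental_solution (kap k) x) y)" by (simp only: cnj_sum)
  also have "\<dots> = - cnj ((kap k)\<^sup>2) * Psi k y"
    unfolding helmholtz_fundamental_solution[OF wave_number_facts(1)[OF k] y] by (simp add: Psi_def)
  finally show ?thesis .
qed

abbreviation "ring k \<xi> \<equiv> 1 + \<bar>norm (\<xi>::plane) - k\<bar>"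
abbreviation "F k \<equiv> cut_fourier (Psi k)"

lemma ring_ge_1: "ring k \<xi> \<ge> 1" and ring_pos: "ring k \<xi> > 0" by auto

lemma cut_Psi_test: "k > 0 \<Longrightarrow> \<eta> \<in> test_functions (- {x}) \<Longrightarrow> (\<lambda>y. complex_of_real (\<eta> y) * Psi k y) \<in> test_functions (- {x})"
  by (rule cut_test_function[OF smooth_Psi])

text \<open>The support of \<eta> keeps a positive distance from x, so the singular bound 1 / (8 pi
  |x - y|) becomes a constant independent of k.\<close>

lemma cut_Psi_bound:
  assumes \<eta>: "\<eta> \<in> test_functions (- {x})"
  shows "\<exists>C\<ge>0. \<forall>k>0. \<forall>y. k * (norm (complex_of_real (\<eta> y) * Psi k y))\<^sup>2 \<le> C * (\<eta> y)\<^sup>2"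
proof -
  have "x \<notin> fun_supp \<eta>" using \<eta> by (auto simp: test_functions_def)
  then obtain \<delta> where \<delta>: "\<delta> > 0" "\<And>y. y \<in> fun_supp \<eta> \<Longrightarrow> \<delta> \<le> dist x y"
    using separate_point_closed[OF fun_supp_closed[of \<eta>], of x] by blast
  have "k * (norm (complex_of_real (\<eta> y) * Psi k y))\<^sup>2 \<le> 1 / (8 * pi * \<delta>) * (\<eta> y)\<^sup>2" if k: "k > 0" for k y
  proof (cases "y \<in> fun_supp \<eta>")
    case True
    have yx: "y \<noteq> x" using True \<open>x \<notin> fun_supp \<eta>\<close> by auto
    have "k * (norm (Psi k y))\<^sup>2 \<le> 1 / (8 * pi * norm (x - y))" by (rule norm_Psi_sq_le[OF k yx])
    also have "\<dots> \<le> 1 / (8 * pi * \<delta>)" using \<delta> True yx by (intro divide_left_mono) (auto simp: dist_norm)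
    finally have "k * (norm (Psi k y))\<^sup>2 * (\<eta> y)\<^sup>2 \<le> 1 / (8 * pi * \<delta>) * (\<eta> y)\<^sup>2" by (intro mult_right_mono) auto
    then show ?thesis by (simp add: norm_mult power_mult_distrib mult_ac)
  qed (simp add: fun_supp_zero)
  moreover have "1 / (8 * pi * \<delta>) \<ge> 0" using \<delta>(1) by simp
  ultimately show ?thesis by blast
qed

lemma test_sq_integrable:
  assumes "\<eta> \<in> test_functions S" shows "integrable lborel (\<lambda>y. (\<eta> y :: real)\<^sup>2)"
proof -
  have "(\<lambda>y. \<eta> y * \<eta> y) \<in> test_functions S"
    using assms by (intro test_functions_mult[where W=UNIV]) (auto simp: test_functions_def)
  from test_functions_integrable[OF this] show ?thesis by (simp add: power2_eq_square)
qed

lemma cut_Psi_L1: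
  assumes \<eta>: "\<eta> \<in> test_functions (- {x})"
  shows "\<exists>C\<ge>0. \<forall>k>0. (\<integral>y. norm (complex_of_real (\<eta> y) * Psi k y) \<partial>lborel) \<le> C / sqrt k"
proof -
  obtain C where C: "C \<ge> 0" "\<And>k y. k > 0 \<Longrightarrow> k * (norm (complex_of_real (\<eta> y) * Psi k y))\<^sup>2 \<le> C * (\<eta> y)\<^sup>2"
    using cut_Psi_bound[OF \<eta>] by blast
  have i: "integrable lborel (\<lambda>y. \<bar>\<eta> y\<bar>)" using test_functions_integrable[OF \<eta>] by simp
  have "(\<integral>y. norm (complex_of_real (\<eta> y) * Psi k y) \<partial>lborel) \<le> (sqrt C * (\<integral>y. \<bar>\<eta> y\<bar> \<partial>lborel)) / sqrt k" if k: "k > 0" for k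
  proof -
    have "(\<integral>y. norm (complex_of_real (\<eta> y) * Psi k y) \<partial>lborel) \<le> (\<integral>y. sqrt C / sqrt k * \<bar>\<eta> y\<bar> \<partial>lborel)"
    proof (rule integral_mono)
      show "integrable lborel (\<lambda>y. norm (complex_of_real (\<eta> y) * Psi k y))"
        using test_functions_integrable[OF cut_Psi_test[OF k \<eta>]] by simp
      show "integrable lborel (\<lambda>y. sqrt C / sqrt k * \<bar>\<eta> y\<bar>)" using i by simp
      fix y
      have "(norm (complex_of_real (\<eta> y) * Psi k y))\<^sup>2 \<le> (sqrt C / sqrt k * \<bar>\<eta> y\<bar>)\<^sup>2"
        using C(2)[OF k, of y] k C(1) by (simp add: power_mult_distrib power_divide field_simps)
      then show "norm (complex_of_real (\<eta> y) * Psi k y) \<le> sqrt C / sqrt k * \<bar>\<eta> y\<bar>"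
        by (rule power2_le_imp_le) (use C k in auto)
    qed
    then show ?thesis by simp
  qed
  moreover have "sqrt C * (\<integral>y. \<bar>\<eta> y\<bar> \<partial>lborel) \<ge> 0" using C by (intro mult_nonneg_nonneg integral_nonneg_AE) auto
  ultimately show ?thesis by blast
qed

text \<open>The weights are traded for other cutoffs, whose transforms are bounded by L1 norms. This
  secures the integrability of all weighted transforms; their size is measured in L2 below.\<close>

lemma cut_fourier_pointwise:
  assumes \<eta>: "\<eta> \<in> test_functions (- {x})"
  shows "\<exists>C\<ge>0. \<forall>k\<ge>1. \<forall>\<xi>. ring k \<xi> ^ n * norm (F k \<eta> \<xi>) \<le> C"
proof -
  have base: "\<exists>C\<ge>0. \<forall>k\<ge>1. \<forall>\<xi>. norm (F k \<zeta> \<xi>) \<le> C" if \<zeta>: "\<zeta> \<in> test_functions (- {x})" for \<zeta>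
  proof -
    obtain C where C: "C \<ge> 0" "\<And>k. k > 0 \<Longrightarrow> (\<integral>y. norm (complex_of_real (\<zeta> y) * Psi k y) \<partial>lborel) \<le> C / sqrt k"
      using cut_Psi_L1[OF \<zeta>] by blast
    have "norm (F k \<zeta> \<xi>) \<le> C" if k: "k \<ge> 1" for k \<xi>
    proof -
      have "norm (F k \<zeta> \<xi>) \<le> (\<integral>y. norm (complex_of_real (\<zeta> y) * Psi k y) \<partial>lborel)"
        unfolding cut_fourier_def by (rule fourier_norm_le)
      also have "\<dots> \<le> C / sqrt k" using k by (intro C) simp
      also have "\<dots> \<le> C / 1" using k C by (intro divide_left_mono) auto
      finally show ?thesis by simp
    qed
    then show ?thesis using C(1) by blast
  qed
  obtain \<zeta>s where zs: "set \<zeta>s \<subseteq> test_functions (- {x})"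
    and le: "\<And>\<Psi> \<Lambda> k \<xi>. smooth_fun_on (- {x}) \<Psi> \<Longrightarrow> (\<forall>y. y \<noteq> x \<longrightarrow> (\<Sum>b\<in>Basis. dir_derivs [b, b] \<Psi> y) = - \<Lambda> * \<Psi> y) \<Longrightarrow>
       k \<ge> 1 \<Longrightarrow> Re \<Lambda> = k\<^sup>2 \<Longrightarrow> ring k \<xi> ^ n * norm (cut_fourier \<Psi> \<eta> \<xi>) \<le> (\<Sum>\<zeta>\<leftarrow>\<zeta>s. norm (cut_fourier \<Psi> \<zeta> \<xi>))"
    using ring_weight_power[OF \<eta>, of n] by blast
  obtain B where B: "\<And>\<zeta>. \<zeta> \<in> set \<zeta>s \<Longrightarrow> B \<zeta> \<ge> 0 \<and> (\<forall>k\<ge>1. \<forall>\<xi>. norm (F k \<zeta> \<xi>) \<le> B \<zeta>)"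
    using base zs by (metis subsetD)
  have "ring k \<xi> ^ n * norm (F k \<eta> \<xi>) \<le> (\<Sum>\<zeta>\<leftarrow>\<zeta>s. B \<zeta>)" if k: "k \<ge> 1" for k \<xi>
  proof -
    have k0: "k > 0" using k by simp
    have Re_cnj: "Re (cnj ((kap k)\<^sup>2)) = k\<^sup>2" using wave_number_facts(6)[OF k0] by (simp only: cnj.sel)
    have "ring k \<xi> ^ n * norm (F k \<eta> \<xi>) \<le> (\<Sum>\<zeta>\<leftarrow>\<zeta>s. norm (F k \<zeta> \<xi>))"
      by (rule le[OF smooth_Psi[OF k0] _ k Re_cnj]) (use helmholtz_Psi[OF k0] in blast)
    also have "\<dots> \<le> (\<Sum>\<zeta>\<leftarrow>\<zeta>s. B \<zeta>)" using B k by (intro sum_list_mono) auto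
    finally show ?thesis .
  qed
  moreover have "(\<Sum>\<zeta>\<leftarrow>\<zeta>s. B \<zeta>) \<ge> 0" using B by (intro sum_list_nonneg) auto
  ultimately show ?thesis by blast
qed

lemma cut_fourier_borel [measurable]: "k > 0 \<Longrightarrow> \<eta> \<in> test_functions (- {x}) \<Longrightarrow> F k \<eta> \<in> borel_measurable borel"
  unfolding cut_fourier_def by (intro fourier_measurable test_functions_borel[OF cut_Psi_test])

lemma ring_F_integrable:
  assumes \<eta>: "\<eta> \<in> test_functions (- {x})" and k: "k \<ge> 1"
  shows "integrable lborel (\<lambda>\<xi>. ring k \<xi> ^ n * norm (F k \<eta> \<xi>))"
proof -
  \<comment> \<open>Four additional weights pay for integrability over the plane.\<close>
  obtain C where C: "C \<ge> 0" "\<And>k \<xi>. k \<ge> 1 \<Longrightarrow> ring k \<xi> ^ (n + 4) * norm (F k \<eta> \<xi>) \<le> C"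
    using cut_fourier_pointwise[OF \<eta>, of "n + 4"] by blast
  have k0: "k > 0" using k by simp
  have "integrable lborel (\<lambda>\<xi>::plane. C * (1 / ring k \<xi> ^ 4))"
    using k by (intro integrable_mult_right integrable_ring_weight) auto
  then show ?thesis
  proof (rule Bochner_Integration.integrable_bound)
    show "AE \<xi> in lborel. norm (ring k \<xi> ^ n * norm (F k \<eta> \<xi>)) \<le> norm (C * (1 / ring k \<xi> ^ 4))"
    proof (rule AE_I2)
      fix \<xi> :: plane
      have "ring k \<xi> ^ 4 > 0" by (rule zero_less_power[OF ring_pos])
      then have "ring k \<xi> ^ n * norm (F k \<eta> \<xi>) \<le> C * (1 / ring k \<xi> ^ 4)"
        using C(2)[OF k, of \<xi>] by (simp add: field_simps power_add)
      moreover have "ring k \<xi> ^ n * norm (F k \<eta> \<xi>) \<ge> 0" by (intro mult_nonneg_nonneg zero_le_power) auto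
      ultimately show "norm (ring k \<xi> ^ n * norm (F k \<eta> \<xi>)) \<le> norm (C * (1 / ring k \<xi> ^ 4))" using C(1) by simp
    qed
  qed (use cut_fourier_borel[OF k0 \<eta>] in measurable)
qed

lemma ring_F_sq_integrable:
  assumes \<eta>: "\<eta> \<in> test_functions (- {x})" and k: "k \<ge> 1"
  shows "integrable lborel (\<lambda>\<xi>. (ring k \<xi> ^ n * norm (F k \<eta> \<xi>))\<^sup>2)"
proof -
  obtain C where C: "C \<ge> 0" "\<And>k \<xi>. k \<ge> 1 \<Longrightarrow> ring k \<xi> ^ n * norm (F k \<eta> \<xi>) \<le> C"
    using cut_fourier_pointwise[OF \<eta>, of n] by blast
  have k0: "k > 0" using k by simp
  have "integrable lborel (\<lambda>\<xi>. C * (ring k \<xi> ^ n * norm (F k \<eta> \<xi>)))"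
    by (intro integrable_mult_right ring_F_integrable \<eta> k)
  then show ?thesis
  proof (rule Bochner_Integration.integrable_bound)
    show "AE \<xi> in lborel. norm ((ring k \<xi> ^ n * norm (F k \<eta> \<xi>))\<^sup>2) \<le> norm (C * (ring k \<xi> ^ n * norm (F k \<eta> \<xi>)))"
    proof (rule AE_I2)
      fix \<xi> :: plane
      have p: "ring k \<xi> ^ n * norm (F k \<eta> \<xi>) \<ge> 0" by (intro mult_nonneg_nonneg zero_le_power) auto
      have "(ring k \<xi> ^ n * norm (F k \<eta> \<xi>)) * (ring k \<xi> ^ n * norm (F k \<eta> \<xi>)) \<le> C * (ring k \<xi> ^ n * norm (F k \<eta> \<xi>))"
        by (intro mult_right_mono C k p)
      moreover have "norm (q\<^sup>2) \<le> norm (C * q)" if "q \<ge> 0" "q * q \<le> C * q" for q :: real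
        using that C(1) by (simp add: power2_eq_square)
      ultimately show "norm ((ring k \<xi> ^ n * norm (F k \<eta> \<xi>))\<^sup>2) \<le> norm (C * (ring k \<xi> ^ n * norm (F k \<eta> \<xi>)))"
        using p by blast
    qed
  qed (use cut_fourier_borel[OF k0 \<eta>] in measurable)
qed

text \<open>Provides the hypothesis under which \<open>fourier_inversion\<close> and
  \<open>parseval\<close> apply to the cut solution.\<close>

lemma fourier_cut_integrable:
  assumes \<eta>: "\<eta> \<in> test_functions (- {x})" and k: "k \<ge> 1"
  shows "integrable lborel (F k \<eta>)"
  by (rule Bochner_Integration.integrable_bound[OF ring_F_integrable[OF \<eta> k, of 0]])
     (use cut_fourier_borel[of k \<eta>] \<eta> k in auto)

lemma cut_fourier_L2:
  assumes \<eta>: "\<eta> \<in> test_functions (- {x})"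
  shows "\<exists>C\<ge>0. \<forall>k\<ge>1. (\<integral>\<xi>. (norm (F k \<eta> \<xi>))\<^sup>2 \<partial>lborel) \<le> C / k"
proof -
  obtain C where C: "C \<ge> 0" "\<And>k y. k > 0 \<Longrightarrow> k * (norm (complex_of_real (\<eta> y) * Psi k y))\<^sup>2 \<le> C * (\<eta> y)\<^sup>2"
    using cut_Psi_bound[OF \<eta>] by blast
  have "(\<integral>\<xi>. (norm (F k \<eta> \<xi>))\<^sup>2 \<partial>lborel) \<le> ((2 * pi)\<^sup>2 * (C * (\<integral>y. (\<eta> y)\<^sup>2 \<partial>lborel))) / k" if k: "k \<ge> 1" for k
  proof -
    have k0: "k > 0" using k by simp
    let ?g = "\<lambda>y. complex_of_real (\<eta> y) * Psi k y"
    have gt: "?g \<in> test_functions (- {x})" by (rule cut_Psi_test[OF k0 \<eta>])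
    have "complex_of_real (\<integral>\<xi>. (norm (F k \<eta> \<xi>))\<^sup>2 \<partial>lborel) = (\<integral>\<xi>. F k \<eta> \<xi> * cnj (F k \<eta> \<xi>) \<partial>lborel)"
      unfolding complex_norm_square[symmetric] by (rule integral_complex_of_real[symmetric])
    also have "\<dots> = of_real ((2 * pi)\<^sup>2) * (\<integral>y. ?g y * cnj (?g y) \<partial>lborel)"
      unfolding cut_fourier_def
      by (rule parseval[OF gt fourier_cut_integrable[OF \<eta> k, unfolded cut_fourier_def] test_functions_integrable[OF gt]])
    also have "(\<integral>y. ?g y * cnj (?g y) \<partial>lborel) = complex_of_real (\<integral>y. (norm (?g y))\<^sup>2 \<partial>lborel)"
      unfolding complex_norm_square[symmetric] by (rule integral_complex_of_real)
    finally have "(\<integral>\<xi>. (norm (F k \<eta> \<xi>))\<^sup>2 \<partial>lborel) = (2 * pi)\<^sup>2 * (\<integral>y. (norm (?g y))\<^sup>2 \<partial>lborel)"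
      by (simp only: of_real_mult[symmetric] of_real_eq_iff)
    also have "\<dots> \<le> (2 * pi)\<^sup>2 * (\<integral>y. C / k * (\<eta> y)\<^sup>2 \<partial>lborel)"
    proof (intro mult_left_mono integral_mono')
      show "integrable lborel (\<lambda>y. C / k * (\<eta> y)\<^sup>2)" by (intro integrable_mult_right test_sq_integrable[OF \<eta>])
      show "(norm (?g y))\<^sup>2 \<le> C / k * (\<eta> y)\<^sup>2" for y using C(2)[OF k0, of y] k0 by (simp add: field_simps)
      show "0 \<le> C / k * (\<eta> y)\<^sup>2" for y using C k0 by simp
    qed auto
    finally show ?thesis by simp
  qed
  moreover have "(2 * pi)\<^sup>2 * (C * (\<integral>y. (\<eta> y)\<^sup>2 \<partial>lborel)) \<ge> 0" using C by (intro mult_nonneg_nonneg integral_nonneg_AE) auto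
  ultimately show ?thesis by blast
qed

text \<open>Pointwise the weighted transform is at most a sum of m unweighted ones; its square is at
  most m times the sum of their squares, and Parseval bounds each of them by a multiple of 1 /
  k.\<close>

lemma ring_fourier_L2:
  assumes \<eta>: "\<eta> \<in> test_functions (- {x})"
  shows "\<exists>C\<ge>0. \<forall>k\<ge>1. (\<integral>\<xi>. (ring k \<xi> ^ n * norm (F k \<eta> \<xi>))\<^sup>2 \<partial>lborel) \<le> C / k"
proof -
  obtain \<zeta>s where zs: "set \<zeta>s \<subseteq> test_functions (- {x})"
    and le: "\<And>\<Psi> \<Lambda> k \<xi>. smooth_fun_on (- {x}) \<Psi> \<Longrightarrow> (\<forall>y. y \<noteq> x \<longrightarrow> (\<Sum>b\<in>Basis. dir_derivs [b, b] \<Psi> y) = - \<Lambda> * \<Psi> y) \<Longrightarrow>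
       k \<ge> 1 \<Longrightarrow> Re \<Lambda> = k\<^sup>2 \<Longrightarrow> ring k \<xi> ^ n * norm (cut_fourier \<Psi> \<eta> \<xi>) \<le> (\<Sum>\<zeta>\<leftarrow>\<zeta>s. norm (cut_fourier \<Psi> \<zeta> \<xi>))"
    using ring_weight_power[OF \<eta>, of n] by blast
  \<comment> \<open>Summation is over positions in the list, since a cutoff may occur several
    times.\<close>
  define m where "m = length \<zeta>s"
  have zt: "\<zeta>s ! i \<in> test_functions (- {x})" if "i < m" for i using that zs by (auto simp: m_def)
  obtain B where B: "\<And>\<zeta>. \<zeta> \<in> test_functions (- {x}) \<Longrightarrow> B \<zeta> \<ge> 0 \<and> (\<forall>k\<ge>1. (\<integral>\<xi>. (norm (F k \<zeta> \<xi>))\<^sup>2 \<partial>lborel) \<le> B \<zeta> / k)"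
    using cut_fourier_L2 by metis
  have sqi: "integrable lborel (\<lambda>\<xi>. (norm (F k \<zeta> \<xi>))\<^sup>2)" if "\<zeta> \<in> test_functions (- {x})" "k \<ge> 1" for \<zeta> k
    using ring_F_sq_integrable[OF that, of 0] by simp
  have "(\<integral>\<xi>. (ring k \<xi> ^ n * norm (F k \<eta> \<xi>))\<^sup>2 \<partial>lborel) \<le> (real m * (\<Sum>i<m. B (\<zeta>s ! i))) / k" if k: "k \<ge> 1" for k
  proof -
    have k0: "k > 0" using k by simp
    have Re_cnj: "Re (cnj ((kap k)\<^sup>2)) = k\<^sup>2" using wave_number_facts(6)[OF k0] by (simp only: cnj.sel)
    have "(\<integral>\<xi>. (ring k \<xi> ^ n * norm (F k \<eta> \<xi>))\<^sup>2 \<partial>lborel) \<le> (\<integral>\<xi>. (\<Sum>i<m. (norm (F k (\<zeta>s ! i) \<xi>))\<^sup>2) * real m \<partial>lborel)"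
    proof (rule integral_mono)
      show "integrable lborel (\<lambda>\<xi>. (ring k \<xi> ^ n * norm (F k \<eta> \<xi>))\<^sup>2)" by (rule ring_F_sq_integrable[OF \<eta> k])
      show "integrable lborel (\<lambda>\<xi>. (\<Sum>i<m. (norm (F k (\<zeta>s ! i) \<xi>))\<^sup>2) * real m)"
        by (intro integrable_mult_left Bochner_Integration.integrable_sum sqi zt k) auto
      fix \<xi> :: plane
      have "ring k \<xi> ^ n * norm (F k \<eta> \<xi>) \<le> (\<Sum>\<zeta>\<leftarrow>\<zeta>s. norm (F k \<zeta> \<xi>))"
        by (rule le[OF smooth_Psi[OF k0] _ k Re_cnj]) (use helmholtz_Psi[OF k0] in blast)
      also have "\<dots> = (\<Sum>i<m. norm (F k (\<zeta>s ! i) \<xi>))"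
        unfolding m_def by (simp add: sum_list_sum_nth atLeast0LessThan)
      finally have "(ring k \<xi> ^ n * norm (F k \<eta> \<xi>))\<^sup>2 \<le> (\<Sum>i<m. norm (F k (\<zeta>s ! i) \<xi>))\<^sup>2"
        by (intro power_mono mult_nonneg_nonneg zero_le_power) auto
      also have "\<dots> \<le> (\<Sum>i<m. (norm (F k (\<zeta>s ! i) \<xi>))\<^sup>2) * real m"
        using sum_squared_le_sum_of_squares[of "\<lambda>i. norm (F k (\<zeta>s ! i) \<xi>)" "{..<m}"] by simp
      finally show "(ring k \<xi> ^ n * norm (F k \<eta> \<xi>))\<^sup>2 \<le> (\<Sum>i<m. (norm (F k (\<zeta>s ! i) \<xi>))\<^sup>2) * real m" .
    qed
    also have "\<dots> = (\<Sum>i<m. \<integral>\<xi>. (norm (F k (\<zeta>s ! i) \<xi>))\<^sup>2 \<partial>lborel) * real m"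
      by (subst integral_mult_left_zero, subst Bochner_Integration.integral_sum) (auto intro: sqi zt k)
    also have "\<dots> \<le> (\<Sum>i<m. B (\<zeta>s ! i) / k) * real m"
      using B zt k by (intro mult_right_mono sum_mono) auto
    also have "\<dots> = (real m * (\<Sum>i<m. B (\<zeta>s ! i))) / k" by (simp add: sum_divide_distrib[symmetric])
    finally show ?thesis .
  qed
  moreover have "real m * (\<Sum>i<m. B (\<zeta>s ! i)) \<ge> 0" using B zt by (intro mult_nonneg_nonneg sum_nonneg) auto
  ultimately show ?thesis by blast
qed

end

section \<open>The leading term of the covariance operator\<close>

text \<open>For |\<xi>| \<ge> k / 2 the quantity is t^(-2s) - 1 with t = |\<xi>| / k, which is O(|t
  - 1|), a single weight over k. For |\<xi>| < k / 2 it may be of order k^2, but there the weight is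
  at least k / 2, so its cube over k dominates k^2 up to a constant.\<close>

lemma excised_symbol_estimate:
  assumes \<theta>: "excision \<theta>" and s: "0 < s" "s \<le> 1"
  shows "\<exists>C\<ge>0. \<exists>K\<ge>1. \<forall>k\<ge>K. \<forall>\<xi>::plane. \<bar>k powr (2 * s) * (\<theta> \<xi> * norm \<xi> powr (- 2 * s)) - 1\<bar> \<le> C * (1 + \<bar>norm \<xi> - k\<bar>) ^ 3 / k"
proof -
  obtain r R where r: "r > 0" "\<And>\<xi>. norm \<xi> < r \<Longrightarrow> \<theta> \<xi> = 0" and R: "\<And>\<xi>. R \<le> norm \<xi> \<Longrightarrow> \<theta> \<xi> = 1"
    and sm: "smooth_fun_on UNIV \<theta>" using \<theta> unfolding excision_def by blast
  have "compact (\<theta> ` cball 0 R)"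
    by (intro compact_continuous_image continuous_on_subset[OF smooth_fun_on_continuous[OF sm]]) auto
  then obtain T0 where T0: "\<And>\<xi>. \<xi> \<in> cball 0 R \<Longrightarrow> \<bar>\<theta> \<xi>\<bar> \<le> T0"
    using compact_imp_bounded bounded_iff by (metis imageI real_norm_def)
  define T where "T = max T0 1"
  have T: "T \<ge> 1" "\<bar>\<theta> \<xi>\<bar> \<le> T" for \<xi>
    using T0[of \<xi>] R[of \<xi>] by (auto simp: T_def le_max_iff_disj) (cases "R \<le> norm \<xi>"; auto)+
  \<comment> \<open>The entry 16 serves |\<xi>| \<ge> k / 2; the other serves |\<xi>| < k / 2, its 8
    = 2^3 coming from the weight being at least k / 2.\<close>
  define C where "C = max 16 (8 * (T * r powr (- 2 * s) + 1))"
  have C0: "C \<ge> 16" "C \<ge> 8 * (T * r powr (- 2 * s) + 1)" by (auto simp: C_def)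
  show ?thesis
  \<comment> \<open>For k \<ge> 2 R every \<xi> with |\<xi>| \<ge> k / 2 lies where the excision
    equals 1.\<close>
  proof (rule exI[of _ C], rule conjI[rotated], rule exI[of _ "max 1 (2 * R)"], intro conjI allI impI)
    fix k and \<xi> :: plane assume "max 1 (2 * R) \<le> k"
    then have k: "k \<ge> 1" "2 * R \<le> k" by auto
    define m where "m = norm \<xi>"
    define w where "w = 1 + \<bar>m - k\<bar>"
    have w1: "w \<ge> 1" by (simp add: w_def)
    show "\<bar>k powr (2 * s) * (\<theta> \<xi> * norm \<xi> powr (- 2 * s)) - 1\<bar> \<le> C * (1 + \<bar>norm \<xi> - k\<bar>) ^ 3 / k"
    proof (cases "m \<ge> k / 2")
      case True
      define t where "t = m / k"
      have t: "t \<ge> 1 / 2" using True k by (simp add: t_def field_simps)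
      then have t0: "t > 0" by linarith
      have fact1: "1 - 1 / t\<^sup>2 = (t - 1) * ((t + 1) / t\<^sup>2)" using t0 by (simp add: divide_simps power2_eq_square algebra_simps)
      have th: "\<theta> \<xi> = 1" using True k by (intro R) (auto simp: m_def)
      have "k powr (2 * s) * m powr (- 2 * s) = t powr (- 2 * s)"
        using k True by (simp add: t_def powr_divide powr_minus field_simps)
      \<comment> \<open>As 0 < s \<le> 1, the power t^(-2s) lies between 1 and t^(-2), so only the
        rational function 1 / t^2 has to be estimated, uniformly in s.\<close>
      moreover have "\<bar>t powr (- 2 * s) - 1\<bar> \<le> 16 * \<bar>t - 1\<bar>"
      proof (cases "t \<ge> 1")
        case True
        have "t powr (- 2 * s) \<le> t powr 0" using True s by (intro powr_mono) auto
        moreover have "t powr (- 2) \<le> t powr (- 2 * s)" using True s by (intro powr_mono) auto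
        moreover have "t powr (- 2) = 1 / t\<^sup>2" using t0 by (simp add: powr_minus powr_numeral divide_inverse)
        moreover have "1 - 1 / t\<^sup>2 \<le> 16 * (t - 1)"
        proof -
          have "1 - 1 / t\<^sup>2 = (t - 1) * ((t + 1) / t\<^sup>2)" by (rule fact1)
          also have "\<dots> \<le> (t - 1) * 16"
          proof (rule mult_left_mono)
            have "t + 1 \<le> 2 * t" using True by simp
            also have "\<dots> \<le> 16 * t\<^sup>2" using True by (simp add: power2_eq_square)
            finally show "(t + 1) / t\<^sup>2 \<le> 16" using t0 by (simp add: divide_le_eq)
          qed (use True in auto)
          finally show ?thesis by simp
        qed
        ultimately show ?thesis using True by simp
      next
        case False
        have "t powr 0 \<le> t powr (- 2 * s)" using False s t by (intro powr_mono') auto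
        moreover have "t powr (- 2 * s) \<le> t powr (- 2)" using False s t by (intro powr_mono') auto
        moreover have "t powr (- 2) = 1 / t\<^sup>2" using t0 by (simp add: powr_minus powr_numeral divide_inverse)
        moreover have "1 / t\<^sup>2 - 1 \<le> 16 * (1 - t)"
        proof -
          have "1 / t\<^sup>2 - 1 = (1 - t) * ((1 + t) / t\<^sup>2)" using t0 by (simp add: divide_simps power2_eq_square algebra_simps)
          also have "\<dots> \<le> (1 - t) * 16"
          proof (rule mult_left_mono)
            have "(1 / 2)\<^sup>2 \<le> t\<^sup>2" using t by (intro power_mono) auto
            then have "1 + t \<le> 16 * t\<^sup>2" using False by (simp add: power_divide)
            then show "(1 + t) / t\<^sup>2 \<le> 16" using t0 by (simp add: divide_le_eq)
          qed (use False in auto)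
          finally show ?thesis by simp
        qed
        ultimately show ?thesis using False t by simp
      qed
      moreover have "16 * \<bar>t - 1\<bar> \<le> C * w ^ 3 / k"
      proof -
        have "t - 1 = (m - k) / k" using k by (simp add: t_def diff_divide_distrib)
        then have "\<bar>t - 1\<bar> = \<bar>m - k\<bar> / k" using k by (simp add: abs_divide)
        also have "\<dots> \<le> w ^ 3 / k"
        proof (intro divide_right_mono)
          have "\<bar>m - k\<bar> \<le> w ^ 1" by (simp add: w_def)
          also have "\<dots> \<le> w ^ 3" using w1 by (intro power_increasing) auto
          finally show "\<bar>m - k\<bar> \<le> w ^ 3" .
        qed (use k in auto)
        finally have "16 * \<bar>t - 1\<bar> \<le> C * (w ^ 3 / k)" using C0 w1 k by (intro mult_mono) auto
        then show ?thesis by simp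
      qed
      ultimately show ?thesis using th by (simp add: m_def[symmetric] w_def[symmetric])
    next
      case False
      \<comment> \<open>The excision vanishes for |\<xi>| < r and so removes the singularity of the
        leading term at 0.\<close>
      have b: "\<bar>\<theta> \<xi> * m powr (- 2 * s)\<bar> \<le> T * r powr (- 2 * s)"
      proof (cases "m < r")
        case True
        then show ?thesis using r(2)[of \<xi>] T(1) by (simp add: m_def)
      next
        case False
        then have "m powr (- 2 * s) \<le> r powr (- 2 * s)" using r s by (intro powr_mono2') auto
        then show ?thesis using T by (simp add: abs_mult mult_mono)
      qed
      have "k powr (2 * s) \<le> k powr 2" using k s by (intro powr_mono) auto
      then have k2: "k powr (2 * s) \<le> k\<^sup>2" using k by (simp add: powr_numeral)
      have "\<bar>k powr (2 * s) * (\<theta> \<xi> * m powr (- 2 * s)) - 1\<bar> \<le> \<bar>k powr (2 * s) * (\<theta> \<xi> * m powr (- 2 * s))\<bar> + 1" by linarith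
      also have "\<dots> \<le> k\<^sup>2 * (T * r powr (- 2 * s)) + k\<^sup>2 * 1"
      proof (rule add_mono)
        show "\<bar>k powr (2 * s) * (\<theta> \<xi> * m powr (- 2 * s))\<bar> \<le> k\<^sup>2 * (T * r powr (- 2 * s))"
          unfolding abs_mult[of "k powr (2 * s)"] using k2 b by (intro mult_mono) auto
        show "1 \<le> k\<^sup>2 * 1" using k by simp
      qed
      also have "\<dots> = (T * r powr (- 2 * s) + 1) * k\<^sup>2" by (simp add: algebra_simps)
      also have "\<dots> \<le> (T * r powr (- 2 * s) + 1) * (8 * (w ^ 3 / k))"
      proof (rule mult_left_mono)
        have "k / 2 \<le> w" using False k by (simp add: w_def)
        then have "(k / 2) ^ 3 \<le> w ^ 3" using k by (intro power_mono) auto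
        then have "k ^ 3 \<le> 8 * w ^ 3" by (simp add: power_divide)
        then show "k\<^sup>2 \<le> 8 * (w ^ 3 / k)" using k by (simp add: field_simps power3_eq_cube power2_eq_square)
        show "0 \<le> T * r powr (- 2 * s) + 1" using T by simp
      qed
      also have "\<dots> = 8 * (T * r powr (- 2 * s) + 1) * (w ^ 3 / k)" by simp
      also have "\<dots> \<le> C * (w ^ 3 / k)" using C0 w1 k by (intro mult_right_mono) auto
      finally show ?thesis by (simp add: m_def w_def)
    qed
  qed (use C0 in auto)
qed

lemma symbol_class_bound:
  assumes "c \<in> symbol_class m" "compact K"
  shows "\<exists>C. \<forall>y\<in>K. \<forall>\<xi>. norm (c (y, \<xi>)) \<le> C * (1 + norm \<xi>) powr m"
proof -
  have "\<exists>C. \<forall>y\<in>K. \<forall>\<xi>. norm (dir_derivs (map (\<lambda>b. (0, b)) [] @ map (\<lambda>b. (b, 0)) []) c (y, \<xi>))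
      \<le> C * (1 + norm \<xi>) powr (m - real (length ([] :: plane list)))"
    using conjunct2[OF assms(1)[unfolded symbol_class_def mem_Collect_eq], rule_format, of "[]" "[]" K] assms(2) by simp
  then show ?thesis by simp
qed

context helmholtz_point
begin

text \<open>Cauchy-Schwarz for ring^3 |F| = ring^(-2) (ring^5 |F|): the first factor has L2 norm
  o(k), the second O(k^(-1/2)). It is carried out as an inequality between arithmetic and geometric
  means with a free parameter t.\<close>

lemma weighted_L1_asymptotic:
  assumes \<eta>: "\<eta> \<in> test_functions (- {x})"
  shows "((\<lambda>k. (\<integral>\<xi>. ring k \<xi> ^ 3 * norm (F k \<eta> \<xi>) \<partial>lborel) / sqrt k) \<longlongrightarrow> 0) at_top"
proof -
  obtain C where C: "C \<ge> 0" "\<And>k. k \<ge> 1 \<Longrightarrow> (\<integral>\<xi>. (ring k \<xi> ^ 5 * norm (F k \<eta> \<xi>))\<^sup>2 \<partial>lborel) \<le> C / k"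
    using ring_fourier_L2[OF \<eta>, of 5] by blast
  define A where "A k = (\<integral>\<xi>. 1 / ring k \<xi> ^ 4 \<partial>lborel)" for k
  define \<rho> where "\<rho> k = A k / k\<^sup>2" for k
  have A0: "A k \<ge> 0" for k unfolding A_def by (intro integral_nonneg_AE) auto
  have \<rho>0: "\<rho> k \<ge> 0" for k using A0 by (simp add: \<rho>_def)
  have \<rho>: "(\<rho> \<longlongrightarrow> 0) at_top" unfolding \<rho>_def[abs_def] A_def by (rule ring_weight_asymptotic)
  have bound: "(\<integral>\<xi>. ring k \<xi> ^ 3 * norm (F k \<eta> \<xi>) \<partial>lborel) / sqrt k \<le> (sqrt (\<rho> k) + C * (sqrt (\<rho> k) + 1 / k)) / 2" if k: "k \<ge> 1" for k
  proof -
    \<comment> \<open>The summand 1 / k keeps e positive even where \<rho> k is 0, so that t may be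
      divided by.\<close>
    define e where "e = sqrt (\<rho> k) + 1 / k"
    have e: "e > 0" using k \<rho>0[of k] by (simp add: e_def add_nonneg_pos)
    \<comment> \<open>This t makes both terms of order sqrt k times a null sequence:
      \<open>A k\<close> is at most k^2 sqrt (\<rho> k) e, and the squared L2 norm is at most C /
      k.\<close>
    define t where "t = k * sqrt k * e"
    have t: "t > 0" using e k by (simp add: t_def)
    have i1: "integrable lborel (\<lambda>\<xi>. 1 / ring k \<xi> ^ 4)" using k by (intro integrable_ring_weight) simp
    have i2: "integrable lborel (\<lambda>\<xi>. (ring k \<xi> ^ 5 * norm (F k \<eta> \<xi>))\<^sup>2)" by (rule ring_F_sq_integrable[OF \<eta> k])
    have "(\<integral>\<xi>. ring k \<xi> ^ 3 * norm (F k \<eta> \<xi>) \<partial>lborel) \<le> (\<integral>\<xi>. 1 / (2 * t) * (1 / ring k \<xi> ^ 4) + t / 2 * (ring k \<xi> ^ 5 * norm (F k \<eta> \<xi>))\<^sup>2 \<partial>lborel)"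
    proof (rule integral_mono)
      show "integrable lborel (\<lambda>\<xi>. ring k \<xi> ^ 3 * norm (F k \<eta> \<xi>))" by (rule ring_F_integrable[OF \<eta> k])
      show "integrable lborel (\<lambda>\<xi>. 1 / (2 * t) * (1 / ring k \<xi> ^ 4) + t / 2 * (ring k \<xi> ^ 5 * norm (F k \<eta> \<xi>))\<^sup>2)"
        by (intro Bochner_Integration.integrable_add integrable_mult_right i1 i2)
      fix \<xi> :: plane
      have gen: "w ^ 3 * a \<le> 1 / (2 * t) * (1 / w ^ 4) + t / 2 * (w ^ 5 * a)\<^sup>2" if w: "w > 0" for w a :: real
      proof -
        define p where "p = 1 / w\<^sup>2"
        define q where "q = w ^ 5 * a"
        have pq: "w ^ 3 * a = p * q" using w by (simp add: p_def q_def field_simps power_eq_if)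
        have p2: "1 / w ^ 4 = p\<^sup>2" by (simp add: p_def power_divide power_mult[symmetric])
        have "0 \<le> (p - t * q)\<^sup>2" by simp
        then have "2 * t * (p * q) \<le> p\<^sup>2 + t\<^sup>2 * q\<^sup>2" by (simp add: power2_eq_square algebra_simps)
        then have "p * q \<le> (p\<^sup>2 + t\<^sup>2 * q\<^sup>2) / (2 * t)" using t by (simp add: field_simps)
        also have "\<dots> = 1 / (2 * t) * p\<^sup>2 + t / 2 * q\<^sup>2" using t by (simp add: field_simps power2_eq_square)
        finally show ?thesis unfolding pq p2 q_def .
      qed
      show "ring k \<xi> ^ 3 * norm (F k \<eta> \<xi>) \<le> 1 / (2 * t) * (1 / ring k \<xi> ^ 4) + t / 2 * (ring k \<xi> ^ 5 * norm (F k \<eta> \<xi>))\<^sup>2"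
        by (rule gen[OF ring_pos])
    qed
    also have "\<dots> = 1 / (2 * t) * A k + t / 2 * (\<integral>\<xi>. (ring k \<xi> ^ 5 * norm (F k \<eta> \<xi>))\<^sup>2 \<partial>lborel)"
      unfolding A_def
      by (subst Bochner_Integration.integral_add[OF integrable_mult_right[OF i1] integrable_mult_right[OF i2]])
         (simp only: integral_mult_right_zero)
    also have "\<dots> \<le> 1 / (2 * t) * A k + t / 2 * (C / k)"
      using C(2)[OF k] t by (intro add_left_mono mult_left_mono) auto
    also have "\<dots> \<le> sqrt k * ((sqrt (\<rho> k) + C * e) / 2)"
    proof -
      have "A k = k\<^sup>2 * \<rho> k" using k by (simp add: \<rho>_def)
      also have "\<dots> \<le> k\<^sup>2 * (sqrt (\<rho> k) * e)"
      proof (rule mult_left_mono)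
        have "\<rho> k = sqrt (\<rho> k) * sqrt (\<rho> k)" using \<rho>0 by simp
        also have "\<dots> \<le> sqrt (\<rho> k) * e" using \<rho>0 k by (intro mult_left_mono) (auto simp: e_def)
        finally show "\<rho> k \<le> sqrt (\<rho> k) * e" .
      qed simp
      finally have "1 / (2 * t) * A k \<le> 1 / (2 * t) * (k\<^sup>2 * (sqrt (\<rho> k) * e))"
        using t by (intro mult_left_mono) auto
      also have "\<dots> = sqrt k * (sqrt (\<rho> k) / 2)"
      proof -
        have "1 / (2 * (q * q * q * e)) * ((q * q)\<^sup>2 * (p * e)) = q * (p / 2)" if "q > 0" for p q :: real
          using that e by (simp add: field_simps power2_eq_square)
        from this[of "sqrt k" "sqrt (\<rho> k)"] show ?thesis using k by (simp add: t_def)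
      qed
      finally have 1: "1 / (2 * t) * A k \<le> sqrt k * (sqrt (\<rho> k) / 2)" .
      have "t / 2 * (C / k) = sqrt k * (C * e / 2)" using k by (simp add: t_def)
      with 1 show ?thesis by (simp add: algebra_simps)
    qed
    finally have "(\<integral>\<xi>. ring k \<xi> ^ 3 * norm (F k \<eta> \<xi>) \<partial>lborel) \<le> ((sqrt (\<rho> k) + C * e) / 2) * sqrt k" by (simp only: mult.commute)
    moreover have sk: "sqrt k > 0" using k by simp
    ultimately show ?thesis unfolding e_def[symmetric] pos_divide_le_eq[OF sk] by simp
  qed
  have "((\<lambda>k::real. 1 / k) \<longlongrightarrow> 0) at_top" by real_asymp
  then have "((\<lambda>k. (sqrt (\<rho> k) + C * (sqrt (\<rho> k) + 1 / k)) / 2) \<longlongrightarrow> (sqrt 0 + C * (sqrt 0 + 0)) / 2) at_top"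
    by (intro tendsto_intros \<rho>) auto
  then have lim: "((\<lambda>k. (sqrt (\<rho> k) + C * (sqrt (\<rho> k) + 1 / k)) / 2) \<longlongrightarrow> 0) at_top" by simp
  show ?thesis
  proof (rule tendsto_sandwich[OF _ _ tendsto_const lim])
    show "\<forall>\<^sub>F k in at_top. 0 \<le> (\<integral>\<xi>. ring k \<xi> ^ 3 * norm (F k \<eta> \<xi>) \<partial>lborel) / sqrt k"
      using eventually_ge_at_top[of 1]
      by eventually_elim (intro divide_nonneg_nonneg integral_nonneg_AE AE_I2 mult_nonneg_nonneg zero_le_power, auto)
    show "\<forall>\<^sub>F k in at_top. (\<integral>\<xi>. ring k \<xi> ^ 3 * norm (F k \<eta> \<xi>) \<partial>lborel) / sqrt k \<le> (sqrt (\<rho> k) + C * (sqrt (\<rho> k) + 1 / k)) / 2"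
      using eventually_ge_at_top[of 1] by eventually_elim (rule bound)
  qed
qed

text \<open>The cutoff is 1 where \<mu> is nonzero and so drops out; the pointwise limit of k
  |\<Phi>|^2 is carried through the integral with a multiple of |\<mu>| as majorant.\<close>

lemma main_term_limit:
  assumes \<zeta>: "\<zeta> \<in> test_functions (- {x})" and \<mu>: "\<mu> \<in> test_functions (- {x})" and one: "\<And>y. \<mu> y \<noteq> 0 \<Longrightarrow> \<zeta> y = 1"
  shows "((\<lambda>k. k * (\<integral>y. \<mu> y * (norm (complex_of_real (\<zeta> y) * Psi k y))\<^sup>2 \<partial>lborel)) \<longlongrightarrow>
    (\<integral>y. \<mu> y * (exp (- \<sigma> * norm (x - y)) / (8 * pi * norm (x - y))) \<partial>lborel)) at_top"
proof -
  obtain C where C: "C \<ge> 0" "\<And>k y. k > 0 \<Longrightarrow> k * (norm (complex_of_real (\<zeta> y) * Psi k y))\<^sup>2 \<le> C * (\<zeta> y)\<^sup>2"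
    using cut_Psi_bound[OF \<zeta>] by blast
  \<comment> \<open>Replacing k by max 1 k defines a measurable and dominated integrand for every
    real k; from k = 1 on it is the original one.\<close>
  let ?s = "\<lambda>k y. max 1 k * (\<mu> y * (norm (complex_of_real (\<zeta> y) * Psi (max 1 k) y))\<^sup>2)"
  have [measurable]: "\<mu> \<in> borel_measurable borel" "\<zeta> \<in> borel_measurable borel" by (rule test_functions_borel[OF \<mu>], rule test_functions_borel[OF \<zeta>])
  have [measurable]: "(\<lambda>y. complex_of_real (\<zeta> y) * Psi (max 1 k) y) \<in> borel_measurable borel" for k
    by (rule test_functions_borel[OF cut_Psi_test[OF _ \<zeta>]]) simp
  have \<mu>i: "integrable lborel (\<lambda>y. C * \<bar>\<mu> y\<bar>)" using test_functions_integrable[OF \<mu>] by simp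
  have "((\<lambda>k. \<integral>y. ?s k y \<partial>lborel) \<longlongrightarrow> (\<integral>y. \<mu> y * (exp (- \<sigma> * norm (x - y)) / (8 * pi * norm (x - y))) \<partial>lborel)) at_top"
  proof (rule integral_dominated_convergence_at_top[OF _ _ \<mu>i])
    show "\<forall>\<^sub>F k in at_top. AE y in lborel. norm (?s k y) \<le> C * \<bar>\<mu> y\<bar>"
    proof (intro always_eventually allI AE_I2)
      fix k y
      show "norm (?s k y) \<le> C * \<bar>\<mu> y\<bar>"
      proof (cases "\<mu> y = 0")
        case False
        have "max 1 k * (norm (complex_of_real (\<zeta> y) * Psi (max 1 k) y))\<^sup>2 \<le> C"
          using C(2)[of "max 1 k" y] one[OF False] by simp
        then have "\<bar>\<mu> y\<bar> * (max 1 k * (norm (complex_of_real (\<zeta> y) * Psi (max 1 k) y))\<^sup>2) \<le> \<bar>\<mu> y\<bar> * C"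
          by (rule mult_left_mono) simp
        then show ?thesis by (simp add: abs_mult mult_ac)
      qed simp
    qed
    show "AE y in lborel. ((\<lambda>k. ?s k y) \<longlongrightarrow> \<mu> y * (exp (- \<sigma> * norm (x - y)) / (8 * pi * norm (x - y)))) at_top"
    proof (rule AE_I2)
      fix y
      show "((\<lambda>k. ?s k y) \<longlongrightarrow> \<mu> y * (exp (- \<sigma> * norm (x - y)) / (8 * pi * norm (x - y)))) at_top"
      proof (cases "\<mu> y = 0")
        case False
        have "x \<notin> fun_supp \<mu>" using \<mu> by (auto simp: test_functions_def)
        then have yx: "y \<noteq> x" using False fun_supp_zero[of x \<mu>] by auto
        have "((\<lambda>k. \<mu> y * (k * (norm (Psi k y))\<^sup>2)) \<longlongrightarrow> \<mu> y * (exp (- \<sigma> * norm (x - y)) / (8 * pi * norm (x - y)))) at_top"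
          by (intro tendsto_mult tendsto_const norm_Psi_sq_tendsto yx)
        moreover have "eventually (\<lambda>k. \<mu> y * (k * (norm (Psi k y))\<^sup>2) = ?s k y) at_top"
          using eventually_ge_at_top[of 1] by eventually_elim (simp add: one[OF False] max_def)
        ultimately show ?thesis by (rule Lim_transform_eventually)
      qed simp
    qed
  qed measurable
  moreover have "eventually (\<lambda>k. (\<integral>y. ?s k y \<partial>lborel) = k * (\<integral>y. \<mu> y * (norm (complex_of_real (\<zeta> y) * Psi k y))\<^sup>2 \<partial>lborel)) at_top"
    using eventually_ge_at_top[of 1] by eventually_elim (simp add: max_def)
  ultimately show ?thesis by (rule Lim_transform_eventually)
qed

text \<open>Replacing k^(2s) c(y, \<xi>) by \<mu>(y) turns the operator into multiplication by
  \<mu>, by Fourier inversion. The error is at most (C / k) S k pointwise, pairing with g costs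
  O(k^(-1/2)), and the outer factor k leaves a multiple of S k / sqrt k, which tends to 0.\<close>

lemma pseudo_diff_asymptotic:
  assumes s: "0 < s" "s \<le> 1"
    and \<zeta>: "\<zeta> \<in> test_functions (- {x})" and \<mu>: "\<mu> \<in> test_functions (- {x})"
    and c: "classical_symbol (- 2 * s) (\<lambda>(y, \<xi>). complex_of_real (\<mu> y * norm \<xi> powr (- 2 * s))) c"
  shows "((\<lambda>k. complex_of_real k * (of_real (k powr (2 * s)) *
      (\<integral>y. cnj (complex_of_real (\<zeta> y) * Psi k y) * pseudo_diff_op c (\<lambda>y. complex_of_real (\<zeta> y) * Psi k y) y \<partial>lborel)
      - of_real (\<integral>y. \<mu> y * (norm (complex_of_real (\<zeta> y) * Psi k y))\<^sup>2 \<partial>lborel))) \<longlongrightarrow> 0) at_top"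
proof -
  have cs: "smooth_fun_on UNIV c" using c by (simp add: classical_symbol_def symbol_class_def)
  have [measurable]: "c \<in> borel_measurable (borel \<Otimes>\<^sub>M borel)"
    unfolding borel_prod by (intro borel_measurable_continuous_onI smooth_fun_on_continuous cs)
  obtain a \<theta> where a0: "\<And>y \<xi>. \<xi> \<noteq> 0 \<Longrightarrow> a (0::nat) (y, \<xi>) = complex_of_real (\<mu> y * norm \<xi> powr (- 2 * s))"
    and \<theta>: "excision \<theta>"
    and rem: "\<And>N. (\<lambda>(y, \<xi>). c (y, \<xi>) - complex_of_real (\<theta> \<xi>) * (\<Sum>j<N. a j (y, \<xi>))) \<in> symbol_class (- 2 * s - real N)"
    using c unfolding classical_symbol_def by auto
  have \<theta>0: "\<theta> 0 = 0" using \<theta> unfolding excision_def by auto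
  \<comment> \<open>Symbol estimates are only locally uniform in the space variable; this compact
    set suffices because g vanishes off it.\<close>
  define K where "K = fun_supp \<zeta>"
  have Kc: "compact K" using \<zeta> by (simp add: K_def test_functions_def)
  \<comment> \<open>The expansion is cut after its leading term: N = 1 leaves a remainder of order
    -2s - 1.\<close>
  have "\<exists>C. \<forall>y\<in>K. \<forall>\<xi>. norm ((\<lambda>(y, \<xi>). c (y, \<xi>) - complex_of_real (\<theta> \<xi>) * (\<Sum>j<1. a j (y, \<xi>))) (y, \<xi>))
      \<le> C * (1 + norm \<xi>) powr (- 2 * s - real 1)"
    by (rule symbol_class_bound[OF rem[of 1] Kc])
  then obtain Cr where Cr': "\<And>y \<xi>. y \<in> K \<Longrightarrow> norm (c (y, \<xi>) - complex_of_real (\<theta> \<xi>) * a 0 (y, \<xi>)) \<le> Cr * (1 + norm \<xi>) powr (- 2 * s - 1)"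
    by auto
  \<comment> \<open>At \<xi> = 0 the coefficient \<open>a 0\<close> is not determined by the leading
    term, but the excision vanishes there.\<close>
  have Cr: "norm (c (y, \<xi>) - complex_of_real (\<theta> \<xi> * (\<mu> y * norm \<xi> powr (- 2 * s)))) \<le> \<bar>Cr\<bar> * (1 + norm \<xi>) powr (- (2 * s + 1))" if "y \<in> K" for y \<xi>
  proof -
    have "complex_of_real (\<theta> \<xi>) * a 0 (y, \<xi>) = complex_of_real (\<theta> \<xi> * (\<mu> y * norm \<xi> powr (- 2 * s)))"
      using a0[of \<xi> y] \<theta>0 by (cases "\<xi> = 0") auto
    moreover have "- 2 * s - 1 = - (2 * s + 1)" by simp
    ultimately have "norm (c (y, \<xi>) - complex_of_real (\<theta> \<xi> * (\<mu> y * norm \<xi> powr (- 2 * s)))) \<le> Cr * (1 + norm \<xi>) powr (- (2 * s + 1))"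
      using Cr'[OF that, of \<xi>] by metis
    also have "\<dots> \<le> \<bar>Cr\<bar> * (1 + norm \<xi>) powr (- (2 * s + 1))" by (intro mult_right_mono) auto
    finally show ?thesis .
  qed
  obtain Ce K0 where Ce: "Ce \<ge> 0" and K0: "K0 \<ge> 1"
    and ex: "\<And>k \<xi>. k \<ge> K0 \<Longrightarrow> \<bar>k powr (2 * s) * (\<theta> \<xi> * norm \<xi> powr (- 2 * s)) - 1\<bar> \<le> Ce * ring k \<xi> ^ 3 / k"
    using excised_symbol_estimate[OF \<theta> s] by blast
  obtain Bm where Bm: "Bm \<ge> 0" "\<And>y. norm (\<mu> y) \<le> Bm" using test_functions_bounded[OF \<mu>] by blast
  obtain C1 where C1: "C1 \<ge> 0" "\<And>k. k > 0 \<Longrightarrow> (\<integral>y. norm (complex_of_real (\<zeta> y) * Psi k y) \<partial>lborel) \<le> C1 / sqrt k"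
    using cut_Psi_L1[OF \<zeta>] by blast
  define C where "C = Bm * Ce + \<bar>Cr\<bar>"
  have C0: "C \<ge> 0" using Bm Ce by (simp add: C_def)
  define S where "S k = (\<integral>\<xi>. ring k \<xi> ^ 3 * norm (F k \<zeta> \<xi>) \<partial>lborel)" for k
  have S0: "S k \<ge> 0" for k unfolding S_def by (intro integral_nonneg_AE AE_I2 mult_nonneg_nonneg zero_le_power) auto
  have symbol: "norm (of_real (k powr (2 * s)) * c (y, \<xi>) - complex_of_real (\<mu> y)) \<le> C / k * ring k \<xi> ^ 3" if k: "k \<ge> K0" and y: "y \<in> K" for k y \<xi>
  proof -
    have k1: "k \<ge> 1" using k K0 by simp
    define w where "w = ring k \<xi>"
    have w1: "w \<ge> 1" unfolding w_def by (rule ring_ge_1)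
    define m where "m = norm \<xi>"
    have m0: "m \<ge> 0" by (simp add: m_def)
    have "of_real (k powr (2 * s)) * c (y, \<xi>) - complex_of_real (\<mu> y)
      = of_real (\<mu> y * (k powr (2 * s) * (\<theta> \<xi> * norm \<xi> powr (- 2 * s)) - 1))
        + of_real (k powr (2 * s)) * (c (y, \<xi>) - complex_of_real (\<theta> \<xi> * (\<mu> y * norm \<xi> powr (- 2 * s))))"
      by (simp add: algebra_simps)
    also have "norm \<dots> \<le> norm (complex_of_real (\<mu> y * (k powr (2 * s) * (\<theta> \<xi> * norm \<xi> powr (- 2 * s)) - 1)))
       + norm (of_real (k powr (2 * s)) * (c (y, \<xi>) - complex_of_real (\<theta> \<xi> * (\<mu> y * norm \<xi> powr (- 2 * s)))))"
      by (rule norm_triangle_ineq)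
    also have "\<dots> \<le> Bm * (Ce * w ^ 3 / k) + \<bar>Cr\<bar> * (w ^ 3 / k)"
    proof (rule add_mono)
      show "norm (complex_of_real (\<mu> y * (k powr (2 * s) * (\<theta> \<xi> * norm \<xi> powr (- 2 * s)) - 1))) \<le> Bm * (Ce * w ^ 3 / k)"
        unfolding norm_of_real abs_mult[of "\<mu> y"] w_def using Bm ex[OF k, of \<xi>] by (intro mult_mono) auto
      \<comment> \<open>From k \<le> (1 + |\<xi>|) w, decay in \<xi> can be traded for powers of 1 /
        k at the cost of the weight w; the exponent 2s + 1 is at most 3, which is again where the
        cube suffices.\<close>
      have "k powr (2 * s) * (1 + m) powr (- (2 * s + 1)) \<le> w ^ 3 / k"
      proof -
        have "k \<le> (1 + m) * w"
        proof -
          have "k \<le> m + \<bar>m - k\<bar>" by linarith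
          also have "\<dots> \<le> (1 + m) * w" using m0 by (simp add: w_def m_def[symmetric] algebra_simps)
          finally show ?thesis .
        qed
        then have "k / w \<le> 1 + m" using w1 by (simp add: field_simps)
        then have "(1 + m) powr (- (2 * s + 1)) \<le> (k / w) powr (- (2 * s + 1))"
          using k1 w1 s by (intro powr_mono2') auto
        also have "\<dots> = w powr (2 * s + 1) * k powr (- (2 * s + 1))"
        proof -
          have "(k / w) powr (- b) = w powr b * k powr (- b)" for b
          proof -
            have "(k / w) powr (- b) = k powr (- b) / w powr (- b)"
              by (rule powr_divide)
            also have "\<dots> = w powr b * k powr (- b)" unfolding powr_minus[of w] by (simp add: divide_inverse)
            finally show ?thesis .
          qed
          then show ?thesis .
        qed
        also have "\<dots> \<le> w powr 3 * k powr (- (2 * s + 1))"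
          using w1 s by (intro mult_right_mono powr_mono) auto
        finally have "k powr (2 * s) * (1 + m) powr (- (2 * s + 1)) \<le> k powr (2 * s) * (w powr 3 * k powr (- (2 * s + 1)))"
          by (intro mult_left_mono) auto
        also have "\<dots> = w powr 3 * (k powr (2 * s) * k powr (- (2 * s + 1)))" by simp
        also have "k powr (2 * s) * k powr (- (2 * s + 1)) = k powr (- 1)" by (simp add: powr_add[symmetric])
        also have "w powr 3 * k powr (- 1) = w ^ 3 / k" using k1 w1 by (simp add: powr_numeral powr_minus divide_inverse)
        finally show ?thesis .
      qed
      then have "\<bar>Cr\<bar> * (k powr (2 * s) * (1 + m) powr (- (2 * s + 1))) \<le> \<bar>Cr\<bar> * (w ^ 3 / k)" by (rule mult_left_mono) simp
      moreover have "norm (of_real (k powr (2 * s)) * (c (y, \<xi>) - complex_of_real (\<theta> \<xi> * (\<mu> y * norm \<xi> powr (- 2 * s)))))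
         \<le> k powr (2 * s) * (\<bar>Cr\<bar> * (1 + m) powr (- (2 * s + 1)))"
        unfolding norm_mult norm_of_real abs_of_nonneg[OF powr_ge_zero] m_def by (intro mult_left_mono Cr y) auto
      ultimately show "norm (of_real (k powr (2 * s)) * (c (y, \<xi>) - complex_of_real (\<theta> \<xi> * (\<mu> y * norm \<xi> powr (- 2 * s))))) \<le> \<bar>Cr\<bar> * (w ^ 3 / k)"
        by (simp add: mult_ac)
    qed
    also have "\<dots> = C / k * w ^ 3" by (simp add: C_def algebra_simps add_divide_distrib)
    finally show ?thesis by (simp only: w_def)
  qed
  have est: "norm (complex_of_real k * (of_real (k powr (2 * s)) *
      (\<integral>y. cnj (complex_of_real (\<zeta> y) * Psi k y) * pseudo_diff_op c (\<lambda>y. complex_of_real (\<zeta> y) * Psi k y) y \<partial>lborel)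
      - of_real (\<integral>y. \<mu> y * (norm (complex_of_real (\<zeta> y) * Psi k y))\<^sup>2 \<partial>lborel))) \<le> C1 * C * (S k / sqrt k)" if k: "k \<ge> K0" for k
  proof -
    have k1: "k \<ge> 1" and k0: "k > 0" using k K0 by auto
    define g where "g y = complex_of_real (\<zeta> y) * Psi k y" for y
    have gt: "g \<in> test_functions (- {x})" unfolding g_def[abs_def] by (rule cut_Psi_test[OF k0 \<zeta>])
    have [measurable]: "g \<in> borel_measurable borel" by (rule test_functions_borel[OF gt])
    have [measurable]: "\<mu> \<in> borel_measurable borel" by (rule test_functions_borel[OF \<mu>])
    define G where "G = fourier g"
    have GF: "G = F k \<zeta>" by (simp add: G_def cut_fourier_def g_def[abs_def])
    have Gi: "integrable lborel G" unfolding GF by (rule fourier_cut_integrable[OF \<zeta> k1])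
    have [measurable]: "G \<in> borel_measurable borel" using Gi by auto
    \<comment> \<open>The error of the rescaled symbol against its value on the circle |\<xi>| = k;
      R is the corresponding oscillatory integral.\<close>
    define m where "m y \<xi> = of_real (k powr (2 * s)) * c (y, \<xi>) - complex_of_real (\<mu> y)" for y \<xi>
    define R where "R y = (\<integral>\<xi>. exp (\<i> * complex_of_real (y \<bullet> \<xi>)) * m y \<xi> * G \<xi> \<partial>lborel)" for y
    have Rm [measurable]: "R \<in> borel_measurable borel" unfolding R_def[abs_def] m_def by measurable
    have wi: "integrable lborel (\<lambda>\<xi>. C / k * (ring k \<xi> ^ 3 * norm (G \<xi>)))"
      unfolding GF by (intro integrable_mult_right ring_F_integrable[OF \<zeta> k1])
    have mG: "norm (exp (\<i> * complex_of_real (y \<bullet> \<xi>)) * m y \<xi> * G \<xi>) \<le> C / k * (ring k \<xi> ^ 3 * norm (G \<xi>))" if "y \<in> K" for y \<xi>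
      using mult_right_mono[OF symbol[OF k that, of \<xi>] norm_ge_zero[of "G \<xi>"]] by (simp add: norm_mult m_def mult_ac)
    have Ri: "integrable lborel (\<lambda>\<xi>. exp (\<i> * complex_of_real (y \<bullet> \<xi>)) * m y \<xi> * G \<xi>)" if "y \<in> K" for y
    proof (rule Bochner_Integration.integrable_bound[OF wi])
      show "(\<lambda>\<xi>. exp (\<i> * complex_of_real (y \<bullet> \<xi>)) * m y \<xi> * G \<xi>) \<in> borel_measurable lborel"
        unfolding m_def by measurable
      show "AE \<xi> in lborel. norm (exp (\<i> * complex_of_real (y \<bullet> \<xi>)) * m y \<xi> * G \<xi>) \<le> norm (C / k * (ring k \<xi> ^ 3 * norm (G \<xi>)))"
        by (intro AE_I2 order_trans[OF mG[OF that]]) (unfold real_norm_def, rule abs_ge_self)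
    qed
    have RB: "norm (R y) \<le> C / k * S k" if "y \<in> K" for y
    proof -
      have "norm (R y) \<le> (\<integral>\<xi>. norm (exp (\<i> * complex_of_real (y \<bullet> \<xi>)) * m y \<xi> * G \<xi>) \<partial>lborel)"
        unfolding R_def by (rule integral_norm_bound)
      also have "\<dots> \<le> (\<integral>\<xi>. C / k * (ring k \<xi> ^ 3 * norm (G \<xi>)) \<partial>lborel)"
        by (rule integral_mono[OF integrable_norm[OF Ri[OF that]] wi mG[OF that]])
      also have "\<dots> = C / k * S k" by (simp only: integral_mult_right_zero S_def GF)
      finally show ?thesis .
    qed
    \<comment> \<open>A symbol independent of \<xi> acts by multiplication, so inversion evaluates
      the \<mu> part exactly and only R remains.\<close>
    have op: "of_real (k powr (2 * s)) * pseudo_diff_op c g y = of_real (\<mu> y) * g y + of_real (1 / (2 * pi)\<^sup>2) * R y" if y: "y \<in> K" for y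
    proof -
      let ?E = "\<lambda>\<xi>. exp (\<i> * complex_of_real (y \<bullet> \<xi>))"
      have Ei: "integrable lborel (\<lambda>\<xi>. ?E \<xi> * G \<xi>)"
        by (rule Bochner_Integration.integrable_bound[OF Gi]) (auto simp: norm_mult)
      have "of_real (k powr (2 * s)) * (\<integral>\<xi>. ?E \<xi> * c (y, \<xi>) * G \<xi> \<partial>lborel) = (\<integral>\<xi>. of_real (k powr (2 * s)) * (?E \<xi> * c (y, \<xi>) * G \<xi>) \<partial>lborel)"
        by (rule integral_mult_right_zero[symmetric])
      also have "\<dots> = (\<integral>\<xi>. of_real (\<mu> y) * (?E \<xi> * G \<xi>) + ?E \<xi> * m y \<xi> * G \<xi> \<partial>lborel)"
        by (intro Bochner_Integration.integral_cong refl) (simp add: m_def algebra_simps)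
      also have "\<dots> = of_real (\<mu> y) * (\<integral>\<xi>. ?E \<xi> * G \<xi> \<partial>lborel) + R y"
        unfolding R_def using Ei Ri[OF y] by (subst Bochner_Integration.integral_add) auto
      also have "(\<integral>\<xi>. ?E \<xi> * G \<xi> \<partial>lborel) = of_real ((2 * pi)\<^sup>2) * g y"
        unfolding G_def by (rule fourier_inversion[OF gt Gi[unfolded G_def]])
      finally have i: "of_real (k powr (2 * s)) * (\<integral>\<xi>. ?E \<xi> * c (y, \<xi>) * G \<xi> \<partial>lborel) = of_real (\<mu> y) * (of_real ((2 * pi)\<^sup>2) * g y) + R y" .
      have "of_real (k powr (2 * s)) * pseudo_diff_op c g y = of_real (1 / (2 * pi)\<^sup>2) * (of_real (k powr (2 * s)) * (\<integral>\<xi>. ?E \<xi> * c (y, \<xi>) * G \<xi> \<partial>lborel))"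
        by (simp only: pseudo_diff_op_def G_def mult_ac)
      also have "\<dots> = of_real (1 / (2 * pi)\<^sup>2 * (2 * pi)\<^sup>2) * (of_real (\<mu> y) * g y) + of_real (1 / (2 * pi)\<^sup>2) * R y"
        unfolding i by (simp only: distrib_left of_real_mult mult_ac)
      also have "1 / (2 * pi)\<^sup>2 * (2 * pi)\<^sup>2 = 1" by simp
      finally show ?thesis by simp
    qed
    have gK: "g y = 0" if "y \<notin> K" for y using that by (simp add: g_def K_def fun_supp_zero)
    have gi: "integrable lborel g" by (rule test_functions_integrable[OF gt])
    have Rgi: "integrable lborel (\<lambda>y. cnj (g y) * R y)"
    proof (rule Bochner_Integration.integrable_bound[where f="\<lambda>y. C / k * S k * norm (g y)"])
      show "integrable lborel (\<lambda>y. C / k * S k * norm (g y))" using gi by (intro integrable_mult_right integrable_norm)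
      show "AE y in lborel. norm (cnj (g y) * R y) \<le> norm (C / k * S k * norm (g y))"
      proof (rule AE_I2)
        fix y
        show "norm (cnj (g y) * R y) \<le> norm (C / k * S k * norm (g y))"
        proof (cases "y \<in> K")
          case True
          have "norm (cnj (g y) * R y) \<le> norm (g y) * (C / k * S k)"
            unfolding norm_mult complex_mod_cnj by (intro mult_left_mono RB True) auto
          also have "\<dots> \<le> norm (C / k * S k * norm (g y))" by (metis abs_ge_self mult.commute real_norm_def)
          finally show ?thesis .
        qed (simp add: gK)
      qed
    next
      have "(\<lambda>y. cnj (g y)) \<in> borel_measurable borel"
        by (rule test_functions_borel[OF test_functions_bounded_linear[OF gt bounded_linear_cnj]])
      then show "(\<lambda>y. cnj (g y) * R y) \<in> borel_measurable lborel"
        unfolding measurable_lborel2 by (rule borel_measurable_times[OF _ Rm])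
    qed
    have g2: "integrable lborel (\<lambda>y. complex_of_real (\<mu> y * (norm (g y))\<^sup>2))"
    proof -
      obtain Bg where Bg: "Bg \<ge> 0" "\<And>y. norm (g y) \<le> Bg" using test_functions_bounded[OF gt] by blast
      have "integrable lborel (\<lambda>y. Bm * Bg * norm (g y))" using gi by (intro integrable_mult_right integrable_norm)
      then show ?thesis
      proof (rule Bochner_Integration.integrable_bound)
        show "AE y in lborel. norm (complex_of_real (\<mu> y * (norm (g y))\<^sup>2)) \<le> norm (Bm * Bg * norm (g y))"
        proof (rule AE_I2)
          fix y
          have "\<bar>\<mu> y\<bar> * (norm (g y) * norm (g y)) \<le> Bm * (Bg * norm (g y))"
            using Bm Bg by (intro mult_mono mult_right_mono) auto
          then show "norm (complex_of_real (\<mu> y * (norm (g y))\<^sup>2)) \<le> norm (Bm * Bg * norm (g y))"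
            using Bm(1) Bg(1) by (simp add: norm_mult norm_power power2_eq_square abs_mult mult_ac)
        qed
      qed measurable
    qed
    have "of_real (k powr (2 * s)) * (\<integral>y. cnj (g y) * pseudo_diff_op c g y \<partial>lborel)
      = (\<integral>y. complex_of_real (\<mu> y * (norm (g y))\<^sup>2) + of_real (1 / (2 * pi)\<^sup>2) * (cnj (g y) * R y) \<partial>lborel)"
      unfolding integral_mult_right_zero[symmetric]
    proof (intro Bochner_Integration.integral_cong refl)
      fix y
      show "of_real (k powr (2 * s)) * (cnj (g y) * pseudo_diff_op c g y) = complex_of_real (\<mu> y * (norm (g y))\<^sup>2) + of_real (1 / (2 * pi)\<^sup>2) * (cnj (g y) * R y)"
      proof (cases "y \<in> K")
        case True
        have "of_real (k powr (2 * s)) * (cnj (g y) * pseudo_diff_op c g y) = cnj (g y) * (of_real (k powr (2 * s)) * pseudo_diff_op c g y)" by (simp only: mult_ac)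
        also have "\<dots> = of_real (\<mu> y) * (g y * cnj (g y)) + of_real (1 / (2 * pi)\<^sup>2) * (cnj (g y) * R y)"
          unfolding op[OF True] by (simp only: distrib_left mult_ac)
        also have "g y * cnj (g y) = of_real ((norm (g y))\<^sup>2)" by (rule complex_norm_square[symmetric])
        finally show ?thesis by (simp only: of_real_mult)
      qed (simp add: gK)
    qed
    also have "\<dots> = of_real (\<integral>y. \<mu> y * (norm (g y))\<^sup>2 \<partial>lborel) + of_real (1 / (2 * pi)\<^sup>2) * (\<integral>y. cnj (g y) * R y \<partial>lborel)"
      by (subst Bochner_Integration.integral_add[OF g2 integrable_mult_right[OF Rgi]]) (simp only: integral_complex_of_real integral_mult_right_zero)
    finally have eq: "of_real (k powr (2 * s)) * (\<integral>y. cnj (g y) * pseudo_diff_op c g y \<partial>lborel) - of_real (\<integral>y. \<mu> y * (norm (g y))\<^sup>2 \<partial>lborel)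
       = of_real (1 / (2 * pi)\<^sup>2) * (\<integral>y. cnj (g y) * R y \<partial>lborel)" by (simp only: add_diff_cancel_left')
    have "norm (\<integral>y. cnj (g y) * R y \<partial>lborel) \<le> (\<integral>y. norm (cnj (g y) * R y) \<partial>lborel)" by (rule integral_norm_bound)
    also have "\<dots> \<le> (\<integral>y. C / k * S k * norm (g y) \<partial>lborel)"
    proof (rule integral_mono[OF integrable_norm[OF Rgi]])
      show "integrable lborel (\<lambda>y. C / k * S k * norm (g y))" using gi by (intro integrable_mult_right integrable_norm)
      fix y
      show "norm (cnj (g y) * R y) \<le> C / k * S k * norm (g y)"
      proof (cases "y \<in> K")
        case True
        have "norm (cnj (g y) * R y) \<le> norm (g y) * (C / k * S k)"
          unfolding norm_mult complex_mod_cnj by (intro mult_left_mono RB True) auto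
        then show ?thesis by (simp only: mult.commute)
      qed (simp add: gK)
    qed
    also have "\<dots> = C / k * S k * (\<integral>y. norm (g y) \<partial>lborel)" by (rule integral_mult_right_zero)
    also have "\<dots> \<le> C / k * S k * (C1 / sqrt k)"
      using C1(2)[OF k0] C0 S0[of k] k0 unfolding g_def by (intro mult_left_mono) auto
    finally have fin: "norm (\<integral>y. cnj (g y) * R y \<partial>lborel) \<le> C / k * S k * (C1 / sqrt k)" .
    have pi1: "1 / (2 * pi)\<^sup>2 \<le> 1"
    proof -
      have "1 \<le> 2 * pi" using pi_ge_two by simp
      then have "1\<^sup>2 \<le> (2 * pi)\<^sup>2" by (intro power_mono) auto
      then show ?thesis by simp
    qed
    have "norm (complex_of_real k * (of_real (1 / (2 * pi)\<^sup>2) * (\<integral>y. cnj (g y) * R y \<partial>lborel))) = k * (1 / (2 * pi)\<^sup>2 * norm (\<integral>y. cnj (g y) * R y \<partial>lborel))"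
      unfolding norm_mult norm_of_real using k0 by simp
    also have "\<dots> \<le> k * (1 * (C / k * S k * (C1 / sqrt k)))"
      using k0 pi1 fin by (intro mult_left_mono mult_mono) auto
    also have "\<dots> = C1 * C * (S k / sqrt k)" using k0 by simp
    finally show ?thesis unfolding eq[symmetric] unfolding g_def .
  qed
  have "((\<lambda>k. C1 * C * (S k / sqrt k)) \<longlongrightarrow> C1 * C * 0) at_top"
    unfolding S_def by (intro tendsto_mult tendsto_const weighted_L1_asymptotic[OF \<zeta>])
  then have "((\<lambda>k. C1 * C * (S k / sqrt k)) \<longlongrightarrow> 0) at_top" by simp
  then show ?thesis
  proof (rule Lim_null_comparison[rotated])
  qed (rule eventually_mono[OF eventually_ge_at_top[of K0]], rule est)
qed

end

section \<open>Gaussian random fields\<close>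

lemma real_gaussian_field_tempered:
  assumes "real_gaussian_field M f" "\<omega> \<in> space M" shows "f \<omega> \<in> tempered"
proof -
  have "f \<in> measurable M tempered_measurable_space" using assms(1) by (simp add: real_gaussian_field_def)
  from measurable_space[OF this assms(2)] show ?thesis
    by (auto simp: tempered_measurable_space_def space_restrict_space)
qed

text \<open>Reality of the field on real test functions turns the second moment into the covariance form.\<close>
lemma real_gaussian_field_second_moment:
  assumes f: "real_gaussian_field M f" and \<phi>: "\<phi> \<in> test_functions UNIV"
  shows "integrable M (\<lambda>\<omega>. (cmod (f \<omega> \<phi>))\<^sup>2)"
    and "complex_of_real (\<integral>\<omega>. (cmod (f \<omega> \<phi>))\<^sup>2 \<partial>M) = covariance M f \<phi> (\<lambda>y. cnj (\<phi> y))"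
proof -
  let ?R = "\<lambda>y. Re (\<phi> y)" and ?I = "\<lambda>y. Im (\<phi> y)"
  have R: "?R \<in> test_functions UNIV" and I: "?I \<in> test_functions UNIV"
    using test_functions_bounded_linear[OF \<phi> bounded_linear_Re] test_functions_bounded_linear[OF \<phi> bounded_linear_Im] .
  define A where "A \<omega> = f \<omega> (\<lambda>y. complex_of_real (?R y))" for \<omega>
  define B where "B \<omega> = f \<omega> (\<lambda>y. complex_of_real (?I y))" for \<omega>
  have sR: "(\<lambda>y. complex_of_real (?R y)) \<in> schwartz" and sI: "(\<lambda>y. complex_of_real (?I y)) \<in> schwartz"
    using test_functions_bounded_linear[OF R bounded_linear_of_real] test_functions_bounded_linear[OF I bounded_linear_of_real]
    by (auto intro: test_functions_schwartz)
  have fr: "\<forall>\<omega>\<in>space M. f \<omega> (\<lambda>y. complex_of_real (h y)) \<in> \<real>"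
    and fg: "centered_gaussian M (\<lambda>\<omega>. Re (f \<omega> (\<lambda>y. complex_of_real (h y))))" if "h \<in> test_functions UNIV" for h
    using f that unfolding real_gaussian_field_def by simp_all
  have AB: "A \<omega> \<in> \<real>" "B \<omega> \<in> \<real>" if "\<omega> \<in> space M" for \<omega>
    using fr[OF R] fr[OF I] that unfolding A_def B_def by auto
  have f1: "f \<omega> \<phi> = A \<omega> + \<i> * B \<omega>" and f2: "f \<omega> (\<lambda>y. cnj (\<phi> y)) = A \<omega> - \<i> * B \<omega>" if "\<omega> \<in> space M" for \<omega>
  proof -
    have t: "f \<omega> \<in> tempered" by (rule real_gaussian_field_tempered[OF f that])
    have "f \<omega> (\<lambda>y. 1 * complex_of_real (?R y) + \<i> * complex_of_real (?I y)) = 1 * A \<omega> + \<i> * B \<omega>"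
      unfolding A_def B_def by (rule tempered_linear[OF t sR sI])
    moreover have "(\<lambda>y. 1 * complex_of_real (?R y) + \<i> * complex_of_real (?I y)) = \<phi>" by (auto simp: complex_eq_iff)
    ultimately show "f \<omega> \<phi> = A \<omega> + \<i> * B \<omega>" by simp
    have "f \<omega> (\<lambda>y. 1 * complex_of_real (?R y) + (- \<i>) * complex_of_real (?I y)) = 1 * A \<omega> + (- \<i>) * B \<omega>"
      unfolding A_def B_def by (rule tempered_linear[OF t sR sI])
    moreover have "(\<lambda>y. 1 * complex_of_real (?R y) + (- \<i>) * complex_of_real (?I y)) = (\<lambda>y. cnj (\<phi> y))" by (auto simp: complex_eq_iff)
    ultimately show "f \<omega> (\<lambda>y. cnj (\<phi> y)) = A \<omega> - \<i> * B \<omega>" by simp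
  qed
  have sq: "(cmod (f \<omega> \<phi>))\<^sup>2 = (Re (A \<omega>))\<^sup>2 + (Re (B \<omega>))\<^sup>2"
    and pr: "f \<omega> \<phi> * f \<omega> (\<lambda>y. cnj (\<phi> y)) = complex_of_real ((cmod (f \<omega> \<phi>))\<^sup>2)" if "\<omega> \<in> space M" for \<omega>
  proof -
    have i: "Im (A \<omega>) = 0" "Im (B \<omega>) = 0" using AB[OF that] by (auto simp: complex_is_Real_iff)
    show s: "(cmod (f \<omega> \<phi>))\<^sup>2 = (Re (A \<omega>))\<^sup>2 + (Re (B \<omega>))\<^sup>2"
      unfolding f1[OF that] cmod_power2 by (simp add: i)
    show "f \<omega> \<phi> * f \<omega> (\<lambda>y. cnj (\<phi> y)) = complex_of_real ((cmod (f \<omega> \<phi>))\<^sup>2)"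
      unfolding s unfolding f1[OF that] f2[OF that] by (simp add: complex_eq_iff i power2_eq_square)
  qed
  have "centered_gaussian M (\<lambda>\<omega>. Re (A \<omega>))" "centered_gaussian M (\<lambda>\<omega>. Re (B \<omega>))"
    unfolding A_def B_def by (rule fg[OF R], rule fg[OF I])
  then have "integrable M (\<lambda>\<omega>. (Re (A \<omega>))\<^sup>2 + (Re (B \<omega>))\<^sup>2)"
    by (intro Bochner_Integration.integrable_add centered_gaussian_sq_integrable)
  then show int: "integrable M (\<lambda>\<omega>. (cmod (f \<omega> \<phi>))\<^sup>2)"
    by (rule Bochner_Integration.integrable_cong[THEN iffD1, rotated -1]) (simp_all add: sq)
  have "complex_of_real (\<integral>\<omega>. (cmod (f \<omega> \<phi>))\<^sup>2 \<partial>M) = (\<integral>\<omega>. complex_of_real ((cmod (f \<omega> \<phi>))\<^sup>2) \<partial>M)"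
    by (rule integral_complex_of_real[symmetric])
  also have "\<dots> = covariance M f \<phi> (\<lambda>y. cnj (\<phi> y))"
    unfolding covariance_def by (intro Bochner_Integration.integral_cong refl) (rule pr[symmetric])
  finally show "complex_of_real (\<integral>\<omega>. (cmod (f \<omega> \<phi>))\<^sup>2 \<partial>M) = covariance M f \<phi> (\<lambda>y. cnj (\<phi> y))" .
qed

theorem theorem4p2:
  fixes M :: "'w measure"
    and f :: "'w \<Rightarrow> (plane \<Rightarrow> complex) \<Rightarrow> complex"
    and \<mu> :: "plane \<Rightarrow> real"
    and D U :: "plane set"
    and \<sigma> p s H r0 :: real
    and x :: plane
  assumes "prob_space M" and "complete_measure M"
    and "\<sigma> \<ge> 0"
    and "1 < p" and "p \<le> 2"
    and "2 / p - 1 < s" and "s \<le> 1"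
    and "H = s - 1"
    and "open D" and "connected D" and "D \<noteq> {}" and "bounded D"
    and "real_gaussian_field M f"
    and "AE \<omega> in M. compact (dist_supp (f \<omega>)) \<and> dist_supp (f \<omega>) \<subseteq> D"
    and "\<mu> \<in> test_functions D" and "\<And>y. 0 \<le> \<mu> y"
    and "covariance_classical_psido M f (- 2 * s)
           (\<lambda>(y, \<xi>). complex_of_real (\<mu> y * norm \<xi> powr (- 2 * s)))"
    and "\<And>\<epsilon>. \<epsilon> > 0 \<Longrightarrow> f \<in> L2_bessel M (H - \<epsilon>) p"
    and "open U" and "connected U" and "U \<noteq> {}" and "bounded U"
    and "setdist U D = r0" and "r0 > 0"
    and "x \<in> U"
  shows "(\<forall>k>0. integrable M (\<lambda>\<omega>. (cmod (helmholtz_solution \<sigma> (f \<omega>) k x))\<^sup>2)) \<and>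
    ((\<lambda>k. k powr (2 * s + 1) * (\<integral>\<omega>. (cmod (helmholtz_solution \<sigma> (f \<omega>) k x))\<^sup>2 \<partial>M))
       \<longlongrightarrow> 1 / (2 ^ 3 * pi) * (\<integral>y. exp (- \<sigma> * norm (x - y)) / norm (x - y) * \<mu> y \<partial>lborel)) at_top"
proof -
  interpret helmholtz_point \<sigma> x by standard (rule assms(3))
  have s: "0 < s" "s \<le> 1"
  proof -
    \<comment> \<open>Positivity of s comes from p \<le> 2, which makes the lower bound 2 / p - 1
      nonnegative.\<close>
    have "2 / p \<ge> 1" using assms(4,5) by simp
    then show "0 < s" using assms(6) by linarith
  qed (rule assms(7))
  have gf: "real_gaussian_field M f" by (rule assms(13))
  have "x \<notin> closure D"
  proof
    assume "x \<in> closure D"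
    then obtain y where y: "y \<in> D" "dist y x < r0" using \<open>r0 > 0\<close> closure_approachable by blast
    moreover have "r0 \<le> dist x y" using setdist_le_dist[OF \<open>x \<in> U\<close> y(1)] \<open>setdist U D = r0\<close> by simp
    ultimately show False by (simp add: dist_commute)
  qed
  \<comment> \<open>The support of a realization varies with the sample inside D, so one cutoff that
    is 1 near the compact closure of D serves almost all of them.\<close>
  then obtain \<zeta> :: "plane \<Rightarrow> real" and V where \<zeta>: "\<zeta> \<in> test_functions (- {x})" and V: "open V" "closure D \<subseteq> V" "\<And>y. y \<in> V \<Longrightarrow> \<zeta> y = 1"
    using cutoff_exists[of "closure D" "- {x}"] \<open>bounded D\<close> by (metis ComplI compact_closure open_Compl closed_singleton singletonD subsetI)
  have DV: "D \<subseteq> V" using V(2) closure_subset by blast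
  have "D \<subseteq> - {x}" using \<open>x \<notin> closure D\<close> closure_subset by blast
  then have \<mu>: "\<mu> \<in> test_functions (- {x})" using assms(15) test_functions_mono by blast
  have one: "\<zeta> y = 1" if "\<mu> y \<noteq> 0" for y
  proof -
    have "y \<in> fun_supp \<mu>" using that fun_supp_zero by blast
    then show ?thesis using assms(15) DV V(3) by (auto simp: test_functions_def)
  qed
  obtain c where c: "classical_symbol (- 2 * s) (\<lambda>(y, \<xi>). complex_of_real (\<mu> y * norm \<xi> powr (- 2 * s))) c"
    and cov: "\<And>\<phi> \<psi>. \<phi> \<in> test_functions UNIV \<Longrightarrow> \<psi> \<in> test_functions UNIV \<Longrightarrow> covariance M f \<phi> \<psi> = (\<integral>y. \<phi> y * pseudo_diff_op c \<psi> y \<partial>lborel)"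
    using assms(17) unfolding covariance_classical_psido_def by blast
  define g where "g k y = complex_of_real (\<zeta> y) * Psi k y" for k y
  \<comment> \<open>Undoing the conjugation in \<open>Psi\<close>, this is the cutoff times the
    fundamental solution: the test function at which the field is evaluated.\<close>
  define \<phi> where "\<phi> k y = cnj (g k y)" for k y
  have g\<phi>: "(\<lambda>y. cnj (\<phi> k y)) = g k" for k by (simp add: \<phi>_def fun_eq_iff)
  have gt: "g k \<in> test_functions UNIV" if "k > 0" for k
    unfolding g_def[abs_def] using cut_Psi_test[OF that \<zeta>] test_functions_mono[of "- {x}" UNIV] by blast
  have \<phi>t: "\<phi> k \<in> test_functions UNIV" if "k > 0" for k
    unfolding \<phi>_def[abs_def] by (rule test_functions_bounded_linear[OF gt[OF that] bounded_linear_cnj])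
  \<comment> \<open>Only almost sure, because the support of f \<omega> is known to lie in D only
    for almost every sample.\<close>
  have ae: "AE \<omega> in M. (cmod (helmholtz_solution \<sigma> (f \<omega>) k x))\<^sup>2 = (cmod (f \<omega> (\<phi> k)))\<^sup>2" if k: "k > 0" for k
    using assms(14) AE_space
  proof eventually_elim
    case (elim \<omega>)
    have "dist_pairing (f \<omega>) (fundamental_solution (wave_number \<sigma> k) x) = f \<omega> (\<phi> k)"
    proof (rule dist_pairing_eq[OF real_gaussian_field_tempered[OF gf elim(2)] \<phi>t[OF k] V(1)])
      show "dist_supp (f \<omega>) \<subseteq> V" using elim DV by blast
      show "\<phi> k y = fundamental_solution (wave_number \<sigma> k) x y" if "y \<in> V" for y
        using V(3)[OF that] by (simp add: \<phi>_def g_def Psi_def)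
    qed
    then show ?case by (simp add: helmholtz_solution_def)
  qed
  have hm: "(\<lambda>\<omega>. (cmod (helmholtz_solution \<sigma> (f \<omega>) k x))\<^sup>2) \<in> borel_measurable M" if k: "k > 0" for k
    by (rule complete_measure_borel_measurable_AE[OF assms(2) _ ae[OF k]])
       (use real_gaussian_field_second_moment(1)[OF gf \<phi>t[OF k]] in auto)
  have int: "integrable M (\<lambda>\<omega>. (cmod (helmholtz_solution \<sigma> (f \<omega>) k x))\<^sup>2)" if k: "k > 0" for k
    using real_gaussian_field_second_moment(1)[OF gf \<phi>t[OF k]] ae[OF k] hm[OF k]
    by (subst integrable_cong_AE[of _ M "\<lambda>\<omega>. (cmod (f \<omega> (\<phi> k)))\<^sup>2"]) auto
  have val: "complex_of_real (\<integral>\<omega>. (cmod (helmholtz_solution \<sigma> (f \<omega>) k x))\<^sup>2 \<partial>M) = (\<integral>y. cnj (g k y) * pseudo_diff_op c (g k) y \<partial>lborel)" if k: "k > 0" for k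
  proof -
    have "(\<integral>\<omega>. (cmod (helmholtz_solution \<sigma> (f \<omega>) k x))\<^sup>2 \<partial>M) = (\<integral>\<omega>. (cmod (f \<omega> (\<phi> k)))\<^sup>2 \<partial>M)"
      using real_gaussian_field_second_moment(1)[OF gf \<phi>t[OF k]] by (intro integral_cong_AE hm[OF k] ae[OF k]) auto
    then have "complex_of_real (\<integral>\<omega>. (cmod (helmholtz_solution \<sigma> (f \<omega>) k x))\<^sup>2 \<partial>M) = covariance M f (\<phi> k) (\<lambda>y. cnj (\<phi> k y))"
      using real_gaussian_field_second_moment(2)[OF gf \<phi>t[OF k]] by simp
    also have "\<dots> = (\<integral>y. \<phi> k y * pseudo_diff_op c (g k) y \<partial>lborel)"
      unfolding g\<phi> by (rule cov[OF \<phi>t[OF k] gt[OF k]])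
    finally show ?thesis by (simp only: \<phi>_def)
  qed
  define L where "L = (\<integral>y. \<mu> y * (exp (- \<sigma> * norm (x - y)) / (8 * pi * norm (x - y))) \<partial>lborel)"
  define m where "m k = (\<integral>y. \<mu> y * (norm (g k y))\<^sup>2 \<partial>lborel)" for k
  have l1: "((\<lambda>k. complex_of_real k * (of_real (k powr (2 * s)) * (\<integral>y. cnj (g k y) * pseudo_diff_op c (g k) y \<partial>lborel) - of_real (m k))) \<longlongrightarrow> 0) at_top"
    unfolding m_def g_def[abs_def] by (rule pseudo_diff_asymptotic[OF s \<zeta> \<mu> c])
  have l2: "((\<lambda>k. complex_of_real (k * m k)) \<longlongrightarrow> of_real L) at_top"
    unfolding m_def g_def L_def by (intro tendsto_of_real main_term_limit \<zeta> \<mu> one)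
  \<comment> \<open>The limit is taken in the complex plane, as the operator pairing is a priori
    complex; it is a real number since it equals a second moment.\<close>
  have "((\<lambda>k. complex_of_real (k powr (2 * s + 1) * (\<integral>\<omega>. (cmod (helmholtz_solution \<sigma> (f \<omega>) k x))\<^sup>2 \<partial>M))) \<longlongrightarrow> 0 + of_real L) at_top"
  proof (rule Lim_transform_eventually[OF tendsto_add[OF l1 l2]])
    show "\<forall>\<^sub>F k in at_top. complex_of_real k * (of_real (k powr (2 * s)) * (\<integral>y. cnj (g k y) * pseudo_diff_op c (g k) y \<partial>lborel) - of_real (m k)) + complex_of_real (k * m k)
      = complex_of_real (k powr (2 * s + 1) * (\<integral>\<omega>. (cmod (helmholtz_solution \<sigma> (f \<omega>) k x))\<^sup>2 \<partial>M))"
      using eventually_gt_at_top[of 0]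
    proof eventually_elim
      case (elim k)
      have "k powr (2 * s + 1) = k * k powr (2 * s)" using elim by (simp add: powr_add)
      then show ?case unfolding val[OF elim, symmetric] by (simp add: algebra_simps)
    qed
  qed
  then have "((\<lambda>k. k powr (2 * s + 1) * (\<integral>\<omega>. (cmod (helmholtz_solution \<sigma> (f \<omega>) k x))\<^sup>2 \<partial>M)) \<longlongrightarrow> L) at_top"
    unfolding add_0 by (simp only: tendsto_of_real_iff)
  moreover have "L = 1 / (2 ^ 3 * pi) * (\<integral>y. exp (- \<sigma> * norm (x - y)) / norm (x - y) * \<mu> y \<partial>lborel)"
    unfolding L_def integral_mult_right_zero[symmetric] by (intro Bochner_Integration.integral_cong refl) simp
  ultimately show ?thesis using int by (simp only:) blast
qed

end
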